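(* Let $\beta\ge 0$, $\eta>0$, $s>-\tfrac12$ and $\phi\in H^s(\mathbb{T})$. Then the supremum of all $T>0$ for which the following assertions all hold is infinity: (a) there exists a unique solution $u$ of the integral equation $$u(t)=S(t)\phi-\int_0^t S(t-t')[u(t')u_x(t')]\,dt',\qquad t\in[0,T],$$ satisfying $u\in C([0,T],H^s(\mathbb{T}))\cap C((0,T),H^{\infty}(\mathbb{T}))$; (b) the flow map $\phi\mapsto u(t)$ is smooth from $H^s(\mathbb{T})$ to $C([0,T],H^s(\mathbb{T}))\cap C((0,T],H^{\infty}(\mathbb{T}))\cap \mathfrak{X}_T^s$.
   Context: $\mathbb{T}$ is the circle; functions and distributions on it are $2\pi$-periodic. Fourier coefficients: $\widehat f(k)=\frac1{2\pi}\int_{-\pi}^{\pi}e^{-ikz}f(z)\,dz$, $k\in\mathbb{Z}$ (extended to periodic distributions). $H^s(\mathbb{T})$ is the Sobolev space of periodic distributions with finite norm $\|\phi\|_{H^s}=(2\pi)^{1/2}\|(1+k^2)^{s/2}\widehat\phi(k)\|_{l^2(\mathbb{Z})}$, and $H^\infty(\mathbb{T})=\bigcap_{r}H^r(\mathbb{T})$ with its Fréchet topology. For $t\ge0$, $S(t)$ is the operator $\widehat{S(t)f}(k)=e^{i q(k)t-p(k)t}\widehat f(k)$ with $q(k)=\beta k|k|$, $p(k)=\eta(k^2-|k|)$, $k\in\mathbb{Z}$. The product $u u_x$ is understood as $\frac12\partial_x(u^2)$. For $s<0$ and $T>0$, $X_T^s$ is the space of all $u\in C([0,T];H^s(\mathbb{T}))$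 such that $\|u\|_{X_T^s}:=\sup_{t\in(0,T]}\big(\|u(t)\|_{H^s}+t^{|s|/2}\|u(t)\|_{L^2}\big)<\infty$. The space $\mathfrak{X}_T^s$ is $X_T^s$ if $-\frac12<s<0$, and $C([0,T];H^s(\mathbb{T}))$ if $s\ge0$. The statement on the flow map is understood locally near $\phi$: there is an open ball $B\ni\phi$ in $H^s(\mathbb{T})$ such that the solution exists on $[0,T]$ for every datum in $B$, and the flow map is considered on $B$.
   Formalization: The periodic distributions in $H^s(\mathbb{T})$ (data and solutions) are taken real-valued; for complex-valued data such as $\phi=Ae^{ix}$ with $A$ large the solution blows up in finite time and the claim fails. *)

theory Defs
  imports
    "HOL-Analysis.Analysis"
    "HOL-Library.Function_Algebras"
    "HOL-Library.Extended_Real"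
begin

section \<open>Real periodic test functions\<close>

definition smooth_periodic :: "(real \<Rightarrow> real) \<Rightarrow> bool" where
  "smooth_periodic f \<longleftrightarrow>
     (\<forall>x. f (x + 2 * pi) = f x) \<and> (\<forall>n x. (deriv ^^ n) f differentiable (at x))"

lemma smooth_periodic_has_deriv:
  assumes "smooth_periodic f"
  shows "((deriv ^^ n) f has_real_derivative (deriv ^^ Suc n) f x) (at x)"
  using assms unfolding smooth_periodic_def
  by (simp add: DERIV_deriv_iff_real_differentiable)

lemma smooth_periodicI:
  assumes per: "\<And>x. f (x + 2 * pi) = f x"
    and D0: "D 0 = f"
    and D: "\<And>n x. (D n has_real_derivative D (Suc n) x) (at x)"
  shows "smooth_periodic f" and "(deriv ^^ n) f = D n"
proof -
  have eq: "(deriv ^^ n) f = D n" for n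
  proof (induction n)
    case 0
    show ?case by (simp add: D0)
  next
    case (Suc n)
    have "deriv (D n) = D (Suc n)"
      using D[of n] by (intro ext) (rule DERIV_imp_deriv)
    then show ?case using Suc by simp
  qed
  then show "(deriv ^^ n) f = D n" .
  have "(deriv ^^ n) f differentiable (at x)" for n x
    unfolding eq using D[of n x] real_differentiable_def by blast
  then show "smooth_periodic f"
    using per by (simp add: smooth_periodic_def)
qed

lemma smooth_periodic_lincomb:
  assumes f: "smooth_periodic f" and g: "smooth_periodic g"
  shows "smooth_periodic (\<lambda>x. a * f x + b * g x)"
    and "(deriv ^^ n) (\<lambda>x. a * f x + b * g x) =
      (\<lambda>x. a * (deriv ^^ n) f x + b * (deriv ^^ n) g x)"
proof -
  let ?D = "\<lambda>n x. a * (deriv ^^ n) f x + b * (deriv ^^ n) g x"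
  have D: "(?D n has_real_derivative ?D (Suc n) x) (at x)" for n x
    by (intro derivative_intros DERIV_cmult smooth_periodic_has_deriv f g)
  have per: "a * f (x + 2 * pi) + b * g (x + 2 * pi) = a * f x + b * g x" for x
    using f g by (simp add: smooth_periodic_def)
  show "smooth_periodic (\<lambda>x. a * f x + b * g x)"
    by (rule smooth_periodicI(1)[where D = ?D]) (use per D in auto)
  show "(deriv ^^ n) (\<lambda>x. a * f x + b * g x) = ?D n"
    by (rule smooth_periodicI(2)[where D = ?D]) (use per D in auto)
qed

lemma smooth_periodic_zero: "smooth_periodic (\<lambda>x. 0)"
  by (rule smooth_periodicI(1)[of _ "\<lambda>n x. 0"]) auto

lemma smooth_periodic_deriv_periodic:
  assumes "smooth_periodic f"
  shows "(deriv ^^ n) f (x + 2 * pi) = (deriv ^^ n) f x"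
proof (induction n arbitrary: x)
  case 0
  show ?case using assms by (simp add: smooth_periodic_def)
next
  case (Suc n)
  have "((\<lambda>y. (deriv ^^ n) f (y + 2 * pi)) has_real_derivative (deriv ^^ Suc n) f (x + 2 * pi)) (at x)"
    using smooth_periodic_has_deriv[OF assms, of n "x + 2 * pi"] by (simp add: DERIV_shift)
  then have "((deriv ^^ n) f has_real_derivative (deriv ^^ Suc n) f (x + 2 * pi)) (at x)"
    using Suc by simp
  then show ?case
    using smooth_periodic_has_deriv[OF assms, of n x] DERIV_unique by blast
qed

lemma smooth_periodic_deriv:
  assumes "smooth_periodic f"
  shows "smooth_periodic (deriv f)"
proof -
  have "(deriv ^^ n) (deriv f) = (deriv ^^ Suc n) f" for n
    by (simp add: funpow_swap1)
  then have "(deriv ^^ n) (deriv f) differentiable (at x)" for n x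
    using assms unfolding smooth_periodic_def by metis
  then show ?thesis
    using smooth_periodic_deriv_periodic[OF assms, of 1]
    unfolding smooth_periodic_def by simp
qed

lemma smooth_periodic_trig: "smooth_periodic (\<lambda>x. a * cos (of_int k * x) + b * sin (of_int k * x))"
proof (rule smooth_periodicI(1))
  define c :: "nat \<Rightarrow> real \<times> real" where
    "c n = ((\<lambda>(a, b). (of_int k * b, - of_int k * a)) ^^ n) (a, b)" for n
  let ?D = "\<lambda>n x. fst (c n) * cos (of_int k * x) + snd (c n) * sin (of_int k * x)"
  show "?D 0 = (\<lambda>x. a * cos (of_int k * x) + b * sin (of_int k * x))"
    by (simp add: c_def)
  show "(?D n has_real_derivative ?D (Suc n) x) (at x)" for n x
    by (auto intro!: derivative_eq_intros simp: c_def case_prod_unfold algebra_simps)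
  show "a * cos (of_int k * (x + 2 * pi)) + b * sin (of_int k * (x + 2 * pi)) =
    a * cos (of_int k * x) + b * sin (of_int k * x)" for x :: real
  proof -
    have "of_int k * (x + 2 * pi) = of_int k * x + 2 * pi * of_int k"
      by (simp add: algebra_simps)
    then show ?thesis
      by (simp add: cos_add sin_add)
  qed
qed

lemma smooth_periodic_bdd:
  assumes "smooth_periodic f"
  shows "bdd_above (range (\<lambda>x. \<bar>(deriv ^^ n) f x\<bar>))"
proof -
  let ?g = "\<lambda>x. \<bar>(deriv ^^ n) f x\<bar>"
  have "continuous_on {0..2 * pi} ?g"
    by (intro continuous_on_rabs continuous_at_imp_continuous_on ballI)
      (rule DERIV_isCont[OF smooth_periodic_has_deriv[OF assms]])
  then have "bdd_above (?g ` {0..2 * pi})"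
    by (intro bounded_imp_bdd_above compact_imp_bounded compact_continuous_image) auto
  then obtain M where M: "\<And>x. x \<in> {0..2 * pi} \<Longrightarrow> ?g x \<le> M"
    unfolding bdd_above_def by blast
  interpret periodic_fun_simple "(deriv ^^ n) f" "2 * pi"
    by standard (rule smooth_periodic_deriv_periodic[OF assms])
  have "?g x \<le> M" for x
  proof -
    let ?m = "\<lfloor>x / (2 * pi)\<rfloor>"
    have "of_int ?m * (2 * pi) \<le> x" "x < (of_int ?m + 1) * (2 * pi)"
      using floor_divide_lower[of "2 * pi" x] floor_divide_upper[of "2 * pi" x] by auto
    then have "x - of_int ?m * (2 * pi) \<in> {0..2 * pi}"
      by (auto simp: algebra_simps)
    from M[OF this] show ?thesis
      by (simp add: minus_of_int)
  qed
  then show ?thesis by (auto simp: bdd_above_def)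
qed

typedef ptest = "{f. smooth_periodic f}"
  using smooth_periodic_zero by blast

setup_lifting type_definition_ptest

instantiation ptest :: real_vector
begin

lift_definition zero_ptest :: ptest is "\<lambda>x. 0"
  by (rule smooth_periodic_zero)

lift_definition plus_ptest :: "ptest \<Rightarrow> ptest \<Rightarrow> ptest" is "\<lambda>f g x. f x + g x"
  using smooth_periodic_lincomb(1)[of _ _ 1 1] by simp

lift_definition minus_ptest :: "ptest \<Rightarrow> ptest \<Rightarrow> ptest" is "\<lambda>f g x. f x - g x"
  using smooth_periodic_lincomb(1)[of _ _ 1 "-1"] by simp

lift_definition uminus_ptest :: "ptest \<Rightarrow> ptest" is "\<lambda>f x. - f x"
  using smooth_periodic_lincomb(1)[of _ _ "-1" 0] by simp

lift_definition scaleR_ptest :: "real \<Rightarrow> ptest \<Rightarrow> ptest" is "\<lambda>c f x. c * f x"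
  using smooth_periodic_lincomb(1)[of _ _ _ 0] by simp

instance
  by standard (transfer; simp add: algebra_simps)+

end

lift_definition test_deriv :: "ptest \<Rightarrow> ptest" is deriv
  by (rule smooth_periodic_deriv)

lift_definition test_cos :: "int \<Rightarrow> ptest" is "\<lambda>k x. cos (of_int k * x)"
  using smooth_periodic_trig[of 1 _ 0] by simp

lift_definition test_sin :: "int \<Rightarrow> ptest" is "\<lambda>k x. sin (of_int k * x)"
  using smooth_periodic_trig[of 0 _ 1] by simp

text \<open>These increasing norms generate the Frechet topology of the space of test functions.\<close>

definition test_norm :: "nat \<Rightarrow> ptest \<Rightarrow> real" where
  "test_norm N f = (\<Sum>n\<le>N. SUP x. \<bar>(deriv ^^ n) (Rep_ptest f) x\<bar>)"

lemma deriv_le_SUP: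
  "\<bar>(deriv ^^ n) (Rep_ptest f) x\<bar> \<le> (SUP x. \<bar>(deriv ^^ n) (Rep_ptest f) x\<bar>)"
  using Rep_ptest[of f] by (intro cSUP_upper smooth_periodic_bdd) auto

lemma SUP_deriv_nonneg: "0 \<le> (SUP x. \<bar>(deriv ^^ n) (Rep_ptest f) x\<bar>)"
  using deriv_le_SUP[of n f 0] by linarith

lemma test_norm_nonneg: "0 \<le> test_norm N f"
  unfolding test_norm_def by (intro sum_nonneg SUP_deriv_nonneg)

lemma test_norm_mono: "M \<le> N \<Longrightarrow> test_norm M f \<le> test_norm N f"
  unfolding test_norm_def by (intro sum_mono2 SUP_deriv_nonneg) auto

lemma test_norm_deriv: "test_norm N (test_deriv f) \<le> test_norm (Suc N) f"
proof -
  have "test_norm N (test_deriv f) = (\<Sum>n\<le>N. SUP x. \<bar>(deriv ^^ Suc n) (Rep_ptest f) x\<bar>)"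
    by (simp add: test_norm_def test_deriv.rep_eq funpow_swap1)
  then show ?thesis
    unfolding test_norm_def sum.atMost_Suc_shift using SUP_deriv_nonneg[of 0 f] by simp
qed

lemma linear_test_deriv: "linear test_deriv"
proof (rule linearI)
  fix f g :: ptest and c :: real
  have lin: "deriv (\<lambda>x. a * f x + b * g x) = (\<lambda>x. a * deriv f x + b * deriv g x)"
    if "smooth_periodic f" "smooth_periodic g" for f g a b
    using smooth_periodic_lincomb(2)[OF that, of 1 a b] by simp
  show "test_deriv (f + g) = test_deriv f + test_deriv g"
    by transfer (use lin[of _ _ 1 1] in simp)
  show "test_deriv (c *\<^sub>R f) = c *\<^sub>R test_deriv f"
  proof transfer
    fix c :: real and f
    assume "smooth_periodic f"
    then show "deriv (\<lambda>x. c * f x) = (\<lambda>x. c * deriv f x)"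
      using lin[of f f c 0] by simp
  qed
qed


section \<open>Real periodic distributions\<close>

definition cont_functional :: "(ptest \<Rightarrow> real) \<Rightarrow> bool" where
  "cont_functional u \<longleftrightarrow> linear u \<and> (\<exists>N C. \<forall>f. \<bar>u f\<bar> \<le> C * test_norm N f)"

lemma cont_functional_lincomb:
  assumes u: "cont_functional u" and v: "cont_functional v"
  shows "cont_functional (\<lambda>f. a * u f + b * v f)"
proof -
  obtain N C where C: "\<And>f. \<bar>u f\<bar> \<le> C * test_norm N f"
    using u unfolding cont_functional_def by blast
  obtain M K where K: "\<And>f. \<bar>v f\<bar> \<le> K * test_norm M f"
    using v unfolding cont_functional_def by blast
  have "\<bar>a * u f + b * v f\<bar> \<le> (\<bar>a\<bar> * \<bar>C\<bar> + \<bar>b\<bar> * \<bar>K\<bar>) * test_norm (max N M) f" for f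
  proof -
    have "\<bar>u f\<bar> \<le> \<bar>C\<bar> * test_norm (max N M) f"
      by (rule order_trans[OF C mult_mono]) (auto simp: test_norm_nonneg intro: test_norm_mono)
    moreover have "\<bar>v f\<bar> \<le> \<bar>K\<bar> * test_norm (max N M) f"
      by (rule order_trans[OF K mult_mono]) (auto simp: test_norm_nonneg intro: test_norm_mono)
    ultimately have "\<bar>a\<bar> * \<bar>u f\<bar> + \<bar>b\<bar> * \<bar>v f\<bar> \<le>
        \<bar>a\<bar> * (\<bar>C\<bar> * test_norm (max N M) f) + \<bar>b\<bar> * (\<bar>K\<bar> * test_norm (max N M) f)"
      by (intro add_mono mult_left_mono) auto
    moreover have "\<bar>a * u f + b * v f\<bar> \<le> \<bar>a\<bar> * \<bar>u f\<bar> + \<bar>b\<bar> * \<bar>v f\<bar>"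
      by (metis abs_mult abs_triangle_ineq)
    ultimately show ?thesis by (simp add: algebra_simps)
  qed
  moreover have "linear (\<lambda>f. a * u f + b * v f)"
    using u v unfolding cont_functional_def
    by (auto intro!: linearI simp: linear_add linear_scale algebra_simps)
  ultimately show ?thesis unfolding cont_functional_def by blast
qed

lemma cont_functional_zero: "cont_functional (\<lambda>f. 0)"
  unfolding cont_functional_def by (auto intro!: linearI exI[of _ 0])

text \<open>Continuous linear functionals on the real test functions. Real-valuedness is essential for the
  global theory: complex-valued data can blow up.\<close>

typedef pdist = "{u. cont_functional u}" morphisms pairing Abs_pdist
  using cont_functional_zero by blast

setup_lifting type_definition_pdist

instantiation pdist :: real_vector
begin

lift_definition zero_pdist :: pdist is "\<lambda>f. 0"
  by (rule cont_functional_zero)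

lift_definition plus_pdist :: "pdist \<Rightarrow> pdist \<Rightarrow> pdist" is "\<lambda>u v f. u f + v f"
  using cont_functional_lincomb[of _ _ 1 1] by simp

lift_definition minus_pdist :: "pdist \<Rightarrow> pdist \<Rightarrow> pdist" is "\<lambda>u v f. u f - v f"
  using cont_functional_lincomb[of _ _ 1 "-1"] by simp

lift_definition uminus_pdist :: "pdist \<Rightarrow> pdist" is "\<lambda>u f. - u f"
  using cont_functional_lincomb[of _ _ "-1" 0] by simp

lift_definition scaleR_pdist :: "real \<Rightarrow> pdist \<Rightarrow> pdist" is "\<lambda>c u f. c * u f"
  using cont_functional_lincomb[of _ _ _ 0] by simp

instance
  by standard (transfer; simp add: algebra_simps)+

end

lift_definition dist_deriv :: "pdist \<Rightarrow> pdist" is "\<lambda>u f. - u (test_deriv f)"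
proof -
  fix u :: "ptest \<Rightarrow> real"
  assume u: "cont_functional u"
  then obtain N C where C: "\<And>f. \<bar>u f\<bar> \<le> C * test_norm N f"
    unfolding cont_functional_def by blast
  have "\<bar>- u (test_deriv f)\<bar> \<le> \<bar>C\<bar> * test_norm (Suc N) f" for f
  proof -
    have "\<bar>u (test_deriv f)\<bar> \<le> C * test_norm N (test_deriv f)" by (rule C)
    also have "\<dots> \<le> \<bar>C\<bar> * test_norm (Suc N) f"
      by (intro mult_mono test_norm_deriv) (auto simp: test_norm_nonneg)
    finally show ?thesis by simp
  qed
  moreover have "linear (\<lambda>f. - u (test_deriv f))"
    using u unfolding cont_functional_def
    by (auto intro!: linearI simp: linear_add linear_scale linear_add[OF linear_test_deriv]
        linear_scale[OF linear_test_deriv])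
  ultimately show "cont_functional (\<lambda>f. - u (test_deriv f))"
    unfolding cont_functional_def by blast
qed

abbreviation circle_measure :: "real measure" where
  "circle_measure \<equiv> lebesgue_on {- pi..pi}"

lift_definition dist_of_fun :: "(real \<Rightarrow> real) \<Rightarrow> pdist" is
  "\<lambda>g f. if integrable circle_measure g then LINT z|circle_measure. g z * Rep_ptest f z else 0"
proof -
  fix g :: "real \<Rightarrow> real"
  let ?u = "\<lambda>f. LINT z|circle_measure. g z * Rep_ptest f z"
  show "cont_functional (\<lambda>f. if integrable circle_measure g then ?u f else 0)"
  proof (cases "integrable circle_measure g")
    case False
    then show ?thesis by (simp add: cont_functional_zero)
  next
    case True
    have bound: "\<bar>Rep_ptest f z\<bar> \<le> test_norm 0 f" for f z
      using deriv_le_SUP[of 0 f z] by (simp add: test_norm_def)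
    have cont: "continuous_on UNIV (Rep_ptest f)" for f
      using smooth_periodic_has_deriv[of "Rep_ptest f" 0] Rep_ptest[of f]
      by (auto intro!: continuous_at_imp_continuous_on DERIV_isCont)
    have meas: "Rep_ptest f \<in> borel_measurable circle_measure" for f
      using borel_measurable_continuous_onI[OF cont[of f]]
      by (intro measurable_restrict_space1) (simp add: measurable_completion)
    have int: "integrable circle_measure (\<lambda>z. g z * Rep_ptest f z)" for f
    proof (rule Bochner_Integration.integrable_bound)
      show "integrable circle_measure (\<lambda>z. test_norm 0 f * \<bar>g z\<bar>)"
        using True by simp
      show "(\<lambda>z. g z * Rep_ptest f z) \<in> borel_measurable circle_measure"
        using True meas[of f] by (auto intro: borel_measurable_times)
      show "AE z in circle_measure. norm (g z * Rep_ptest f z) \<le> norm (test_norm 0 f * \<bar>g z\<bar>)"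
      proof (rule AE_I2)
        fix z :: real
        have "\<bar>g z\<bar> * \<bar>Rep_ptest f z\<bar> \<le> \<bar>g z\<bar> * test_norm 0 f"
          by (intro mult_left_mono bound) auto
        then show "norm (g z * Rep_ptest f z) \<le> norm (test_norm 0 f * \<bar>g z\<bar>)"
          by (simp add: abs_mult test_norm_nonneg mult.commute)
      qed
    qed
    have "\<bar>?u f\<bar> \<le> (LINT z|circle_measure. \<bar>g z\<bar>) * test_norm 0 f" for f
    proof -
      have "\<bar>?u f\<bar> \<le> (LINT z|circle_measure. \<bar>g z * Rep_ptest f z\<bar>)"
        using integral_norm_bound[of circle_measure "\<lambda>z. g z * Rep_ptest f z"] by simp
      also have "\<dots> \<le> (LINT z|circle_measure. \<bar>g z\<bar> * test_norm 0 f)"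
      proof (rule integral_mono)
        show "integrable circle_measure (\<lambda>z. \<bar>g z * Rep_ptest f z\<bar>)"
          using int[of f] by (rule integrable_abs)
        show "integrable circle_measure (\<lambda>z. \<bar>g z\<bar> * test_norm 0 f)"
          using True by simp
      qed (auto simp: abs_mult intro!: mult_left_mono bound)
      finally show ?thesis by simp
    qed
    moreover have "linear ?u"
    proof (rule linearI)
      fix f h :: ptest and c :: real
      have "?u (f + h) = (LINT z|circle_measure. g z * Rep_ptest f z + g z * Rep_ptest h z)"
        by (simp add: plus_ptest.rep_eq distrib_left)
      then show "?u (f + h) = ?u f + ?u h"
        using int by simp
      have "?u (c *\<^sub>R f) = (LINT z|circle_measure. c * (g z * Rep_ptest f z))"
        by (simp add: scaleR_ptest.rep_eq mult.left_commute)
      then show "?u (c *\<^sub>R f) = c *\<^sub>R ?u f"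
        by simp
    qed
    ultimately show ?thesis using True unfolding cont_functional_def by auto
  qed
qed

text \<open>The pairing of a real distribution with exp(-ikz) = cos(kz) - i sin(kz), divided by 2 pi.\<close>

definition fcoef :: "pdist \<Rightarrow> int \<Rightarrow> complex" where
  "fcoef u k = Complex (pairing u (test_cos k)) (- pairing u (test_sin k)) / of_real (2 * pi)"


section \<open>Sobolev spaces and squares\<close>

definition Hs :: "real \<Rightarrow> pdist set" where
  "Hs s = {u. (\<lambda>k::int. ((1 + (of_int k)\<^sup>2) powr (s / 2) * cmod (fcoef u k))\<^sup>2) summable_on UNIV}"

definition Hs_norm :: "real \<Rightarrow> pdist \<Rightarrow> real" where
  "Hs_norm s u = sqrt (2 * pi) *
     sqrt (\<Sum>\<^sub>\<infinity>k::int. ((1 + (of_int k)\<^sup>2) powr (s / 2) * cmod (fcoef u k))\<^sup>2)"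

definition is_L2_density :: "pdist \<Rightarrow> (real \<Rightarrow> real) \<Rightarrow> bool" where
  "is_L2_density u g \<longleftrightarrow> g \<in> borel_measurable circle_measure \<and>
     integrable circle_measure (\<lambda>z. (g z)\<^sup>2) \<and> u = dist_of_fun g"

definition L2 :: "pdist set" where
  "L2 = {u. \<exists>g. is_L2_density u g}"

text \<open>The density is unique up to null sets, so that the choice does not matter below.\<close>

definition density_of :: "pdist \<Rightarrow> real \<Rightarrow> real" where
  "density_of u = (SOME g. is_L2_density u g)"

definition L2_norm :: "pdist \<Rightarrow> real" where
  "L2_norm u = sqrt (LINT z|circle_measure. (density_of u z)\<^sup>2)"

definition dist_square :: "pdist \<Rightarrow> pdist" where
  "dist_square u = dist_of_fun (\<lambda>z. (density_of u z)\<^sup>2)"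

definition u_ux :: "pdist \<Rightarrow> pdist" where
  "u_ux u = (1 / 2) *\<^sub>R dist_deriv (dist_square u)"


section \<open>Spaces of time-dependent distributions\<close>

text \<open>A function on \<open>[0,T]\<close> is extended by zero to all times, so that equality of functions
  on \<open>[0,T]\<close> is equality in HOL and the spaces below are linear subspaces of
  \<open>real \<Rightarrow> pdist\<close>.\<close>

definition time_functions :: "real \<Rightarrow> (real \<Rightarrow> pdist) set" where
  "time_functions T = {u. \<forall>t. t \<notin> {0..T} \<longrightarrow> u t = 0}"

definition cont_Hs :: "real \<Rightarrow> real set \<Rightarrow> (real \<Rightarrow> pdist) \<Rightarrow> bool" where
  "cont_Hs s I u \<longleftrightarrow> (\<forall>t\<in>I. u t \<in> Hs s) \<and>
     (\<forall>t\<in>I. ((\<lambda>t'. Hs_norm s (u t' - u t)) \<longlongrightarrow> 0) (at t within I))"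

text \<open>Continuity into the Frechet space of smooth functions, whose topology is generated by all
  Sobolev norms.\<close>

definition cont_Hinf :: "real set \<Rightarrow> (real \<Rightarrow> pdist) \<Rightarrow> bool" where
  "cont_Hinf I u \<longleftrightarrow> (\<forall>r. cont_Hs r I u)"

definition X_space :: "real \<Rightarrow> real \<Rightarrow> (real \<Rightarrow> pdist) set" where
  "X_space s T = {u \<in> time_functions T. cont_Hs s {0..T} u \<and> (\<forall>t\<in>{0<..T}. u t \<in> L2) \<and>
     bdd_above ((\<lambda>t. Hs_norm s (u t) + t powr (\<bar>s\<bar> / 2) * L2_norm (u t)) ` {0<..T})}"

definition X_norm :: "real \<Rightarrow> real \<Rightarrow> (real \<Rightarrow> pdist) \<Rightarrow> real" where
  "X_norm s T u = (SUP t\<in>{0<..T}. Hs_norm s (u t) + t powr (\<bar>s\<bar> / 2) * L2_norm (u t))"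

definition frakX_space :: "real \<Rightarrow> real \<Rightarrow> (real \<Rightarrow> pdist) set" where
  "frakX_space s T = (if s < 0 then X_space s T
     else {u \<in> time_functions T. cont_Hs s {0..T} u})"

definition sup_norm :: "real \<Rightarrow> real set \<Rightarrow> (real \<Rightarrow> pdist) \<Rightarrow> real" where
  "sup_norm s I u = (SUP t\<in>I. Hs_norm s (u t))"

definition frakX_norm :: "real \<Rightarrow> real \<Rightarrow> (real \<Rightarrow> pdist) \<Rightarrow> real" where
  "frakX_norm s T u = (if s < 0 then X_norm s T u else sup_norm s {0..T} u)"

definition target_space :: "real \<Rightarrow> real \<Rightarrow> (real \<Rightarrow> pdist) set" where
  "target_space s T = {u \<in> time_functions T. cont_Hs s {0..T} u} \<inter>
     {u. cont_Hinf {0<..T} u} \<inter> frakX_space s T"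

text \<open>The intersection carries the coarsest locally convex topology for which the three inclusions
  are continuous; the second space has the topology of uniform convergence on compact
  subintervals of \<open>(0,T]\<close> in every Sobolev norm.\<close>

definition target_seminorms :: "real \<Rightarrow> real \<Rightarrow> ((real \<Rightarrow> pdist) \<Rightarrow> real) set" where
  "target_seminorms s T = {sup_norm s {0..T}} \<union> {sup_norm r {a..T} | r a. 0 < a \<and> a \<le> T} \<union>
     {frakX_norm s T}"


section \<open>The integral equation\<close>

text \<open>\<open>S(t)\<close> for \<open>t \<ge> 0\<close>; distributions are determined by their Fourier coefficients.\<close>

definition S_op :: "real \<Rightarrow> real \<Rightarrow> real \<Rightarrow> pdist \<Rightarrow> pdist" where
  "S_op \<beta> \<eta> t f = (THE g. \<forall>k::int. fcoef g k =
     exp (\<i> * of_real (\<beta> * of_int k * \<bar>of_int k\<bar> * t) -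
          of_real (\<eta> * ((of_int k)\<^sup>2 - \<bar>of_int k\<bar>) * t)) * fcoef f k)"

text \<open>The integral of a distribution-valued function, in the weak sense: tested against every test
  function. Absolute integrability makes the integral on the right a Lebesgue integral.\<close>

definition has_dist_integral :: "(real \<Rightarrow> pdist) \<Rightarrow> pdist \<Rightarrow> real set \<Rightarrow> bool" where
  "has_dist_integral F v A \<longleftrightarrow>
     (\<forall>f. (\<lambda>t. pairing (F t) f) absolutely_integrable_on A \<and>
          integral A (\<lambda>t. pairing (F t) f) = pairing v f)"

definition integral_equation ::
  "real \<Rightarrow> real \<Rightarrow> real \<Rightarrow> pdist \<Rightarrow> (real \<Rightarrow> pdist) \<Rightarrow> bool" where
  "integral_equation \<beta> \<eta> T \<phi> u \<longleftrightarrow> (\<forall>t\<in>{0..T}. \<exists>v.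
     has_dist_integral (\<lambda>t'. S_op \<beta> \<eta> (t - t') (u_ux (u t'))) v {0<..<t} \<and>
     u t = S_op \<beta> \<eta> t \<phi> - v)"

definition is_solution ::
  "real \<Rightarrow> real \<Rightarrow> real \<Rightarrow> real \<Rightarrow> pdist \<Rightarrow> (real \<Rightarrow> pdist) \<Rightarrow> bool" where
  "is_solution \<beta> \<eta> s T \<phi> u \<longleftrightarrow> u \<in> time_functions T \<and> cont_Hs s {0..T} u \<and>
     cont_Hinf {0<..<T} u \<and> integral_equation \<beta> \<eta> T \<phi> u"

definition flow_map ::
  "real \<Rightarrow> real \<Rightarrow> real \<Rightarrow> real \<Rightarrow> pdist \<Rightarrow> real \<Rightarrow> pdist" where
  "flow_map \<beta> \<eta> s T \<phi> = (THE u. is_solution \<beta> \<eta> s T \<phi> u)"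


section \<open>Smooth maps from a normed space to a locally convex space\<close>

instantiation "fun" :: (type, real_vector) real_vector
begin

definition scaleR_fun :: "real \<Rightarrow> ('a \<Rightarrow> 'b) \<Rightarrow> 'a \<Rightarrow> 'b" where
  "scaleR_fun c f = (\<lambda>x. c *\<^sub>R f x)"

instance
  by standard (auto simp: scaleR_fun_def plus_fun_def scaleR_add_right scaleR_add_left)

end

definition multilinear_on ::
  "'a::real_vector set \<Rightarrow> nat \<Rightarrow> ('a list \<Rightarrow> 'b::real_vector) \<Rightarrow> bool" where
  "multilinear_on E n A \<longleftrightarrow>
     (\<forall>hs i x y a b. length hs = n \<and> set hs \<subseteq> E \<and> i < n \<and> x \<in> E \<and> y \<in> E \<longrightarrow>
        A (hs[i := a *\<^sub>R x + b *\<^sub>R y]) = a *\<^sub>R A (hs[i := x]) + b *\<^sub>R A (hs[i := y]))"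

text \<open>Infinite Frechet differentiability on \<open>U\<close>, an open subset of the space \<open>E\<close> normed by
  \<open>nE\<close>, with values in the space \<open>F\<close> topologized by the seminorms \<open>P\<close>. \<open>D n x\<close> is the derivative
  of order \<open>n\<close> at \<open>x\<close>, a bounded \<open>n\<close>-linear map on lists of directions of length \<open>n\<close>, and
  \<open>D (Suc n)\<close> is the Frechet derivative of \<open>D n\<close>, uniformly on bounded sets of directions.\<close>

definition smooth_map_on ::
  "'a::real_vector set \<Rightarrow> ('a \<Rightarrow> real) \<Rightarrow> 'a set \<Rightarrow> 'b::real_vector set \<Rightarrow> ('b \<Rightarrow> real) set \<Rightarrow>
    ('a \<Rightarrow> 'b) \<Rightarrow> bool" where
  "smooth_map_on E nE U F P f \<longleftrightarrow> (\<exists>D :: nat \<Rightarrow> 'a \<Rightarrow> 'a list \<Rightarrow> 'b.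
     (\<forall>x\<in>U. D 0 x [] = f x) \<and>
     (\<forall>n. \<forall>x\<in>U. multilinear_on E n (D n x) \<and>
        (\<forall>hs. length hs = n \<and> set hs \<subseteq> E \<longrightarrow> D n x hs \<in> F) \<and>
        (\<forall>p\<in>P. \<exists>C. \<forall>hs. length hs = n \<and> set hs \<subseteq> E \<longrightarrow>
           p (D n x hs) \<le> C * prod_list (map nE hs))) \<and>
     (\<forall>n. \<forall>x\<in>U. \<forall>p\<in>P. \<forall>\<epsilon>>0. \<exists>\<delta>>0. \<forall>h\<in>E. x + h \<in> U \<and> nE h < \<delta> \<longrightarrow>
        (\<forall>hs. length hs = n \<and> set hs \<subseteq> E \<longrightarrow>
           p (D n (x + h) hs - D n x hs - D (Suc n) x (h # hs)) \<le>
             \<epsilon> * nE h * prod_list (map nE hs))))"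

definition Hs_ball :: "real \<Rightarrow> pdist \<Rightarrow> real \<Rightarrow> pdist set" where
  "Hs_ball s c \<rho> = {\<psi> \<in> Hs s. Hs_norm s (\<psi> - c) < \<rho>}"

definition unique_solution :: "real \<Rightarrow> real \<Rightarrow> real \<Rightarrow> pdist \<Rightarrow> real \<Rightarrow> bool" where
  "unique_solution \<beta> \<eta> s \<phi> T \<longleftrightarrow> (\<exists>!u. is_solution \<beta> \<eta> s T \<phi> u)"

definition smooth_flow_near :: "real \<Rightarrow> real \<Rightarrow> real \<Rightarrow> pdist \<Rightarrow> real \<Rightarrow> bool" where
  "smooth_flow_near \<beta> \<eta> s \<phi> T \<longleftrightarrow> (\<exists>c\<in>Hs s. \<exists>\<rho>. \<phi> \<in> Hs_ball s c \<rho> \<and>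
     (\<forall>\<psi>\<in>Hs_ball s c \<rho>. unique_solution \<beta> \<eta> s \<psi> T) \<and>
     smooth_map_on (Hs s) (Hs_norm s) (Hs_ball s c \<rho>) (target_space s T) (target_seminorms s T)
       (flow_map \<beta> \<eta> s T))"

end

theory Submission
  imports Defs
begin

text \<open>On the Fourier side the equation is \<open>u = lin c + bil u u\<close> for coefficient functions. The operator
  \<open>bil\<close> is bounded on a space whose norm controls the \<open>H\<^sup>s\<close> norm, \<open>t powr gam\<close> times the \<open>sig\<close> norm with
  \<open>gam = max 0 (-s) / 2\<close>, and, for \<open>\<delta> > 0\<close>, an exponential weight in the frequency that forces
  smoothness for positive times. For fixed \<open>u\<close> the linear map \<open>bil u\<close> is a Volterra operator: it contracts
  after weighting with \<open>exp (- lm * t)\<close>. Hence \<open>I - 2 bil u\<close> is invertible on every time interval, the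
  solution depends smoothly on the data by repeated differentiation of the quadratic equation, and
  solutions are unique. They exist for small times by contraction, become square integrable at once, and
  extend globally because, for real data, the nonlinearity does not contribute to the \<open>L\<^sup>2\<close> energy
  balance, and the multiplier is bounded by 1.\<close>

section \<open>Quadratic equations in complete normed spaces\<close>

text \<open>For \<open>\<bar>k\<bar> \<le> 1\<close> the multiplier has modulus 1. Hence damping
  that also pays for a strip of analyticity, here widening at speed \<open>\<eta> / 2\<close>, holds
  only up to exponential growth in time; \<open>exp (- lm * t)\<close> absorbs that growth. What
  survives is a Gaussian factor \<open>exp (- \<eta> * k\<^sup>2 * t / 4)\<close>, which converts
  the derivative in the nonlinearity into an integrable time singularity. Differentiability needs
  one space for all data in a ball, so neither the strip nor the bound may depend on the datum.
  Restarting provides this: every late time is the end of a local solution of fixed length whose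
  initial \<open>L^2\<close> norm is controlled by the energy. The statement speaks of functionals
  on test functions, squares of chosen densities and weak integrals, whereas the analysis lives on
  coefficient sequences. Crossing over requires that trigonometric polynomials be dense among test
  functions and that an integrable function with vanishing coefficients be zero almost everywhere.
  Both rest on polynomial approximation on the unit circle.\<close>

locale normed_subspace =
  fixes V :: "'a::real_vector set" and nn :: "'a \<Rightarrow> real"
  assumes zero_mem: "0 \<in> V"
    and add_mem: "x \<in> V \<Longrightarrow> y \<in> V \<Longrightarrow> x + y \<in> V"
    and scale_mem: "x \<in> V \<Longrightarrow> c *\<^sub>R x \<in> V"
    and norm_nonneg: "x \<in> V \<Longrightarrow> 0 \<le> nn x"
    and norm_add: "x \<in> V \<Longrightarrow> y \<in> V \<Longrightarrow> nn (x + y) \<le> nn x + nn y"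
    and norm_scale: "x \<in> V \<Longrightarrow> nn (c *\<^sub>R x) = \<bar>c\<bar> * nn x"
begin

lemma uminus_mem: "x \<in> V \<Longrightarrow> - x \<in> V"
  using scale_mem[of x "-1"] by simp

lemma diff_mem: "x \<in> V \<Longrightarrow> y \<in> V \<Longrightarrow> x - y \<in> V"
  using add_mem[of x "- y"] uminus_mem by simp

lemma norm_zero: "nn 0 = 0"
  using norm_scale[OF zero_mem, of 0] by simp

lemma norm_uminus: "x \<in> V \<Longrightarrow> nn (- x) = nn x"
  using norm_scale[of x "-1"] by simp

lemma norm_diff: "x \<in> V \<Longrightarrow> y \<in> V \<Longrightarrow> nn (x - y) \<le> nn x + nn y"
  using norm_add[of x "- y"] uminus_mem norm_uminus by simp

end

text \<open>Completeness is asked only of sequences with geometrically shrinking steps. The iterates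
  of a contraction with factor 1/2 are of this kind, and the explicit rate simplifies the
  verification in the solution space.\<close>

locale complete_subspace = normed_subspace +
  assumes norm_eq_zero: "x \<in> V \<Longrightarrow> nn x = 0 \<Longrightarrow> x = 0"
    and complete: "(\<And>n. f n \<in> V) \<Longrightarrow> (\<And>n. nn (f (Suc n) - f n) \<le> c * (1/2) ^ n) \<Longrightarrow>
      \<exists>l\<in>V. (\<lambda>n. nn (f n - l)) \<longlonglongrightarrow> 0"
begin

text \<open>The iteration starts at 0, so its first step has norm at most \<open>r\<close> and later
  ones at most \<open>r * (1/2) ^ n\<close>. The limit remains in the ball, which is what permits
  applying \<open>contr\<close> to it.\<close>

lemma contraction_fixpoint:
  assumes G: "\<And>x. x \<in> V \<Longrightarrow> nn x \<le> r \<Longrightarrow> G x \<in> V \<and> nn (G x) \<le> r"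
    and contr: "\<And>x y. x \<in> V \<Longrightarrow> nn x \<le> r \<Longrightarrow> y \<in> V \<Longrightarrow> nn y \<le> r \<Longrightarrow> nn (G x - G y) \<le> 1/2 * nn (x - y)"
    and r: "0 \<le> r"
  shows "\<exists>x\<in>V. nn x \<le> r \<and> x = G x"
proof -
  define f where "f n = (G ^^ n) 0" for n
  have f0: "f 0 = 0" and fS: "f (Suc n) = G (f n)" for n
    by (simp_all add: f_def)
  have fV: "f n \<in> V \<and> nn (f n) \<le> r" for n
    by (induction n) (use G zero_mem r norm_zero in \<open>auto simp: f0 fS\<close>)
  have step: "nn (f (Suc n) - f n) \<le> r * (1/2) ^ n" for n
  proof (induction n)
    case 0
    show ?case using fV[of 1] by (simp add: f0)
  next
    case (Suc n)
    have "nn (f (Suc (Suc n)) - f (Suc n)) \<le> 1/2 * nn (f (Suc n) - f n)"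
      using contr[of "f (Suc n)" "f n"] fV[of n] fV[of "Suc n"] by (simp only: fS)
    then show ?case using Suc by simp
  qed
  obtain l where l: "l \<in> V" and lim: "(\<lambda>n. nn (f n - l)) \<longlonglongrightarrow> 0"
    using complete[of f r] fV step by blast
  have lr: "nn l \<le> r"
  proof (rule LIMSEQ_le_const2)
    show "\<exists>N. \<forall>n\<ge>N. nn l - nn (f n - l) \<le> r"
    proof (intro exI allI impI)
      fix n
      have "nn l \<le> nn (f n) + nn (f n - l)"
        using norm_diff[of "f n" "f n - l"] fV[of n] l diff_mem by simp
      then show "nn l - nn (f n - l) \<le> r" using fV[of n] by simp
    qed
    show "(\<lambda>n. nn l - nn (f n - l)) \<longlonglongrightarrow> nn l"
      using tendsto_diff[OF tendsto_const lim] by simp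
  qed
  have "nn (l - G l) \<le> 0"
  proof (rule LIMSEQ_le_const)
    show "(\<lambda>n. nn (f (Suc n) - l) + 1/2 * nn (f n - l)) \<longlonglongrightarrow> 0"
      using tendsto_add[OF LIMSEQ_Suc[OF lim] tendsto_mult_left[OF lim, of "1/2"]] by simp
    show "\<exists>N. \<forall>n\<ge>N. nn (l - G l) \<le> nn (f (Suc n) - l) + 1/2 * nn (f n - l)"
    proof (intro exI allI impI)
      fix n
      have Gl: "G l \<in> V" using G l lr by blast
      have "l - G l = (f (Suc n) - G l) - (f (Suc n) - l)" by simp
      then have "nn (l - G l) \<le> nn (f (Suc n) - G l) + nn (f (Suc n) - l)"
        using norm_diff[of "f (Suc n) - G l" "f (Suc n) - l"] fV[of "Suc n"] Gl l diff_mem by metis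
      moreover have "nn (f (Suc n) - G l) \<le> 1/2 * nn (f n - l)"
        using contr[of "f n" l] fV[of n] l lr by (simp add: fS)
      ultimately show "nn (l - G l) \<le> nn (f (Suc n) - l) + 1/2 * nn (f n - l)" by simp
    qed
  qed
  then have "l - G l = 0"
    using norm_eq_zero[of "l - G l"] norm_nonneg[of "l - G l"] G l lr diff_mem by force
  then show ?thesis using l lr by auto
qed

text \<open>The two norms may differ: below, Volterra operators contract in an exponentially weighted
  norm.\<close>

lemma linear_equation_solvable:
  assumes L: "\<And>x. x \<in> V \<Longrightarrow> L x \<in> V"
    and Ldiff: "\<And>x y. x \<in> V \<Longrightarrow> y \<in> V \<Longrightarrow> L (x - y) = L x - L y"
    and Lb: "\<And>x. x \<in> V \<Longrightarrow> nn (L x) \<le> 1/2 * nn x"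
  shows "f \<in> V \<Longrightarrow> \<exists>!v. v \<in> V \<and> v = f + L v"
    and "v \<in> V \<Longrightarrow> nn v \<le> 2 * nn (v - L v)"
proof -
  have b: "nn v \<le> 2 * nn (v - L v)" if "v \<in> V" for v
    using norm_add[of "v - L v" "L v"] that L Lb[of v] diff_mem by force
  show "v \<in> V \<Longrightarrow> nn v \<le> 2 * nn (v - L v)" using b .
  assume f: "f \<in> V"
  have "\<exists>x\<in>V. nn x \<le> 2 * nn f \<and> x = f + L x"
  proof (rule contraction_fixpoint)
    fix x assume x: "x \<in> V" "nn x \<le> 2 * nn f"
    then show "f + L x \<in> V \<and> nn (f + L x) \<le> 2 * nn f"
      using norm_add[of f "L x"] Lb[of x] L f add_mem by force
  next
    fix x y assume "x \<in> V" "y \<in> V"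
    then show "nn (f + L x - (f + L y)) \<le> 1/2 * nn (x - y)"
      using Lb[of "x - y"] Ldiff diff_mem by simp
  qed (use norm_nonneg f in auto)
  then obtain x where x: "x \<in> V" "x = f + L x" by blast
  show "\<exists>!v. v \<in> V \<and> v = f + L v"
  proof (rule ex1I[of _ x])
    fix v assume v: "v \<in> V \<and> v = f + L v"
    have "v - x = L v - L x" using v x(2) by (metis add_diff_cancel_left)
    then have "v - x - L (v - x) = 0" using v x Ldiff[of v x] by simp
    then have "nn (v - x) \<le> 0" using b[of "v - x"] v x diff_mem norm_zero by simp
    then show "v = x" using norm_eq_zero[of "v - x"] norm_nonneg[of "v - x"] v x diff_mem by force
  qed (use x in auto)
qed

text \<open>On the ball of radius \<open>2 * R\<close> the difference of two squares splits as
  \<open>B (x - y) x + B y (x - y)\<close>. Each half has Lipschitz constant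
  \<open>2 * R * K\<close>, at most 1/4; this is the origin of the 8.\<close>

lemma quadratic_equation_solvable:
  assumes B: "\<And>x y. x \<in> V \<Longrightarrow> y \<in> V \<Longrightarrow> B x y \<in> V"
    and Bl: "\<And>x y z. x \<in> V \<Longrightarrow> y \<in> V \<Longrightarrow> z \<in> V \<Longrightarrow> B (x - y) z = B x z - B y z"
    and Br: "\<And>x y z. x \<in> V \<Longrightarrow> y \<in> V \<Longrightarrow> z \<in> V \<Longrightarrow> B z (x - y) = B z x - B z y"
    and Bb: "\<And>x y. x \<in> V \<Longrightarrow> y \<in> V \<Longrightarrow> nn (B x y) \<le> K * nn x * nn y"
    and f: "f \<in> V" "nn f \<le> R" and K: "0 \<le> K" "8 * K * R \<le> 1"
  shows "\<exists>x\<in>V. nn x \<le> 2 * R \<and> x = f + B x x"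
proof (rule contraction_fixpoint)
  have R: "0 \<le> R" using f norm_nonneg by force
  then show "0 \<le> 2 * R" by simp
  have KR: "2 * R * K \<le> 1/4" using K by (simp add: mult_ac)
  fix x assume x: "x \<in> V" "nn x \<le> 2 * R"
  have "nn (B x x) \<le> K * nn x * nn x" using Bb x by blast
  also have "\<dots> \<le> (K * (2 * R)) * (2 * R)"
    by (intro mult_mono) (use x K R norm_nonneg in auto)
  also have "\<dots> \<le> 1/4 * (2 * R)"
    by (intro mult_right_mono) (use KR R in \<open>auto simp: mult_ac\<close>)
  finally show "f + B x x \<in> V \<and> nn (f + B x x) \<le> 2 * R"
    using norm_add[of f "B x x"] f x B add_mem R by force
  fix y assume y: "y \<in> V" "nn y \<le> 2 * R"
  have "f + B x x - (f + B y y) = B (x - y) x + B y (x - y)"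
    using Bl[of x y x] Br[of x y y] x y by simp
  then have "nn (f + B x x - (f + B y y)) \<le> nn (B (x - y) x) + nn (B y (x - y))"
    using norm_add B x y diff_mem by simp
  also have "\<dots> \<le> K * nn (x - y) * nn x + K * nn y * nn (x - y)"
    by (intro add_mono Bb diff_mem x y)
  also have "\<dots> \<le> K * nn (x - y) * (2 * R) + K * (2 * R) * nn (x - y)"
    by (intro add_mono mult_mono mult_left_mono) (use x y K R norm_nonneg diff_mem in auto)
  also have "\<dots> = 2 * (2 * R * K) * nn (x - y)" by (simp add: mult_ac)
  also have "\<dots> \<le> 2 * (1/4) * nn (x - y)"
    by (intro mult_right_mono mult_left_mono) (use KR norm_nonneg diff_mem x y in auto)
  finally show "nn (f + B x x - (f + B y y)) \<le> 1/2 * nn (x - y)" by simp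
qed

end

section \<open>Smooth dependence for quadratic equations\<close>

text \<open>The Leibniz rule for a bilinear expression: \<open>as\<close> and \<open>bs\<close> are the directions in which the
  first and the second factor are differentiated.\<close>

fun leibniz_sum :: "('a list \<Rightarrow> 'a list \<Rightarrow> 'b::real_vector) \<Rightarrow> 'a list \<Rightarrow> 'b" where
  "leibniz_sum F [] = F [] []"
| "leibniz_sum F (h # hs) = leibniz_sum (\<lambda>as bs. F (h # as) bs + F as (h # bs)) hs"

lemma leibniz_sum_cong:
  assumes "\<And>as bs. length as + length bs = length hs \<Longrightarrow> set as \<subseteq> set hs \<Longrightarrow> set bs \<subseteq> set hs \<Longrightarrow>
    F as bs = G as bs"
  shows "leibniz_sum F hs = leibniz_sum G hs"
  using assms
proof (induction hs arbitrary: F G)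
  case (Cons h hs)
  show ?case
    unfolding leibniz_sum.simps
  proof (rule Cons.IH)
    fix as bs assume "length as + length bs = length hs" "set as \<subseteq> set hs" "set bs \<subseteq> set hs"
    then show "F (h # as) bs + F as (h # bs) = G (h # as) bs + G as (h # bs)"
      by (intro arg_cong2[of _ _ _ _ plus] Cons.prems) auto
  qed
qed simp

text \<open>This tells the recursion for the derivatives that the two lists of directions share the
  length of \<open>hs\<close>. If both are nonempty, both are shorter than \<open>hs\<close>, which
  gives termination.\<close>

lemma leibniz_sum_cong_fundef [fundef_cong]:
  assumes "hs = hs'"
    and "\<And>as bs. length as + length bs = length hs' \<Longrightarrow> F as bs = G as bs"
  shows "leibniz_sum F hs = leibniz_sum G hs'"
  using leibniz_sum_cong[of hs F G] assms by blast

lemma leibniz_sum_add: "leibniz_sum (\<lambda>as bs. F as bs + G as bs) hs = leibniz_sum F hs + leibniz_sum G hs"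
proof (induction hs arbitrary: F G)
  case (Cons h hs)
  show ?case
    unfolding leibniz_sum.simps Cons.IH[symmetric] by (rule leibniz_sum_cong) (simp add: algebra_simps)
qed simp

lemma leibniz_sum_scale: "leibniz_sum (\<lambda>as bs. c *\<^sub>R F as bs) hs = c *\<^sub>R leibniz_sum F hs"
proof (induction hs arbitrary: F)
  case (Cons h hs)
  show ?case
    unfolding leibniz_sum.simps Cons.IH[symmetric] by (rule leibniz_sum_cong) (simp add: algebra_simps)
qed simp

lemma leibniz_sum_diff: "leibniz_sum (\<lambda>as bs. F as bs - G as bs) hs = leibniz_sum F hs - leibniz_sum G hs"
  using leibniz_sum_add[of F "\<lambda>as bs. (-1) *\<^sub>R G as bs" hs] leibniz_sum_scale[of "-1" G hs] by simp

lemma leibniz_sum_right_Nil: "leibniz_sum (\<lambda>as bs. if bs = [] then F as bs else 0) hs = F hs []"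
proof (induction hs arbitrary: F)
  case (Cons h hs)
  have "leibniz_sum (\<lambda>as bs. if bs = [] then F as bs else 0) (h # hs) =
      leibniz_sum (\<lambda>as bs. if bs = [] then F (h # as) bs else 0) hs"
    unfolding leibniz_sum.simps by (rule leibniz_sum_cong) auto
  then show ?case using Cons.IH[of "\<lambda>as. F (h # as)"] by simp
qed simp

lemma leibniz_sum_left_Nil: "leibniz_sum (\<lambda>as bs. if as = [] then F as bs else 0) hs = F [] hs"
proof (induction hs arbitrary: F)
  case (Cons h hs)
  have "leibniz_sum (\<lambda>as bs. if as = [] then F as bs else 0) (h # hs) =
      leibniz_sum (\<lambda>as bs. if as = [] then F as (h # bs) else 0) hs"
    unfolding leibniz_sum.simps by (rule leibniz_sum_cong) auto
  then show ?case using Cons.IH[of "\<lambda>as bs. F as (h # bs)"] by simp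
qed simp

text \<open>Terms of lower order: the derivative of highest order occurs only in the two extreme
  terms that are removed here. Those two go into the linear operator that has to be
  inverted.\<close>

definition proper :: "('a list \<Rightarrow> 'a list \<Rightarrow> 'b::zero) \<Rightarrow> 'a list \<Rightarrow> 'a list \<Rightarrow> 'b" where
  "proper F as bs = (if as = [] \<or> bs = [] then 0 else F as bs)"

text \<open>For \<open>hs = []\<close> the two extreme terms are the same one and would be counted
  twice.\<close>

lemma leibniz_sum_split:
  assumes "hs \<noteq> []"
  shows "leibniz_sum F hs = F hs [] + F [] hs + leibniz_sum (proper F) hs"
proof -
  have "leibniz_sum F hs = leibniz_sum (\<lambda>as bs. ((if bs = [] then F as bs else 0) +
      (if as = [] then F as bs else 0)) + proper F as bs) hs"
    by (rule leibniz_sum_cong) (use assms in \<open>auto simp: proper_def\<close>)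
  then show ?thesis by (simp add: leibniz_sum_add leibniz_sum_right_Nil leibniz_sum_left_Nil)
qed

lemma (in normed_subspace) leibniz_sum_mem:
  assumes "\<And>as bs. set as \<subseteq> set hs \<Longrightarrow> set bs \<subseteq> set hs \<Longrightarrow> F as bs \<in> V"
  shows "leibniz_sum F hs \<in> V"
  using assms
proof (induction hs arbitrary: F)
  case (Cons h hs)
  show ?case
    unfolding leibniz_sum.simps by (intro Cons.IH add_mem Cons.prems) auto
qed simp

text \<open>There are \<open>2 ^ length hs\<close> ways of distributing the directions over the two
  factors, and the product of the \<open>p\<close> is the same for each of them.\<close>

lemma (in normed_subspace) leibniz_sum_bound:
  assumes "\<And>as bs. length as + length bs = length hs \<Longrightarrow> set as \<subseteq> set hs \<Longrightarrow> set bs \<subseteq> set hs \<Longrightarrow>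
      F as bs \<in> V \<and> nn (F as bs) \<le> c * (prod_list (map p as) * prod_list (map p bs))"
  shows "leibniz_sum F hs \<in> V \<and> nn (leibniz_sum F hs) \<le> 2 ^ length hs * c * prod_list (map p hs)"
  using assms
proof (induction hs arbitrary: F c)
  case Nil
  then show ?case using Nil[of "[]" "[]"] by simp
next
  case (Cons h hs)
  have "leibniz_sum (\<lambda>as bs. F (h # as) bs + F as (h # bs)) hs \<in> V \<and>
     nn (leibniz_sum (\<lambda>as bs. F (h # as) bs + F as (h # bs)) hs) \<le>
       2 ^ length hs * (2 * c * p h) * prod_list (map p hs)"
  proof (rule Cons.IH)
    fix as bs assume *: "length as + length bs = length hs" "set as \<subseteq> set hs" "set bs \<subseteq> set hs"
    have 1: "F (h # as) bs \<in> V \<and> nn (F (h # as) bs) \<le> c * (prod_list (map p (h # as)) * prod_list (map p bs))"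
      by (rule Cons.prems) (use * in auto)
    have 2: "F as (h # bs) \<in> V \<and> nn (F as (h # bs)) \<le> c * (prod_list (map p as) * prod_list (map p (h # bs)))"
      by (rule Cons.prems) (use * in auto)
    show "F (h # as) bs + F as (h # bs) \<in> V \<and>
      nn (F (h # as) bs + F as (h # bs)) \<le> (2 * c * p h) * (prod_list (map p as) * prod_list (map p bs))"
      using 1 2 norm_add[of "F (h # as) bs" "F as (h # bs)"] add_mem by (auto simp: algebra_simps)
  qed
  then show ?case by (simp add: mult_ac)
qed

text \<open>Linearity in one entry, phrased along the structure of lists instead of by list update.
  It thereby follows the recursion of \<open>leibniz_sum\<close>, in which the varied entry moves
  into one of two sublists.\<close>

inductive lincomb_entry :: "real \<Rightarrow> real \<Rightarrow> 'a::real_vector list \<Rightarrow> 'a list \<Rightarrow> 'a list \<Rightarrow> bool" for a b where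
  here: "lincomb_entry a b ((a *\<^sub>R x + b *\<^sub>R y) # hs) (x # hs) (y # hs)"
| there: "lincomb_entry a b l l1 l2 \<Longrightarrow> lincomb_entry a b (h # l) (h # l1) (h # l2)"

lemma lincomb_entry_update:
  "i < length hs \<Longrightarrow> lincomb_entry a b (hs[i := a *\<^sub>R x + b *\<^sub>R y]) (hs[i := x]) (hs[i := y])"
proof (induction hs arbitrary: i)
  case (Cons h hs)
  then show ?case by (cases i) (auto intro: lincomb_entry.intros)
qed simp

lemma lincomb_entry_length: "lincomb_entry a b l l1 l2 \<Longrightarrow> length l1 = length l \<and> length l2 = length l"
  by (induction rule: lincomb_entry.induct) auto

lemma lincomb_entry_nonempty: "lincomb_entry a b l l1 l2 \<Longrightarrow> l \<noteq> [] \<and> l1 \<noteq> [] \<and> l2 \<noteq> []"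
  by (induction rule: lincomb_entry.induct) auto

text \<open>In each term of the sum the varied entry falls to exactly one factor; the last two
  assumptions treat the two cases.\<close>

lemma leibniz_sum_lincomb:
  assumes "lincomb_entry a b l l1 l2" and "set l1 \<subseteq> E" "set l2 \<subseteq> E"
    and "\<And>as as1 as2 bs. lincomb_entry a b as as1 as2 \<Longrightarrow> length as + length bs = length l \<Longrightarrow>
      set as1 \<subseteq> E \<Longrightarrow> set as2 \<subseteq> E \<Longrightarrow> set bs \<subseteq> E \<Longrightarrow>
      F as bs = a *\<^sub>R F as1 bs + b *\<^sub>R F as2 bs"
    and "\<And>as bs bs1 bs2. lincomb_entry a b bs bs1 bs2 \<Longrightarrow> length as + length bs = length l \<Longrightarrow>
      set bs1 \<subseteq> E \<Longrightarrow> set bs2 \<subseteq> E \<Longrightarrow> set as \<subseteq> E \<Longrightarrow>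
      F as bs = a *\<^sub>R F as bs1 + b *\<^sub>R F as bs2"
  shows "leibniz_sum F l = a *\<^sub>R leibniz_sum F l1 + b *\<^sub>R leibniz_sum F l2"
  using assms
proof (induction arbitrary: F rule: lincomb_entry.induct)
  case (here x y hs)
  have "leibniz_sum F ((a *\<^sub>R x + b *\<^sub>R y) # hs) =
     leibniz_sum (\<lambda>as bs. a *\<^sub>R (F (x # as) bs + F as (x # bs)) + b *\<^sub>R (F (y # as) bs + F as (y # bs))) hs"
    unfolding leibniz_sum.simps
  proof (rule leibniz_sum_cong)
    fix as bs assume *: "length as + length bs = length hs" "set as \<subseteq> set hs" "set bs \<subseteq> set hs"
    have 1: "F ((a *\<^sub>R x + b *\<^sub>R y) # as) bs = a *\<^sub>R F (x # as) bs + b *\<^sub>R F (y # as) bs"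
      by (rule here.prems) (use * here.prems in \<open>auto intro: lincomb_entry.intros\<close>)
    have 2: "F as ((a *\<^sub>R x + b *\<^sub>R y) # bs) = a *\<^sub>R F as (x # bs) + b *\<^sub>R F as (y # bs)"
      by (rule here.prems) (use * here.prems in \<open>auto intro: lincomb_entry.intros\<close>)
    show "F ((a *\<^sub>R x + b *\<^sub>R y) # as) bs + F as ((a *\<^sub>R x + b *\<^sub>R y) # bs) =
      a *\<^sub>R (F (x # as) bs + F as (x # bs)) + b *\<^sub>R (F (y # as) bs + F as (y # bs))"
      unfolding 1 2 by (simp add: algebra_simps)
  qed
  then show ?case by (simp only: leibniz_sum_add leibniz_sum_scale leibniz_sum.simps)
next
  case (there l l1 l2 h)
  let ?G = "\<lambda>as bs. F (h # as) bs + F as (h # bs)"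
  have h: "h \<in> E" using there.prems by simp
  have "leibniz_sum ?G l = a *\<^sub>R leibniz_sum ?G l1 + b *\<^sub>R leibniz_sum ?G l2"
  proof (rule there.IH)
    fix as as1 as2 bs
    assume *: "lincomb_entry a b as as1 as2" "length as + length bs = length l" "set as1 \<subseteq> E" "set as2 \<subseteq> E" "set bs \<subseteq> E"
    have 1: "F (h # as) bs = a *\<^sub>R F (h # as1) bs + b *\<^sub>R F (h # as2) bs"
      by (rule there.prems(3)) (use * h in \<open>auto intro: lincomb_entry.intros\<close>)
    have 2: "F as (h # bs) = a *\<^sub>R F as1 (h # bs) + b *\<^sub>R F as2 (h # bs)"
      by (rule there.prems(3)) (use * h in \<open>auto intro: lincomb_entry.intros\<close>)
    show "F (h # as) bs + F as (h # bs) = a *\<^sub>R (F (h # as1) bs + F as1 (h # bs)) + b *\<^sub>R (F (h # as2) bs + F as2 (h # bs))"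
      unfolding 1 2 by (simp add: algebra_simps)
  next
    fix as bs bs1 bs2
    assume *: "lincomb_entry a b bs bs1 bs2" "length as + length bs = length l" "set bs1 \<subseteq> E" "set bs2 \<subseteq> E" "set as \<subseteq> E"
    have 1: "F (h # as) bs = a *\<^sub>R F (h # as) bs1 + b *\<^sub>R F (h # as) bs2"
      by (rule there.prems(4)) (use * h in \<open>auto intro: lincomb_entry.intros\<close>)
    have 2: "F as (h # bs) = a *\<^sub>R F as (h # bs1) + b *\<^sub>R F as (h # bs2)"
      by (rule there.prems(4)) (use * h in \<open>auto intro: lincomb_entry.intros\<close>)
    show "F (h # as) bs + F as (h # bs) = a *\<^sub>R (F (h # as) bs1 + F as (h # bs1)) + b *\<^sub>R (F (h # as) bs2 + F as (h # bs2))"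
      unfolding 1 2 by (simp add: algebra_simps)
  qed (use there.prems in auto)
  then show ?case by simp
qed

text \<open>The Volterra constant is uniform over balls, and \<open>u\<close> is bounded by
  \<open>M\<close> on \<open>U\<close>. Together these make every estimate for the derivatives
  uniform in the base point. In the application \<open>A\<close> is the free evolution and
  \<open>B\<close> the bilinear Duhamel operator.\<close>

locale quadratic_flow = normed_subspace V nn for V :: "'b::real_vector set" and nn +
  fixes E :: "'a::real_vector set" and nE :: "'a \<Rightarrow> real" and U :: "'a set"
    and A :: "'a \<Rightarrow> 'b" and B :: "'b \<Rightarrow> 'b \<Rightarrow> 'b" and u :: "'a \<Rightarrow> 'b" and KA KB M :: real
  assumes E_lincomb: "x \<in> E \<Longrightarrow> y \<in> E \<Longrightarrow> a *\<^sub>R x + b *\<^sub>R y \<in> E"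
    and nE_nonneg: "h \<in> E \<Longrightarrow> 0 \<le> nE h"
    and U_sub: "U \<subseteq> E"
    and A_mem: "h \<in> E \<Longrightarrow> A h \<in> V"
    and A_lincomb: "x \<in> E \<Longrightarrow> y \<in> E \<Longrightarrow> A (a *\<^sub>R x + b *\<^sub>R y) = a *\<^sub>R A x + b *\<^sub>R A y"
    and A_bound: "h \<in> E \<Longrightarrow> nn (A h) \<le> KA * nE h"
    and B_mem: "v \<in> V \<Longrightarrow> w \<in> V \<Longrightarrow> B v w \<in> V"
    and B_sym: "v \<in> V \<Longrightarrow> w \<in> V \<Longrightarrow> B v w = B w v"
    and B_lincomb: "v \<in> V \<Longrightarrow> w \<in> V \<Longrightarrow> z \<in> V \<Longrightarrow> B z (a *\<^sub>R v + b *\<^sub>R w) = a *\<^sub>R B z v + b *\<^sub>R B z w"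
    and B_bound: "v \<in> V \<Longrightarrow> w \<in> V \<Longrightarrow> nn (B v w) \<le> KB * nn v * nn w"
    and KA: "0 \<le> KA" and KB: "0 \<le> KB"
    and volterra: "\<exists>C\<ge>0. \<forall>y\<in>V. nn y \<le> R \<longrightarrow> (\<forall>f\<in>V. \<exists>!v. v \<in> V \<and> v = f + B y v) \<and>
      (\<forall>v\<in>V. nn v \<le> C * nn (v - B y v))"
    and u_mem: "x \<in> U \<Longrightarrow> u x \<in> V"
    and u_bound: "x \<in> U \<Longrightarrow> nn (u x) \<le> M"
    and u_eq: "x \<in> U \<Longrightarrow> u x = A x + B (u x) (u x)"
begin

lemma B_add: "x \<in> V \<Longrightarrow> y \<in> V \<Longrightarrow> z \<in> V \<Longrightarrow> B z (x + y) = B z x + B z y"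
  using B_lincomb[of x y z 1 1] by simp

lemma B_diff: "x \<in> V \<Longrightarrow> y \<in> V \<Longrightarrow> z \<in> V \<Longrightarrow> B z (x - y) = B z x - B z y"
  using B_lincomb[of x y z 1 "-1"] by simp

lemma B_add_left: "x \<in> V \<Longrightarrow> y \<in> V \<Longrightarrow> z \<in> V \<Longrightarrow> B (x + y) z = B x z + B y z"
  using B_add[of x y z] B_sym add_mem by metis

lemma B_diff_left: "x \<in> V \<Longrightarrow> y \<in> V \<Longrightarrow> z \<in> V \<Longrightarrow> B (x - y) z = B x z - B y z"
  using B_diff[of x y z] B_sym diff_mem by metis

text \<open>The inverse of \<open>I - B y\<close>.\<close>

definition resolvent :: "'b \<Rightarrow> 'b \<Rightarrow> 'b" where
  "resolvent y f = (THE v. v \<in> V \<and> v = f + B y v)"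

lemma resolvent_unique:
  assumes "y \<in> V" "v \<in> V" "v = f + B y v" "f \<in> V"
  shows "resolvent y f = v"
proof -
  have "\<exists>!v. v \<in> V \<and> v = f + B y v" using volterra[of "nn y"] assms by blast
  then show ?thesis unfolding resolvent_def using assms by (intro the1_equality) auto
qed

lemma resolvent:
  assumes "y \<in> V" "f \<in> V"
  shows "resolvent y f \<in> V" and "resolvent y f = f + B y (resolvent y f)"
proof -
  have "\<exists>!v. v \<in> V \<and> v = f + B y v" using volterra[of "nn y"] assms by blast
  then have "resolvent y f \<in> V \<and> resolvent y f = f + B y (resolvent y f)"
    unfolding resolvent_def by (rule theI')
  then show "resolvent y f \<in> V" "resolvent y f = f + B y (resolvent y f)" by blast+
qed

definition source :: "'a list \<Rightarrow> 'b" where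
  "source hs = (case hs of [h] \<Rightarrow> A h | _ \<Rightarrow> 0)"

text \<open>Differentiating \<open>u x = A x + B (u x) (u x)\<close> along \<open>hs\<close> yields
  two terms that contain \<open>D x hs\<close> itself, and by symmetry they add up to
  \<open>B (2 *\<^sub>R u x) (D x hs)\<close>. Solving for \<open>D x hs\<close> leaves only
  derivatives of lower order on the right.\<close>

function D :: "'a \<Rightarrow> 'a list \<Rightarrow> 'b" where
  "D x hs = (if hs = [] then u x else
     resolvent (2 *\<^sub>R u x) (source hs +
       leibniz_sum (\<lambda>as bs. if as = [] \<or> bs = [] then 0 else B (D x as) (D x bs)) hs))"
  by pat_completeness auto
termination
  by (relation "Wellfounded.measure (\<lambda>(x, hs). length hs)") (auto simp flip: length_greater_0_conv)

declare D.simps [simp del]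

lemma D_Nil: "D x [] = u x"
  by (simp add: D.simps)

lemma D_resolvent: "hs \<noteq> [] \<Longrightarrow> D x hs = resolvent (2 *\<^sub>R u x) (source hs +
       leibniz_sum (proper (\<lambda>as bs. B (D x as) (D x bs))) hs)"
  by (subst D.simps) (simp add: proper_def[abs_def])

abbreviation P :: "'a list \<Rightarrow> real" where "P hs \<equiv> prod_list (map nE hs)"

lemma P_nonneg: "set hs \<subseteq> E \<Longrightarrow> 0 \<le> P hs"
  by (induction hs) (auto simp: nE_nonneg)

lemma source_mem: "set hs \<subseteq> E \<Longrightarrow> source hs \<in> V"
  by (auto simp: source_def zero_mem A_mem split: list.split)

lemma source_bound: "set hs \<subseteq> E \<Longrightarrow> nn (source hs) \<le> KA * P hs"
  using P_nonneg[of hs] by (auto simp: source_def norm_zero A_bound KA split: list.split)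

lemma P_split_nonneg: "set as \<subseteq> E \<Longrightarrow> set bs \<subseteq> E \<Longrightarrow> 0 \<le> P as * P bs"
  by (simp add: P_nonneg)

lemma B_P_bound:
  assumes "x \<in> V" "y \<in> V" "nn x \<le> a * P as" "nn y \<le> b * P bs" "0 \<le> a" "0 \<le> b" "set as \<subseteq> E" "set bs \<subseteq> E"
  shows "nn (B x y) \<le> KB * a * b * (P as * P bs)"
proof -
  have "nn (B x y) \<le> KB * nn x * nn y" using B_bound assms by blast
  also have "\<dots> \<le> KB * (a * P as) * (b * P bs)"
    by (intro mult_mono mult_left_mono) (use assms KB norm_nonneg P_nonneg in auto)
  finally show ?thesis by (simp add: mult_ac)
qed

text \<open>Induction on the order. The source of the linear equation is bounded by products of
  lower derivatives, and the Volterra bound for the ball of radius \<open>2 * M\<close> transfers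
  this to the solution, uniformly in \<open>x\<close>.\<close>

lemma D_bound: "\<exists>C\<ge>0. \<forall>x\<in>U. \<forall>hs. length hs \<le> n \<and> set hs \<subseteq> E \<longrightarrow> D x hs \<in> V \<and> nn (D x hs) \<le> C * P hs"
proof (induction n)
  case 0
  show ?case
  proof (intro exI[of _ "\<bar>M\<bar>"] conjI ballI allI impI)
    fix x and hs :: "'a list" assume "x \<in> U" "length hs \<le> 0 \<and> set hs \<subseteq> E"
    then show "D x hs \<in> V" "nn (D x hs) \<le> \<bar>M\<bar> * P hs"
      using u_mem[of x] u_bound[of x] by (auto simp: D_Nil)
  qed simp
next
  case (Suc n)
  then obtain C where C: "C \<ge> 0" "\<And>x hs. x \<in> U \<Longrightarrow> length hs \<le> n \<Longrightarrow> set hs \<subseteq> E \<Longrightarrow>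
    D x hs \<in> V \<and> nn (D x hs) \<le> C * P hs" by blast
  obtain K where K: "K \<ge> 0" "\<And>y v. y \<in> V \<Longrightarrow> nn y \<le> 2 * M \<Longrightarrow> v \<in> V \<Longrightarrow> nn v \<le> K * nn (v - B y v)"
    using volterra[of "2 * M"] by blast
  define C' where "C' = max C (K * (KA + 2 ^ Suc n * (KB * C * C)))"
  show ?case
  proof (intro exI[of _ C'] conjI ballI allI impI)
    show "0 \<le> C'" using C by (simp add: C'_def)
    fix x and hs :: "'a list" assume x: "x \<in> U" and hs: "length hs \<le> Suc n \<and> set hs \<subseteq> E"
    have "D x hs \<in> V \<and> nn (D x hs) \<le> C' * P hs"
    proof (cases "length hs \<le> n")
      case True
      have "C * P hs \<le> C' * P hs" by (intro mult_right_mono P_nonneg) (use hs in \<open>auto simp: C'_def\<close>)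
      then show ?thesis using C(2)[of x hs] True x hs by auto
    next
      case False
      then have len: "length hs = Suc n" and ne: "hs \<noteq> []" using hs by auto
      let ?f = "source hs + leibniz_sum (proper (\<lambda>as bs. B (D x as) (D x bs))) hs"
      have L: "leibniz_sum (proper (\<lambda>as bs. B (D x as) (D x bs))) hs \<in> V \<and>
        nn (leibniz_sum (proper (\<lambda>as bs. B (D x as) (D x bs))) hs) \<le> 2 ^ length hs * (KB * C * C) * P hs"
      proof (rule leibniz_sum_bound)
        fix as bs assume *: "length as + length bs = length hs" "set as \<subseteq> set hs" "set bs \<subseteq> set hs"
        then have s: "set as \<subseteq> E" "set bs \<subseteq> E" using hs by auto
        show "proper (\<lambda>as bs. B (D x as) (D x bs)) as bs \<in> V \<and>
          nn (proper (\<lambda>as bs. B (D x as) (D x bs)) as bs) \<le> (KB * C * C) * (P as * P bs)"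
        proof (cases "as = [] \<or> bs = []")
          case True
          then show ?thesis using P_split_nonneg[OF s] C KB by (auto simp: proper_def zero_mem norm_zero)
        next
          case False
          then have "length as \<le> n" "length bs \<le> n" using * len by (cases as; cases bs; auto)+
          then show ?thesis
            using C(2)[OF x, of as] C(2)[OF x, of bs] s False
            by (auto simp: proper_def intro!: B_mem B_P_bound C(1))
        qed
      qed
      have u2: "2 *\<^sub>R u x \<in> V" "nn (2 *\<^sub>R u x) \<le> 2 * M"
        using u_mem[OF x] u_bound[OF x] by (auto simp: scale_mem norm_scale)
      have f: "?f \<in> V" using L source_mem hs add_mem by blast
      have D: "D x hs \<in> V" "D x hs = ?f + B (2 *\<^sub>R u x) (D x hs)"
        unfolding D_resolvent[OF ne] by (rule resolvent[OF u2(1) f])+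
      have "nn (D x hs) \<le> K * nn (D x hs - B (2 *\<^sub>R u x) (D x hs))"
        by (rule K(2)[OF u2 D(1)])
      also have "D x hs - B (2 *\<^sub>R u x) (D x hs) = ?f" using D(2) by (metis add_diff_cancel_right')
      also have "K * nn ?f \<le> K * (KA * P hs + 2 ^ length hs * (KB * C * C) * P hs)"
        by (intro mult_left_mono order_trans[OF norm_add] add_mono)
          (use L source_mem source_bound hs K in auto)
      also have "\<dots> = (K * (KA + 2 ^ Suc n * (KB * C * C))) * P hs"
        by (simp add: len algebra_simps)
      also have "\<dots> \<le> C' * P hs"
        by (intro mult_right_mono P_nonneg) (use hs in \<open>auto simp: C'_def\<close>)
      finally show ?thesis using D by blast
    qed
    then show "D x hs \<in> V" "nn (D x hs) \<le> C' * P hs" by auto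
  qed
qed

lemma D_mem: "x \<in> U \<Longrightarrow> set hs \<subseteq> E \<Longrightarrow> D x hs \<in> V"
  using D_bound[of "length hs"] by blast

text \<open>Unlike \<open>source\<close>, this has the value \<open>A x\<close> at the empty list.
  With it the equation of order 0 has the same form as the differentiated ones.\<close>

definition base :: "'a \<Rightarrow> 'a list \<Rightarrow> 'b" where
  "base x hs = (case hs of [] \<Rightarrow> A x | [h] \<Rightarrow> A h | _ \<Rightarrow> 0)"

text \<open>The equation that results from differentiating \<open>u x = A x + B (u x) (u x)\<close>
  in the directions \<open>hs\<close>.\<close>

lemma proper_leibniz_mem:
  assumes "x \<in> U" "set hs \<subseteq> E"
  shows "leibniz_sum (proper (\<lambda>as bs. B (D x as) (D x bs))) hs \<in> V"
proof (rule leibniz_sum_mem)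
  fix as bs assume "set as \<subseteq> set hs" "set bs \<subseteq> set hs"
  then show "proper (\<lambda>as bs. B (D x as) (D x bs)) as bs \<in> V"
    using assms D_mem[of x as] D_mem[of x bs] by (auto simp: proper_def zero_mem intro!: B_mem)
qed

lemma D_eq:
  assumes "x \<in> U" "set hs \<subseteq> E"
  shows "D x hs = base x hs + leibniz_sum (\<lambda>as bs. B (D x as) (D x bs)) hs"
proof (cases "hs = []")
  case True
  then show ?thesis using u_eq[OF assms(1)] by (simp add: D_Nil base_def)
next
  case False
  let ?f = "source hs + leibniz_sum (proper (\<lambda>as bs. B (D x as) (D x bs))) hs"
  have f: "?f \<in> V" using proper_leibniz_mem source_mem assms add_mem by blast
  have u: "u x \<in> V" using u_mem assms by blast
  have D: "D x hs = ?f + B (2 *\<^sub>R u x) (D x hs)"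
    unfolding D_resolvent[OF False] by (rule resolvent(2)[OF scale_mem[OF u] f])
  have 2: "B (2 *\<^sub>R u x) (D x hs) = B (D x hs) (D x []) + B (D x []) (D x hs)"
    using B_add_left[of "u x" "u x" "D x hs"] u D_mem[OF assms] B_sym
    by (simp add: D_Nil scaleR_2)
  have 3: "base x hs = source hs" using False by (auto simp: base_def source_def split: list.split)
  have 4: "leibniz_sum (\<lambda>as bs. B (D x as) (D x bs)) hs = B (D x hs) (D x []) + B (D x []) (D x hs) +
      leibniz_sum (proper (\<lambda>as bs. B (D x as) (D x bs))) hs"
    by (rule leibniz_sum_split[OF False])
  note D
  also have "?f + B (2 *\<^sub>R u x) (D x hs) = base x hs + leibniz_sum (\<lambda>as bs. B (D x as) (D x bs)) hs"
    unfolding 2 3 4 by (simp add: ac_simps)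
  finally show ?thesis .
qed

text \<open>Strong induction on the length: the sources are linear in the varied entry because lower
  derivatives are. The linear combination of the two solutions then solves the equation for the
  combined source, and solutions are unique.\<close>

lemma D_lincomb:
  assumes "x \<in> U"
  shows "lincomb_entry a b l l1 l2 \<Longrightarrow> set l1 \<subseteq> E \<Longrightarrow> set l2 \<subseteq> E \<Longrightarrow>
    D x l = a *\<^sub>R D x l1 + b *\<^sub>R D x l2"
proof (induction "length l" arbitrary: l l1 l2 rule: less_induct)
  case less
  have ne: "l \<noteq> []" "l1 \<noteq> []" "l2 \<noteq> []" and len: "length l1 = length l" "length l2 = length l"
    using lincomb_entry_nonempty lincomb_entry_length less.prems by blast+
  have lE: "set l \<subseteq> E"
    using less.prems by (induction rule: lincomb_entry.induct) (auto simp: E_lincomb)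
  let ?F = "proper (\<lambda>as bs. B (D x as) (D x bs))"
  let ?S = "\<lambda>l. source l + leibniz_sum ?F l"
  have src: "source l = a *\<^sub>R source l1 + b *\<^sub>R source l2"
    using less.prems(1) less.prems(2,3)
  proof cases
    case (here x y hs)
    then show ?thesis using less.prems(2,3) by (auto simp: source_def A_lincomb split: list.split)
  next
    case (there l l1 l2 h)
    then show ?thesis using lincomb_entry_nonempty[OF there(4)] by (auto simp: source_def split: list.split)
  qed
  have lei: "leibniz_sum ?F l = a *\<^sub>R leibniz_sum ?F l1 + b *\<^sub>R leibniz_sum ?F l2"
  proof (rule leibniz_sum_lincomb[OF less.prems])
    fix as as1 as2 bs
    assume *: "lincomb_entry a b as as1 as2" "length as + length bs = length l"
      "set as1 \<subseteq> E" "set as2 \<subseteq> E" "set bs \<subseteq> E"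
    note n = lincomb_entry_nonempty[OF *(1)]
    show "?F as bs = a *\<^sub>R ?F as1 bs + b *\<^sub>R ?F as2 bs"
    proof (cases "bs = []")
      case False
      then have "length as < length l" using *(2) by (cases bs) auto
      then have 1: "D x as = a *\<^sub>R D x as1 + b *\<^sub>R D x as2" using less.hyps * by blast
      have "B (D x bs) (D x as) = a *\<^sub>R B (D x bs) (D x as1) + b *\<^sub>R B (D x bs) (D x as2)"
        unfolding 1 by (rule B_lincomb) (use * assms D_mem in auto)
      moreover have "set as \<subseteq> E" using *(1,3,4)
        by (induction rule: lincomb_entry.induct) (auto simp: E_lincomb)
      ultimately show ?thesis using False n B_sym D_mem[OF assms] * by (auto simp: proper_def)
    qed (simp add: proper_def)
  next
    fix as bs bs1 bs2
    assume *: "lincomb_entry a b bs bs1 bs2" "length as + length bs = length l"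
      "set bs1 \<subseteq> E" "set bs2 \<subseteq> E" "set as \<subseteq> E"
    note n = lincomb_entry_nonempty[OF *(1)]
    show "?F as bs = a *\<^sub>R ?F as bs1 + b *\<^sub>R ?F as bs2"
    proof (cases "as = []")
      case False
      then have "length bs < length l" using *(2) by (cases as) auto
      then have 1: "D x bs = a *\<^sub>R D x bs1 + b *\<^sub>R D x bs2" using less.hyps * by blast
      have "B (D x as) (D x bs) = a *\<^sub>R B (D x as) (D x bs1) + b *\<^sub>R B (D x as) (D x bs2)"
        unfolding 1 by (rule B_lincomb) (use * assms D_mem in auto)
      then show ?thesis using False n by (auto simp: proper_def)
    qed (simp add: proper_def)
  qed
  have S: "?S l = a *\<^sub>R ?S l1 + b *\<^sub>R ?S l2" unfolding src lei by (simp add: algebra_simps)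
  have u2: "2 *\<^sub>R u x \<in> V" using assms u_mem scale_mem by blast
  have SV: "?S l \<in> V" "?S l1 \<in> V" "?S l2 \<in> V"
    using source_mem proper_leibniz_mem assms less.prems lE add_mem by blast+
  note r1 = resolvent[OF u2 SV(2)] and r2 = resolvent[OF u2 SV(3)]
  have "resolvent (2 *\<^sub>R u x) (?S l) = a *\<^sub>R resolvent (2 *\<^sub>R u x) (?S l1) + b *\<^sub>R resolvent (2 *\<^sub>R u x) (?S l2)"
  proof (rule resolvent_unique[OF u2 _ _ SV(1)])
    show "a *\<^sub>R resolvent (2 *\<^sub>R u x) (?S l1) + b *\<^sub>R resolvent (2 *\<^sub>R u x) (?S l2) \<in> V"
      using r1 r2 add_mem scale_mem by blast
    have "a *\<^sub>R resolvent (2 *\<^sub>R u x) (?S l1) + b *\<^sub>R resolvent (2 *\<^sub>R u x) (?S l2) =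
       a *\<^sub>R (?S l1 + B (2 *\<^sub>R u x) (resolvent (2 *\<^sub>R u x) (?S l1))) +
       b *\<^sub>R (?S l2 + B (2 *\<^sub>R u x) (resolvent (2 *\<^sub>R u x) (?S l2)))"
      using r1(2) r2(2) by simp
    then show "a *\<^sub>R resolvent (2 *\<^sub>R u x) (?S l1) + b *\<^sub>R resolvent (2 *\<^sub>R u x) (?S l2) =
       ?S l + B (2 *\<^sub>R u x) (a *\<^sub>R resolvent (2 *\<^sub>R u x) (?S l1) + b *\<^sub>R resolvent (2 *\<^sub>R u x) (?S l2))"
      unfolding B_lincomb[OF r1(1) r2(1) u2] S by (simp add: algebra_simps)
  qed
  then show ?case using D_resolvent ne by metis
qed

lemma D_multilinear:
  assumes "x \<in> U"
  shows "multilinear_on E n (D x)"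
  unfolding multilinear_on_def
proof (intro allI impI)
  fix hs i y z and a b :: real
  assume *: "length hs = n \<and> set hs \<subseteq> E \<and> i < n \<and> y \<in> E \<and> z \<in> E"
  show "D x (hs[i := a *\<^sub>R y + b *\<^sub>R z]) = a *\<^sub>R D x (hs[i := y]) + b *\<^sub>R D x (hs[i := z])"
  proof (rule D_lincomb[OF assms lincomb_entry_update])
    show "i < length hs" using * by simp
    show "set (hs[i := y]) \<subseteq> E" "set (hs[i := z]) \<subseteq> E"
      using * set_update_subset_insert[of hs i] by blast+
  qed
qed

text \<open>Only the Volterra bound is used to absorb the terms that contain the difference of highest order.\<close>

lemma D_increment_bound:
  "\<exists>C\<ge>0. \<forall>x\<in>U. \<forall>h\<in>E. x + h \<in> U \<longrightarrow> (\<forall>hs. length hs \<le> n \<and> set hs \<subseteq> E \<longrightarrow>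
     nn (D (x + h) hs - D x hs) \<le> C * nE h * P hs)"
proof (induction n)
  case 0
  obtain K where K: "K \<ge> 0" "\<And>y v. y \<in> V \<Longrightarrow> nn y \<le> 2 * M \<Longrightarrow> v \<in> V \<Longrightarrow> nn v \<le> K * nn (v - B y v)"
    using volterra[of "2 * M"] by blast
  show ?case
  proof (intro exI[of _ "K * KA"] conjI ballI allI impI)
    show "0 \<le> K * KA" using K KA by simp
    fix x h and hs :: "'a list" assume x: "x \<in> U" "h \<in> E" "x + h \<in> U" and "length hs \<le> 0 \<and> set hs \<subseteq> E"
    then have hs: "hs = []" by simp
    let ?d = "u (x + h) - u x"
    have uV: "u (x + h) \<in> V" "u x \<in> V" using u_mem x by auto
    have A1: "A (x + h) = A x + A h" using A_lincomb[of x h 1 1] x U_sub by auto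
    have "u (x + h) + u x \<in> V" "nn (u (x + h) + u x) \<le> 2 * M"
      using uV add_mem norm_add[OF uV] u_bound[OF x(1)] u_bound[OF x(3)] by auto
    then have "nn ?d \<le> K * nn (?d - B (u (x + h) + u x) ?d)"
      using K(2) uV diff_mem by blast
    \<comment> \<open>By symmetry the difference of the two squares factors, so the increment solves
      a linear equation with \<open>u (x + h) + u x\<close> in place of
      \<open>2 *\<^sub>R u x\<close>. Its norm is again at most \<open>2 * M\<close>.\<close>
    also have "?d - B (u (x + h) + u x) ?d = A h"
    proof -
      have "B (u (x + h) + u x) ?d = B (u (x + h)) (u (x + h)) - B (u x) (u x)"
        using uV B_sym[OF uV] by (simp add: B_add_left B_diff diff_mem)
      moreover have "?d = (A x + A h + B (u (x + h)) (u (x + h))) - (A x + B (u x) (u x))"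
        using u_eq[OF x(1)] u_eq[OF x(3)] A1 by metis
      ultimately have "?d - B (u (x + h) + u x) ?d =
        ((A x + A h + B (u (x + h)) (u (x + h))) - (A x + B (u x) (u x))) -
          (B (u (x + h)) (u (x + h)) - B (u x) (u x))" by (rule arg_cong2[of _ _ _ _ minus, rotated])
      then show ?thesis by simp
    qed
    also have "K * nn (A h) \<le> K * (KA * nE h)" by (intro mult_left_mono A_bound x K)
    finally show "nn (D (x + h) hs - D x hs) \<le> K * KA * nE h * P hs"
      by (simp add: hs D_Nil mult_ac)
  qed
next
  case (Suc n)
  then obtain C where C: "C \<ge> 0" "\<And>x h hs. x \<in> U \<Longrightarrow> h \<in> E \<Longrightarrow> x + h \<in> U \<Longrightarrow> length hs \<le> n \<Longrightarrow> set hs \<subseteq> E \<Longrightarrow>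
    nn (D (x + h) hs - D x hs) \<le> C * nE h * P hs" by blast
  obtain G where G: "G \<ge> 0" "\<And>x hs. x \<in> U \<Longrightarrow> length hs \<le> Suc n \<Longrightarrow> set hs \<subseteq> E \<Longrightarrow> nn (D x hs) \<le> G * P hs"
    using D_bound[of "Suc n"] by blast
  obtain K where K: "K \<ge> 0" "\<And>y v. y \<in> V \<Longrightarrow> nn y \<le> 2 * M \<Longrightarrow> v \<in> V \<Longrightarrow> nn v \<le> K * nn (v - B y v)"
    using volterra[of "2 * M"] by blast
  define C' where "C' = max C (K * (2 * (KB * C * G) + 2 ^ Suc n * (2 * (KB * C * G))))"
  show ?case
  proof (intro exI[of _ C'] conjI ballI allI impI)
    show "0 \<le> C'" using C by (simp add: C'_def)
    fix x h and hs :: "'a list" assume x: "x \<in> U" "h \<in> E" "x + h \<in> U" and hs: "length hs \<le> Suc n \<and> set hs \<subseteq> E"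
    show "nn (D (x + h) hs - D x hs) \<le> C' * nE h * P hs"
    proof (cases "length hs \<le> n")
      case True
      have "C * nE h * P hs \<le> C' * nE h * P hs"
        by (intro mult_right_mono P_nonneg nE_nonneg) (use x hs in \<open>auto simp: C'_def\<close>)
      then show ?thesis using C(2)[of x h hs] True x hs by auto
    next
      case False
      then have len: "length hs = Suc n" and ne: "hs \<noteq> []" using hs by auto
      define d where "d as = D (x + h) as - D x as" for as
      have dV: "set as \<subseteq> E \<Longrightarrow> d as \<in> V" for as using D_mem x diff_mem by (simp add: d_def)
      have dC: "length as \<le> n \<Longrightarrow> set as \<subseteq> E \<Longrightarrow> nn (d as) \<le> C * nE h * P as" for as
        using C(2) x by (simp add: d_def)
      let ?F = "\<lambda>as bs. B (d as) (D (x + h) bs) + B (D x as) (d bs)"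
      have hsE: "set hs \<subseteq> E" using hs by simp
      have b: "base (x + h) hs = base x hs" using ne by (auto simp: base_def split: list.split)
      have "d hs = leibniz_sum (\<lambda>as bs. B (D (x + h) as) (D (x + h) bs) - B (D x as) (D x bs)) hs"
        unfolding leibniz_sum_diff d_def by (subst (1 2) D_eq) (use x hsE b in auto)
      also have "\<dots> = leibniz_sum ?F hs"
      proof (rule leibniz_sum_cong)
        fix as bs assume "set as \<subseteq> set hs" "set bs \<subseteq> set hs"
        then have "set as \<subseteq> E" "set bs \<subseteq> E" using hsE by auto
        then show "B (D (x + h) as) (D (x + h) bs) - B (D x as) (D x bs) = ?F as bs"
          using D_mem x by (simp add: d_def B_diff B_diff_left)
      qed
      also have "\<dots> = ?F hs [] + ?F [] hs + leibniz_sum (proper ?F) hs" by (rule leibniz_sum_split[OF ne])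
      finally have deq: "d hs = ?F hs [] + ?F [] hs + leibniz_sum (proper ?F) hs" .
      let ?y = "u (x + h) + u x"
      have uV: "u (x + h) \<in> V" "u x \<in> V" using u_mem x by auto
      have y: "?y \<in> V" "nn ?y \<le> 2 * M"
        using uV add_mem norm_add[OF uV] u_bound[OF x(1)] u_bound[OF x(3)] by auto
      have DV: "D x hs \<in> V" "D (x + h) hs \<in> V" using D_mem x hsE by auto
      have d0: "d [] = u (x + h) - u x" "d [] \<in> V" using dV[of "[]"] by (auto simp: d_def D_Nil)
      \<comment> \<open>The two terms with the increment of highest order carry different base
        points. By symmetry they still combine to one linear operator, the one already met at order
        0.\<close>
      have By: "B ?y (d hs) = B (d hs) (D (x + h) []) + B (D x []) (d hs)"
        using uV dV[OF hsE] B_sym by (simp add: D_Nil B_add_left)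
      have rest: "d hs - B ?y (d hs) = B (D x hs) (d []) + B (d []) (D (x + h) hs) + leibniz_sum (proper ?F) hs"
        unfolding By using arg_cong[OF deq, of "\<lambda>v. v - (B (d hs) (D (x + h) []) + B (D x []) (d hs))"]
        by (simp add: algebra_simps)
      have tm: "nn (B (D z as) (d bs)) \<le> (KB * C * G * nE h) * (P as * P bs) \<and>
          nn (B (d bs) (D z as)) \<le> (KB * C * G * nE h) * (P as * P bs)"
        if "z \<in> U" "length bs \<le> n" "length as \<le> Suc n" "set as \<subseteq> E" "set bs \<subseteq> E" for as bs z
      proof -
        have "nn (B (D z as) (d bs)) \<le> KB * G * (C * nE h) * (P as * P bs)"
          by (rule B_P_bound) (use that x C G dV dC D_mem nE_nonneg in auto)
        moreover have "B (d bs) (D z as) = B (D z as) (d bs)"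
          using that B_sym dV D_mem by blast
        ultimately show ?thesis by (simp add: mult_ac)
      qed
      have L: "leibniz_sum (proper ?F) hs \<in> V \<and> nn (leibniz_sum (proper ?F) hs) \<le> 2 ^ length hs * (2 * (KB * C * G * nE h)) * P hs"
      proof (rule leibniz_sum_bound)
        fix as bs assume *: "length as + length bs = length hs" "set as \<subseteq> set hs" "set bs \<subseteq> set hs"
        then have s: "set as \<subseteq> E" "set bs \<subseteq> E" using hs by auto
        show "proper ?F as bs \<in> V \<and> nn (proper ?F as bs) \<le> 2 * (KB * C * G * nE h) * (P as * P bs)"
        proof (cases "as = [] \<or> bs = []")
          case True
          then show ?thesis using P_split_nonneg[OF s] C(1) G(1) KB nE_nonneg[OF x(2)] by (auto simp: proper_def zero_mem norm_zero)
        next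
          case False
          then have l: "length as \<le> n" "length bs \<le> n" using * len by (cases as; cases bs; auto)+
          have m: "B (d as) (D (x + h) bs) \<in> V" "B (D x as) (d bs) \<in> V"
            using s x D_mem dV B_mem by auto
          show ?thesis
            using norm_add[OF m] tm[of "x + h" as bs] tm[of x bs as] m add_mem[OF m] s x l False
            by (auto simp: proper_def mult_ac)
        qed
      qed
      have m: "B (D x hs) (d []) \<in> V" "B (d []) (D (x + h) hs) \<in> V" using DV d0 B_mem by auto
      have "nn (d hs) \<le> K * nn (d hs - B ?y (d hs))" using K(2)[OF y] dV hsE by blast
      also have "\<dots> \<le> K * ((KB * C * G * nE h) * P hs + (KB * C * G * nE h) * P hs + 2 ^ length hs * (2 * (KB * C * G * nE h)) * P hs)"
        unfolding rest
        using tm[of x "[]" hs] tm[of "x + h" "[]" hs] x hs L m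
        by (intro mult_left_mono K order_trans[OF norm_add] add_mono add_mem) auto
      also have "\<dots> = (K * (2 * (KB * C * G) + 2 ^ Suc n * (2 * (KB * C * G)))) * nE h * P hs"
        by (simp add: len algebra_simps)
      also have "\<dots> \<le> C' * nE h * P hs"
        by (intro mult_right_mono P_nonneg nE_nonneg) (use x hs in \<open>auto simp: C'_def\<close>)
      finally show ?thesis by (simp add: d_def)
    qed
  qed
qed

text \<open>The first-order Taylor remainder solves the linear equation with
  \<open>2 *\<^sub>R u x\<close>. Its source consists of products of two increments, which are
  quadratic in \<open>h\<close>, and of remainders of lower order.\<close>

lemma D_remainder_bound:
  "\<exists>C\<ge>0. \<forall>x\<in>U. \<forall>h\<in>E. x + h \<in> U \<longrightarrow> (\<forall>hs. length hs \<le> n \<and> set hs \<subseteq> E \<longrightarrow>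
     nn (D (x + h) hs - D x hs - D x (h # hs)) \<le> C * (nE h)\<^sup>2 * P hs)"
proof -
  obtain K where K: "K \<ge> 0" "\<And>y v. y \<in> V \<Longrightarrow> nn y \<le> 2 * M \<Longrightarrow> v \<in> V \<Longrightarrow> nn v \<le> K * nn (v - B y v)"
    using volterra[of "2 * M"] by blast
  obtain C where C: "C \<ge> 0" "\<And>x h hs. x \<in> U \<Longrightarrow> h \<in> E \<Longrightarrow> x + h \<in> U \<Longrightarrow> length hs \<le> n \<Longrightarrow> set hs \<subseteq> E \<Longrightarrow>
    nn (D (x + h) hs - D x hs) \<le> C * nE h * P hs" using D_increment_bound[of n] by blast
  obtain G where G: "G \<ge> 0" "\<And>x hs. x \<in> U \<Longrightarrow> length hs \<le> n \<Longrightarrow> set hs \<subseteq> E \<Longrightarrow> nn (D x hs) \<le> G * P hs"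
    using D_bound[of n] by blast
  define r where "r x h as = D (x + h) as - D x as - D x (h # as)" for x h as
  have rV: "x \<in> U \<Longrightarrow> h \<in> E \<Longrightarrow> x + h \<in> U \<Longrightarrow> set as \<subseteq> E \<Longrightarrow> r x h as \<in> V" for x h as
    using D_mem diff_mem by (simp add: r_def)
  \<comment> \<open>The constants \<open>C\<close> and \<open>G\<close> are fixed for order
    \<open>n\<close>, and the induction runs over the orders \<open>m\<close> below it.\<close>
  have "m \<le> n \<Longrightarrow> \<exists>Q\<ge>0. \<forall>x\<in>U. \<forall>h\<in>E. x + h \<in> U \<longrightarrow> (\<forall>hs. length hs \<le> m \<and> set hs \<subseteq> E \<longrightarrow>
     nn (r x h hs) \<le> Q * (nE h)\<^sup>2 * P hs)" for m
  proof (induction m)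
    case 0
    show ?case
    proof (intro exI[of _ "K * (KB * C * C)"] conjI ballI allI impI)
      show "0 \<le> K * (KB * C * C)" using K C KB by simp
      fix x h and hs :: "'a list" assume x: "x \<in> U" "h \<in> E" "x + h \<in> U" and "length hs \<le> 0 \<and> set hs \<subseteq> E"
      then have hs: "hs = []" by simp
      let ?d = "u (x + h) - u x"
      let ?r = "r x h []"
      have uV: "u (x + h) \<in> V" "u x \<in> V" "?d \<in> V" using u_mem x diff_mem by auto
      have u2: "2 *\<^sub>R u x \<in> V" "nn (2 *\<^sub>R u x) \<le> 2 * M"
        using u_mem[OF x(1)] u_bound[OF x(1)] by (auto simp: scale_mem norm_scale)
      have A1: "A (x + h) = A x + A h" using A_lincomb[of x h 1 1] x U_sub by auto
      have Dh: "D x [h] \<in> V" using D_mem x by auto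
      have Dheq: "D x [h] = A h + (B (D x [h]) (u x) + B (u x) (D x [h]))"
        using D_eq[of x "[h]"] x by (simp add: base_def D_Nil)
      have "nn ?r \<le> K * nn (?r - B (2 *\<^sub>R u x) ?r)" using K(2)[OF u2] rV x by simp
      \<comment> \<open>Subtracting the linearization at \<open>u x\<close> from the difference of
        squares leaves the square of the increment.\<close>
      also have "?r - B (2 *\<^sub>R u x) ?r = B ?d ?d"
      proof -
        have "r x h [] = u (x + h) - u x - D x [h]" by (simp add: r_def D_Nil)
        also have "\<dots> = A x + A h + B (u (x + h)) (u (x + h)) - (A x + B (u x) (u x))
            - (A h + (B (D x [h]) (u x) + B (u x) (D x [h])))"
          using u_eq[OF x(1)] u_eq[OF x(3)] A1 Dheq by metis
        finally have 1: "?r = B (u (x + h)) (u (x + h)) - B (u x) (u x) - (B (D x [h]) (u x) + B (u x) (D x [h]))"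
          by simp
        have 2: "B (2 *\<^sub>R u x) ?r = B (u x) (u (x + h)) + B (u (x + h)) (u x) - B (u x) (u x) - B (u x) (u x)
             - (B (D x [h]) (u x) + B (u x) (D x [h]))"
          using uV Dh B_sym by (simp add: scaleR_2 B_add_left rV x r_def D_Nil B_diff diff_mem)
        show ?thesis
          unfolding 2 unfolding 1 using uV B_sym by (simp add: B_diff B_diff_left)
      qed
      also have "K * nn (B ?d ?d) \<le> K * (KB * (C * nE h) * (C * nE h) * (P [] * P []))"
        using C(2)[OF x, of "[]"] uV K C nE_nonneg[OF x(2)] by (intro mult_left_mono B_P_bound) (auto simp: D_Nil)
      finally show "nn (r x h hs) \<le> K * (KB * C * C) * (nE h)\<^sup>2 * P hs"
        by (simp add: hs power2_eq_square mult_ac)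
    qed
  next
    case (Suc m)
    then obtain Q where Q: "Q \<ge> 0" "\<And>x h hs. x \<in> U \<Longrightarrow> h \<in> E \<Longrightarrow> x + h \<in> U \<Longrightarrow> length hs \<le> m \<Longrightarrow> set hs \<subseteq> E \<Longrightarrow>
      nn (r x h hs) \<le> Q * (nE h)\<^sup>2 * P hs" by (meson Suc_leD)
    define Z where "Z = KB * C * C + 2 * (KB * Q * G)"
    have Z: "0 \<le> Z" using KB C Q G by (simp add: Z_def)
    define Q' where "Q' = max Q (K * (2 * Z + 2 ^ Suc m * Z))"
    show ?case
    proof (intro exI[of _ Q'] conjI ballI allI impI)
      show "0 \<le> Q'" using Q by (simp add: Q'_def)
      fix x h and hs :: "'a list" assume x: "x \<in> U" "h \<in> E" "x + h \<in> U" and hs: "length hs \<le> Suc m \<and> set hs \<subseteq> E"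
      show "nn (r x h hs) \<le> Q' * (nE h)\<^sup>2 * P hs"
      proof (cases "length hs \<le> m")
        case True
        have "Q * (nE h)\<^sup>2 * P hs \<le> Q' * (nE h)\<^sup>2 * P hs"
          by (intro mult_right_mono P_nonneg) (use hs in \<open>auto simp: Q'_def\<close>)
        then show ?thesis using Q(2)[of x h hs] True x hs by auto
      next
        case False
        then have len: "length hs = Suc m" and ne: "hs \<noteq> []" using hs by auto
        have hsE: "set hs \<subseteq> E" using hs by simp
        define d where "d as = D (x + h) as - D x as" for as
        have dV: "set as \<subseteq> E \<Longrightarrow> d as \<in> V" for as using D_mem x diff_mem by (simp add: d_def)
        have dC: "length as \<le> n \<Longrightarrow> set as \<subseteq> E \<Longrightarrow> nn (d as) \<le> C * nE h * P as" for as
          using C(2) x by (simp add: d_def)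
        have rV': "set as \<subseteq> E \<Longrightarrow> r x h as \<in> V" for as using rV x by blast
        have rQ: "length as \<le> m \<Longrightarrow> set as \<subseteq> E \<Longrightarrow> nn (r x h as) \<le> Q * (nE h)\<^sup>2 * P as" for as
          using Q(2) x by blast
        have DV: "set as \<subseteq> E \<Longrightarrow> D x as \<in> V \<and> D (x + h) as \<in> V \<and> D x (h # as) \<in> V" for as
          using D_mem x by simp
        \<comment> \<open>Taylor remainder of a product: with increments \<open>d\<close> and
          remainders \<open>r\<close>, what is left after the first-order part is
          \<open>d d + r b + a r\<close>.\<close>
        let ?F = "\<lambda>as bs. B (d as) (d bs) + (B (r x h as) (D x bs) + B (D x as) (r x h bs))"
        have base: "base (x + h) hs = base x hs" "base x (h # hs) = 0"
          using ne by (auto simp: base_def split: list.split)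
        have "r x h hs = leibniz_sum (\<lambda>as bs. B (D (x + h) as) (D (x + h) bs) - B (D x as) (D x bs) -
          (B (D x (h # as)) (D x bs) + B (D x as) (D x (h # bs)))) hs"
          unfolding leibniz_sum_diff r_def
          using D_eq[of "x + h" hs] D_eq[of x hs] D_eq[of x "h # hs"] x hsE base by simp
        also have "\<dots> = leibniz_sum ?F hs"
        proof (rule leibniz_sum_cong)
          fix as bs assume "set as \<subseteq> set hs" "set bs \<subseteq> set hs"
          then have "set as \<subseteq> E" "set bs \<subseteq> E" using hsE by auto
          then show "B (D (x + h) as) (D (x + h) bs) - B (D x as) (D x bs) -
            (B (D x (h # as)) (D x bs) + B (D x as) (D x (h # bs))) = ?F as bs"
            using DV by (simp add: d_def r_def B_diff B_diff_left diff_mem)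
        qed
        also have "\<dots> = ?F hs [] + ?F [] hs + leibniz_sum (proper ?F) hs" by (rule leibniz_sum_split[OF ne])
        finally have req: "r x h hs = ?F hs [] + ?F [] hs + leibniz_sum (proper ?F) hs" .
        have uV: "u x \<in> V" using u_mem x by auto
        have u2: "2 *\<^sub>R u x \<in> V" "nn (2 *\<^sub>R u x) \<le> 2 * M"
          using u_mem[OF x(1)] u_bound[OF x(1)] by (auto simp: scale_mem norm_scale)
        have Bu: "B (2 *\<^sub>R u x) (r x h hs) = B (r x h hs) (D x []) + B (D x []) (r x h hs)"
          using uV rV'[OF hsE] B_sym by (simp add: D_Nil scaleR_2 B_add_left)
        have rest: "r x h hs - B (2 *\<^sub>R u x) (r x h hs) = (B (d hs) (d []) + B (D x hs) (r x h [])) +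
          (B (d []) (d hs) + B (r x h []) (D x hs)) + leibniz_sum (proper ?F) hs"
          unfolding Bu using arg_cong[OF req, of "\<lambda>v. v - (B (r x h hs) (D x []) + B (D x []) (r x h hs))"]
          by (simp add: algebra_simps)
        let ?N = "(nE h)\<^sup>2"
        have dd: "nn (B (d as) (d bs)) \<le> (KB * C * C * ?N) * (P as * P bs)"
          if "length as \<le> n" "length bs \<le> n" "set as \<subseteq> E" "set bs \<subseteq> E" for as bs
        proof -
          have "nn (B (d as) (d bs)) \<le> KB * (C * nE h) * (C * nE h) * (P as * P bs)"
            by (rule B_P_bound) (use that x C dV dC nE_nonneg in auto)
          then show ?thesis by (simp add: power2_eq_square mult_ac)
        qed
        have rr: "nn (B (D x as) (r x h bs)) \<le> (KB * Q * G * ?N) * (P as * P bs)"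
          "nn (B (r x h bs) (D x as)) \<le> (KB * Q * G * ?N) * (P as * P bs)"
          if "length as \<le> n" "length bs \<le> m" "set as \<subseteq> E" "set bs \<subseteq> E" for as bs
        proof -
          have 1: "nn (B (D x as) (r x h bs)) \<le> KB * G * (Q * ?N) * (P as * P bs)"
            by (rule B_P_bound) (use that x Q G rV' rQ DV in auto)
          then show "nn (B (D x as) (r x h bs)) \<le> (KB * Q * G * ?N) * (P as * P bs)"
            by (simp add: mult_ac)
          have "B (r x h bs) (D x as) = B (D x as) (r x h bs)"
            using that B_sym rV' DV by blast
          then show "nn (B (r x h bs) (D x as)) \<le> (KB * Q * G * ?N) * (P as * P bs)"
            using 1 by (simp add: mult_ac)
        qed
        have mem: "B (d as) (d bs) \<in> V" "B (r x h as) (D x bs) \<in> V" "B (D x as) (r x h bs) \<in> V"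
          if "set as \<subseteq> E" "set bs \<subseteq> E" for as bs
          using that dV rV' DV B_mem by auto
        have L: "leibniz_sum (proper ?F) hs \<in> V \<and> nn (leibniz_sum (proper ?F) hs) \<le> 2 ^ length hs * (Z * ?N) * P hs"
        proof (rule leibniz_sum_bound)
          fix as bs assume *: "length as + length bs = length hs" "set as \<subseteq> set hs" "set bs \<subseteq> set hs"
          then have s: "set as \<subseteq> E" "set bs \<subseteq> E" using hs by auto
          show "proper ?F as bs \<in> V \<and> nn (proper ?F as bs) \<le> Z * ?N * (P as * P bs)"
          proof (cases "as = [] \<or> bs = []")
            case True
            then show ?thesis using P_split_nonneg[OF s] Z by (auto simp: proper_def zero_mem norm_zero)
          next
            case False
            then have l: "length as \<le> m" "length bs \<le> m" using * len by (cases as; cases bs; auto)+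
            then have l': "length as \<le> n" "length bs \<le> n" using Suc.prems by auto
            have "nn (?F as bs) \<le> (KB * C * C * ?N) * (P as * P bs) + ((KB * Q * G * ?N) * (P bs * P as) + (KB * Q * G * ?N) * (P as * P bs))"
              by (intro order_trans[OF norm_add] add_mono dd rr mem add_mem) (use s l l' in auto)
            also have "\<dots> = Z * ?N * (P as * P bs)" by (simp add: Z_def algebra_simps)
            finally show ?thesis
              using False mem[OF s] add_mem by (auto simp: proper_def)
          qed
        qed
        have n: "length hs \<le> n" using Suc.prems len by simp
        have hN: "set [] \<subseteq> E" by simp
        have "nn (r x h hs) \<le> K * nn (r x h hs - B (2 *\<^sub>R u x) (r x h hs))" using K(2)[OF u2] rV' hsE by blast
        also have "\<dots> \<le> K * (((KB * C * C * ?N) * (P hs * P []) + (KB * Q * G * ?N) * (P hs * P [])) +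
          ((KB * C * C * ?N) * (P [] * P hs) + (KB * Q * G * ?N) * (P hs * P [])) + 2 ^ length hs * (Z * ?N) * P hs)"
          unfolding rest
          by (intro mult_left_mono K order_trans[OF norm_add] add_mono dd rr mem add_mem L[THEN conjunct1] L[THEN conjunct2] hsE n hN) auto
        also have "\<dots> \<le> (K * (2 * Z + 2 ^ Suc m * Z)) * ?N * P hs"
        proof -
          have "(KB * C * C + KB * Q * G) * (?N * P hs) \<le> Z * (?N * P hs)"
            using KB Q G P_nonneg[OF hsE] by (intro mult_right_mono) (auto simp: Z_def)
          then have "K * (2 * ((KB * C * C + KB * Q * G) * (?N * P hs)) + 2 ^ length hs * (Z * ?N) * P hs) \<le>
            K * (2 * (Z * (?N * P hs)) + 2 ^ length hs * (Z * ?N) * P hs)"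
            by (intro mult_left_mono add_right_mono K) auto
          then show ?thesis by (simp add: len algebra_simps)
        qed
        also have "\<dots> \<le> Q' * ?N * P hs"
          by (intro mult_right_mono P_nonneg) (use hs in \<open>auto simp: Q'_def\<close>)
        finally show ?thesis .
      qed
    qed
  qed
  from this[of n] show ?thesis unfolding r_def by simp
qed

text \<open>The derivatives are constructed in one normed space. A linear map that is bounded for
  every seminorm in \<open>Q\<close> carries them, with their remainder estimates, into the locally
  convex target.\<close>

theorem smooth_flow:
  fixes \<Phi> :: "'b \<Rightarrow> 'c::real_vector"
  assumes Phi_mem: "\<And>v. v \<in> V \<Longrightarrow> \<Phi> v \<in> F"
    and Phi_lincomb: "\<And>v w a b. v \<in> V \<Longrightarrow> w \<in> V \<Longrightarrow> \<Phi> (a *\<^sub>R v + b *\<^sub>R w) = a *\<^sub>R \<Phi> v + b *\<^sub>R \<Phi> w"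
    and Phi_bound: "\<And>p. p \<in> Q \<Longrightarrow> \<exists>C\<ge>0. \<forall>v\<in>V. p (\<Phi> v) \<le> C * nn v"
    and f: "\<And>x. x \<in> U \<Longrightarrow> f x = \<Phi> (u x)"
  shows "smooth_map_on E nE U F Q f"
  unfolding smooth_map_on_def
proof (intro exI[of _ "\<lambda>n x hs. \<Phi> (D x hs)"] conjI ballI allI impI)
  show "x \<in> U \<Longrightarrow> \<Phi> (D x []) = f x" for x by (simp add: D_Nil f)
  show "multilinear_on E n (\<lambda>hs. \<Phi> (D x hs))" if "x \<in> U" for n x
    unfolding multilinear_on_def
  proof (intro allI impI)
    fix hs i y z and a b :: real
    assume *: "length hs = n \<and> set hs \<subseteq> E \<and> i < n \<and> y \<in> E \<and> z \<in> E"
    have "set (hs[i := y]) \<subseteq> E" "set (hs[i := z]) \<subseteq> E"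
      using * set_update_subset_insert[of hs i] by blast+
    then show "\<Phi> (D x (hs[i := a *\<^sub>R y + b *\<^sub>R z])) = a *\<^sub>R \<Phi> (D x (hs[i := y])) + b *\<^sub>R \<Phi> (D x (hs[i := z]))"
      using D_multilinear[OF that, of n] * Phi_lincomb D_mem[OF that] unfolding multilinear_on_def by metis
  qed
  show "\<Phi> (D x hs) \<in> F" if "x \<in> U" "length hs = n \<and> set hs \<subseteq> E" for n x hs
    using that D_mem Phi_mem by blast
next
  fix n x p assume x: "x \<in> U" and p: "p \<in> Q"
  obtain C where C: "C \<ge> 0" "\<And>v. v \<in> V \<Longrightarrow> p (\<Phi> v) \<le> C * nn v" using Phi_bound[OF p] by blast
  obtain G where G: "\<And>hs. length hs \<le> n \<Longrightarrow> set hs \<subseteq> E \<Longrightarrow> D x hs \<in> V \<and> nn (D x hs) \<le> G * P hs"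
    using D_bound[of n] x by blast
  show "\<exists>C. \<forall>hs. length hs = n \<and> set hs \<subseteq> E \<longrightarrow> p (\<Phi> (D x hs)) \<le> C * P hs"
  proof (intro exI allI impI)
    fix hs assume hs: "length hs = n \<and> set hs \<subseteq> E"
    then have "p (\<Phi> (D x hs)) \<le> C * nn (D x hs)" using C G by simp
    also have "\<dots> \<le> C * (G * P hs)" using G[of hs] hs C by (intro mult_left_mono) auto
    finally show "p (\<Phi> (D x hs)) \<le> (C * G) * P hs" by (simp add: mult_ac)
  qed
next
  fix n x p and \<epsilon> :: real assume x: "x \<in> U" and p: "p \<in> Q" and e: "\<epsilon> > 0"
  obtain C where C: "C \<ge> 0" "\<And>v. v \<in> V \<Longrightarrow> p (\<Phi> v) \<le> C * nn v" using Phi_bound[OF p] by blast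
  obtain G where G: "G \<ge> 0" "\<And>h hs. h \<in> E \<Longrightarrow> x + h \<in> U \<Longrightarrow> length hs \<le> n \<Longrightarrow> set hs \<subseteq> E \<Longrightarrow>
      nn (D (x + h) hs - D x hs - D x (h # hs)) \<le> G * (nE h)\<^sup>2 * P hs"
    using D_remainder_bound[of n] x by blast
  show "\<exists>\<delta>>0. \<forall>h\<in>E. x + h \<in> U \<and> nE h < \<delta> \<longrightarrow> (\<forall>hs. length hs = n \<and> set hs \<subseteq> E \<longrightarrow>
    p (\<Phi> (D (x + h) hs) - \<Phi> (D x hs) - \<Phi> (D x (h # hs))) \<le> \<epsilon> * nE h * P hs)"
  \<comment> \<open>The remainder is at most \<open>C * G * (nE h)\<^sup>2\<close>. The added 1
    keeps the quotient meaningful when \<open>C * G = 0\<close>.\<close>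
  proof (intro exI[of _ "\<epsilon> / (C * G + 1)"] conjI ballI allI impI)
    have CG: "0 \<le> C * G" using C G by simp
    then show "0 < \<epsilon> / (C * G + 1)" using e by (simp add: add_nonneg_pos)
    fix h hs assume h: "h \<in> E" "x + h \<in> U \<and> nE h < \<epsilon> / (C * G + 1)" and hs: "length hs = n \<and> set hs \<subseteq> E"
    have mem: "D (x + h) hs \<in> V" "D x hs \<in> V" "D x (h # hs) \<in> V" using D_mem h hs x by auto
    have diff: "\<Phi> (v - w) = \<Phi> v - \<Phi> w" if "v \<in> V" "w \<in> V" for v w
      using Phi_lincomb[OF that, of 1 "-1"] by simp
    have "\<Phi> (D (x + h) hs) - \<Phi> (D x hs) - \<Phi> (D x (h # hs)) = \<Phi> (D (x + h) hs - D x hs - D x (h # hs))"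
      using mem diff diff_mem by simp
    then have "p (\<Phi> (D (x + h) hs) - \<Phi> (D x hs) - \<Phi> (D x (h # hs))) \<le> C * nn (D (x + h) hs - D x hs - D x (h # hs))"
      using C(2) mem diff_mem by simp
    also have "\<dots> \<le> C * (G * (nE h)\<^sup>2 * P hs)" using G(2)[of h hs] h hs C by (intro mult_left_mono) auto
    also have "\<dots> = (C * G * nE h) * (nE h * P hs)" by (simp add: power2_eq_square mult_ac)
    also have "\<dots> \<le> \<epsilon> * (nE h * P hs)"
    proof (rule mult_right_mono)
      have "(C * G + 1) * nE h \<le> \<epsilon>"
        using h CG by (simp add: pos_less_divide_eq add_nonneg_pos mult.commute)
      moreover have "C * G * nE h \<le> (C * G + 1) * nE h" using nE_nonneg[OF h(1)] by (simp add: algebra_simps)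
      ultimately show "C * G * nE h \<le> \<epsilon>" by linarith
      show "0 \<le> nE h * P hs" using nE_nonneg h P_nonneg hs by simp
    qed
    finally show "p (\<Phi> (D (x + h) hs) - \<Phi> (D x hs) - \<Phi> (D x (h # hs))) \<le> \<epsilon> * nE h * P hs" by (simp add: mult_ac)
  qed
qed

end

section \<open>Square-summable families\<close>

definition l2 :: "('a \<Rightarrow> real) \<Rightarrow> bool" where
  "l2 c \<longleftrightarrow> (\<lambda>k. (c k)\<^sup>2) summable_on UNIV"

definition l2n :: "('a \<Rightarrow> real) \<Rightarrow> real" where
  "l2n c = sqrt (\<Sum>\<^sub>\<infinity>k. (c k)\<^sup>2)"

lemma l2n_nonneg: "0 \<le> l2n c"
  by (simp add: l2n_def infsum_nonneg)

lemma l2_I: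
  assumes "\<And>F. finite F \<Longrightarrow> L2_set c F \<le> C"
  shows "l2 c" and "l2n c \<le> C"
proof -
  have C: "0 \<le> C" using assms[of "{}"] by simp
  have le: "(\<Sum>k\<in>F. (c k)\<^sup>2) \<le> C\<^sup>2" if "finite F" for F
    using assms[OF that] C by (simp add: L2_set_def real_sqrt_le_iff' sqrt_le_D)
  show 1: "l2 c"
    unfolding l2_def
    by (rule nonneg_bdd_above_summable_on) (auto simp: bdd_above_def intro!: exI[of _ "C\<^sup>2"] le)
  have "(\<Sum>\<^sub>\<infinity>k. (c k)\<^sup>2) \<le> C\<^sup>2"
    using 1 by (intro infsum_le_finite_sums le) (auto simp: l2_def)
  then show "l2n c \<le> C"
    using C by (simp add: l2n_def real_le_lsqrt infsum_nonneg)
qed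

lemma L2_set_le_l2n:
  assumes "l2 c" "finite F"
  shows "L2_set c F \<le> l2n c"
  unfolding L2_set_def l2n_def
  using assms by (intro real_sqrt_le_mono finite_sum_le_infsum) (auto simp: l2_def)

lemma l2n_power2: "(l2n c)\<^sup>2 = (\<Sum>\<^sub>\<infinity>k. (c k)\<^sup>2)"
  by (simp add: l2n_def infsum_nonneg)

lemma abs_le_l2n: "l2 c \<Longrightarrow> \<bar>c k\<bar> \<le> l2n c"
  using L2_set_le_l2n[of c "{k}"] by simp

lemma l2_mono:
  assumes "l2 b" "\<And>k. \<bar>a k\<bar> \<le> \<bar>b k\<bar>"
  shows "l2 a" and "l2n a \<le> l2n b"
proof -
  have "L2_set a F \<le> l2n b" if "finite F" for F
  proof -
    have "L2_set a F \<le> L2_set b F"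
      unfolding L2_set_def by (intro real_sqrt_le_mono sum_mono) (use assms(2) abs_le_square_iff in blast)
    then show ?thesis using L2_set_le_l2n[OF assms(1) that] by simp
  qed
  from l2_I[OF this] show "l2 a" "l2n a \<le> l2n b" by auto
qed

lemma l2_add:
  assumes "l2 a" "l2 b"
  shows "l2 (\<lambda>k. a k + b k)" and "l2n (\<lambda>k. a k + b k) \<le> l2n a + l2n b"
proof -
  have "L2_set (\<lambda>k. a k + b k) F \<le> l2n a + l2n b" if "finite F" for F
    using L2_set_triangle_ineq[of a b F] L2_set_le_l2n[OF assms(1) that] L2_set_le_l2n[OF assms(2) that] by simp
  from l2_I[OF this] show "l2 (\<lambda>k. a k + b k)" "l2n (\<lambda>k. a k + b k) \<le> l2n a + l2n b" by auto
qed

lemma l2n_scale: "l2n (\<lambda>k. r * a k) = \<bar>r\<bar> * l2n a"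
  by (simp add: l2n_def power_mult_distrib infsum_cmult_right' real_sqrt_mult)

lemma l2_scale: "l2 a \<Longrightarrow> l2 (\<lambda>k. r * a k)"
  by (simp add: l2_def power_mult_distrib summable_on_cmult_right)

lemma l2_zero: "l2 (\<lambda>k. 0)" "l2n (\<lambda>k. 0) = 0"
  by (simp_all add: l2_def l2n_def)

lemma l2_reindex:
  assumes "bij g"
  shows "l2 (\<lambda>k. a (g k)) \<longleftrightarrow> l2 a" "l2n (\<lambda>k. a (g k)) = l2n a"
  using summable_on_reindex_bij_betw[OF assms, of "\<lambda>k. (a k)\<^sup>2"]
    infsum_reindex_bij_betw[OF assms, of "\<lambda>k. (a k)\<^sup>2"]
  by (simp_all add: l2_def l2n_def)

lemma l2_mult_summable:
  assumes "l2 a" "l2 b"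
  shows "(\<lambda>k. \<bar>a k * b k\<bar>) summable_on UNIV" and "(\<Sum>\<^sub>\<infinity>k. \<bar>a k * b k\<bar>) \<le> l2n a * l2n b"
proof -
  have le: "(\<Sum>k\<in>F. \<bar>a k * b k\<bar>) \<le> l2n a * l2n b" if "finite F" for F
  proof -
    have "(\<Sum>k\<in>F. \<bar>a k * b k\<bar>) \<le> L2_set a F * L2_set b F"
      using L2_set_mult_ineq[of a b F] by (simp add: abs_mult)
    also have "\<dots> \<le> l2n a * l2n b"
      using assms that by (intro mult_mono L2_set_le_l2n) (auto simp: l2n_nonneg)
    finally show ?thesis .
  qed
  show 1: "(\<lambda>k. \<bar>a k * b k\<bar>) summable_on UNIV"
    by (rule nonneg_bdd_above_summable_on) (auto simp: bdd_above_def intro!: exI[of _ "l2n a * l2n b"] le)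
  show "(\<Sum>\<^sub>\<infinity>k. \<bar>a k * b k\<bar>) \<le> l2n a * l2n b"
    using 1 le by (intro infsum_le_finite_sums) auto
qed

lemma infsum_norm_bound:
  fixes f :: "'a \<Rightarrow> complex"
  assumes "M summable_on UNIV" "\<And>k. norm (f k) \<le> M k" "infsum M UNIV \<le> C"
  shows "(\<lambda>k. norm (f k)) summable_on UNIV" and "norm (infsum f UNIV) \<le> C"
proof -
  show 1: "(\<lambda>k. norm (f k)) summable_on UNIV"
    using assms(1) by (rule summable_on_comparison_test) (use assms in auto)
  have "norm (infsum f UNIV) \<le> (\<Sum>\<^sub>\<infinity>k. norm (f k))" by (rule norm_infsum_bound[OF 1])
  also have "\<dots> \<le> infsum M UNIV" by (rule infsum_mono[OF 1 assms(1)]) (use assms in auto)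
  finally show "norm (infsum f UNIV) \<le> C" using assms(3) by simp
qed

lemma continuous_on_infsum:
  fixes f :: "'a \<Rightarrow> 'b::topological_space \<Rightarrow> 'c::banach"
  assumes "\<And>k. continuous_on A (f k)" "M summable_on UNIV" "\<And>k t. t \<in> A \<Longrightarrow> norm (f k t) \<le> M k"
  shows "continuous_on A (\<lambda>t. \<Sum>\<^sub>\<infinity>k. f k t)"
proof (rule uniform_limit_theorem)
  show "uniform_limit A (\<lambda>X t. \<Sum>k\<in>X. f k t) (\<lambda>t. \<Sum>\<^sub>\<infinity>k. f k t) (finite_subsets_at_top UNIV)"
    by (rule Weierstrass_m_test_general) (use assms in auto)
  show "\<forall>\<^sub>F X in finite_subsets_at_top UNIV. continuous_on A (\<lambda>t. \<Sum>k\<in>X. f k t)"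
    by (intro always_eventually allI continuous_on_sum assms)
qed simp

lemma summable_on_int_nat:
  fixes f :: "int \<Rightarrow> real" and g :: "nat \<Rightarrow> real"
  assumes g: "summable g" "\<And>n. 0 \<le> g n" and f: "\<And>k. \<bar>f k\<bar> \<le> g (nat \<bar>k\<bar>)"
  shows "(\<lambda>k. \<bar>f k\<bar>) summable_on UNIV"
proof -
  have gs: "g summable_on UNIV" using g by (simp add: summable_on_UNIV_nonneg_real_iff)
  have b1: "bij_betw int UNIV {0..}" by (rule bij_betwI[of _ _ _ nat]) auto
  \<comment> \<open>The shift by one keeps 0 out of the negative half; it is the reason for
    \<open>Suc n\<close> in the majorant.\<close>
  have b2: "bij_betw (\<lambda>n. - int n - 1) UNIV {..<0}"
    by (rule bij_betwI[of _ _ _ "\<lambda>k. nat (- k - 1)"]) auto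
  have g2: "(\<lambda>n. g (Suc n)) summable_on UNIV"
    using g summable_Suc_iff[of g] by (simp add: summable_on_UNIV_nonneg_real_iff)
  have 1: "(\<lambda>k. \<bar>f k\<bar>) summable_on {0..}"
    unfolding summable_on_reindex_bij_betw[OF b1, symmetric]
    by (rule summable_on_comparison_test[OF gs]) (use f[of "int _"] in auto)
  have 2: "(\<lambda>k. \<bar>f k\<bar>) summable_on {..<0}"
    unfolding summable_on_reindex_bij_betw[OF b2, symmetric]
  proof (rule summable_on_comparison_test[OF g2])
    show "\<bar>f (- int n - 1)\<bar> \<le> g (Suc n)" for n
      using f[of "- int n - 1"] by (simp add: nat_add_distrib abs_if)
  qed auto
  have "UNIV = {0..} \<union> {..<(0::int)}" by auto
  then show ?thesis using summable_on_Un_disjoint[OF 1 2] by (simp add: disjoint_iff)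
qed

text \<open>The term at \<open>k = 0\<close> is harmless because
  \<open>0 powr a = 0\<close>.\<close>

lemma summable_on_abs_powr:
  assumes "a < -1"
  shows "(\<lambda>k::int. \<bar>of_int k :: real\<bar> powr a) summable_on UNIV"
proof -
  have "(\<lambda>k. \<bar>\<bar>of_int k :: real\<bar> powr a\<bar>) summable_on (UNIV :: int set)"
    by (rule summable_on_int_nat[of "\<lambda>n. real n powr a"]) (use assms in \<open>auto simp: summable_real_powr_iff\<close>)
  then show ?thesis by simp
qed

lemma powr_square: "(x powr a)\<^sup>2 = x powr (2 * a)" for x a :: real
  by (metis mult_2 power2_eq_square powr_add)

lemma l2_abs_powr: "a < -1/2 \<Longrightarrow> l2 (\<lambda>k::int. \<bar>of_int k :: real\<bar> powr a)"
  using summable_on_abs_powr[of "2 * a"] by (simp add: l2_def powr_square)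

section \<open>Polynomial and exponential weights in the frequency\<close>

abbreviation jb :: "int \<Rightarrow> real" where
  "jb k \<equiv> 1 + (of_int k)\<^sup>2"

lemma jb_ge_1: "1 \<le> jb k" and jb_pos: "0 < jb k"
  by (auto simp: add_pos_nonneg)

text \<open>The right side exceeds the left by
  \<open>1 + (j - k)\<^sup>2 + 2 * (j * k)\<^sup>2\<close>. This inequality distributes a Sobolev
  weight of nonnegative order over the two factors of a convolution.\<close>

lemma jb_submult: "jb (j + k) \<le> 2 * (jb j * jb k)"
proof -
  have "0 \<le> ((of_int j :: real) - of_int k)\<^sup>2" "0 \<le> ((of_int j :: real) * of_int k)\<^sup>2" by auto
  then show ?thesis by (simp add: power2_eq_square algebra_simps)
qed

text \<open>A single term of the exponential series, of order \<open>2 * n\<close> with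
  \<open>n \<ge> a\<close>, dominates the polynomial weight for \<open>\<bar>k\<bar> > 1\<close>;
  the remaining frequencies account for the summand 1.\<close>

lemma jb_powr_nonneg_exp_bound:
  assumes "0 \<le> a" and b: "0 < b"
  shows "\<exists>C>0. \<forall>k. jb k powr a * exp (- b * \<bar>of_int k\<bar>) \<le> C"
proof -
  obtain n :: nat where n: "a \<le> real n" using real_arch_simple by blast
  have "jb k powr a * exp (- b * \<bar>of_int k\<bar>) \<le> 4 ^ n * (1 + fact (2 * n) / b ^ (2 * n))" for k
  proof -
    let ?x = "\<bar>of_int k\<bar> :: real"
    have "jb k powr a \<le> jb k powr real n" using n jb_ge_1 by (intro powr_mono) auto
    also have "\<dots> = jb k ^ n" using jb_pos by (simp add: powr_realpow)
    also have "\<dots> \<le> (4 * (max 1 ?x)\<^sup>2) ^ n"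
    proof (rule power_mono)
      have "(of_int k :: real)\<^sup>2 \<le> (max 1 ?x)\<^sup>2" "1 \<le> (max 1 ?x)\<^sup>2"
        by (auto simp: abs_le_square_iff[symmetric] one_le_power)
      then show "jb k \<le> 4 * (max 1 ?x)\<^sup>2" by linarith
    qed (use jb_pos less_imp_le in blast)
    also have "\<dots> = 4 ^ n * (max 1 ?x) ^ (2 * n)" by (simp add: power_mult_distrib power_mult)
    finally have 1: "jb k powr a \<le> 4 ^ n * (max 1 ?x) ^ (2 * n)" .
    have e: "(b * ?x) ^ (2 * n) / fact (2 * n) \<le> exp (b * ?x)"
    proof -
      have "(\<Sum>i\<in>{2 * n}. (b * ?x) ^ i /\<^sub>R fact i) \<le> (\<Sum>i. (b * ?x) ^ i /\<^sub>R fact i)"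
        using b by (intro sum_le_suminf summable_exp_generic) auto
      then show ?thesis by (simp add: exp_def field_simps)
    qed
    have 2: "(max 1 ?x) ^ (2 * n) * exp (- b * ?x) \<le> 1 + fact (2 * n) / b ^ (2 * n)"
    proof (cases "?x \<le> 1")
      case True
      have "exp (- b * ?x) \<le> 1" using b by simp
      moreover have "max 1 ?x = 1" using True by simp
      moreover have "0 \<le> fact (2 * n) / b ^ (2 * n)" using b by simp
      ultimately have "exp (- b * ?x) \<le> 1 + fact (2 * n) / b ^ (2 * n)" "max 1 ?x = 1" by linarith+
      then show ?thesis by simp
    next
      case False
      have "?x ^ (2 * n) \<le> fact (2 * n) / b ^ (2 * n) * exp (b * ?x)"
        using e b by (simp add: power_mult_distrib field_simps)
      then have "?x ^ (2 * n) * exp (- b * ?x) \<le> fact (2 * n) / b ^ (2 * n) * exp (b * ?x) * exp (- b * ?x)"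
        by (intro mult_right_mono) auto
      also have "\<dots> = fact (2 * n) / b ^ (2 * n)" by (simp add: exp_minus)
      finally have "?x ^ (2 * n) * exp (- b * ?x) \<le> fact (2 * n) / b ^ (2 * n)" .
      moreover have "max 1 ?x = ?x" using False by simp
      ultimately show ?thesis by simp
    qed
    have "jb k powr a * exp (- b * ?x) \<le> 4 ^ n * (max 1 ?x) ^ (2 * n) * exp (- b * ?x)"
      by (intro mult_right_mono 1) auto
    also have "\<dots> \<le> 4 ^ n * (1 + fact (2 * n) / b ^ (2 * n))"
      using 2 by (simp add: mult.assoc)
    finally show ?thesis .
  qed
  moreover have "0 < 4 ^ n * (1 + fact (2 * n) / b ^ (2 * n))" using b by (simp add: add_pos_nonneg)
  ultimately show ?thesis by blast
qed

lemma jb_powr_exp_bound: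
  assumes "0 < b"
  shows "\<exists>C>0. \<forall>k. jb k powr a * exp (- b * \<bar>of_int k\<bar>) \<le> C"
proof (cases "0 \<le> a")
  case True
  then show ?thesis using jb_powr_nonneg_exp_bound[of a b] assms by simp
next
  case False
  have "jb k powr a * exp (- b * \<bar>of_int k\<bar>) \<le> 1" for k
  proof -
    have "jb k powr a \<le> jb k powr 0" using False jb_ge_1 by (intro powr_mono) auto
    then have "jb k powr a \<le> 1" using jb_pos[of k] by simp
    then show ?thesis using assms by (intro mult_le_one) auto
  qed
  then show ?thesis by (intro exI[of _ 1]) auto
qed

text \<open>One additional power of \<open>jb\<close> is also absorbed by the exponential, which
  leaves the summable majorant \<open>C / jb k\<close>.\<close>

lemma summable_exp_abs:
  assumes "0 < b"
  shows "(\<lambda>k::int. jb k powr a * exp (- b * \<bar>of_int k\<bar>)) summable_on UNIV"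
proof -
  obtain C where C: "C > 0" "\<And>k. jb k powr (a + 1) * exp (- b * \<bar>of_int k\<bar>) \<le> C"
    using jb_powr_exp_bound[OF assms] by blast
  have "(\<lambda>k. \<bar>jb k powr a * exp (- b * \<bar>of_int k\<bar>)\<bar>) summable_on (UNIV::int set)"
  proof (rule summable_on_int_nat)
    show "summable (\<lambda>n. C * (1 / (1 + (real n)\<^sup>2)))"
    proof (intro summable_mult summable_comparison_test'[OF inverse_power_summable[of 2], of 1])
      show "norm (1 / (1 + (real n)\<^sup>2)) \<le> inverse ((of_nat n)\<^sup>2)" if "1 \<le> n" for n
        using that by (simp add: field_simps add_pos_nonneg)
    qed auto
    show "\<bar>jb k powr a * exp (- b * \<bar>of_int k\<bar>)\<bar> \<le> C * (1 / (1 + (real (nat \<bar>k\<bar>))\<^sup>2))" for k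
    proof -
      have "jb k powr (a + 1) = jb k powr a * jb k" using jb_pos[of k] by (simp add: powr_add)
      then have "jb k powr a * exp (- b * \<bar>of_int k\<bar>) * jb k \<le> C" using C(2)[of k] by (simp add: mult_ac)
      then have "jb k powr a * exp (- b * \<bar>of_int k\<bar>) \<le> C / jb k" using jb_pos[of k] by (simp add: pos_le_divide_eq)
      then show ?thesis by simp
    qed
  qed (use C in auto)
  then show ?thesis by simp
qed

lemma l2_exp_abs:
  assumes "0 < b"
  shows "l2 (\<lambda>k::int. jb k powr a * exp (- b * \<bar>of_int k\<bar>))"
  using summable_exp_abs[of "2 * b" "2 * a"] assms
  by (simp add: l2_def power_mult_distrib powr_square flip: exp_double) (simp add: mult_ac)

section \<open>The Duhamel kernel\<close>

text \<open>This trades damping for a time singularity of freely chosen order \<open>a\<close>, with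
  constant 1.\<close>

lemma exp_minus_le_powr:
  fixes x a :: real
  assumes "0 < x" "0 \<le> a" "a \<le> 1"
  shows "exp (- x) \<le> x powr (- a)"
proof -
  have "x powr a \<le> exp x"
  proof (cases "x \<le> 1")
    case True
    then have "x powr a \<le> 1" using assms by (intro powr_le1) auto
    then show ?thesis using assms by (smt (verit) one_le_exp_iff)
  next
    case False
    then have "x powr a \<le> x powr 1" using assms by (intro powr_mono) auto
    also have "\<dots> \<le> exp x" using assms exp_ge_add_one_self[of x] unfolding powr_one[OF less_imp_le[OF assms(1)]] by linarith
    finally show ?thesis .
  qed
  then have "inverse (exp x) \<le> inverse (x powr a)" using assms by (intro le_imp_inverse_le) auto
  then show ?thesis by (simp add: exp_minus powr_minus)
qed

text \<open>A product of singularities at the two ends of the time interval is replaced by a sum,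
  whose integral is elementary; no Beta function is required.\<close>

lemma powr_minus_mult_le_add:
  fixes x y p q :: real
  assumes "0 < x" "0 < y" "0 \<le> p" "0 \<le> q"
  shows "x powr (- p) * y powr (- q) \<le> x powr (- (p + q)) + y powr (- (p + q))"
proof (cases "x \<le> y")
  case True
  have "x powr (- p) * y powr (- q) \<le> x powr (- p) * x powr (- q)"
    using True assms by (intro mult_left_mono powr_mono2') auto
  also have "\<dots> = x powr (- (p + q))" by (simp flip: powr_add)
  finally show ?thesis by (simp add: add_increasing2)
next
  case False
  have "x powr (- p) * y powr (- q) \<le> y powr (- p) * y powr (- q)"
    using False assms by (intro mult_right_mono powr_mono2') auto
  also have "\<dots> = y powr (- (p + q))" by (simp flip: powr_add)
  finally show ?thesis by (simp add: add_increasing)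
qed

lemma powr_add_le_double:
  fixes x y a :: real
  assumes "0 \<le> x" "0 \<le> y" "0 \<le> a" "a \<le> 1"
  shows "(x + y) powr a \<le> 2 * (x powr a + y powr a)"
proof -
  have "(x + y) powr a \<le> (2 * max x y) powr a" using assms by (intro powr_mono2) auto
  also have "\<dots> = 2 powr a * (max x y) powr a" using assms by (simp add: powr_mult)
  also have "\<dots> \<le> 2 * (max x y) powr a"
    using assms powr_mono[of a 1 2] by (intro mult_right_mono) auto
  also have "(max x y) powr a \<le> x powr a + y powr a" by (simp add: max_def)
  finally show ?thesis by simp
qed

lemma integral_powr_sum:
  fixes a t :: real
  assumes "0 \<le> a" "a < 1" "0 \<le> t"
  shows "((\<lambda>r. (t - r) powr (- a) + r powr (- a)) has_integral 2 * (t powr (1 - a) / (1 - a))) {0..t}"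
proof -
  have 1: "((\<lambda>r. r powr (- a)) has_integral t powr (1 - a) / (1 - a)) {0..t}"
    using has_integral_powr_from_0[of "- a" t] assms by (simp add: add.commute)
  then have "((\<lambda>r. (- r) powr (- a)) has_integral t powr (1 - a) / (1 - a)) {-t..0}"
    using has_integral_reflect_real[of "\<lambda>r. r powr (- a)" _ t 0] by simp
  then have 2: "((\<lambda>r. (t - r) powr (- a)) has_integral t powr (1 - a) / (1 - a)) {0..t}"
    using has_integral_shift_Icc_real[of "\<lambda>r. (- r) powr (- a)" "-t" "t powr (1 - a) / (1 - a)" 0 t]
    by (simp add: o_def)
  show ?thesis using has_integral_add[OF 2 1] by simp
qed

section \<open>Exponents, Fourier multiplier and weights\<close>

locale dissipative =
  fixes \<beta> \<eta> s :: real
  assumes eta: "0 < \<eta>" and s_gt: "- 1/2 < s"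
begin

text \<open>For negative \<open>s\<close> this is \<open>\<bar>s\<bar> / 2\<close>, the exponent of
  time in the norm of \<open>X_T^s\<close>. The order \<open>sig\<close> below is
  \<open>max 0 s\<close>, so that \<open>sig = 0\<close> corresponds to \<open>L^2\<close> in that
  case.\<close>

definition gam :: real where "gam = max 0 (- s) / 2"

text \<open>Square-summability of \<open>\<bar>k\<bar> powr (1 - 2 * th0)\<close> needs \<open>th0 > 3/4\<close>. The kernel is then singular of
  order \<open>rho\<close> in time, and \<open>rho < 1\<close> because \<open>gam < 1/4\<close>; this is where \<open>s > -1/2\<close> enters.\<close>

definition eps :: real where "eps = (1/4 - gam) / 4"
definition th0 :: real where "th0 = 3/4 + eps"
definition rho :: real where "rho = 1 - 2 * eps"
definition sig :: real where "sig = s + 2 * gam"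

lemma gam: "0 \<le> gam" "gam < 1/4" using s_gt by (auto simp: gam_def)
lemma eps: "0 < eps" "eps \<le> 1/16" using gam by (auto simp: eps_def)
text \<open>Taking a quarter of the gap \<open>1/4 - gam\<close> as \<open>eps\<close> gives
  \<open>th0 + eps + gam = 3/4 + gam + 2 * eps = 1 - 2 * eps\<close>.\<close>

lemma rho: "0 < rho" "rho < 1" "rho = th0 + eps + gam"
  using eps by (auto simp: rho_def th0_def eps_def field_simps)
lemma sig: "0 \<le> sig" by (simp add: sig_def gam_def)

text \<open>Defined for all real times: on a single frequency the semigroup extends to a group, and
  \<open>mlt (- t)\<close> undoes the linear evolution.\<close>

definition mlt :: "real \<Rightarrow> int \<Rightarrow> complex" where
  "mlt t k = exp (\<i> * of_real (\<beta> * of_int k * \<bar>of_int k\<bar> * t) -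
          of_real (\<eta> * ((of_int k)\<^sup>2 - \<bar>of_int k\<bar>) * t))"

lemma mlt_add: "mlt (a + b) k = mlt a k * mlt b k"
  by (simp add: mlt_def ring_distribs flip: exp_add) (simp add: algebra_simps)

lemma mlt_0 [simp]: "mlt 0 k = 1" by (simp add: mlt_def)

lemma mlt_minus: "mlt (- a) k * mlt a k = 1" "mlt a k * mlt (- a) k = 1"
  using mlt_add[of "- a" a k] mlt_add[of a "- a" k] by simp_all

lemma norm_mlt: "norm (mlt t k) = exp (- \<eta> * ((of_int k)\<^sup>2 - \<bar>of_int k\<bar>) * t)"
  by (simp add: mlt_def norm_exp)

lemma mlt_uminus: "mlt t (- k) = cnj (mlt t k)"
  by (simp add: mlt_def exp_cnj)

lemma continuous_mlt [continuous_intros]: "continuous_on A f \<Longrightarrow> continuous_on A (\<lambda>t. mlt (f t) k)"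
  unfolding mlt_def by (intro continuous_intros)

lemma abs_le_square: "\<bar>of_int k\<bar> \<le> (of_int k :: real)\<^sup>2" for k :: int
proof -
  have "\<bar>k\<bar> \<le> k * k" by (metis abs_mult_self_eq abs_ge_zero linorder_not_le mult_le_cancel_left1 mult_cancel_left1 int_one_le_iff_zero_less order.strict_iff_order)
  then have "real_of_int \<bar>k\<bar> \<le> real_of_int (k * k)" by (simp only: of_int_le_iff)
  then show ?thesis by (simp add: power2_eq_square)
qed

lemma norm_mlt_le_1: "0 \<le> t \<Longrightarrow> norm (mlt t k) \<le> 1"
  using abs_le_square[of k] eta by (simp add: norm_mlt)

text \<open>The speed at which the strip of analyticity widens. It is small enough for a quarter of
  the damping to remain, see \<open>weight_damping\<close>.\<close>

definition nu :: real where "nu = \<eta> / 2"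

text \<open>The two summands in the middle give the \<open>H^s\<close> norm and
  \<open>t powr gam\<close> times the \<open>H^sig\<close> norm. The width of the strip is capped at
  \<open>\<delta>\<close> because over long times only a fixed width is under control;
  \<open>\<delta> = 0\<close> switches analyticity off.\<close>

definition wgt :: "real \<Rightarrow> real \<Rightarrow> real \<Rightarrow> int \<Rightarrow> real" where
  "wgt lm \<delta> t k = exp (- lm * t) * (jb k powr (s / 2) * (1 + t powr gam * jb k powr gam)) *
     exp (nu * min t \<delta> * \<bar>of_int k\<bar>)"

lemma wgt_pos: "0 < wgt lm \<delta> t k"
  unfolding wgt_def using jb_pos[of k] by (intro mult_pos_pos add_pos_nonneg) auto

lemma wgt_lambda: "wgt lm \<delta> t k = exp (- lm * t) * wgt 0 \<delta> t k"
  by (simp add: wgt_def)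

lemma wgt_ge_Hs: "0 \<le> t \<Longrightarrow> 0 \<le> \<delta> \<Longrightarrow> jb k powr (s / 2) \<le> wgt 0 \<delta> t k"
proof -
  assume a: "0 \<le> t" "0 \<le> \<delta>"
  have "jb k powr (s / 2) * 1 * 1 \<le> jb k powr (s / 2) * (1 + t powr gam * jb k powr gam) * exp (nu * min t \<delta> * \<bar>of_int k\<bar>)"
    by (intro mult_mono) (use a eta in \<open>auto simp: nu_def\<close>)
  then show ?thesis by (simp add: wgt_def)
qed

lemma wgt_ge: "exp (- lm * t) * t powr gam * jb k powr (sig / 2) * exp (nu * min t \<delta> * \<bar>of_int k\<bar>) \<le> wgt lm \<delta> t k"
proof -
  have "jb k powr (sig / 2) = jb k powr (s / 2) * jb k powr gam"
    by (simp add: sig_def flip: powr_add) (simp add: field_simps)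
  then have "exp (- lm * t) * t powr gam * jb k powr (sig / 2) * exp (nu * min t \<delta> * \<bar>of_int k\<bar>) =
     exp (- lm * t) * (jb k powr (s / 2) * (t powr gam * jb k powr gam)) * exp (nu * min t \<delta> * \<bar>of_int k\<bar>)" by simp
  also have "\<dots> \<le> wgt lm \<delta> t k"
    unfolding wgt_def by (intro mult_right_mono mult_left_mono) auto
  finally show ?thesis .
qed

text \<open>Between \<open>r\<close> and \<open>t\<close> the width grows by at most
  \<open>t - r\<close>, which costs \<open>nu * \<bar>k\<bar> * (t - r)\<close> in the exponent.
  With \<open>nu = \<eta> / 2\<close> the slack in the resulting inequality is
  \<open>3 * \<eta> / 4 * (1 - \<bar>k\<bar>)\<^sup>2\<close>; this is where the rate
  \<open>3 * \<eta> / 4\<close> comes from.\<close>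

lemma weight_damping:
  assumes "0 \<le> r" "r \<le> t" "0 \<le> \<delta>"
  shows "exp (nu * min t \<delta> * \<bar>of_int k\<bar>) * norm (mlt (t - r) k) \<le>
    exp ((3 * \<eta> / 4 - \<eta> * (of_int k)\<^sup>2 / 4) * (t - r)) * exp (nu * min r \<delta> * \<bar>of_int k\<bar>)"
proof -
  let ?x = "\<bar>of_int k\<bar> :: real"
  have "0 \<le> (1 - ?x)\<^sup>2" by simp
  then have "nu * ?x - \<eta> * (?x\<^sup>2 - ?x) \<le> 3 * \<eta> / 4 - \<eta> * ?x\<^sup>2 / 4"
    using eta mult_left_mono[of 0 "(1 - ?x)\<^sup>2" "3 * \<eta> / 4"] by (simp add: nu_def power2_eq_square algebra_simps)
  then have "(nu * ?x - \<eta> * (?x\<^sup>2 - ?x)) * (t - r) \<le> (3 * \<eta> / 4 - \<eta> * ?x\<^sup>2 / 4) * (t - r)"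
    using assms by (intro mult_right_mono) auto
  moreover have "nu * ?x * min t \<delta> \<le> nu * ?x * (min r \<delta> + (t - r))"
    using assms eta by (intro mult_left_mono) (auto simp: nu_def)
  moreover have "nu * min t \<delta> * ?x + - \<eta> * (?x\<^sup>2 - ?x) * (t - r) =
      nu * ?x * min t \<delta> + (nu * ?x - \<eta> * (?x\<^sup>2 - ?x)) * (t - r) - nu * ?x * (t - r)"
    "nu * ?x * (min r \<delta> + (t - r)) = nu * min r \<delta> * ?x + nu * ?x * (t - r)"
    by (simp_all add: algebra_simps)
  ultimately have "nu * min t \<delta> * ?x + - \<eta> * (?x\<^sup>2 - ?x) * (t - r) \<le> (3 * \<eta> / 4 - \<eta> * ?x\<^sup>2 / 4) * (t - r) + nu * min r \<delta> * ?x"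
    by linarith
  then show ?thesis by (simp add: norm_mlt flip: exp_add)
qed

definition ker :: real where
  "ker = 5 * ((\<eta> / 4) powr (- th0) + (\<eta> / 4) powr (- (th0 - gam)))"

lemma ker_pos: "0 < ker" unfolding ker_def using eta by (intro mult_pos_pos add_pos_pos) auto

text \<open>The power is shared: \<open>eps\<close> of it goes to the large parameter
  \<open>l\<close> and provides smallness, the part \<open>b\<close> goes to the frequency and
  provides decay.\<close>

lemma resolvent_powr_bound:
  assumes l: "0 < l" and k: "k \<noteq> 0" and b: "0 \<le> b" "a = b + eps"
  shows "(l + \<eta> * (of_int k)\<^sup>2 / 4) powr (- a) \<le>
    l powr (- eps) * ((\<eta> / 4) powr (- b) * \<bar>of_int k\<bar> powr (- 2 * b))"
proof -
  let ?y = "\<eta> * (of_int k)\<^sup>2 / 4"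
  have y: "0 < ?y" using k eta by simp
  have "- a = - eps + - b" using b by simp
  then have "(l + ?y) powr (- a) = (l + ?y) powr (- eps) * (l + ?y) powr (- b)"
    by (simp only: powr_add)
  also have "\<dots> \<le> l powr (- eps) * ?y powr (- b)"
    using l y eps b by (intro mult_mono powr_mono2') auto
  also have "?y powr (- b) = (\<eta> / 4) powr (- b) * \<bar>of_int k\<bar> powr (- 2 * b)"
  proof -
    have "?y = (\<eta> / 4) * \<bar>of_int k\<bar> powr 2" using k by (simp add: powr_numeral)
    then have "?y powr (- b) = ((\<eta> / 4) * \<bar>of_int k\<bar> powr 2) powr (- b)" by simp
    also have "\<dots> = (\<eta> / 4) powr (- b) * \<bar>of_int k\<bar> powr (- 2 * b)"
      by (subst powr_mult) (use eta in \<open>simp_all add: powr_powr del: powr_numeral\<close>)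
    finally show ?thesis .
  qed
  finally show ?thesis .
qed

text \<open>After splitting \<open>(x + r) powr gam\<close> there are three terms. The damping is
  spent with exponent \<open>th0 + eps - gam\<close> on the first and \<open>th0 + eps\<close> on
  the others, so that each one carries the frequency factor
  \<open>\<bar>k\<bar> powr (1 - 2 * th0)\<close> and has total time singularity of order
  \<open>th0 + eps + gam = rho\<close>.\<close>

lemma kernel_bound:
  assumes x: "0 < x" and r: "0 < r" and l: "1 \<le> l" and k: "k \<noteq> 0"
  shows "exp (- (l + \<eta> * (of_int k)\<^sup>2 / 4) * x) * \<bar>of_int k\<bar> * (jb k powr (- gam) + (x + r) powr gam) * r powr (- 2 * gam)
    \<le> ker * l powr (- eps) * \<bar>of_int k\<bar> powr (1 - 2 * th0) * (x powr (- rho) + r powr (- rho))"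
proof -
  let ?K = "\<bar>of_int k\<bar> :: real"
  let ?y = "l + \<eta> * (of_int k)\<^sup>2 / 4"
  let ?e = "exp (- ?y * x)"
  let ?R = "x powr (- rho) + r powr (- rho)"
  let ?c1 = "(\<eta> / 4) powr (- th0)" and ?c2 = "(\<eta> / 4) powr (- (th0 - gam))"
  let ?L = "l powr (- eps) * ?K powr (1 - 2 * th0)"
  have y: "0 < ?y" using l eta by (intro add_pos_nonneg) auto
  have K: "1 \<le> ?K" using k by linarith
  have R0: "0 \<le> ?R" by simp
  have e: "?e \<le> ?y powr (- a) * x powr (- a)" if "0 \<le> a" "a \<le> 1" for a
  proof -
    have "exp (- (?y * x)) \<le> ?y powr (- a) * x powr (- a)"
      using exp_minus_le_powr[of "?y * x" a] y x that by (simp add: powr_mult)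
    then show ?thesis by (simp only: mult_minus_left)
  qed
  have th: "th0 + eps \<le> 1" "eps \<le> th0 + eps - gam" "0 \<le> th0 - gam" "gam \<le> th0 + eps"
    using eps gam by (auto simp: th0_def eps_def field_simps)
  have y1: "?y powr (- (th0 + eps)) \<le> l powr (- eps) * (?c1 * ?K powr (- 2 * th0))"
    by (rule resolvent_powr_bound) (use l k eps in \<open>auto simp: th0_def\<close>)
  have y2: "?y powr (- (th0 + eps - gam)) \<le> l powr (- eps) * (?c2 * ?K powr (- 2 * (th0 - gam)))"
    by (rule resolvent_powr_bound) (use l k th in auto)
  have KK: "?K * ?K powr a = ?K powr (1 + a)" for a using K by (simp add: powr_add)
  have p1: "x powr (- (th0 + eps - gam)) * r powr (- (2 * gam)) \<le> ?R"
    using powr_minus_mult_le_add[OF x r, of "th0 + eps - gam" "2 * gam"] th gam eps rho by simp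
  have p2: "x powr (- (th0 + eps)) * r powr (- gam) \<le> ?R"
    using powr_minus_mult_le_add[OF x r, of "th0 + eps" "gam"] th gam eps rho by simp
  have t1: "?e * ?K * jb k powr (- gam) * r powr (- 2 * gam) \<le> ?c2 * ?L * ?R"
  proof -
    have "jb k powr (- gam) \<le> (?K powr 2) powr (- gam)"
      using gam K by (intro powr_mono2') (auto simp: powr_numeral)
    then have j: "jb k powr (- gam) \<le> ?K powr (- 2 * gam)" by (simp add: powr_powr del: powr_numeral)
    have "?e * ?K * jb k powr (- gam) * r powr (- 2 * gam) \<le>
      (l powr (- eps) * (?c2 * ?K powr (- 2 * (th0 - gam))) * x powr (- (th0 + eps - gam))) * ?K * ?K powr (- 2 * gam) * r powr (- 2 * gam)"
      by (intro mult_mono j order_trans[OF e[of "th0 + eps - gam"]] y2) (use th gam K in auto)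
    also have "\<dots> = ?c2 * l powr (- eps) * (?K * (?K powr (- 2 * (th0 - gam)) * ?K powr (- 2 * gam))) * (x powr (- (th0 + eps - gam)) * r powr (- (2 * gam)))"
      by (simp add: mult_ac)
    also have "?K * (?K powr (- 2 * (th0 - gam)) * ?K powr (- 2 * gam)) = ?K powr (1 - 2 * th0)"
      by (simp add: KK flip: powr_add)
    also have "?c2 * l powr (- eps) * ?K powr (1 - 2 * th0) * (x powr (- (th0 + eps - gam)) * r powr (- (2 * gam))) \<le>
      ?c2 * l powr (- eps) * ?K powr (1 - 2 * th0) * ?R"
      by (intro mult_left_mono p1) auto
    finally show ?thesis by (simp add: mult_ac)
  qed
  have t23: "?e * ?K * z * r powr (- 2 * gam) \<le> ?c1 * ?L * ?R"
    if z: "0 \<le> z" "x powr (- (th0 + eps)) * z * r powr (- 2 * gam) \<le> ?R" for z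
  proof -
    have "?e * ?K * z * r powr (- 2 * gam) \<le>
      (l powr (- eps) * (?c1 * ?K powr (- 2 * th0)) * x powr (- (th0 + eps))) * ?K * z * r powr (- 2 * gam)"
      by (intro mult_right_mono order_trans[OF e[of "th0 + eps"]] y1) (use th gam eps K z in auto)
    also have "\<dots> = ?c1 * l powr (- eps) * (?K * ?K powr (- 2 * th0)) * (x powr (- (th0 + eps)) * z * r powr (- 2 * gam))"
      by (simp add: mult_ac)
    also have "?K * ?K powr (- 2 * th0) = ?K powr (1 - 2 * th0)" by (simp add: KK)
    also have "?c1 * l powr (- eps) * ?K powr (1 - 2 * th0) * (x powr (- (th0 + eps)) * z * r powr (- 2 * gam)) \<le>
      ?c1 * l powr (- eps) * ?K powr (1 - 2 * th0) * ?R"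
      by (intro mult_left_mono z) auto
    finally show ?thesis by (simp add: mult_ac)
  qed
  have t2: "?e * ?K * (x powr gam) * r powr (- 2 * gam) \<le> ?c1 * ?L * ?R"
  proof (rule t23)
    have "x powr (- (th0 + eps)) * x powr gam = x powr (- (th0 + eps - gam))"
      by (simp flip: powr_add) (simp add: algebra_simps)
    then show "x powr (- (th0 + eps)) * x powr gam * r powr (- 2 * gam) \<le> ?R" using p1 by simp
  qed simp
  have t3: "?e * ?K * (r powr gam) * r powr (- 2 * gam) \<le> ?c1 * ?L * ?R"
  proof (rule t23)
    have "r powr gam * r powr (- 2 * gam) = r powr (- gam)" by (simp flip: powr_add)
    then show "x powr (- (th0 + eps)) * r powr gam * r powr (- 2 * gam) \<le> ?R"
      using p2 by (simp add: mult.assoc)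
  qed simp
  have "?e * ?K * (jb k powr (- gam) + (x + r) powr gam) * r powr (- 2 * gam) \<le>
     ?e * ?K * (jb k powr (- gam) + 2 * (x powr gam + r powr gam)) * r powr (- 2 * gam)"
    by (intro mult_right_mono mult_left_mono add_left_mono powr_add_le_double) (use x r gam K in auto)
  also have "\<dots> = ?e * ?K * jb k powr (- gam) * r powr (- 2 * gam) + 2 * (?e * ?K * (x powr gam) * r powr (- 2 * gam)) +
     2 * (?e * ?K * (r powr gam) * r powr (- 2 * gam))" by (simp add: algebra_simps)
  also have "\<dots> \<le> ?c2 * ?L * ?R + 2 * (?c1 * ?L * ?R) + 2 * (?c1 * ?L * ?R)"
    using t1 t2 t3 by linarith
  also have "\<dots> = (4 * ?c1 + ?c2) * (?L * ?R)" by (simp add: algebra_simps)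
  also have "\<dots> \<le> ker * (?L * ?R)"
    by (intro mult_right_mono) (auto simp: ker_def)
  finally show ?thesis by (simp add: mult_ac)
qed

text \<open>The forcing bound is the one satisfied by a convolution of two functions in the weighted space.\<close>

lemma duhamel_kernel_bound:
  assumes "0 < r" "r < t" "0 \<le> \<delta>" and lam: "3 * \<eta> / 4 + 1 \<le> lm"
  shows "wgt lm \<delta> t k * \<bar>of_int k\<bar> * norm (mlt (t - r) k) *
      (r powr (- 2 * gam) * jb k powr (- sig / 2) * exp (lm * r) * exp (- nu * min r \<delta> * \<bar>of_int k\<bar>))
    \<le> ker * (lm - 3 * \<eta> / 4) powr (- eps) * \<bar>of_int k\<bar> powr (1 - 2 * th0) * ((t - r) powr (- rho) + r powr (- rho))"
proof (cases "k = 0")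
  case False
  let ?l = "lm - 3 * \<eta> / 4"
  let ?K = "\<bar>of_int k\<bar> :: real"
  let ?W = "jb k powr (s / 2) * (1 + t powr gam * jb k powr gam)"
  have "wgt lm \<delta> t k * ?K * norm (mlt (t - r) k) *
      (r powr (- 2 * gam) * jb k powr (- sig / 2) * exp (lm * r) * exp (- nu * min r \<delta> * ?K)) =
    (exp (nu * min t \<delta> * ?K) * norm (mlt (t - r) k)) * (exp (- lm * t) * exp (lm * r) * exp (- nu * min r \<delta> * ?K) * ?W * ?K *
      r powr (- 2 * gam) * jb k powr (- sig / 2))"
    by (simp add: wgt_def mult_ac)
  also have "\<dots> \<le> (exp ((3 * \<eta> / 4 - \<eta> * (of_int k)\<^sup>2 / 4) * (t - r)) * exp (nu * min r \<delta> * ?K)) *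
     (exp (- lm * t) * exp (lm * r) * exp (- nu * min r \<delta> * ?K) * ?W * ?K * r powr (- 2 * gam) * jb k powr (- sig / 2))"
    by (rule mult_right_mono, rule weight_damping) (use assms in auto)
  also have "\<dots> = (exp ((3 * \<eta> / 4 - \<eta> * (of_int k)\<^sup>2 / 4) * (t - r)) * exp (nu * min r \<delta> * ?K) * exp (- lm * t) * exp (lm * r) *
      exp (- nu * min r \<delta> * ?K)) * ?K * (?W * jb k powr (- sig / 2)) * r powr (- 2 * gam)"
    by (simp add: mult_ac)
  also have "exp ((3 * \<eta> / 4 - \<eta> * (of_int k)\<^sup>2 / 4) * (t - r)) * exp (nu * min r \<delta> * ?K) * exp (- lm * t) * exp (lm * r) *
      exp (- nu * min r \<delta> * ?K) = exp (- (?l + \<eta> * (of_int k)\<^sup>2 / 4) * (t - r))"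
    by (simp flip: exp_add) (simp add: algebra_simps)
  also have "?W * jb k powr (- sig / 2) = jb k powr (- gam) + (t - r + r) powr gam"
  proof -
    have "jb k powr (s / 2) * jb k powr (- sig / 2) = jb k powr (- gam)"
      by (simp add: sig_def flip: powr_add) (simp add: field_simps)
    moreover have "jb k powr (- gam) * jb k powr gam = 1" using jb_pos[of k] by (simp flip: powr_add)
    ultimately show ?thesis by (simp add: algebra_simps)
  qed
  also have "exp (- (?l + \<eta> * (of_int k)\<^sup>2 / 4) * (t - r)) * ?K * (jb k powr (- gam) + (t - r + r) powr gam) * r powr (- 2 * gam) \<le>
     ker * ?l powr (- eps) * ?K powr (1 - 2 * th0) * ((t - r) powr (- rho) + r powr (- rho))"
    by (rule kernel_bound) (use assms False in auto)
  finally show ?thesis .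
qed simp

text \<open>The time \<open>a\<close> is independent of \<open>t\<close>: the value
  \<open>a = t\<close> gives the Duhamel integral, \<open>a = 0\<close> the form with the linear
  evolution removed. Integrability at 0 holds because \<open>2 * gam < 1\<close>.\<close>

lemma forcing_integrable:
  assumes "continuous_on {0<..T} g" "0 \<le> t" "t \<le> T"
    and g: "\<And>r. 0 < r \<Longrightarrow> r \<le> T \<Longrightarrow> norm (g r) \<le> C * r powr (- 2 * gam)"
  shows "(\<lambda>r. mlt (a - r) k * g r) absolutely_integrable_on {0<..<t}"
    and "(\<lambda>r. mlt (a - r) k * g r) integrable_on {0..t}"
proof -
  have "{0<..<t} \<subseteq> {0<..T}" using assms(3) by auto
  then have cont: "continuous_on {0<..<t} (\<lambda>r. mlt (a - r) k * g r)"
    by (intro continuous_intros continuous_on_subset[OF assms(1)])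
  have "continuous_on {0..t} (\<lambda>r. norm (mlt (a - r) k))" by (intro continuous_intros)
  then have "bounded ((\<lambda>r. norm (mlt (a - r) k)) ` {0..t})"
    by (intro compact_imp_bounded compact_continuous_image) auto
  then obtain D where "\<forall>r\<in>{0..t}. norm (mlt (a - r) k) \<le> D"
    by (auto simp: bounded_iff)
  then have D: "\<And>r. r \<in> {0..t} \<Longrightarrow> norm (mlt (a - r) k) \<le> D" by blast
  have C: "0 \<le> C" if "t > 0"
  proof -
    have "0 \<le> C * t powr (- 2 * gam)" using order_trans[OF norm_ge_zero g[of t]] that assms by auto
    then show ?thesis using that by (simp add: zero_le_mult_iff)
  qed
  show 1: "(\<lambda>r. mlt (a - r) k * g r) absolutely_integrable_on {0<..<t}"
  proof (rule measurable_bounded_by_integrable_imp_absolutely_integrable)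
    show "(\<lambda>r. mlt (a - r) k * g r) \<in> borel_measurable (lebesgue_on {0<..<t})"
      by (rule continuous_imp_measurable_on_sets_lebesgue[OF cont]) auto
    have "(\<lambda>r. r powr (- 2 * gam)) integrable_on {0..t}"
      by (intro has_integral_integrable[OF has_integral_powr_from_0]) (use gam assms in auto)
    then show "(\<lambda>r. D * C * r powr (- 2 * gam)) integrable_on {0<..<t}"
      unfolding integrable_on_open_interval_real by (rule integrable_on_mult_right)
    fix r assume r: "r \<in> {0<..<t}"
    then have "norm (mlt (a - r) k) * norm (g r) \<le> D * (C * r powr (- 2 * gam))"
      using D[of r] g[of r] assms by (intro mult_mono order_trans[OF norm_ge_zero D[of r]]) auto
    then show "norm (mlt (a - r) k * g r) \<le> D * C * r powr (- 2 * gam)" by (simp add: norm_mult mult_ac)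
  qed auto
  show "(\<lambda>r. mlt (a - r) k * g r) integrable_on {0..t}"
    using 1 set_lebesgue_integral_eq_integral(1) integrable_on_open_interval_real by blast
qed

definition duhK :: "real \<Rightarrow> real" where
  "duhK T = ker * (T powr (1 - rho) / (1 - rho))"

lemma duhK_nonneg: "0 \<le> duhK T" using ker_pos rho by (simp add: duhK_def)

lemma duhK_mono: "0 \<le> T \<Longrightarrow> T \<le> T' \<Longrightarrow> duhK T \<le> duhK T'"
  unfolding duhK_def using ker_pos rho by (intro mult_left_mono divide_right_mono powr_mono2) auto

text \<open>A convolution of square-summable sequences is only bounded in the frequency, and in the
  applications \<open>G\<close> is a bound independent of \<open>k\<close>. Integrating the kernel
  produces a square-summable factor, so the result belongs to the solution space again. Both
  singular endpoints contribute equally, and their factor 2 cancels the 1/2 of the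
  nonlinearity.\<close>

lemma duhamel_bound:
  assumes int: "(\<lambda>r. mlt (t - r) k * g r) integrable_on {0..t}" and t: "0 \<le> t" "t \<le> T" and \<delta>: "0 \<le> \<delta>" and lam: "3 * \<eta> / 4 + 1 \<le> lm"
    and G: "0 \<le> G" and g: "\<And>r. 0 < r \<Longrightarrow> r \<le> T \<Longrightarrow>
      norm (g r) \<le> G * (r powr (- 2 * gam) * jb k powr (- sig / 2) * exp (lm * r) * exp (- nu * min r \<delta> * \<bar>of_int k\<bar>))"
  shows "wgt lm \<delta> t k * (\<bar>of_int k\<bar> / 2 * norm (integral {0..t} (\<lambda>r. mlt (t - r) k * g r))) \<le>
      duhK T * (lm - 3 * \<eta> / 4) powr (- eps) * G * \<bar>of_int k\<bar> powr (1 - 2 * th0)"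
proof -
  let ?c = "ker * (lm - 3 * \<eta> / 4) powr (- eps) * \<bar>of_int k\<bar> powr (1 - 2 * th0) * G"
  let ?w = "wgt lm \<delta> t k * \<bar>of_int k\<bar> :: real"
  have "norm (integral {0<..<t} (\<lambda>r. of_real ?w * (mlt (t - r) k * g r))) \<le> integral {0<..<t} (\<lambda>r. ?c * ((t - r) powr (- rho) + r powr (- rho)))"
  proof (rule integral_norm_bound_integral)
    show "(\<lambda>r. of_real ?w * (mlt (t - r) k * g r)) integrable_on {0<..<t}"
      unfolding integrable_on_open_interval_real using int by (rule integrable_on_mult_right)
    show "(\<lambda>r. ?c * ((t - r) powr (- rho) + r powr (- rho))) integrable_on {0<..<t}"
      unfolding integrable_on_open_interval_real
      using integral_powr_sum[of rho t] rho t by (intro integrable_on_mult_right) auto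
    fix r assume r: "r \<in> {0<..<t}"
    have "norm (of_real ?w * (mlt (t - r) k * g r)) = ?w * norm (mlt (t - r) k) * norm (g r)"
      using wgt_pos[of lm \<delta> t k] by (simp add: norm_mult)
    also have "\<dots> \<le> ?w * norm (mlt (t - r) k) * (G * (r powr (- 2 * gam) * jb k powr (- sig / 2) * exp (lm * r) * exp (- nu * min r \<delta> * \<bar>of_int k\<bar>)))"
      using r t wgt_pos[of lm \<delta> t k] by (intro mult_left_mono g) auto
    also have "\<dots> = G * (?w * norm (mlt (t - r) k) * (r powr (- 2 * gam) * jb k powr (- sig / 2) * exp (lm * r) * exp (- nu * min r \<delta> * \<bar>of_int k\<bar>)))"
      by (simp add: mult_ac)
    also have "\<dots> \<le> G * (ker * (lm - 3 * \<eta> / 4) powr (- eps) * \<bar>of_int k\<bar> powr (1 - 2 * th0) * ((t - r) powr (- rho) + r powr (- rho)))"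
      using r t by (intro mult_left_mono duhamel_kernel_bound \<delta> lam G) auto
    finally show "norm (of_real ?w * (mlt (t - r) k * g r)) \<le> ?c * ((t - r) powr (- rho) + r powr (- rho))"
      by (simp add: mult_ac)
  qed
  also have "integral {0<..<t} (\<lambda>r. ?c * ((t - r) powr (- rho) + r powr (- rho))) = ?c * (2 * (t powr (1 - rho) / (1 - rho)))"
    unfolding integral_open_interval_real
    by (intro integral_unique has_integral_mult_right integral_powr_sum[unfolded has_integral_Icc_iff_Ioo])
      (use rho(1,2) t in auto)
  also have "\<dots> \<le> ?c * (2 * (T powr (1 - rho) / (1 - rho)))"
    using ker_pos G rho t by (intro mult_left_mono divide_right_mono powr_mono2) auto
  finally have "?w * norm (integral {0..t} (\<lambda>r. mlt (t - r) k * g r)) \<le> ?c * (2 * (T powr (1 - rho) / (1 - rho)))"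
    using wgt_pos[of lm \<delta> t k] unfolding integral_open_interval_real by (simp add: norm_mult)
  then show ?thesis by (simp add: duhK_def mult_ac)
qed

end

section \<open>Convolutions\<close>

definition conv :: "(int \<Rightarrow> complex) \<Rightarrow> (int \<Rightarrow> complex) \<Rightarrow> int \<Rightarrow> complex" where
  "conv a b k = (\<Sum>\<^sub>\<infinity>j. a j * b (k - j))"

lemma bij_diff_int: "bij (\<lambda>j. k - j)" for k :: int
  by (rule bijI') (auto intro: exI[of _ "k - _"])

lemma conv_commute: "conv a b k = conv b a k"
  unfolding conv_def using infsum_reindex_bij_betw[OF bij_diff_int[of k], of "\<lambda>j. a j * b (k - j)"]
  by (simp add: mult.commute)

lemma conv_uminus:
  assumes "\<And>k. a (- k) = cnj (a k)" "\<And>k. b (- k) = cnj (b k)"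
  shows "conv a b (- k) = cnj (conv a b k)"
proof -
  have "bij (uminus :: int \<Rightarrow> int)" by (rule bijI') (auto intro: exI[of _ "- _"])
  then have "conv a b (- k) = (\<Sum>\<^sub>\<infinity>j. a (- j) * b (- k - - j))"
    unfolding conv_def by (subst infsum_reindex_bij_betw) auto
  also have "\<dots> = (\<Sum>\<^sub>\<infinity>j. cnj (a j * b (k - j)))"
    using assms(1) assms(2)[of "k - _"] by (intro infsum_cong) simp
  finally show ?thesis by (simp add: conv_def flip: infsum_cnj)
qed

lemma conv_lincomb:
  assumes "(\<lambda>j. norm (a j * b (k - j))) summable_on UNIV" "(\<lambda>j. norm (a j * c (k - j))) summable_on UNIV"
  shows "conv a (\<lambda>j. x * b j + y * c j) k = x * conv a b k + y * conv a c k"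
proof -
  have 1: "(\<lambda>j. a j * b (k - j)) summable_on UNIV" "(\<lambda>j. a j * c (k - j)) summable_on UNIV"
    using assms by (auto intro: abs_summable_summable)
  have "conv a (\<lambda>j. x * b j + y * c j) k = (\<Sum>\<^sub>\<infinity>j. x * (a j * b (k - j)) + y * (a j * c (k - j)))"
    unfolding conv_def by (simp add: algebra_simps)
  also have "\<dots> = (\<Sum>\<^sub>\<infinity>j. x * (a j * b (k - j))) + (\<Sum>\<^sub>\<infinity>j. y * (a j * c (k - j)))"
    by (intro infsum_add summable_on_cmult_right 1)
  finally show ?thesis by (simp add: conv_def infsum_cmult_right')
qed

section \<open>The space of solutions\<close>

context dissipative
begin

definition Mx :: "real \<Rightarrow> real \<Rightarrow> real \<Rightarrow> (real \<Rightarrow> int \<Rightarrow> complex) \<Rightarrow> int \<Rightarrow> real" where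
  "Mx lm \<delta> T u k = (SUP t\<in>{0..T}. wgt lm \<delta> t k * cmod (u t k))"

definition nW :: "real \<Rightarrow> real \<Rightarrow> real \<Rightarrow> (real \<Rightarrow> int \<Rightarrow> complex) \<Rightarrow> real" where
  "nW lm \<delta> T u = l2n (Mx lm \<delta> T u)"

text \<open>Taking the supremum in time inside the sum over the frequencies makes continuity in time with
  values in the Sobolev space a consequence of continuity of every Fourier mode.\<close>

definition W :: "real \<Rightarrow> real \<Rightarrow> (real \<Rightarrow> int \<Rightarrow> complex) set" where
  "W \<delta> T = {u. (\<forall>t. t \<notin> {0..T} \<longrightarrow> u t = 0) \<and> (\<forall>k. continuous_on {0..T} (\<lambda>t. u t k)) \<and>
     (\<forall>t k. u t (- k) = cnj (u t k)) \<and>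
     (\<exists>c. l2 c \<and> (\<forall>t\<in>{0..T}. \<forall>k. wgt 0 \<delta> t k * cmod (u t k) \<le> c k))}"

lemma wgt_lm_le:
  assumes "0 \<le> t" "t \<le> T" "0 \<le> lm"
  shows "wgt lm \<delta> t k \<le> wgt 0 \<delta> t k" and "wgt 0 \<delta> t k \<le> exp (lm * T) * wgt lm \<delta> t k"
proof -
  have e: "exp (- lm * t) \<le> 1" "1 \<le> exp (lm * T) * exp (- lm * t)"
    using assms by (auto simp: mult_left_mono simp flip: exp_add)
  show "wgt lm \<delta> t k \<le> wgt 0 \<delta> t k"
    unfolding wgt_lambda[of lm] using e wgt_pos[of 0 \<delta> t k] by (simp add: mult_left_le_one_le)
  have "1 * wgt 0 \<delta> t k \<le> exp (lm * T) * exp (- lm * t) * wgt 0 \<delta> t k"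
    by (intro mult_right_mono e) (use wgt_pos[of 0 \<delta> t k] in auto)
  then show "wgt 0 \<delta> t k \<le> exp (lm * T) * wgt lm \<delta> t k"
    unfolding wgt_lambda[of lm] by (simp add: mult_ac)
qed

lemma Mx_ge_aux:
  assumes "\<And>t. t \<in> {0..T} \<Longrightarrow> wgt lm \<delta> t k * cmod (u t k) \<le> C" "t \<in> {0..T}"
  shows "wgt lm \<delta> t k * cmod (u t k) \<le> Mx lm \<delta> T u k"
  unfolding Mx_def by (rule cSUP_upper[OF assms(2)]) (unfold bdd_above_def, use assms(1) in blast)

lemma Mx_le:
  assumes "0 \<le> T" "\<And>t. t \<in> {0..T} \<Longrightarrow> wgt lm \<delta> t k * cmod (u t k) \<le> C"
  shows "Mx lm \<delta> T u k \<le> C" and "0 \<le> Mx lm \<delta> T u k"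
proof -
  show "Mx lm \<delta> T u k \<le> C" unfolding Mx_def by (rule cSUP_least) (use assms in auto)
  have "0 \<le> wgt lm \<delta> 0 k * cmod (u 0 k)" using wgt_pos[of lm \<delta> 0 k] by simp
  also have "\<dots> \<le> Mx lm \<delta> T u k" by (rule Mx_ge_aux) (use assms in auto)
  finally show "0 \<le> Mx lm \<delta> T u k" .
qed

lemma W_dom:
  assumes "u \<in> W \<delta> T" "0 \<le> lm"
  shows "\<exists>c. l2 c \<and> (\<forall>t\<in>{0..T}. \<forall>k. wgt lm \<delta> t k * cmod (u t k) \<le> c k)"
proof -
  obtain c where c: "l2 c" "\<And>t k. t \<in> {0..T} \<Longrightarrow> wgt 0 \<delta> t k * cmod (u t k) \<le> c k"
    using assms by (auto simp: W_def)
  have "wgt lm \<delta> t k * cmod (u t k) \<le> c k" if "t \<in> {0..T}" for t k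
    using that assms(2) by (intro order_trans[OF mult_right_mono[OF wgt_lm_le(1)] c(2)]) auto
  then show ?thesis using c(1) by blast
qed

lemma W_I:
  assumes "\<And>t. t \<notin> {0..T} \<Longrightarrow> u t = 0" "\<And>k. continuous_on {0..T} (\<lambda>t. u t k)"
    and "\<And>t k. t \<in> {0..T} \<Longrightarrow> u t (- k) = cnj (u t k)"
    and c: "l2 c" "\<And>t k. t \<in> {0..T} \<Longrightarrow> wgt lm \<delta> t k * cmod (u t k) \<le> c k" and lm: "0 \<le> lm"
  shows "u \<in> W \<delta> T"
proof -
  have "wgt 0 \<delta> t k * cmod (u t k) \<le> exp (lm * T) * c k" if "t \<in> {0..T}" for t k
  proof -
    have "wgt 0 \<delta> t k * cmod (u t k) \<le> exp (lm * T) * wgt lm \<delta> t k * cmod (u t k)"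
      using that lm by (intro mult_right_mono wgt_lm_le(2)) auto
    then show ?thesis unfolding mult.assoc by (rule order_trans[OF _ mult_left_mono[OF c(2)[OF that] exp_ge_zero]])
  qed
  moreover have "u t (- k) = cnj (u t k)" for t k using assms(1,3)[of t] by (cases "t \<in> {0..T}") auto
  ultimately show ?thesis unfolding W_def using assms(1,2) l2_scale[OF c(1), of "exp (lm * T)"] by blast
qed

lemma W_cont: "u \<in> W \<delta> T \<Longrightarrow> continuous_on {0..T} (\<lambda>t. u t k)"
  and W_sym: "u \<in> W \<delta> T \<Longrightarrow> u t (- k) = cnj (u t k)"
  and W_zero: "u \<in> W \<delta> T \<Longrightarrow> t \<notin> {0..T} \<Longrightarrow> u t = 0"
  by (auto simp: W_def)

context
  fixes T \<delta> lm :: real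
  assumes T: "0 \<le> T" and lm: "0 \<le> lm"
begin

lemma Mx_ge: "u \<in> W \<delta> T \<Longrightarrow> t \<in> {0..T} \<Longrightarrow> wgt lm \<delta> t k * cmod (u t k) \<le> Mx lm \<delta> T u k"
  using W_dom[of u \<delta> T lm] lm by (metis Mx_ge_aux)

lemma Mx_nonneg: "u \<in> W \<delta> T \<Longrightarrow> 0 \<le> Mx lm \<delta> T u k"
  using W_dom[of u \<delta> T lm] lm Mx_le(2)[OF T] by metis

lemma nW_le:
  assumes "l2 c" "\<And>t k. t \<in> {0..T} \<Longrightarrow> wgt lm \<delta> t k * cmod (u t k) \<le> c k"
  shows "nW lm \<delta> T u \<le> l2n c" and "l2 (Mx lm \<delta> T u)"
proof -
  have "\<bar>Mx lm \<delta> T u k\<bar> \<le> \<bar>c k\<bar>" for k using Mx_le[OF T, of lm \<delta> k u "c k"] assms(2) by simp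
  then show "nW lm \<delta> T u \<le> l2n c" "l2 (Mx lm \<delta> T u)" using l2_mono[OF assms(1)] unfolding nW_def by blast+
qed

lemma l2_Mx: "u \<in> W \<delta> T \<Longrightarrow> l2 (Mx lm \<delta> T u)"
  using W_dom[of u \<delta> T lm] nW_le(2) lm by metis

lemma Mx_le_nW: "u \<in> W \<delta> T \<Longrightarrow> Mx lm \<delta> T u k \<le> nW lm \<delta> T u"
  unfolding nW_def using abs_le_l2n[OF l2_Mx, of u k] by simp

lemma W_subspace: "normed_subspace (W \<delta> T) (nW lm \<delta> T)"
proof
  show "0 \<in> W \<delta> T"
    by (rule W_I[of _ _ "\<lambda>_. 0" 0]) (auto simp: l2_zero)
next
  fix u v assume u: "u \<in> W \<delta> T" and v: "v \<in> W \<delta> T"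
  have b: "wgt lm \<delta> t k * cmod ((u + v) t k) \<le> Mx lm \<delta> T u k + Mx lm \<delta> T v k" if "t \<in> {0..T}" for t k
  proof -
    have "wgt lm \<delta> t k * cmod ((u + v) t k) \<le> wgt lm \<delta> t k * (cmod (u t k) + cmod (v t k))"
      using wgt_pos[of lm \<delta> t k] by (intro mult_left_mono) (auto simp: norm_triangle_ineq)
    then show ?thesis using Mx_ge[OF u that, of k] Mx_ge[OF v that, of k] by (simp add: distrib_left)
  qed
  show "u + v \<in> W \<delta> T"
    by (rule W_I[OF _ _ _ l2_add(1)[OF l2_Mx[OF u] l2_Mx[OF v]] b lm])
      (use W_zero[OF u] W_zero[OF v] W_sym[OF u] W_sym[OF v] in
        \<open>auto intro!: continuous_on_add W_cont[OF u] W_cont[OF v]\<close>)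
  show "nW lm \<delta> T (u + v) \<le> nW lm \<delta> T u + nW lm \<delta> T v"
    using nW_le(1)[OF l2_add(1)[OF l2_Mx[OF u] l2_Mx[OF v]] b] l2_add(2)[OF l2_Mx[OF u] l2_Mx[OF v]]
    unfolding nW_def by linarith
next
  fix u and r :: real assume u: "u \<in> W \<delta> T"
  have b: "wgt lm \<delta> t k * cmod ((r *\<^sub>R u) t k) \<le> \<bar>r\<bar> * Mx lm \<delta> T u k" if "t \<in> {0..T}" for t k r
    using mult_left_mono[OF Mx_ge[OF u that, of k], of "\<bar>r\<bar>"] by (simp add: scaleR_fun_def mult_ac)
  show ru: "r *\<^sub>R u \<in> W \<delta> T" for r
    by (rule W_I[OF _ _ _ l2_scale[OF l2_Mx[OF u]] b lm])
      (use W_zero[OF u] W_sym[OF u] in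
        \<open>auto simp: scaleR_fun_def intro!: continuous_on_scaleR W_cont[OF u]\<close>)
  have le: "nW lm \<delta> T (r *\<^sub>R u) \<le> \<bar>r\<bar> * nW lm \<delta> T u" for r
    using nW_le(1)[OF l2_scale[OF l2_Mx[OF u]] b] by (simp add: l2n_scale nW_def)
  show "nW lm \<delta> T (r *\<^sub>R u) = \<bar>r\<bar> * nW lm \<delta> T u"
  proof (rule antisym[OF le])
    have "Mx lm \<delta> T (r *\<^sub>R u) k = \<bar>r\<bar> * Mx lm \<delta> T u k" if "r \<noteq> 0" for k
    proof (rule antisym)
      show "Mx lm \<delta> T (r *\<^sub>R u) k \<le> \<bar>r\<bar> * Mx lm \<delta> T u k" by (rule Mx_le[OF T b])
      have "wgt lm \<delta> t k * cmod (u t k) \<le> Mx lm \<delta> T (r *\<^sub>R u) k / \<bar>r\<bar>" if "t \<in> {0..T}" for t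
        using Mx_ge[OF ru[of r] that, of k] \<open>r \<noteq> 0\<close> by (simp add: scaleR_fun_def field_simps)
      then have "Mx lm \<delta> T u k \<le> Mx lm \<delta> T (r *\<^sub>R u) k / \<bar>r\<bar>" by (rule Mx_le[OF T])
      then show "\<bar>r\<bar> * Mx lm \<delta> T u k \<le> Mx lm \<delta> T (r *\<^sub>R u) k" using \<open>r \<noteq> 0\<close> by (simp add: field_simps)
    qed
    then show "\<bar>r\<bar> * nW lm \<delta> T u \<le> nW lm \<delta> T (r *\<^sub>R u)"
    proof (cases "r = 0")
      case False
      then have "Mx lm \<delta> T (r *\<^sub>R u) = (\<lambda>k. \<bar>r\<bar> * Mx lm \<delta> T u k)"
        using \<open>\<And>k. r \<noteq> 0 \<Longrightarrow> _ k\<close> by (intro ext) blast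
      then show ?thesis by (simp add: nW_def l2n_scale)
    qed (simp add: nW_def l2n_nonneg)
  qed
qed (simp add: nW_def l2n_nonneg)

interpretation normed_subspace "W \<delta> T" "nW lm \<delta> T" by (rule W_subspace)

text \<open>The limit is taken separately in each frequency and time. Convergence in norm is then
  recovered from bounds on finite sets of frequencies.\<close>

lemma W_complete: "complete_subspace (W \<delta> T) (nW lm \<delta> T)"
proof
  fix u assume u: "u \<in> W \<delta> T" and 0: "nW lm \<delta> T u = 0"
  have "u t k = 0" for t k
  proof (cases "t \<in> {0..T}")
    case True
    have "wgt lm \<delta> t k * cmod (u t k) \<le> 0"
      using Mx_ge[OF u True, of k] Mx_le_nW[OF u, of k] 0 by linarith
    then have "cmod (u t k) \<le> 0" using wgt_pos[of lm \<delta> t k] by (simp add: mult_le_0_iff)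
    then show ?thesis by simp
  qed (simp add: W_zero[OF u])
  then show "u = 0" by (intro ext) simp
next
  fix f :: "nat \<Rightarrow> real \<Rightarrow> int \<Rightarrow> complex" and c :: real
  assume f: "\<And>n. f n \<in> W \<delta> T" and fc: "\<And>n. nW lm \<delta> T (f (Suc n) - f n) \<le> c * (1/2) ^ n"
  have c: "0 \<le> c" using order_trans[OF norm_nonneg[OF diff_mem[OF f[of 1] f[of 0]]]] fc[of 0] by simp
  have fd: "nW lm \<delta> T (f (n + m) - f n) \<le> 2 * c * (1/2) ^ n - 2 * c * (1/2) ^ (n + m)" for n m
  proof (induction m)
    case 0
    have "f (n + 0) - f n = 0" by simp
    then show ?case using norm_zero by (metis add_0_right diff_self order_refl)
  next
    case (Suc m)
    have "f (n + Suc m) - f n = (f (Suc (n + m)) - f (n + m)) + (f (n + m) - f n)" by simp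
    then have "nW lm \<delta> T (f (n + Suc m) - f n) \<le> nW lm \<delta> T (f (Suc (n + m)) - f (n + m)) + nW lm \<delta> T (f (n + m) - f n)"
      using norm_add diff_mem f by metis
    also have "\<dots> \<le> c * (1/2) ^ (n + m) + (2 * c * (1/2) ^ n - 2 * c * (1/2) ^ (n + m))"
      by (intro add_mono fc Suc)
    also have "\<dots> = 2 * c * (1/2) ^ n - 2 * c * (1/2) ^ (n + Suc m)" by simp
    finally show ?case .
  qed
  have fd': "nW lm \<delta> T (f m - f n) \<le> 2 * c * (1/2) ^ n" if "n \<le> m" for n m
  proof -
    have "0 \<le> 2 * c * (1/2) ^ m" using c by simp
    then show ?thesis using fd[of n "m - n"] that by simp
  qed
  have pt: "wgt lm \<delta> t k * cmod (f m t k - f n t k) \<le> 2 * c * (1/2) ^ n" if "n \<le> m" "t \<in> {0..T}" for n m t k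
    using Mx_ge[OF diff_mem[OF f[of m] f[of n]] that(2), of k] Mx_le_nW[OF diff_mem[OF f[of m] f[of n]], of k] fd'[OF that(1)] by simp
  have half: "(\<lambda>n. C * (1/2) ^ n) \<longlonglongrightarrow> 0" for C :: real
    using tendsto_mult_left[OF LIMSEQ_realpow_zero[of "1/2"], of C] by simp
  have cau: "Cauchy (\<lambda>n. f n t k)" if t: "t \<in> {0..T}" for t k
  proof (rule CauchyI)
    fix e :: real assume e: "0 < e"
    have "0 < e * wgt lm \<delta> t k" using e wgt_pos by simp
    then have "\<forall>\<^sub>F n in sequentially. 4 * c * (1/2) ^ n < e * wgt lm \<delta> t k"
      by (rule order_tendstoD(2)[OF half])
    then obtain N where N: "4 * c * (1/2) ^ N < e * wgt lm \<delta> t k" by (auto simp: eventually_sequentially)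
    have "cmod (f m t k - f n t k) < e" if mn: "N \<le> m" "N \<le> n" for m n
    proof -
      have "cmod (f m t k - f n t k) \<le> cmod (f m t k - f N t k) + cmod (f n t k - f N t k)"
        using norm_triangle_ineq4[of "f m t k - f N t k" "f n t k - f N t k"] by simp
      then have "wgt lm \<delta> t k * cmod (f m t k - f n t k) \<le> wgt lm \<delta> t k * cmod (f m t k - f N t k) + wgt lm \<delta> t k * cmod (f n t k - f N t k)"
        using wgt_pos[of lm \<delta> t k] by (metis distrib_left less_imp_le mult_left_mono)
      also have "\<dots> < wgt lm \<delta> t k * e" using pt[OF mn(1) t, where k = k] pt[OF mn(2) t, where k = k] N by (simp add: mult.commute)
      finally show ?thesis using wgt_pos[of lm \<delta> t k] by simp
    qed
    then show "\<exists>M. \<forall>m\<ge>M. \<forall>n\<ge>M. norm (f m t k - f n t k) < e" by blast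
  qed
  define l where "l t k = (if t \<in> {0..T} then lim (\<lambda>n. f n t k) else 0)" for t k
  have lim: "(\<lambda>n. f n t k) \<longlonglongrightarrow> l t k" if "t \<in> {0..T}" for t k
    using cau[OF that, of k] that by (simp add: l_def Cauchy_convergent_iff convergent_LIMSEQ_iff)
  have lpt: "wgt lm \<delta> t k * cmod ((f n - l) t k) \<le> 2 * c * (1/2) ^ n" if "t \<in> {0..T}" for n t k
  proof (rule LIMSEQ_le_const2)
    show "(\<lambda>m. wgt lm \<delta> t k * cmod (f m t k - f n t k)) \<longlonglongrightarrow> wgt lm \<delta> t k * cmod ((f n - l) t k)"
    proof -
      have "cmod ((f n - l) t k) = cmod (l t k - f n t k)" by (simp add: norm_minus_commute)
      then show ?thesis by (simp only:) (intro tendsto_intros lim[OF that])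
    qed
    show "\<exists>N. \<forall>m\<ge>N. wgt lm \<delta> t k * cmod (f m t k - f n t k) \<le> 2 * c * (1/2) ^ n"
      using pt that by blast
  qed
  have Ml: "Mx lm \<delta> T (f n - l) k \<le> 2 * c * (1/2) ^ n" "0 \<le> Mx lm \<delta> T (f n - l) k" for n k
    using Mx_le[OF T, of lm \<delta> k "f n - l" "2 * c * (1/2) ^ n"] lpt by auto
  have Mge: "wgt lm \<delta> t k * cmod ((f n - l) t k) \<le> Mx lm \<delta> T (f n - l) k" if "t \<in> {0..T}" for n t k
    by (rule Mx_ge_aux[where C = "2 * c * (1/2) ^ n"]) (use lpt that in auto)
  \<comment> \<open>For fixed \<open>F\<close> insert a later member \<open>f m\<close>. Its
    distance to \<open>f n\<close> is bounded in norm, and its distance to the limit is bounded in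
    each of finitely many frequencies, which disappears as \<open>m\<close> grows.\<close>
  have L2: "L2_set (Mx lm \<delta> T (f n - l)) F \<le> 2 * c * (1/2) ^ n" if F: "finite F" for n F
  proof (rule LIMSEQ_le_const)
    show "(\<lambda>m. 2 * c * (1/2) ^ n + real (card F) * (2 * c * (1/2) ^ m)) \<longlonglongrightarrow> 2 * c * (1/2) ^ n"
      using tendsto_add[OF tendsto_const half[of "real (card F) * (2 * c)"]] by (simp add: mult.assoc)
    show "\<exists>N. \<forall>m\<ge>N. L2_set (Mx lm \<delta> T (f n - l)) F \<le> 2 * c * (1/2) ^ n + real (card F) * (2 * c * (1/2) ^ m)"
    proof (intro exI allI impI)
      fix m assume m: "n \<le> m"
      have "Mx lm \<delta> T (f n - l) k \<le> Mx lm \<delta> T (f m - f n) k + Mx lm \<delta> T (f m - l) k" for k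
      proof (rule Mx_le[OF T])
        fix t assume t: "t \<in> {0..T}"
        have "cmod ((f n - l) t k) \<le> cmod ((f m - f n) t k) + cmod ((f m - l) t k)"
          using norm_triangle_ineq4[of "f m t k - l t k" "f m t k - f n t k"] by simp
        then have "wgt lm \<delta> t k * cmod ((f n - l) t k) \<le> wgt lm \<delta> t k * (cmod ((f m - f n) t k) + cmod ((f m - l) t k))"
          using wgt_pos[of lm \<delta> t k] by (intro mult_left_mono) auto
        then show "wgt lm \<delta> t k * cmod ((f n - l) t k) \<le> Mx lm \<delta> T (f m - f n) k + Mx lm \<delta> T (f m - l) k"
          using Mx_ge[OF diff_mem[OF f[of m] f[of n]] t, of k] Mge[OF t, where k = k and n = m] by (simp add: distrib_left)
      qed
      then have "L2_set (Mx lm \<delta> T (f n - l)) F \<le> L2_set (\<lambda>k. Mx lm \<delta> T (f m - f n) k + Mx lm \<delta> T (f m - l) k) F"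
        by (intro L2_set_mono) (use Ml in auto)
      also have "\<dots> \<le> L2_set (Mx lm \<delta> T (f m - f n)) F + L2_set (Mx lm \<delta> T (f m - l)) F"
        by (rule L2_set_triangle_ineq)
      also have "\<dots> \<le> nW lm \<delta> T (f m - f n) + (\<Sum>k\<in>F. Mx lm \<delta> T (f m - l) k)"
        unfolding nW_def by (intro add_mono L2_set_le_l2n l2_Mx diff_mem f F L2_set_le_sum) (use Ml in auto)
      also have "\<dots> \<le> 2 * c * (1/2) ^ n + (\<Sum>k\<in>F. 2 * c * (1/2) ^ m)"
        by (intro add_mono fd' m sum_mono Ml)
      finally show "L2_set (Mx lm \<delta> T (f n - l)) F \<le> 2 * c * (1/2) ^ n + real (card F) * (2 * c * (1/2) ^ m)"
        by simp
    qed
  qed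
  have nl: "l2 (Mx lm \<delta> T (f n - l))" "nW lm \<delta> T (f n - l) \<le> 2 * c * (1/2) ^ n" for n
    using l2_I[OF L2] unfolding nW_def by auto
  have "l \<in> W \<delta> T"
  proof (rule W_I[OF _ _ _ l2_add(1)[OF l2_Mx[OF f[of 0]] nl(1)[of 0]] _ lm])
    show "t \<notin> {0..T} \<Longrightarrow> l t = 0" for t by (auto simp: l_def)
    show "l t (- k) = cnj (l t k)" if "t \<in> {0..T}" for t k
      using LIMSEQ_unique[OF lim[OF that, of "- k"]] tendsto_cnj[OF lim[OF that, of k]]
      by (simp add: W_sym[OF f])
    show "wgt lm \<delta> t k * cmod (l t k) \<le> Mx lm \<delta> T (f 0) k + Mx lm \<delta> T (f 0 - l) k" if t: "t \<in> {0..T}" for t k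
    proof -
      have "cmod (l t k) \<le> cmod (f 0 t k) + cmod ((f 0 - l) t k)"
        using norm_triangle_ineq4[of "f 0 t k" "f 0 t k - l t k"] by simp
      then have "wgt lm \<delta> t k * cmod (l t k) \<le> wgt lm \<delta> t k * (cmod (f 0 t k) + cmod ((f 0 - l) t k))"
        using wgt_pos[of lm \<delta> t k] by (intro mult_left_mono) auto
      then show ?thesis using Mx_ge[OF f[of 0] t, of k] Mge[OF t, where k = k and n = 0] by (simp add: distrib_left)
    qed
    show "continuous_on {0..T} (\<lambda>t. l t k)" for k
    proof (rule uniform_limit_theorem)
      show "\<forall>\<^sub>F n in sequentially. continuous_on {0..T} (\<lambda>t. f n t k)" by (intro always_eventually allI W_cont[OF f])
      \<comment> \<open>Uniform convergence needs a positive lower bound of the weight over all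
        times. The summand with \<open>t powr gam\<close> can vanish at \<open>t = 0\<close>, so
        only the plain Sobolev weight is retained. The absolute value of \<open>\<delta>\<close>
        occurs because its sign is not fixed here.\<close>
      let ?w = "exp (- lm * T) * (jb k powr (s / 2))"
      have w: "0 < ?w" using jb_pos[of k] by simp
      have ww: "exp (- nu * \<bar>\<delta>\<bar> * \<bar>of_int k\<bar>) * ?w \<le> wgt lm \<delta> t k" if "t \<in> {0..T}" for t
      proof -
        have "- \<bar>\<delta>\<bar> \<le> min t \<delta>" using that by auto
        then have "nu * \<bar>of_int k\<bar> * - \<bar>\<delta>\<bar> \<le> nu * \<bar>of_int k\<bar> * min t \<delta>"
          using eta by (intro mult_left_mono) (auto simp: nu_def)
        then have 1: "exp (- nu * \<bar>\<delta>\<bar> * \<bar>of_int k\<bar>) \<le> exp (nu * min t \<delta> * \<bar>of_int k\<bar>)" by (simp add: mult_ac)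
        have "exp (- lm * T) * (jb k powr (s / 2) * 1) * exp (- nu * \<bar>\<delta>\<bar> * \<bar>of_int k\<bar>) \<le> wgt lm \<delta> t k"
          unfolding wgt_def using that lm 1 by (intro mult_mono) (auto simp: mult_left_mono)
        then show ?thesis by (simp add: mult_ac)
      qed
      let ?v = "exp (- nu * \<bar>\<delta>\<bar> * \<bar>of_int k\<bar>) * ?w"
      have v: "0 < ?v" using w by simp
      show "uniform_limit {0..T} (\<lambda>n t. f n t k) (\<lambda>t. l t k) sequentially"
      proof (rule uniform_limitI)
        fix e :: real assume e: "0 < e"
        have "\<forall>\<^sub>F n in sequentially. 2 * c * (1/2) ^ n < e * ?v"
          using e v by (intro order_tendstoD(2)[OF half]) auto
        then show "\<forall>\<^sub>F n in sequentially. \<forall>t\<in>{0..T}. dist (f n t k) (l t k) < e"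
        proof eventually_elim
          case (elim n)
          show ?case
          proof
            fix t assume t: "t \<in> {0..T}"
            have "?v * cmod (f n t k - l t k) \<le> wgt lm \<delta> t k * cmod (f n t k - l t k)"
              by (intro mult_right_mono ww t) auto
            also have "\<dots> < e * ?v" using lpt[OF t, where k = k and n = n] elim by simp
            finally have "?v * cmod (f n t k - l t k) < ?v * e" by (simp only: mult.commute)
            then show "dist (f n t k) (l t k) < e" unfolding dist_norm using v mult_less_cancel_left_pos by blast
          qed
        qed
      qed
    qed simp
  qed
  moreover have "(\<lambda>n. nW lm \<delta> T (f n - l)) \<longlonglongrightarrow> 0"
  proof (rule tendsto_sandwich[OF _ _ tendsto_const half[of "2 * c"]])
    show "\<forall>\<^sub>F n in sequentially. 0 \<le> nW lm \<delta> T (f n - l)" by (simp add: nW_def l2n_nonneg)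
    show "\<forall>\<^sub>F n in sequentially. nW lm \<delta> T (f n - l) \<le> 2 * c * (1/2) ^ n"
      by (intro always_eventually allI nl)
  qed
  ultimately show "\<exists>l\<in>W \<delta> T. (\<lambda>n. nW lm \<delta> T (f n - l)) \<longlonglongrightarrow> 0" by blast
qed

end

lemma nW_lm_le:
  assumes "0 \<le> T" "0 \<le> lm" "u \<in> W \<delta> T"
  shows "nW lm \<delta> T u \<le> nW 0 \<delta> T u" and "nW 0 \<delta> T u \<le> exp (lm * T) * nW lm \<delta> T u"
proof -
  have "wgt lm \<delta> t k * cmod (u t k) \<le> Mx 0 \<delta> T u k" if "t \<in> {0..T}" for t k
    using that assms by (intro order_trans[OF mult_right_mono[OF wgt_lm_le(1)] Mx_ge]) auto
  from nW_le(1)[OF assms(1,2) l2_Mx this] assms show "nW lm \<delta> T u \<le> nW 0 \<delta> T u" by (simp add: nW_def)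
  have "wgt 0 \<delta> t k * cmod (u t k) \<le> exp (lm * T) * Mx lm \<delta> T u k" if "t \<in> {0..T}" for t k
  proof -
    have "wgt 0 \<delta> t k * cmod (u t k) \<le> exp (lm * T) * wgt lm \<delta> t k * cmod (u t k)"
      using that assms by (intro mult_right_mono wgt_lm_le(2)) auto
    then show ?thesis unfolding mult.assoc
      by (rule order_trans[OF _ mult_left_mono[OF Mx_ge[OF assms that] exp_ge_zero]])
  qed
  from nW_le(1)[OF assms(1) order_refl l2_scale[OF l2_Mx[OF assms]] this]
  show "nW 0 \<delta> T u \<le> exp (lm * T) * nW lm \<delta> T u" by (simp add: l2n_scale nW_def)
qed

end

context dissipative
begin

section \<open>The bilinear Duhamel operator\<close>

text \<open>\<open>m\<close> stands for \<open>min r \<delta>\<close>, the width of the strip of analyticity at time \<open>r\<close>.\<close>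

lemma conv_bound:
  fixes a b :: "int \<Rightarrow> complex" and A B :: "int \<Rightarrow> real" and k :: int and r m lm :: real
  assumes r: "0 < r" and m: "0 \<le> m" and l2: "l2 A" "l2 B"
    and a: "\<And>j. r powr gam * jb j powr (sig / 2) * exp (nu * m * \<bar>of_int j\<bar>) * cmod (a j) \<le> A j"
    and b: "\<And>j. exp (- lm * r) * r powr gam * jb j powr (sig / 2) * exp (nu * m * \<bar>of_int j\<bar>) * cmod (b j) \<le> B j"
  defines "K \<equiv> 2 powr (sig / 2) * (r powr (- 2 * gam) * jb k powr (- sig / 2) * exp (lm * r) * exp (- nu * m * \<bar>of_int k\<bar>))"
  shows "cmod (a j * b (k - j)) \<le> K * \<bar>A j * B (k - j)\<bar>"
    and "(\<lambda>j. norm (a j * b (k - j))) summable_on UNIV"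
    and "norm (conv a b k) \<le> K * (l2n A * l2n B)"
proof -
  have K: "0 \<le> K" by (simp add: K_def)
  show 1: "cmod (a j * b (k - j)) \<le> K * \<bar>A j * B (k - j)\<bar>" for j
  proof -
    let ?l = "k - j"
    let ?J = "jb j powr (sig / 2) * jb ?l powr (sig / 2)"
    let ?X = "exp (nu * m * \<bar>of_int j\<bar>) * exp (nu * m * \<bar>of_int ?l\<bar>)"
    have nn: "0 \<le> r powr gam * jb j powr (sig / 2) * exp (nu * m * \<bar>of_int j\<bar>) * cmod (a j)"
      "0 \<le> exp (- lm * r) * r powr gam * jb ?l powr (sig / 2) * exp (nu * m * \<bar>of_int ?l\<bar>) * cmod (b ?l)"
      by simp_all
    have prod: "exp (- lm * r) * (r powr gam * r powr gam) * ?J * ?X * cmod (a j * b ?l) \<le> A j * B ?l"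
      using mult_mono[OF a[of j] b[of ?l] order_trans[OF nn(1) a[of j]] nn(2)] by (simp add: norm_mult mult_ac)
    have AB: "A j * B ?l = \<bar>A j * B ?l\<bar>"
      using order_trans[OF nn(1) a] order_trans[OF nn(2) b] by simp
    have J: "jb k powr (sig / 2) \<le> 2 powr (sig / 2) * ?J"
    proof -
      have "jb k powr (sig / 2) \<le> (2 * (jb j * jb ?l)) powr (sig / 2)"
        using jb_submult[of j ?l] jb_pos[of k] sig by (intro powr_mono2) auto
      then show ?thesis by (simp add: powr_mult)
    qed
    have X: "exp (nu * m * \<bar>of_int k\<bar>) \<le> ?X"
    proof -
      have "\<bar>of_int k :: real\<bar> \<le> \<bar>of_int j\<bar> + \<bar>of_int ?l\<bar>" by simp
      then have "nu * m * \<bar>of_int k\<bar> \<le> nu * m * (\<bar>of_int j\<bar> + \<bar>of_int ?l\<bar>)"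
        using eta m by (intro mult_left_mono) (auto simp: nu_def)
      then show ?thesis by (simp add: distrib_left flip: exp_add)
    qed
    have "exp (- lm * r) * (r powr gam * r powr gam) * (jb k powr (sig / 2)) * exp (nu * m * \<bar>of_int k\<bar>) * cmod (a j * b ?l) \<le>
       exp (- lm * r) * (r powr gam * r powr gam) * (2 powr (sig / 2) * ?J) * ?X * cmod (a j * b ?l)"
      by (intro mult_right_mono mult_mono mult_left_mono J X) auto
    also have "\<dots> = 2 powr (sig / 2) * (exp (- lm * r) * (r powr gam * r powr gam) * ?J * ?X * cmod (a j * b ?l))"
      by (simp add: mult_ac)
    also have "\<dots> \<le> 2 powr (sig / 2) * (A j * B ?l)" by (intro mult_left_mono prod) simp
    finally have 2: "exp (- lm * r) * (r powr gam * r powr gam) * (jb k powr (sig / 2)) * exp (nu * m * \<bar>of_int k\<bar>) * cmod (a j * b ?l) \<le>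
      2 powr (sig / 2) * (A j * B ?l)" .
    have "cmod (a j * b ?l) = (r powr (- 2 * gam) * (r powr gam * r powr gam)) * (jb k powr (- sig / 2) * jb k powr (sig / 2)) *
       (exp (lm * r) * exp (- lm * r)) * (exp (- nu * m * \<bar>of_int k\<bar>) * exp (nu * m * \<bar>of_int k\<bar>)) * cmod (a j * b ?l)"
      using r jb_pos[of k] by (simp flip: powr_add exp_add)
    also have "\<dots> = (r powr (- 2 * gam) * jb k powr (- sig / 2) * exp (lm * r) * exp (- nu * m * \<bar>of_int k\<bar>)) *
       (exp (- lm * r) * (r powr gam * r powr gam) * (jb k powr (sig / 2)) * exp (nu * m * \<bar>of_int k\<bar>) * cmod (a j * b ?l))"
      by (simp only: mult_ac)
    also have "\<dots> \<le> (r powr (- 2 * gam) * jb k powr (- sig / 2) * exp (lm * r) * exp (- nu * m * \<bar>of_int k\<bar>)) * (2 powr (sig / 2) * (A j * B ?l))"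
      by (intro mult_left_mono 2) simp
    also have "\<dots> = K * (A j * B ?l)" by (simp add: K_def mult_ac)
    finally show ?thesis using AB by simp
  qed
  have B': "l2 (\<lambda>j. B (k - j))" "l2n (\<lambda>j. B (k - j)) = l2n B"
    using l2_reindex[OF bij_diff_int[of k], of B] l2 by auto
  note s = l2_mult_summable[OF l2(1) B'(1)]
  have s2: "(\<lambda>j. K * \<bar>A j * B (k - j)\<bar>) summable_on UNIV" by (intro summable_on_cmult_right s)
  have s3: "(\<Sum>\<^sub>\<infinity>j. K * \<bar>A j * B (k - j)\<bar>) \<le> K * (l2n A * l2n B)"
    unfolding infsum_cmult_right' using s(2) K B'(2) by (intro mult_left_mono) auto
  show "(\<lambda>j. norm (a j * b (k - j))) summable_on UNIV" "norm (conv a b k) \<le> K * (l2n A * l2n B)"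
    unfolding conv_def using infsum_norm_bound[OF s2 1 s3] by auto
qed

lemma W_fixed_time:
  assumes "0 \<le> lm" "0 \<le> T" "u \<in> W \<delta> T" "0 < r" "r \<le> T"
  shows "exp (- lm * r) * r powr gam * jb j powr (sig / 2) * exp (nu * min r \<delta> * \<bar>of_int j\<bar>) * cmod (u r j) \<le> Mx lm \<delta> T u j"
  using assms by (intro order_trans[OF mult_right_mono[OF wgt_ge] Mx_ge]) auto

lemma W_conv:
  assumes "0 \<le> lm" "0 \<le> T" "0 \<le> \<delta>" "u \<in> W \<delta> T" "v \<in> W \<delta> T" "0 < r" "r \<le> T"
  shows "(\<lambda>j. norm (u r j * v r (k - j))) summable_on UNIV"
    and "norm (conv (u r) (v r) k) \<le> (2 powr (sig / 2) * nW 0 \<delta> T u * nW lm \<delta> T v) *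
      (r powr (- 2 * gam) * jb k powr (- sig / 2) * exp (lm * r) * exp (- nu * min r \<delta> * \<bar>of_int k\<bar>))"
    and "cmod (u r j * v r (k - j)) \<le> 2 powr (sig / 2) * (r powr (- 2 * gam) * jb k powr (- sig / 2) * exp (lm * r) *
      exp (- nu * min r \<delta> * \<bar>of_int k\<bar>)) * \<bar>Mx 0 \<delta> T u j * Mx lm \<delta> T v (k - j)\<bar>"
proof -
  have m: "0 \<le> min r \<delta>" using assms by simp
  have a: "r powr gam * jb j powr (sig / 2) * exp (nu * min r \<delta> * \<bar>of_int j\<bar>) * cmod (u r j) \<le> Mx 0 \<delta> T u j" for j
    using W_fixed_time[of 0 T u \<delta> r j] assms by simp
  have b: "exp (- lm * r) * r powr gam * jb j powr (sig / 2) * exp (nu * min r \<delta> * \<bar>of_int j\<bar>) * cmod (v r j) \<le> Mx lm \<delta> T v j" for j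
    using W_fixed_time[of lm T v \<delta> r j] assms by simp
  have l2: "l2 (Mx 0 \<delta> T u)" "l2 (Mx lm \<delta> T v)" using l2_Mx assms by auto
  note c = conv_bound[where k = k, OF \<open>0 < r\<close> m l2 a b]
  show "(\<lambda>j. norm (u r j * v r (k - j))) summable_on UNIV" by (rule c(2))
  show "norm (conv (u r) (v r) k) \<le> (2 powr (sig / 2) * nW 0 \<delta> T u * nW lm \<delta> T v) *
      (r powr (- 2 * gam) * jb k powr (- sig / 2) * exp (lm * r) * exp (- nu * min r \<delta> * \<bar>of_int k\<bar>))"
    using c(3) by (simp add: nW_def mult_ac)
  show "cmod (u r j * v r (k - j)) \<le> 2 powr (sig / 2) * (r powr (- 2 * gam) * jb k powr (- sig / 2) * exp (lm * r) *
      exp (- nu * min r \<delta> * \<bar>of_int k\<bar>)) * \<bar>Mx 0 \<delta> T u j * Mx lm \<delta> T v (k - j)\<bar>"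
    by (rule c(1))
qed

text \<open>Multiplication by \<open>r powr (2 * gam)\<close> makes the majorant of the series
  independent of \<open>r\<close>; dividing again is harmless away from 0.\<close>

lemma W_conv_continuous:
  assumes "0 \<le> T" "0 \<le> \<delta>" "u \<in> W \<delta> T" "v \<in> W \<delta> T"
  shows "continuous_on {0<..T} (\<lambda>r. conv (u r) (v r) k)"
proof -
  let ?f = "\<lambda>j r. complex_of_real (r powr (2 * gam)) * (u r j * v r (k - j))"
  have "continuous_on {0<..T} (\<lambda>r. \<Sum>\<^sub>\<infinity>j. ?f j r)"
  proof (rule continuous_on_infsum)
    have sub: "{0<..T} \<subseteq> {0..T}" by auto
    show "continuous_on {0<..T} (?f j)" for j
      by (intro continuous_intros continuous_on_subset[OF W_cont[OF assms(3)] sub]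
          continuous_on_subset[OF W_cont[OF assms(4)] sub]) auto
    have "l2 (Mx 0 \<delta> T u)" "l2 (\<lambda>j. Mx 0 \<delta> T v (k - j))"
      using l2_Mx assms l2_reindex[OF bij_diff_int[of k], of "Mx 0 \<delta> T v"] by auto
    from l2_mult_summable(1)[OF this]
    show "(\<lambda>j. 2 powr (sig / 2) * \<bar>Mx 0 \<delta> T u j * Mx 0 \<delta> T v (k - j)\<bar>) summable_on UNIV"
      by (rule summable_on_cmult_right)
    fix j r assume r: "r \<in> {0<..T}"
    let ?M = "\<bar>Mx 0 \<delta> T u j * Mx 0 \<delta> T v (k - j)\<bar>"
    have "jb k powr (- sig / 2) \<le> jb k powr 0" using sig jb_ge_1 by (intro powr_mono) auto
    then have j1: "jb k powr (- sig / 2) \<le> 1" using jb_pos[of k] by simp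
    have e1: "exp (- nu * min r \<delta> * \<bar>of_int k\<bar>) \<le> 1" using r assms eta by (simp add: nu_def)
    have "norm (?f j r) \<le> r powr (2 * gam) * (2 powr (sig / 2) * (r powr (- 2 * gam) * jb k powr (- sig / 2) * exp (0 * r) *
      exp (- nu * min r \<delta> * \<bar>of_int k\<bar>)) * ?M)"
      unfolding norm_mult[of "complex_of_real _"] norm_of_real
      using W_conv(3)[of 0 T \<delta> u v r j k] assms r by (intro mult_mono) auto
    also have "\<dots> = (r powr (2 * gam) * r powr (- 2 * gam)) * 2 powr (sig / 2) * (jb k powr (- sig / 2) *
      exp (- nu * min r \<delta> * \<bar>of_int k\<bar>)) * ?M" by (simp add: mult_ac)
    also have "r powr (2 * gam) * r powr (- 2 * gam) = 1" using r by (simp flip: powr_add)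
    also have "1 * 2 powr (sig / 2) * (jb k powr (- sig / 2) * exp (- nu * min r \<delta> * \<bar>of_int k\<bar>)) * ?M \<le> 1 * 2 powr (sig / 2) * (1 * 1) * ?M"
      by (intro mult_right_mono mult_left_mono mult_mono j1 e1) auto
    finally show "norm (?f j r) \<le> 2 powr (sig / 2) * ?M" by simp
  qed
  then have "continuous_on {0<..T} (\<lambda>r. complex_of_real (r powr (- 2 * gam)) * (\<Sum>\<^sub>\<infinity>j. ?f j r))"
    by (intro continuous_intros) auto
  moreover have "complex_of_real (r powr (- 2 * gam)) * (\<Sum>\<^sub>\<infinity>j. ?f j r) = conv (u r) (v r) k" if "r \<in> {0<..T}" for r
  proof -
    have "complex_of_real (r powr (- 2 * gam)) * complex_of_real (r powr (2 * gam)) = 1"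
      using that by (simp flip: of_real_mult powr_add)
    moreover have "complex_of_real (r powr (- 2 * gam)) * (\<Sum>\<^sub>\<infinity>j. ?f j r) =
      (complex_of_real (r powr (- 2 * gam)) * complex_of_real (r powr (2 * gam))) * conv (u r) (v r) k"
      by (simp only: infsum_cmult_right' conv_def mult.assoc)
    ultimately show ?thesis by simp
  qed
  ultimately show ?thesis by (rule continuous_on_eq)
qed

text \<open>The symbol of \<open>- (1/2) d/dx\<close>, that is, of the nonlinearity with the minus
  sign of the integral equation.\<close>

definition frc :: "int \<Rightarrow> complex" where "frc k = - (\<i> * of_int k / 2)"

lemma norm_frc: "norm (frc k) = \<bar>of_int k\<bar> / 2" by (simp add: frc_def norm_mult norm_divide)

lemma frc_uminus: "frc (- k) = cnj (frc k)" by (simp add: frc_def)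

text \<open>The factor \<open>mlt t k\<close> stands outside so that the integrand does not depend
  on \<open>t\<close>; continuity in \<open>t\<close> is then that of an indefinite
  integral.\<close>

definition bil :: "real \<Rightarrow> (real \<Rightarrow> int \<Rightarrow> complex) \<Rightarrow> (real \<Rightarrow> int \<Rightarrow> complex) \<Rightarrow> real \<Rightarrow> int \<Rightarrow> complex" where
  "bil T u v t k = (if t \<in> {0..T} then
     frc k * (mlt t k * integral {0..t} (\<lambda>r. mlt (- r) k * conv (u r) (v r) k)) else 0)"

definition bilK :: "real \<Rightarrow> real \<Rightarrow> real" where
  "bilK T l = duhK T * l powr (- eps) * 2 powr (sig / 2) * l2n (\<lambda>k::int. \<bar>of_int k\<bar> powr (1 - 2 * th0))"

lemma l2_gain: "l2 (\<lambda>k::int. \<bar>of_int k :: real\<bar> powr (1 - 2 * th0))"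
  using l2_abs_powr[of "1 - 2 * th0"] eps by (simp add: th0_def)

lemma mlt_integral: "mlt t k * integral A (\<lambda>r. mlt (- r) k * g r) = integral A (\<lambda>r. mlt (t - r) k * g r)"
proof -
  have "mlt t k * integral A (\<lambda>r. mlt (- r) k * g r) = integral A (\<lambda>r. mlt t k * (mlt (- r) k * g r))" by simp
  then show ?thesis using mlt_add[of t "- _" k] by (simp add: mult.assoc)
qed

lemma bil_alt: "t \<in> {0..T} \<Longrightarrow> bil T u v t k = frc k * integral {0..t} (\<lambda>r. mlt (t - r) k * conv (u r) (v r) k)"
  by (simp add: bil_def mlt_integral)

lemma conv_forcing_bound:
  assumes "0 \<le> T" "0 \<le> \<delta>" "u \<in> W \<delta> T" "v \<in> W \<delta> T" "0 < r" "r \<le> T"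
  shows "norm (conv (u r) (v r) k) \<le> (2 powr (sig / 2) * nW 0 \<delta> T u * nW 0 \<delta> T v) * r powr (- 2 * gam)"
proof -
  have "jb k powr (- sig / 2) \<le> jb k powr 0" using sig jb_ge_1 by (intro powr_mono) auto
  then have j1: "jb k powr (- sig / 2) \<le> 1" using jb_pos[of k] by simp
  have e1: "exp (- nu * min r \<delta> * \<bar>of_int k\<bar>) \<le> 1" using assms eta by (simp add: nu_def)
  have "norm (conv (u r) (v r) k) \<le> (2 powr (sig / 2) * nW 0 \<delta> T u * nW 0 \<delta> T v) *
      (r powr (- 2 * gam) * jb k powr (- sig / 2) * exp (0 * r) * exp (- nu * min r \<delta> * \<bar>of_int k\<bar>))"
    by (rule W_conv(2)) (use assms in auto)
  also have "\<dots> \<le> (2 powr (sig / 2) * nW 0 \<delta> T u * nW 0 \<delta> T v) * (r powr (- 2 * gam) * 1 * 1 * 1)"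
    by (intro mult_left_mono mult_mono j1 e1) (auto simp: nW_def l2n_nonneg)
  finally show ?thesis by simp
qed

lemma W_forcing_integrable:
  assumes "0 \<le> T" "0 \<le> \<delta>" "u \<in> W \<delta> T" "v \<in> W \<delta> T" "0 \<le> t" "t \<le> T"
  shows "(\<lambda>r. mlt (a - r) k * conv (u r) (v r) k) absolutely_integrable_on {0<..<t}"
    and "(\<lambda>r. mlt (a - r) k * conv (u r) (v r) k) integrable_on {0..t}"
    and "(\<lambda>r. mlt (- r) k * conv (u r) (v r) k) integrable_on {0..t}"
  using forcing_integrable[OF W_conv_continuous[OF assms(1-4)] assms(5,6) conv_forcing_bound[OF assms(1-4)]]
    forcing_integrable(2)[OF W_conv_continuous[OF assms(1-4)] assms(5,6) conv_forcing_bound[OF assms(1-4)], where a = 0]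
  by auto

text \<open>The time discount \<open>exp (- lm * t)\<close> is charged to one factor only. With the
  other factor fixed, the map is linear in the discounted norm, with a constant that decreases in
  \<open>lm\<close>.\<close>

lemma bil_bound:
  assumes "0 \<le> T" "0 \<le> \<delta>" "3 * \<eta> / 4 + 1 \<le> lm" "u \<in> W \<delta> T" "v \<in> W \<delta> T"
  shows "bil T u v \<in> W \<delta> T" and "nW lm \<delta> T (bil T u v) \<le> bilK T (lm - 3 * \<eta> / 4) * nW 0 \<delta> T u * nW lm \<delta> T v"
proof -
  let ?G = "2 powr (sig / 2) * nW 0 \<delta> T u * nW lm \<delta> T v"
  let ?c = "duhK T * (lm - 3 * \<eta> / 4) powr (- eps) * ?G"
  have lm: "0 \<le> lm" using assms eta by linarith
  have G: "0 \<le> ?G" by (simp add: nW_def l2n_nonneg)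
  have c: "0 \<le> ?c" using G duhK_nonneg by simp
  have b: "wgt lm \<delta> t k * cmod (bil T u v t k) \<le> ?c * \<bar>of_int k\<bar> powr (1 - 2 * th0)" if "t \<in> {0..T}" for t k
  proof -
    have "wgt lm \<delta> t k * (\<bar>of_int k\<bar> / 2 * norm (integral {0..t} (\<lambda>r. mlt (t - r) k * conv (u r) (v r) k))) \<le>
        duhK T * (lm - 3 * \<eta> / 4) powr (- eps) * ?G * \<bar>of_int k\<bar> powr (1 - 2 * th0)"
      by (rule duhamel_bound[OF W_forcing_integrable(2)]) (use assms that G W_conv(2)[OF lm assms(1,2,4,5)] in auto)
    then show ?thesis using that by (simp add: bil_alt norm_mult norm_frc)
  qed
  have l2: "l2 (\<lambda>k::int. ?c * \<bar>of_int k\<bar> powr (1 - 2 * th0))" by (intro l2_scale l2_gain)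
  show "bil T u v \<in> W \<delta> T"
  proof (rule W_I[OF _ _ _ l2 b lm])
    show "t \<notin> {0..T} \<Longrightarrow> bil T u v t = 0" for t by (auto simp: bil_def fun_eq_iff)
    show "continuous_on {0..T} (\<lambda>t. bil T u v t k)" for k
    proof -
      have "continuous_on {0..T} (\<lambda>t. frc k * (mlt t k * integral {0..t} (\<lambda>r. mlt (- r) k * conv (u r) (v r) k)))"
        using W_forcing_integrable(3)[OF assms(1,2,4,5,1) order_refl]
        by (intro continuous_intros indefinite_integral_continuous_1) auto
      then show ?thesis by (rule continuous_on_eq) (simp add: bil_def)
    qed
    show "bil T u v t (- k) = cnj (bil T u v t k)" if "t \<in> {0..T}" for t k
    proof -
      have "conv (u r) (v r) (- k) = cnj (conv (u r) (v r) k)" for r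
        by (rule conv_uminus) (auto simp: W_sym[OF assms(4)] W_sym[OF assms(5)])
      then show ?thesis using that by (simp add: bil_def frc_uminus mlt_uminus integral_cnj)
    qed
  qed
  have "nW lm \<delta> T (bil T u v) \<le> l2n (\<lambda>k::int. ?c * \<bar>of_int k\<bar> powr (1 - 2 * th0))"
    by (rule nW_le(1)[OF assms(1) lm l2 b])
  also have "\<dots> = bilK T (lm - 3 * \<eta> / 4) * nW 0 \<delta> T u * nW lm \<delta> T v"
    unfolding l2n_scale abs_of_nonneg[OF c] by (simp add: bilK_def mult_ac)
  finally show "nW lm \<delta> T (bil T u v) \<le> bilK T (lm - 3 * \<eta> / 4) * nW 0 \<delta> T u * nW lm \<delta> T v" .
qed

lemma bil_commute: "bil T u v = bil T v u"
  by (intro ext) (simp add: bil_def conv_commute)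

lemma bil_lincomb:
  assumes "0 \<le> T" "0 \<le> \<delta>" "u \<in> W \<delta> T" "v \<in> W \<delta> T" "z \<in> W \<delta> T"
  shows "bil T z (a *\<^sub>R u + b *\<^sub>R v) = a *\<^sub>R bil T z u + b *\<^sub>R bil T z v"
proof (intro ext)
  fix t k
  show "bil T z (a *\<^sub>R u + b *\<^sub>R v) t k = (a *\<^sub>R bil T z u + b *\<^sub>R bil T z v) t k"
  proof (cases "t \<in> {0..T}")
    case True
    have t: "0 \<le> t" "t \<le> T" using True by auto
    have "integral {0..t} (\<lambda>r. mlt (- r) k * conv (z r) ((a *\<^sub>R u + b *\<^sub>R v) r) k) =
       integral {0<..<t} (\<lambda>r. mlt (- r) k * conv (z r) ((a *\<^sub>R u + b *\<^sub>R v) r) k)"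
      by (rule integral_open_interval_real)
    also have "\<dots> = integral {0<..<t} (\<lambda>r. of_real a * (mlt (- r) k * conv (z r) (u r) k) + of_real b * (mlt (- r) k * conv (z r) (v r) k))"
    proof (rule integral_cong)
      fix r assume r: "r \<in> {0<..<t}"
      have "conv (z r) (\<lambda>j. of_real a * u r j + of_real b * v r j) k = of_real a * conv (z r) (u r) k + of_real b * conv (z r) (v r) k"
        using r t assms W_conv(1)[of 0 T \<delta> z _ r k] by (intro conv_lincomb) auto
      moreover have "(a *\<^sub>R u + b *\<^sub>R v) r = (\<lambda>j. of_real a * u r j + of_real b * v r j)"
        by (intro ext) (simp add: scaleR_fun_def scaleR_conv_of_real)
      ultimately show "mlt (- r) k * conv (z r) ((a *\<^sub>R u + b *\<^sub>R v) r) k =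
        of_real a * (mlt (- r) k * conv (z r) (u r) k) + of_real b * (mlt (- r) k * conv (z r) (v r) k)"
        by (simp add: algebra_simps)
    qed
    also have "\<dots> = of_real a * integral {0..t} (\<lambda>r. mlt (- r) k * conv (z r) (u r) k) + of_real b * integral {0..t} (\<lambda>r. mlt (- r) k * conv (z r) (v r) k)"
      unfolding integral_open_interval_real[symmetric]
      using W_forcing_integrable(3)[OF assms(1,2,5,3) t] W_forcing_integrable(3)[OF assms(1,2,5,4) t]
      by (subst integral_add) (auto intro!: integrable_on_mult_right)
    finally show ?thesis using True by (simp add: bil_def scaleR_fun_def scaleR_conv_of_real algebra_simps)
  next
    case False
    then show ?thesis by (auto simp: bil_def scaleR_fun_def)
  qed
qed

lemma bil_diff:
  assumes "0 \<le> T" "0 \<le> \<delta>" "u \<in> W \<delta> T" "v \<in> W \<delta> T" "z \<in> W \<delta> T"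
  shows "bil T z (u - v) = bil T z u - bil T z v" and "bil T (u - v) z = bil T u z - bil T v z"
  using bil_lincomb[OF assms, of 1 "-1"] bil_commute by auto

lemma bilK_nonneg: "0 \<le> bilK T l"
  by (simp add: bilK_def duhK_nonneg l2n_nonneg)

text \<open>This is what \<open>eps > 0\<close> is kept for: the factor
  \<open>l powr (- eps)\<close> tends to 0.\<close>

lemma bilK_small: "0 < e \<Longrightarrow> \<exists>l\<ge>1. bilK T l \<le> e"
proof -
  assume e: "0 < e"
  define C where "C = duhK T * 2 powr (sig / 2) * l2n (\<lambda>k::int. \<bar>of_int k\<bar> powr (1 - 2 * th0))"
  have C: "0 \<le> C" by (simp add: C_def duhK_nonneg l2n_nonneg)
  define l where "l = (C / e + 1) powr (1 / eps)"
  have 1: "1 \<le> l" unfolding l_def using C e eps by (intro ge_one_powr_ge_zero) auto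
  have "l powr (- eps) = 1 / (C / e + 1)"
    using eps C e by (simp add: l_def powr_powr powr_minus_divide add_nonneg_pos)
  then have "bilK T l = C / (C / e + 1)" by (simp add: bilK_def C_def mult_ac)
  also have "\<dots> \<le> e" using C e by (simp add: field_simps add_nonneg_pos)
  finally show ?thesis using 1 by blast
qed

lemma bilK_mono: "0 \<le> T \<Longrightarrow> T \<le> T' \<Longrightarrow> bilK T l \<le> bilK T' l"
  unfolding bilK_def by (intro mult_right_mono duhK_mono) (auto simp: l2n_nonneg)

text \<open>The discount rate is chosen according to the size \<open>R\<close> of \<open>y\<close>,
  without restriction on \<open>T\<close>. Returning to the undiscounted norm costs
  \<open>exp (lm * T)\<close>, which enters the constant.\<close>

lemma volterra_bil:
  assumes T: "0 \<le> T" and \<delta>: "0 \<le> \<delta>"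
  shows "\<exists>C\<ge>0. \<forall>y\<in>W \<delta> T. nW 0 \<delta> T y \<le> R \<longrightarrow> (\<forall>f\<in>W \<delta> T. \<exists>!v. v \<in> W \<delta> T \<and> v = f + bil T y v) \<and>
      (\<forall>v\<in>W \<delta> T. nW 0 \<delta> T v \<le> C * nW 0 \<delta> T (v - bil T y v))"
proof -
  obtain l where l: "1 \<le> l" "bilK T l \<le> 1 / (2 * (\<bar>R\<bar> + 1))"
    using bilK_small[of "1 / (2 * (\<bar>R\<bar> + 1))" T] by (metis abs_ge_zero add_nonneg_pos zero_less_divide_1_iff zero_less_mult_iff zero_less_numeral zero_less_one)
  define lm where "lm = l + 3 * \<eta> / 4"
  have lm: "3 * \<eta> / 4 + 1 \<le> lm" "0 \<le> lm" "lm - 3 * \<eta> / 4 = l" using l eta by (auto simp: lm_def)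
  interpret complete_subspace "W \<delta> T" "nW lm \<delta> T" by (rule W_complete[OF T lm(2)])
  have main: "(f \<in> W \<delta> T \<longrightarrow> (\<exists>!v. v \<in> W \<delta> T \<and> v = f + bil T y v)) \<and>
      (v \<in> W \<delta> T \<longrightarrow> nW lm \<delta> T v \<le> 2 * nW lm \<delta> T (v - bil T y v))" if y: "y \<in> W \<delta> T" "nW 0 \<delta> T y \<le> R" for f y v
  proof -
    have b: "nW lm \<delta> T (bil T y x) \<le> 1/2 * nW lm \<delta> T x" if x: "x \<in> W \<delta> T" for x
    proof -
      have "nW lm \<delta> T (bil T y x) \<le> bilK T l * nW 0 \<delta> T y * nW lm \<delta> T x"
        using bil_bound(2)[OF T \<delta> lm(1) y(1) x] lm by simp
      also have "\<dots> \<le> (1 / (2 * (\<bar>R\<bar> + 1))) * (\<bar>R\<bar> + 1) * nW lm \<delta> T x"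
        using y l by (intro mult_right_mono mult_mono) (auto simp: nW_def l2n_nonneg)
      also have "(1 / (2 * (\<bar>R\<bar> + 1))) * (\<bar>R\<bar> + 1) = 1/2"
      proof -
        have "\<bar>R\<bar> + 1 \<noteq> 0" by linarith
        then show ?thesis by (simp add: field_simps)
      qed
      finally show ?thesis .
    qed
    show ?thesis
      using linear_equation_solvable(1)[of "bil T y" f] linear_equation_solvable(2)[of "bil T y" v] bil_bound(1)[OF T \<delta> lm(1) y(1)] bil_diff(1)[OF T \<delta> _ _ y(1)] b by blast
  qed
  show ?thesis
  proof (intro exI[of _ "exp (lm * T) * 2"] conjI ballI impI)
    fix y v assume y: "y \<in> W \<delta> T" "nW 0 \<delta> T y \<le> R" and v: "v \<in> W \<delta> T"
    have d: "v - bil T y v \<in> W \<delta> T" using diff_mem v bil_bound(1)[OF T \<delta> lm(1) y(1) v] by blast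
    have "nW 0 \<delta> T v \<le> exp (lm * T) * nW lm \<delta> T v" by (rule nW_lm_le(2)[OF T lm(2) v])
    also have "\<dots> \<le> exp (lm * T) * (2 * nW lm \<delta> T (v - bil T y v))" using main[OF y] v by (intro mult_left_mono) auto
    also have "\<dots> \<le> exp (lm * T) * (2 * nW 0 \<delta> T (v - bil T y v))"
      by (intro mult_left_mono nW_lm_le(1)[OF T lm(2) d]) auto
    finally show "nW 0 \<delta> T v \<le> exp (lm * T) * 2 * nW 0 \<delta> T (v - bil T y v)" by simp
  qed (use main in auto)
qed

lemma bil_bound_0:
  assumes "0 \<le> T" "0 \<le> \<delta>"
  shows "\<exists>K\<ge>0. \<forall>u\<in>W \<delta> T. \<forall>v\<in>W \<delta> T. nW 0 \<delta> T (bil T u v) \<le> K * nW 0 \<delta> T u * nW 0 \<delta> T v"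
proof -
  define lm where "lm = 1 + 3 * \<eta> / 4"
  have lm: "3 * \<eta> / 4 + 1 \<le> lm" "0 \<le> lm" "lm - 3 * \<eta> / 4 = 1" using eta by (auto simp: lm_def)
  show ?thesis
  proof (intro exI[of _ "exp (lm * T) * bilK T 1"] conjI ballI)
    fix u v assume u: "u \<in> W \<delta> T" and v: "v \<in> W \<delta> T"
    note b = bil_bound[OF assms lm(1) u v]
    have "nW 0 \<delta> T (bil T u v) \<le> exp (lm * T) * nW lm \<delta> T (bil T u v)" by (rule nW_lm_le(2)[OF assms(1) lm(2) b(1)])
    also have "\<dots> \<le> exp (lm * T) * (bilK T 1 * nW 0 \<delta> T u * nW lm \<delta> T v)"
      using b(2) lm by (intro mult_left_mono) auto
    also have "\<dots> \<le> exp (lm * T) * (bilK T 1 * nW 0 \<delta> T u * nW 0 \<delta> T v)"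
      by (intro mult_left_mono nW_lm_le(1)[OF assms(1) lm(2) v] mult_nonneg_nonneg) (auto simp: bilK_nonneg nW_def l2n_nonneg)
    finally show "nW 0 \<delta> T (bil T u v) \<le> exp (lm * T) * bilK T 1 * nW 0 \<delta> T u * nW 0 \<delta> T v" by (simp add: mult_ac)
  qed (simp add: bilK_nonneg)
qed

section \<open>Local solutions\<close>

definition Hc :: "(int \<Rightarrow> complex) set" where
  "Hc = {c. (\<forall>k. c (- k) = cnj (c k)) \<and> l2 (\<lambda>k. jb k powr (s / 2) * cmod (c k))}"

definition hn :: "(int \<Rightarrow> complex) \<Rightarrow> real" where
  "hn c = l2n (\<lambda>k. jb k powr (s / 2) * cmod (c k))"

definition lin :: "real \<Rightarrow> (int \<Rightarrow> complex) \<Rightarrow> real \<Rightarrow> int \<Rightarrow> complex" where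
  "lin T c t k = (if t \<in> {0..T} then mlt t k * c k else 0)"

definition linK :: "real \<Rightarrow> real" where
  "linK T = exp (3 * \<eta> * T / 4) * (1 + (4 / \<eta>) powr gam * exp (\<eta> * T / 4))"

lemma linK_pos: "0 < linK T" by (simp add: linK_def add_pos_nonneg)

lemma linK_mono: "T \<le> T' \<Longrightarrow> linK T \<le> linK T'"
  unfolding linK_def using eta by (intro mult_mono add_left_mono mult_left_mono) auto

text \<open>The growing factor is absorbed by the remaining Gaussian: for
  \<open>y = \<eta> * t * jb k / 4\<close> one has \<open>y powr gam * exp (- y) \<le> 1\<close>.
  Since \<open>jb k\<close> is \<open>1 + k\<^sup>2\<close>, the Gaussian in \<open>jb\<close>
  differs from the available one by \<open>exp (\<eta> * t / 4)\<close>.\<close>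

lemma wgt_mlt_bound:
  assumes "0 \<le> \<delta>" "0 \<le> t" "t \<le> T"
  shows "wgt 0 \<delta> t k * cmod (mlt t k) \<le> linK T * jb k powr (s / 2)"
proof -
  let ?J = "jb k powr (s / 2)"
  let ?E = "exp ((3 * \<eta> / 4 - \<eta> * (of_int k)\<^sup>2 / 4) * t)"
  have "exp (nu * min t \<delta> * \<bar>of_int k\<bar>) * norm (mlt t k) \<le> ?E * 1"
    using weight_damping[of 0 t \<delta> k] assms by simp
  then have "?J * (1 + t powr gam * jb k powr gam) * (exp (nu * min t \<delta> * \<bar>of_int k\<bar>) * norm (mlt t k)) \<le>
      ?J * (1 + t powr gam * jb k powr gam) * (?E * 1)"
    by (rule mult_left_mono) simp
  then have "wgt 0 \<delta> t k * cmod (mlt t k) \<le> ?J * (1 + t powr gam * jb k powr gam) * ?E"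
    by (simp add: wgt_def mult.assoc)
  also have "?E = exp (3 * \<eta> * t / 4) * exp (- (\<eta> * t * (of_int k)\<^sup>2 / 4))"
    by (simp flip: exp_add) (simp add: field_simps)
  also have "?J * (1 + t powr gam * jb k powr gam) * (exp (3 * \<eta> * t / 4) * exp (- (\<eta> * t * (of_int k)\<^sup>2 / 4))) =
     ?J * exp (3 * \<eta> * t / 4) * (exp (- (\<eta> * t * (of_int k)\<^sup>2 / 4)) + t powr gam * jb k powr gam * exp (- (\<eta> * t * (of_int k)\<^sup>2 / 4)))"
    by (simp add: algebra_simps)
  also have "\<dots> \<le> ?J * exp (3 * \<eta> * T / 4) * (1 + (4 / \<eta>) powr gam * exp (\<eta> * T / 4))"
  proof (rule mult_mono[OF _ add_mono])
    show "?J * exp (3 * \<eta> * t / 4) \<le> ?J * exp (3 * \<eta> * T / 4)"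
      using assms eta by (intro mult_left_mono) auto
    show "exp (- (\<eta> * t * (of_int k)\<^sup>2 / 4)) \<le> 1" using eta assms by simp
    show "t powr gam * jb k powr gam * exp (- (\<eta> * t * (of_int k)\<^sup>2 / 4)) \<le> (4 / \<eta>) powr gam * exp (\<eta> * T / 4)"
    proof (cases "t = 0")
      case False
      let ?y = "\<eta> / 4 * (t * jb k)"
      have y: "0 < ?y" using False assms eta jb_pos[of k] by (simp add: zero_less_mult_iff)
      have "t powr gam * jb k powr gam = (4 / \<eta> * ?y) powr gam"
        using eta by (simp add: powr_mult)
      also have "\<dots> = (4 / \<eta>) powr gam * ?y powr gam" by (rule powr_mult)
      finally have "t powr gam * jb k powr gam * exp (- ?y) = (4 / \<eta>) powr gam * (?y powr gam * exp (- ?y))" by simp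
      also have "\<dots> \<le> (4 / \<eta>) powr gam * (?y powr gam * ?y powr (- gam))"
        using exp_minus_le_powr[OF y, of gam] gam by (intro mult_left_mono) auto
      also have "?y powr gam * ?y powr (- gam) = 1"
        using y by (metis add.right_inverse less_irrefl powr_add powr_zero_eq_one)
      finally have 1: "t powr gam * jb k powr gam * exp (- ?y) \<le> (4 / \<eta>) powr gam" by simp
      have 2: "exp (- (\<eta> * t * (of_int k)\<^sup>2 / 4)) = exp (- ?y) * exp (\<eta> * t / 4)"
        by (simp flip: exp_add) (simp add: field_simps)
      have "t powr gam * jb k powr gam * exp (- ?y) * exp (\<eta> * t / 4) \<le> (4 / \<eta>) powr gam * exp (\<eta> * T / 4)"
        using 1 assms eta by (intro mult_mono) auto
      then show ?thesis unfolding 2 by (simp add: mult.assoc)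
    qed simp
  qed (use assms eta in auto)
  finally show ?thesis by (simp add: linK_def mult_ac)
qed

lemma lin_W:
  assumes T: "0 \<le> T" and \<delta>: "0 \<le> \<delta>" and c: "c \<in> Hc"
  shows "lin T c \<in> W \<delta> T" and "nW 0 \<delta> T (lin T c) \<le> linK T * hn c"
proof -
  have b: "wgt 0 \<delta> t k * cmod (lin T c t k) \<le> linK T * (jb k powr (s / 2) * cmod (c k))" if "t \<in> {0..T}" for t k
    using mult_right_mono[OF wgt_mlt_bound[OF \<delta>, of t T k], of "cmod (c k)"] that
    by (simp add: lin_def norm_mult mult_ac)
  have l2: "l2 (\<lambda>k. linK T * (jb k powr (s / 2) * cmod (c k)))" using c by (intro l2_scale) (simp add: Hc_def)
  show "lin T c \<in> W \<delta> T"
  proof (rule W_I[OF _ _ _ l2 b order_refl])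
    show "t \<notin> {0..T} \<Longrightarrow> lin T c t = 0" for t by (auto simp: lin_def fun_eq_iff)
    have "continuous_on {0..T} (\<lambda>t. mlt t k * c k)" for k by (intro continuous_intros)
    then show "continuous_on {0..T} (\<lambda>t. lin T c t k)" for k by (rule continuous_on_eq) (simp add: lin_def)
    show "lin T c t (- k) = cnj (lin T c t k)" if "t \<in> {0..T}" for t k
      using c that by (simp add: lin_def mlt_uminus Hc_def)
  qed
  show "nW 0 \<delta> T (lin T c) \<le> linK T * hn c"
    using nW_le(1)[OF T order_refl l2 b] linK_pos[of T] by (simp add: l2n_scale hn_def)
qed

text \<open>Smallness comes from a large discount rate. Restricting to \<open>T \<le> 1 / lm\<close>
  bounds the price \<open>exp (lm * T)\<close> of removing the discount by \<open>exp 1\<close>. The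
  time so obtained depends only on \<open>R\<close>, not on the datum or on
  \<open>\<delta>\<close>.\<close>

theorem local_solution:
  "\<exists>T0>0. \<forall>T. 0 < T \<and> T \<le> T0 \<longrightarrow> (\<forall>\<delta>\<ge>0. \<forall>c\<in>Hc. hn c \<le> R \<longrightarrow>
    (\<exists>u\<in>W \<delta> T. nW 0 \<delta> T u \<le> 2 * (linK 1 * \<bar>R\<bar>) \<and> u = lin T c + bil T u u))"
proof -
  define Q where "Q = linK 1 * \<bar>R\<bar>"
  have Q: "0 \<le> Q" using linK_pos[of 1] by (simp add: Q_def)
  \<comment> \<open>The 8 is the one of \<open>quadratic_equation_solvable\<close>, and
    \<open>exp 1\<close> is the cost of undoing the discount.\<close>
  obtain l where l: "1 \<le> l" "bilK 1 l \<le> 1 / (8 * exp 1 * (Q + 1))"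
    using bilK_small[of "1 / (8 * exp 1 * (Q + 1))" 1] Q by (auto simp: zero_less_mult_iff)
  define lm where "lm = l + 3 * \<eta> / 4"
  have lm: "3 * \<eta> / 4 + 1 \<le> lm" "1 \<le> lm" "0 \<le> lm" "lm - 3 * \<eta> / 4 = l" using l eta by (auto simp: lm_def)
  show ?thesis
  proof (intro exI[of _ "1 / lm"] conjI allI ballI impI)
    show "0 < 1 / lm" using lm by simp
    fix T \<delta> :: real and c assume T: "0 < T \<and> T \<le> 1 / lm" and \<delta>: "0 \<le> \<delta>" and c: "c \<in> Hc" and R: "hn c \<le> R"
    have "1 / lm \<le> 1" using lm by simp
    then have "T \<le> 1" using T by linarith
    then have T1: "T \<le> 1" "0 \<le> T" "lm * T \<le> 1" using T lm by (auto simp: field_simps)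
    interpret complete_subspace "W \<delta> T" "nW 0 \<delta> T" by (rule W_complete[OF T1(2) order_refl])
    have fQ: "nW 0 \<delta> T (lin T c) \<le> Q"
    proof -
      have "linK T * hn c \<le> linK 1 * \<bar>R\<bar>"
        using R linK_mono[OF T1(1)] linK_pos[of T] by (intro mult_mono) (auto simp: hn_def l2n_nonneg)
      then show ?thesis using lin_W(2)[OF T1(2) \<delta> c] by (simp add: Q_def)
    qed
    show "\<exists>u\<in>W \<delta> T. nW 0 \<delta> T u \<le> 2 * (linK 1 * \<bar>R\<bar>) \<and> u = lin T c + bil T u u"
      unfolding Q_def[symmetric]
    proof (rule quadratic_equation_solvable[where K = "exp 1 * bilK 1 l" and B = "bil T" and f = "lin T c" and R = Q])
      fix u v assume u: "u \<in> W \<delta> T" and v: "v \<in> W \<delta> T"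
      note b = bil_bound[OF T1(2) \<delta> lm(1) u v]
      show "bil T u v \<in> W \<delta> T" by (rule b(1))
      have "nW 0 \<delta> T (bil T u v) \<le> exp (lm * T) * nW lm \<delta> T (bil T u v)" by (rule nW_lm_le(2)[OF T1(2) lm(3) b(1)])
      also have "\<dots> \<le> exp 1 * (bilK T l * nW 0 \<delta> T u * nW lm \<delta> T v)"
        using b(2) lm T1 by (intro mult_mono) (auto simp: nW_def l2n_nonneg)
      also have "\<dots> \<le> exp 1 * (bilK 1 l * nW 0 \<delta> T u * nW 0 \<delta> T v)"
        by (intro mult_left_mono mult_mono nW_lm_le(1)[OF T1(2) lm(3) v] mult_nonneg_nonneg bilK_mono T1)
          (auto simp: bilK_nonneg nW_def l2n_nonneg)
      finally show "nW 0 \<delta> T (bil T u v) \<le> exp 1 * bilK 1 l * nW 0 \<delta> T u * nW 0 \<delta> T v" by (simp add: mult_ac)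
    next
      have "8 * (exp 1 * bilK 1 l) * Q \<le> 8 * exp 1 * (1 / (8 * exp 1 * (Q + 1))) * Q"
        unfolding mult.assoc by (intro mult_left_mono mult_right_mono Q l[unfolded mult.assoc]) auto
      also have "\<dots> = Q / (Q + 1)" by simp
      also have "\<dots> \<le> 1" using Q by (simp add: divide_le_eq)
      finally show "8 * (exp 1 * bilK 1 l) * Q \<le> 1" .
    qed (use bil_diff[OF T1(2) \<delta>] lin_W(1)[OF T1(2) \<delta> c] fQ bilK_nonneg in auto)
  qed
qed

text \<open>The difference of two solutions solves the homogeneous linear equation with coefficient
  \<open>u + v\<close>, and the Volterra bound leaves only 0.\<close>

theorem unique_in_W:
  assumes "0 \<le> T" "0 \<le> \<delta>" "u \<in> W \<delta> T" "v \<in> W \<delta> T" "u = lin T c + bil T u u" "v = lin T c + bil T v v"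
  shows "u = v"
proof -
  interpret complete_subspace "W \<delta> T" "nW 0 \<delta> T" by (rule W_complete[OF assms(1) order_refl])
  obtain C where C: "\<And>y w. y \<in> W \<delta> T \<Longrightarrow> nW 0 \<delta> T y \<le> nW 0 \<delta> T (u + v) \<Longrightarrow> w \<in> W \<delta> T \<Longrightarrow>
      nW 0 \<delta> T w \<le> C * nW 0 \<delta> T (w - bil T y w)"
    using volterra_bil[OF assms(1,2), of "nW 0 \<delta> T (u + v)"] by blast
  have m: "u + v \<in> W \<delta> T" "u - v \<in> W \<delta> T" using add_mem diff_mem assms by auto
  have "bil T (u + v) (u - v) = bil T u u - bil T v v"
  proof -
    have "bil T (u + v) (u - v) = bil T (u + v) u - bil T (u + v) v" by (rule bil_diff(1)[OF assms(1-4) m(1)])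
    also have "bil T (u + v) u = bil T u u + bil T u v"
      using bil_lincomb[OF assms(1-4) assms(3), of 1 1] bil_commute[of T "u + v" u] by simp
    also have "bil T (u + v) v = bil T u v + bil T v v"
      using bil_lincomb[OF assms(1-4) assms(4), of 1 1] bil_commute[of T "u + v" v] bil_commute[of T v u] by simp
    also have "(bil T u u + bil T u v) - (bil T u v + bil T v v) = bil T u u - bil T v v" by (intro ext) simp
    finally show ?thesis .
  qed
  moreover have "u - v = (lin T c + bil T u u) - (lin T c + bil T v v)" using assms(5,6) by metis
  ultimately have "u - v - bil T (u + v) (u - v) = ((lin T c + bil T u u) - (lin T c + bil T v v)) - (bil T u u - bil T v v)"
    by (rule arg_cong2[of _ _ _ _ minus, rotated])
  also have "\<dots> = 0" by (intro ext) simp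
  finally have "u - v - bil T (u + v) (u - v) = 0" .
  then have "nW 0 \<delta> T (u - v) \<le> C * 0" using C[OF m(1) order_refl m(2)] norm_zero by simp
  then have "nW 0 \<delta> T (u - v) = 0" using norm_nonneg[OF m(2)] by simp
  then show ?thesis using norm_eq_zero[OF m(2)] by simp
qed

end

section \<open>Cancellation in the energy balance\<close>

text \<open>Over triples of frequencies with sum zero, \<open>a j * a l * a m\<close> is symmetric, so that the sums weighted
  with \<open>j\<close>, \<open>l\<close> and \<open>m\<close> coincide; their sum vanishes.\<close>

lemma conv_self_cancel:
  fixes a :: "int \<Rightarrow> complex"
  assumes b: "0 < b" and a: "\<And>k. cmod (a k) \<le> C * exp (- b * \<bar>of_int k\<bar>)"
  shows "(\<Sum>\<^sub>\<infinity>k. of_int k * a (- k) * conv a a k) = 0"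
proof -
  have C: "0 \<le> C" using order_trans[OF norm_ge_zero a[of 0]] by simp
  let ?e = "\<lambda>k::int. exp (- b * \<bar>of_int k\<bar>)"
  define G where "G = (\<lambda>(j, l). of_int j * (a j * a l * a (- j - l)))"
  have e1: "?e summable_on UNIV" using summable_exp_abs[OF b, of 0] by (simp add: less_imp_neq[OF jb_pos, symmetric])
  have je: "\<bar>of_int j\<bar> * ?e j \<le> jb j powr 1 * ?e j" for j :: int
  proof -
    have "\<bar>of_int j\<bar> \<le> jb j powr 1"
      using sum_squares_bound[of "\<bar>of_int j\<bar>" "1::real"] jb_pos[of j] by (simp add: power2_eq_square)
    then show ?thesis by (intro mult_right_mono) auto
  qed
  have e2: "(\<lambda>j::int. C * C * C * (\<bar>of_int j\<bar> * ?e j)) summable_on UNIV"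
    by (intro summable_on_cmult_right summable_on_comparison_test[OF summable_exp_abs[OF b, of 1]] je) auto
  have "(\<lambda>(j, l). C * C * C * (\<bar>of_int j\<bar> * ?e j) * ?e l) summable_on (UNIV \<times> UNIV)"
  proof (rule summable_on_SigmaI)
    show "((\<lambda>l. case (j, l) of (j, l) \<Rightarrow> C * C * C * (\<bar>of_int j\<bar> * ?e j) * ?e l) has_sum
      C * C * C * (\<bar>of_int j\<bar> * ?e j) * (\<Sum>\<^sub>\<infinity>l. ?e l)) UNIV" for j :: int
      using has_sum_cmult_right[OF has_sum_infsum[OF e1]] by simp
    show "(\<lambda>j. C * C * C * (\<bar>of_int j\<bar> * ?e j) * (\<Sum>\<^sub>\<infinity>l. ?e l)) summable_on UNIV"
      by (rule summable_on_cmult_left[OF e2])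
  qed (use C in auto)
  then have dom: "(\<lambda>(j, l). C * C * C * (\<bar>of_int j\<bar> * ?e j) * ?e l) summable_on UNIV" by simp
  have "(\<lambda>x. norm (G x)) summable_on UNIV"
  proof (rule summable_on_comparison_test[OF dom])
    fix x :: "int \<times> int"
    obtain j l where x: "x = (j, l)" by (cases x)
    \<comment> \<open>The decay of the third factor is given away; that of \<open>a j\<close> and
      \<open>a l\<close> suffices for summing over both indices.\<close>
    have "cmod (a (- j - l)) \<le> C * ?e (- j - l)" by (rule a)
    also have "\<dots> \<le> C * 1" using b C by (intro mult_left_mono) auto
    finally have "cmod (a j * a l * a (- j - l)) \<le> (C * ?e j) * (C * ?e l) * (C * 1)"
      unfolding norm_mult by (intro mult_mono a) (use C in auto)
    then have "\<bar>of_int j\<bar> * cmod (a j * a l * a (- j - l)) \<le> \<bar>of_int j\<bar> * ((C * ?e j) * (C * ?e l) * (C * 1))"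
      by (rule mult_left_mono) simp
    then show "norm (G x) \<le> (case x of (j, l) \<Rightarrow> C * C * C * (\<bar>of_int j\<bar> * ?e j) * ?e l)"
      by (simp add: x G_def norm_mult mult_ac)
  qed simp
  then have Gs: "G summable_on UNIV" by (rule abs_summable_summable)
  define F where "F = (\<lambda>(j, l). of_int (j + l) * (a j * a l * a (- j - l)))"
  have sw: "bij (\<lambda>(j, l). (l, j) :: int \<times> int)" by (rule bijI') auto
  have Gsw: "(\<lambda>x. G ((\<lambda>(j, l). (l, j)) x)) summable_on UNIV" "infsum (\<lambda>x. G ((\<lambda>(j, l). (l, j)) x)) UNIV = infsum G UNIV"
    using summable_on_reindex_bij_betw[OF sw, of G] Gs infsum_reindex_bij_betw[OF sw, of G] by auto
  have FG: "F x = G x + G ((\<lambda>(j, l). (l, j)) x)" for x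
  proof -
    obtain j l where x: "x = (j, l)" by (cases x)
    have e: "a (- l - j) = a (- j - l)" by (rule arg_cong[of _ _ a]) simp
    show ?thesis by (simp add: x F_def G_def distrib_right mult.commute[of "a l" "a j"] e)
  qed
  have Fs: "F summable_on UNIV" unfolding FG by (intro summable_on_add Gs Gsw)
  have F2: "infsum F UNIV = infsum G UNIV + infsum G UNIV"
    unfolding FG by (subst infsum_add[OF Gs Gsw(1)]) (simp add: Gsw(2))
  \<comment> \<open>This involution exchanges \<open>j\<close> with the third frequency
    \<open>- j - l\<close>. It turns \<open>F\<close> into \<open>- G\<close>, while the symmetry in
    \<open>j\<close> and \<open>l\<close> makes the sum of \<open>F\<close> twice the sum of
    \<open>G\<close>; hence both sums vanish.\<close>
  have ro: "bij (\<lambda>(j, l). (- j - l, l) :: int \<times> int)"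
    by (rule involuntory_imp_bij) auto
  have "infsum (\<lambda>x. F ((\<lambda>(j, l). (- j - l, l)) x)) UNIV = infsum F UNIV"
    by (rule infsum_reindex_bij_betw[OF ro])
  moreover have "F ((\<lambda>(j, l). (- j - l, l)) x) = - G x" for x
    by (cases x) (simp add: F_def G_def)
  ultimately have "infsum F UNIV = - infsum G UNIV" by (simp add: infsum_uminus)
  with F2 have F0: "infsum F UNIV = 0" by simp
  have kj: "bij (\<lambda>(k, j). (j, k - j) :: int \<times> int)"
    by (rule bij_betwI[of _ _ _ "\<lambda>(j, l). (j + l, j)"]) auto
  have Fk: "F ((\<lambda>(k, j). (j, k - j)) (k, j)) = of_int k * a (- k) * (a j * a (k - j))" for k j
    by (simp add: F_def)
  have s: "(\<lambda>x. F ((\<lambda>(k, j). (j, k - j)) x)) summable_on (UNIV \<times> UNIV)"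
    using summable_on_reindex_bij_betw[OF kj, of F] Fs by simp
  have "(\<Sum>\<^sub>\<infinity>k. of_int k * a (- k) * conv a a k) = (\<Sum>\<^sub>\<infinity>k. \<Sum>\<^sub>\<infinity>j. F ((\<lambda>(k, j). (j, k - j)) (k, j)))"
    unfolding Fk by (simp add: conv_def infsum_cmult_right')
  also have "\<dots> = infsum (\<lambda>x. F ((\<lambda>(k, j). (j, k - j)) x)) (UNIV \<times> UNIV)"
    by (rule infsum_Sigma_banach[OF s])
  also have "\<dots> = 0" using infsum_reindex_bij_betw[OF kj, of F] F0 by simp
  finally show ?thesis .
qed

section \<open>Mild solutions\<close>

context dissipative
begin

definition forcing :: "(real \<Rightarrow> int \<Rightarrow> complex) \<Rightarrow> int \<Rightarrow> real \<Rightarrow> complex" where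
  "forcing u k r = frc k * (mlt (- r) k * conv (u r) (u r) k)"

text \<open>With the linear evolution removed, the integrand does not involve the final time, so
  restriction, translation and gluing reduce to additivity of the integral. Integrability is
  required only frequency by frequency, so the notion also applies before membership in the weighted
  space is known.\<close>

definition mild :: "real \<Rightarrow> (int \<Rightarrow> complex) \<Rightarrow> (real \<Rightarrow> int \<Rightarrow> complex) \<Rightarrow> bool" where
  "mild T c u \<longleftrightarrow> (\<forall>k. \<forall>t\<in>{0..T}. (forcing u k has_integral (mlt (- t) k * u t k - c k)) {0..t})"

lemma mildD: "mild T c u \<Longrightarrow> 0 \<le> t \<Longrightarrow> t \<le> T \<Longrightarrow>
    (forcing u k has_integral (mlt (- t) k * u t k - c k)) {0..t}"
  by (simp add: mild_def)

lemma W_forcing_integrable':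
  assumes "0 \<le> T" "0 \<le> \<delta>" "u \<in> W \<delta> T" "0 \<le> t" "t \<le> T"
  shows "forcing u k integrable_on {0..t}"
  unfolding forcing_def using W_forcing_integrable(3)[OF assms(1,2,3,3-5)] by (rule integrable_on_mult_right)

lemma W_mild_iff:
  assumes "0 \<le> T" "0 \<le> \<delta>" "u \<in> W \<delta> T"
  shows "u = lin T c + bil T u u \<longleftrightarrow> mild T c u"
proof -
  have hi: "(forcing u k has_integral frc k * integral {0..t} (\<lambda>r. mlt (- r) k * conv (u r) (u r) k)) {0..t}"
    if "t \<in> {0..T}" for t k
    unfolding forcing_def using W_forcing_integrable(3)[OF assms(1,2,3,3), of t k] that
    by (intro has_integral_mult_right integrable_integral) auto
  have eq: "(lin T c + bil T u u) t k = mlt t k * (c k + frc k * integral {0..t} (\<lambda>r. mlt (- r) k * conv (u r) (u r) k))"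
    if "t \<in> {0..T}" for t k using that by (simp add: lin_def bil_def algebra_simps)
  have iff: "x = mlt t k * y \<longleftrightarrow> mlt (- t) k * x = y" for x y t k
  proof
    assume "x = mlt t k * y"
    then show "mlt (- t) k * x = y" using mlt_minus(1)[of t k] by (simp flip: mult.assoc)
  next
    assume "mlt (- t) k * x = y"
    then show "x = mlt t k * y" using mlt_minus(2)[of t k] by (metis mult.assoc mult_1)
  qed
  show ?thesis
  proof
    assume u: "u = lin T c + bil T u u"
    show "mild T c u"
      unfolding mild_def
    proof (intro allI ballI)
      fix k t assume t: "t \<in> {0..T}"
      have "u t k = mlt t k * (c k + frc k * integral {0..t} (\<lambda>r. mlt (- r) k * conv (u r) (u r) k))"
        using fun_cong[OF fun_cong[OF u, of t], of k] eq[OF t, of k] by simp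
      then have "mlt (- t) k * u t k = c k + frc k * integral {0..t} (\<lambda>r. mlt (- r) k * conv (u r) (u r) k)"
        by (simp only: iff)
      then show "(forcing u k has_integral (mlt (- t) k * u t k - c k)) {0..t}" using hi[OF t, of k] by simp
    qed
  next
    assume m: "mild T c u"
    show "u = lin T c + bil T u u"
    proof (intro ext)
      fix t k
      show "u t k = (lin T c + bil T u u) t k"
      proof (cases "t \<in> {0..T}")
        case True
        have "mlt (- t) k * u t k - c k = frc k * integral {0..t} (\<lambda>r. mlt (- r) k * conv (u r) (u r) k)"
          using m True by (intro has_integral_unique[OF _ hi[OF True]]) (auto simp: mild_def)
        then have "mlt (- t) k * u t k = c k + frc k * integral {0..t} (\<lambda>r. mlt (- r) k * conv (u r) (u r) k)"
          by (simp add: algebra_simps)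
        then show ?thesis unfolding eq[OF True] by (simp only: iff)
      next
        case False
        then show ?thesis using W_zero[OF assms(3) False] by (auto simp: lin_def bil_def)
      qed
    qed
  qed
qed

lemma mild_initial: "0 \<le> T \<Longrightarrow> mild T c u \<Longrightarrow> u 0 = c"
proof
  fix k assume "0 \<le> T" "mild T c u"
  then have "(forcing u k has_integral (mlt (- 0) k * u 0 k - c k)) {0..0}" by (intro mildD) auto
  then have "mlt (- 0) k * u 0 k - c k = 0"
    by (rule has_integral_unique) (use has_integral_refl(2)[of "forcing u k" 0] in simp)
  then show "u 0 k = c k" by simp
qed

lemma mild_cong:
  assumes "mild T c u" "T' \<le> T" "\<And>t. t \<in> {0..T'} \<Longrightarrow> u t = v t"
  shows "mild T' c v"
  unfolding mild_def
proof (intro allI ballI)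
  fix k t assume t: "t \<in> {0..T'}"
  have "(forcing u k has_integral (mlt (- t) k * u t k - c k)) {0..t}" using t assms(2) by (intro mildD[OF assms(1)]) auto
  then have "(forcing v k has_integral (mlt (- t) k * u t k - c k)) {0..t}"
    by (rule has_integral_eq[rotated]) (use assms t in \<open>auto simp: forcing_def\<close>)
  then show "(forcing v k has_integral (mlt (- t) k * v t k - c k)) {0..t}" using assms t by simp
qed

lemma mild_increment:
  assumes "mild T c u" "0 \<le> a" "a \<le> t" "t \<le> T"
  shows "(forcing u k has_integral (mlt (- t) k * u t k - mlt (- a) k * u a k)) {a..t}"
proof -
  have 1: "(forcing u k has_integral (mlt (- t) k * u t k - c k)) {0..t}"
    "(forcing u k has_integral (mlt (- a) k * u a k - c k)) {0..a}"
    using assms by (auto intro!: mildD)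
  have "forcing u k integrable_on {a..t}"
    by (rule integrable_subinterval_real[OF has_integral_integrable[OF 1(1)]]) (use assms in auto)
  then obtain J where J: "(forcing u k has_integral J) {a..t}" by blast
  have "mlt (- a) k * u a k - c k + J = mlt (- t) k * u t k - c k"
    by (rule has_integral_unique[OF has_integral_combine[OF assms(2,3) 1(2) J] 1(1)])
  then have "J = mlt (- t) k * u t k - mlt (- a) k * u a k" by (simp add: algebra_simps)
  with J show ?thesis by simp
qed

lemma forcing_shift: "forcing (\<lambda>r. u (a + r)) k r = mlt a k * forcing u k (a + r)"
proof -
  have "mlt (- r) k = mlt a k * mlt (- (a + r)) k" by (simp flip: mlt_add)
  then show ?thesis by (simp add: forcing_def mult_ac)
qed

lemma mild_translate:
  assumes "mild T c u" "0 \<le> a" "a \<le> T"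
  shows "mild (T - a) (u a) (\<lambda>r. u (a + r))"
  unfolding mild_def
proof (intro allI ballI)
  fix k t assume t: "t \<in> {0..T - a}"
  have "(forcing u k has_integral (mlt (- (a + t)) k * u (a + t) k - mlt (- a) k * u a k)) {a..a + t}"
    by (rule mild_increment[OF assms(1)]) (use assms t in auto)
  then have "((forcing u k \<circ> (+) a) has_integral (mlt (- (a + t)) k * u (a + t) k - mlt (- a) k * u a k)) {0..t}"
    using has_integral_shift_Icc_real[of "forcing u k" a _ 0 t] by (simp add: add.commute)
  then have "((\<lambda>r. mlt a k * (forcing u k \<circ> (+) a) r) has_integral (mlt a k * (mlt (- (a + t)) k * u (a + t) k - mlt (- a) k * u a k))) {0..t}"
    by (rule has_integral_mult_right)
  moreover have "mlt a k * (mlt (- (a + t)) k * u (a + t) k - mlt (- a) k * u a k) = mlt (- t) k * u (a + t) k - u a k"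
  proof -
    have "mlt a k * mlt (- (a + t)) k = mlt (- t) k" by (simp flip: mlt_add)
    then show ?thesis using mlt_minus(2)[of a k] by (simp add: right_diff_distrib flip: mult.assoc)
  qed
  ultimately show "(forcing (\<lambda>r. u (a + r)) k has_integral (mlt (- t) k * u (a + t) k - u a k)) {0..t}"
    by (simp add: forcing_shift[abs_def] o_def)
qed

lemma mild_glue:
  assumes u: "mild a c u" and v: "mild b (u a) v" and ab: "0 \<le> a" "0 \<le> b"
  shows "mild (a + b) c (\<lambda>t. if t \<le> a then u t else v (t - a))" (is "mild _ _ ?z")
proof -
  define z where "z = ?z"
  have "mild (a + b) c z"
  unfolding mild_def
proof (intro allI ballI)
  fix k t assume t: "t \<in> {0..a + b}"
  have za: "mild a c z" by (rule mild_cong[OF u]) (auto simp: z_def)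
  show "(forcing z k has_integral (mlt (- t) k * z t k - c k)) {0..t}"
  proof (cases "t \<le> a")
    case True
    then show ?thesis using t by (intro mildD[OF za]) auto
  next
    case False
    have v0: "v 0 = u a" using mild_initial[OF ab(2) v] .
    have zs: "z (a + r) = v r" if "0 \<le> r" for r using that v0 by (cases "r = 0") (auto simp: z_def)
    have "(forcing v k has_integral (mlt (- (t - a)) k * v (t - a) k - u a k)) {0..t - a}"
      by (rule mildD[OF v]) (use t False in auto)
    then have "(forcing (\<lambda>r. z (a + r)) k has_integral (mlt (- (t - a)) k * v (t - a) k - u a k)) {0..t - a}"
      by (rule has_integral_eq[rotated]) (simp add: forcing_def zs)
    then have "((\<lambda>r. mlt (- a) k * forcing (\<lambda>r. z (a + r)) k r) has_integral (mlt (- a) k * (mlt (- (t - a)) k * v (t - a) k - u a k))) {0..t - a}"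
      by (rule has_integral_mult_right)
    moreover have "mlt (- a) k * forcing (\<lambda>r. z (a + r)) k r = (forcing z k \<circ> (+) a) r" for r
      using forcing_shift[of z a k r] mlt_minus(1)[of a k] by (simp flip: mult.assoc)
    ultimately have "((forcing z k \<circ> (+) a) has_integral (mlt (- a) k * (mlt (- (t - a)) k * v (t - a) k - u a k))) {0..t - a}"
      by (simp add: o_def)
    then have 2: "(forcing z k has_integral (mlt (- a) k * (mlt (- (t - a)) k * v (t - a) k - u a k))) {a..t}"
      using has_integral_shift_Icc_real[of "forcing z k" a _ 0 "t - a"] by simp
    have 1: "(forcing z k has_integral (mlt (- a) k * u a k - c k)) {0..a}"
    proof -
      have "z a = u a" by (simp add: z_def)
      then show ?thesis using mildD[OF za, of a k] ab by simp
    qed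
    have "mlt (- a) k * mlt (- (t - a)) k = mlt (- t) k" by (simp flip: mlt_add)
    then have e: "mlt (- a) k * u a k - c k + mlt (- a) k * (mlt (- (t - a)) k * v (t - a) k - u a k) = mlt (- t) k * z t k - c k"
      using False by (simp add: z_def right_diff_distrib flip: mult.assoc)
    show ?thesis using has_integral_combine[OF ab(1) _ 1 2, unfolded e] False by simp
  qed
qed
  then show ?thesis by (simp add: z_def)
qed

section \<open>The energy inequality\<close>

lemma mlt_has_vector_derivative:
  "((\<lambda>t. mlt t k) has_vector_derivative
     ((\<i> * of_real (\<beta> * of_int k * \<bar>of_int k\<bar>) - of_real (\<eta> * ((of_int k)\<^sup>2 - \<bar>of_int k\<bar>))) * mlt t k)) (at t within A)"
proof -
  let ?z = "\<i> * of_real (\<beta> * of_int k * \<bar>of_int k\<bar>) - of_real (\<eta> * ((of_int k)\<^sup>2 - \<bar>of_int k\<bar>)) :: complex"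
  have "((\<lambda>t. exp (t *\<^sub>R ?z)) has_vector_derivative exp (t *\<^sub>R ?z) * ?z) (at t within A)"
    by (rule exp_scaleR_has_vector_derivative_right)
  moreover have "mlt t k = exp (t *\<^sub>R ?z)" for t
    by (simp add: mlt_def scaleR_conv_of_real algebra_simps)
  ultimately show ?thesis by (simp add: mult.commute)
qed

lemma W_decay:
  assumes "0 \<le> T" "u \<in> W \<delta> T" "0 < a" "0 < \<delta>"
  shows "\<exists>D\<ge>0. \<forall>r. a \<le> r \<and> r \<le> T \<longrightarrow> (\<forall>k. cmod (u r k) \<le> D * exp (- (nu * min a \<delta> / 2) * \<bar>of_int k\<bar>))"
proof -
  have nu: "0 < nu" using eta by (simp add: nu_def)
  let ?m = "min a \<delta>"
  have m: "0 < ?m" using assms by simp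
  \<comment> \<open>Half of the exponential decay is used up against the Sobolev weight.\<close>
  obtain C where C: "C > 0" "\<And>k. jb k powr (- s / 2) * exp (- (nu * ?m / 2) * \<bar>of_int k\<bar>) \<le> C"
    using jb_powr_exp_bound[of "nu * ?m / 2" "- s / 2"] nu m by auto
  have N: "0 \<le> nW 0 \<delta> T u" by (simp add: nW_def l2n_nonneg)
  show ?thesis
  proof (intro exI[of _ "nW 0 \<delta> T u * C"] conjI allI impI)
    show "0 \<le> nW 0 \<delta> T u * C" using N C by simp
    fix r k assume r: "a \<le> r \<and> r \<le> T"
    let ?K = "\<bar>of_int k\<bar> :: real"
    have "jb k powr (s / 2) * 1 * exp (nu * ?m * ?K) \<le> wgt 0 \<delta> r k"
    proof -
      have "nu * ?m * ?K \<le> nu * min r \<delta> * ?K" using r nu by (intro mult_right_mono mult_left_mono) auto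
      moreover have "jb k powr (s / 2) * 1 \<le> jb k powr (s / 2) * (1 + r powr gam * jb k powr gam)"
        by (intro mult_left_mono) auto
      ultimately have "(jb k powr (s / 2) * 1) * exp (nu * ?m * ?K) \<le>
        (jb k powr (s / 2) * (1 + r powr gam * jb k powr gam)) * exp (nu * min r \<delta> * ?K)"
        by (intro mult_mono[of "jb k powr (s / 2) * 1"]) auto
      then show ?thesis unfolding wgt_def by simp
    qed
    then have "(jb k powr (s / 2) * exp (nu * ?m * ?K)) * cmod (u r k) \<le> wgt 0 \<delta> r k * cmod (u r k)"
      by (intro mult_right_mono) auto
    also have "\<dots> \<le> nW 0 \<delta> T u"
      using Mx_ge[OF assms(1) order_refl assms(2), of r k] Mx_le_nW[OF assms(1) order_refl assms(2), of k] r assms by auto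
    finally have 1: "(jb k powr (s / 2) * exp (nu * ?m * ?K)) * cmod (u r k) \<le> nW 0 \<delta> T u" .
    have "cmod (u r k) = (jb k powr (- s / 2) * jb k powr (s / 2)) * (exp (- (nu * ?m) * ?K) * exp (nu * ?m * ?K)) * cmod (u r k)"
      using jb_pos[of k] by (simp flip: powr_add exp_add)
    also have "\<dots> = (jb k powr (- s / 2) * exp (- (nu * ?m) * ?K)) * ((jb k powr (s / 2) * exp (nu * ?m * ?K)) * cmod (u r k))"
      by (simp only: mult_ac)
    also have "\<dots> \<le> (jb k powr (- s / 2) * exp (- (nu * ?m) * ?K)) * nW 0 \<delta> T u"
      by (intro mult_left_mono 1) simp
    also have "exp (- (nu * ?m) * ?K) = exp (- (nu * ?m / 2) * ?K) * exp (- (nu * ?m / 2) * ?K)"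
      by (simp flip: exp_add)
    also have "(jb k powr (- s / 2) * (exp (- (nu * ?m / 2) * ?K) * exp (- (nu * ?m / 2) * ?K))) * nW 0 \<delta> T u \<le> nW 0 \<delta> T u * C * exp (- (nu * ?m / 2) * ?K)"
      using mult_right_mono[OF mult_left_mono[OF C(2)[of k] N], of "exp (- (nu * ?m / 2) * ?K)"] by (simp add: mult_ac)
    finally show "cmod (u r k) \<le> nW 0 \<delta> T u * C * exp (- (nu * ?m / 2) * ?K)" .
  qed
qed

text \<open>Inside the interval the forcing is continuous, so every coefficient is differentiable
  there. The endpoint 0 is excluded because the available forcing bound can be singular at
  it.\<close>

lemma mild_has_vector_derivative:
  assumes T: "0 \<le> T" "0 \<le> \<delta>" and u: "u \<in> W \<delta> T" and m: "mild T c u" and t: "0 < t" "t < T"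
  shows "((\<lambda>t. u t k) has_vector_derivative
     ((\<i> * of_real (\<beta> * of_int k * \<bar>of_int k\<bar>) - of_real (\<eta> * ((of_int k)\<^sup>2 - \<bar>of_int k\<bar>))) * u t k +
      frc k * conv (u t) (u t) k)) (at t)"
proof -
  let ?z = "\<i> * of_real (\<beta> * of_int k * \<bar>of_int k\<bar>) - of_real (\<eta> * ((of_int k)\<^sup>2 - \<bar>of_int k\<bar>)) :: complex"
  have ti: "t \<in> interior {0..T}" using t by simp
  have cf: "continuous_on {0<..<T} (forcing u k)"
  proof -
    have "continuous_on {0<..<T} (\<lambda>r. conv (u r) (u r) k)"
      by (rule continuous_on_subset[OF W_conv_continuous[OF T u u]]) auto
    then show ?thesis unfolding forcing_def by (intro continuous_intros)
  qed
  have "((\<lambda>x. integral {0..x} (forcing u k)) has_vector_derivative forcing u k t) (at t within {0..T} - {})"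
  proof (rule integral_has_vector_derivative_continuous_at)
    show "forcing u k integrable_on {0..T}" by (rule W_forcing_integrable'[OF T u T(1) order_refl])
    have "isCont (forcing u k) t" using cf t by (simp add: continuous_on_eq_continuous_at)
    then show "continuous (at t within {0..T} - {}) (forcing u k)" by (rule continuous_at_imp_continuous_at_within)
  qed (use t in auto)
  then have I: "((\<lambda>x. integral {0..x} (forcing u k)) has_vector_derivative forcing u k t) (at t within {0..T})" by simp
  have D: "((\<lambda>x. mlt x k * (c k + integral {0..x} (forcing u k))) has_vector_derivative
     mlt t k * (0 + forcing u k t) + (?z * mlt t k) * (c k + integral {0..t} (forcing u k))) (at t within {0..T})"
    by (intro has_vector_derivative_mult mlt_has_vector_derivative has_vector_derivative_add has_vector_derivative_const I)
  have ueq: "mlt x k * (c k + integral {0..x} (forcing u k)) = u x k" if "x \<in> {0..T}" for x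
  proof -
    have "integral {0..x} (forcing u k) = mlt (- x) k * u x k - c k"
      using that by (intro integral_unique mildD[OF m]) auto
    then show ?thesis using mlt_minus(2)[of x k] by (simp flip: mult.assoc)
  qed
  have d: "((\<lambda>x. u x k) has_vector_derivative
     mlt t k * (0 + forcing u k t) + (?z * mlt t k) * (c k + integral {0..t} (forcing u k))) (at t within {0..T})"
    by (rule has_vector_derivative_transform[OF _ _ D]) (use t ueq in auto)
  have e1: "mlt t k * (0 + forcing u k t) = frc k * conv (u t) (u t) k"
    using mlt_minus(2)[of t k] by (simp add: forcing_def flip: mult.assoc)
  have e2: "(?z * mlt t k) * (c k + integral {0..t} (forcing u k)) = ?z * u t k"
    using ueq[of t] t by (simp add: mult.assoc)
  show ?thesis using d unfolding e1 e2 at_within_interior[OF ti] by (simp only: add.commute)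
qed

text \<open>The energy is truncated to a finite set of frequencies, so that it can be
  differentiated. The linear part only dissipates, since
  \<open>\<bar>k\<bar> \<le> k\<^sup>2\<close>; the nonlinear part is controlled by a tail that
  vanishes as the set grows. The start \<open>a > 0\<close> guarantees exponential decay of the
  coefficients.\<close>

lemma energy_decreasing:
  assumes T: "0 \<le> T" and \<delta>: "0 < \<delta>" and u: "u \<in> W \<delta> T" and m: "mild T c u" and a: "0 < a" "a \<le> t" "t \<le> T"
  shows "l2n (\<lambda>k. cmod (u t k)) \<le> l2n (\<lambda>k. cmod (u a k))" and "l2 (\<lambda>k. cmod (u t k))"
proof -
  obtain D where D: "D \<ge> 0" "\<And>r k. a \<le> r \<Longrightarrow> r \<le> T \<Longrightarrow> cmod (u r k) \<le> D * exp (- (nu * min a \<delta> / 2) * \<bar>of_int k\<bar>)"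
    using W_decay[OF T u a(1) \<delta>] by blast
  define b where "b = nu * min a \<delta> / 2"
  have b: "0 < b" using a \<delta> eta by (simp add: b_def nu_def)
  have Db: "cmod (u r k) \<le> D * exp (- b * \<bar>of_int k\<bar>)" if "a \<le> r" "r \<le> T" for r k
    using D(2)[OF that] by (simp add: b_def)
  have l2e: "l2 (\<lambda>k::int. D * exp (- b * \<bar>of_int k\<bar>))"
    using l2_scale[OF l2_exp_abs[OF b, of 0], of D] by (simp add: less_imp_neq[OF jb_pos, symmetric])
  have l2u: "l2 (\<lambda>k. cmod (u r k))" if "a \<le> r" "r \<le> T" for r
    using l2_mono(1)[OF l2e, of "\<lambda>k. cmod (u r k)"] Db[OF that] by (force intro: order_trans)
  show "l2 (\<lambda>k. cmod (u t k))" using l2u a by simp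
  define Q where "Q = 2 powr (sig / 2) * nW 0 \<delta> T u * nW 0 \<delta> T u * a powr (- 2 * gam)"
  have Q: "0 \<le> Q" by (simp add: Q_def nW_def l2n_nonneg)
  have gQ: "cmod (conv (u r) (u r) k) \<le> Q" if "a \<le> r" "r \<le> T" for r k
  proof -
    have "cmod (conv (u r) (u r) k) \<le> (2 powr (sig / 2) * nW 0 \<delta> T u * nW 0 \<delta> T u) * r powr (- 2 * gam)"
      by (rule conv_forcing_bound[OF T _ u u]) (use that a \<delta> in auto)
    also have "\<dots> \<le> (2 powr (sig / 2) * nW 0 \<delta> T u * nW 0 \<delta> T u) * a powr (- 2 * gam)"
      using that a gam by (intro mult_left_mono powr_mono2') (auto simp: nW_def l2n_nonneg)
    finally show ?thesis by (simp add: Q_def)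
  qed
  define h where "h k = \<bar>of_int k\<bar> / 2 * Q * D * exp (- b * \<bar>of_int k\<bar>)" for k :: int
  have hs: "h summable_on UNIV"
  proof (rule summable_on_comparison_test)
    show "(\<lambda>k. (Q * D) * (jb k powr 1 * exp (- b * \<bar>of_int k\<bar>))) summable_on UNIV"
      by (intro summable_on_cmult_right summable_exp_abs b)
    fix k :: int
    have "\<bar>of_int k\<bar> / 2 \<le> jb k powr 1"
      using sum_squares_bound[of "\<bar>of_int k\<bar>" "1::real"] jb_pos[of k] by (simp add: power2_eq_square)
    then have "\<bar>of_int k\<bar> / 2 * (Q * D * exp (- b * \<bar>of_int k\<bar>)) \<le> jb k powr 1 * (Q * D * exp (- b * \<bar>of_int k\<bar>))"
      using Q D by (intro mult_right_mono) auto
    then show "h k \<le> (Q * D) * (jb k powr 1 * exp (- b * \<bar>of_int k\<bar>))" by (simp add: h_def mult_ac)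
    show "0 \<le> h k" using Q D by (simp add: h_def)
  qed
  have h0: "0 \<le> h k" for k using Q D by (simp add: h_def)
  let ?f = "\<lambda>r k. cnj (u r k) * (frc k * conv (u r) (u r) k)"
  have fh: "cmod (?f r k) \<le> h k" if "a \<le> r" "r \<le> T" for r k
  proof -
    have "cmod (?f r k) = \<bar>of_int k\<bar> / 2 * (cmod (u r k) * cmod (conv (u r) (u r) k))"
      by (simp add: norm_mult norm_frc)
    also have "\<dots> \<le> \<bar>of_int k\<bar> / 2 * ((D * exp (- b * \<bar>of_int k\<bar>)) * Q)"
      by (intro mult_left_mono mult_mono Db gQ that) (use D in auto)
    finally show ?thesis by (simp add: h_def mult_ac)
  qed
  have f0: "infsum (?f r) UNIV = 0" if "a \<le> r" "r \<le> T" for r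
  proof -
    have fe: "?f r k = - (\<i> / 2) * (of_int k * u r (- k) * conv (u r) (u r) k)" for k
      by (simp add: frc_def W_sym[OF u])
    have "infsum (?f r) UNIV = - (\<i> / 2) * (\<Sum>\<^sub>\<infinity>k. of_int k * u r (- k) * conv (u r) (u r) k)"
      unfolding fe by (rule infsum_cmult_right')
    then show ?thesis using conv_self_cancel[OF b Db[OF that]] by simp
  qed
  \<comment> \<open>The full nonlinear sum is 0 by cancellation, so the sum over \<open>F\<close> is
    minus the sum over its complement.\<close>
  have tail: "(\<Sum>k\<in>F. Re (?f r k)) \<le> infsum h (- F)" if F: "finite F" and r: "a \<le> r" "r \<le> T" for F r
  proof -
    have fs: "(\<lambda>k. norm (?f r k)) summable_on UNIV"
      using fh[OF r] by (intro summable_on_comparison_test[OF hs]) auto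
    then have fs': "?f r summable_on UNIV" by (rule abs_summable_summable)
    have "infsum (?f r) UNIV = infsum (?f r) F + infsum (?f r) (- F)"
      using infsum_Un_disjoint[of "?f r" F "- F"] fs' summable_on_subset_banach[OF fs'] F by simp
    then have "(\<Sum>k\<in>F. ?f r k) = - infsum (?f r) (- F)"
      using f0[OF r] F by (simp add: eq_neg_iff_add_eq_0)
    then have "(\<Sum>k\<in>F. Re (?f r k)) \<le> norm (infsum (?f r) (- F))"
      by (metis Re_sum abs_Re_le_cmod abs_le_D1 norm_minus_cancel)
    also have "\<dots> \<le> infsum (\<lambda>k. norm (?f r k)) (- F)"
      by (rule norm_infsum_bound) (rule summable_on_subset_banach[OF fs], simp)
    also have "\<dots> \<le> infsum h (- F)"
      by (intro infsum_mono summable_on_subset_banach[OF fs] summable_on_subset_banach[OF hs] fh r) auto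
    finally show ?thesis .
  qed
  define E where "E F r = (\<Sum>k\<in>F. (cmod (u r k))\<^sup>2)" for F r
  \<comment> \<open>The mean value theorem suffices, since the bound on the derivative does not
    depend on time.\<close>
  have EF: "E F t \<le> E F a + 2 * infsum h (- F) * (t - a)" if F: "finite F" for F
  proof (cases "a = t")
    case False
    then have at: "a < t" using a by simp
    have der: "((\<lambda>r. E F r) has_real_derivative (\<Sum>k\<in>F. 2 * (- (\<eta> * ((of_int k)\<^sup>2 - \<bar>of_int k\<bar>)) * (cmod (u r k))\<^sup>2 + Re (?f r k)))) (at r)"
      if r: "a < r" "r < t" for r
      unfolding E_def
    proof (rule DERIV_sum)
      fix k
      let ?z = "\<i> * of_real (\<beta> * of_int k * \<bar>of_int k\<bar>) - of_real (\<eta> * ((of_int k)\<^sup>2 - \<bar>of_int k\<bar>)) :: complex"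
      have d: "((\<lambda>t. u t k) has_vector_derivative (?z * u r k + frc k * conv (u r) (u r) k)) (at r)"
        by (rule mild_has_vector_derivative[OF T _ u m]) (use r a \<delta> in auto)
      have "((\<lambda>t. inner (u t k) (u t k)) has_vector_derivative
         inner (u r k) (?z * u r k + frc k * conv (u r) (u r) k) + inner (?z * u r k + frc k * conv (u r) (u r) k) (u r k)) (at r)"
        by (rule bounded_bilinear.has_vector_derivative[OF bounded_bilinear_inner d d])
      moreover have "inner (u r k) (?z * u r k + frc k * conv (u r) (u r) k) =
         - (\<eta> * ((of_int k)\<^sup>2 - \<bar>of_int k\<bar>)) * (cmod (u r k))\<^sup>2 + Re (?f r k)"
        unfolding inner_complex_def cmod_power2 by (simp add: power2_eq_square) (simp add: algebra_simps)
      ultimately show "((\<lambda>r. (cmod (u r k))\<^sup>2) has_real_derivative 2 * (- (\<eta> * ((of_int k)\<^sup>2 - \<bar>of_int k\<bar>)) * (cmod (u r k))\<^sup>2 + Re (?f r k))) (at r)"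
        unfolding has_real_derivative_iff_has_vector_derivative power2_norm_eq_inner
        by (simp add: inner_commute)
    qed
    have cont: "continuous_on {a..t} (E F)"
      unfolding E_def by (intro continuous_intros continuous_on_subset[OF W_cont[OF u]]) (use a in auto)
    obtain x where x: "a < x" "x < t" and xe: "E F t - E F a = (t - a) * (\<Sum>k\<in>F. 2 * (- (\<eta> * ((of_int k)\<^sup>2 - \<bar>of_int k\<bar>)) * (cmod (u x k))\<^sup>2 + Re (?f x k)))"
    proof -
      obtain l z where z: "a < z" "z < t" "(E F has_real_derivative l) (at z)" "E F t - E F a = (t - a) * l"
        using MVT[OF at cont] der real_differentiable_def by blast
      then show ?thesis using that[of z] DERIV_unique[OF der z(3)] by simp
    qed
    have "(\<Sum>k\<in>F. 2 * (- (\<eta> * ((of_int k)\<^sup>2 - \<bar>of_int k\<bar>)) * (cmod (u x k))\<^sup>2 + Re (?f x k))) \<le> (\<Sum>k\<in>F. 2 * Re (?f x k))"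
      using abs_le_square eta by (intro sum_mono) simp
    also have "\<dots> = 2 * (\<Sum>k\<in>F. Re (?f x k))" by (rule sum_distrib_left[symmetric])
    also have "\<dots> \<le> 2 * infsum h (- F)" by (intro mult_left_mono tail F) (use x a in auto)
    finally have "E F t - E F a \<le> (t - a) * (2 * infsum h (- F))" unfolding xe using at by (intro mult_left_mono) auto
    then show ?thesis by (simp add: algebra_simps)
  qed simp
  show "l2n (\<lambda>k. cmod (u t k)) \<le> l2n (\<lambda>k. cmod (u a k))"
  proof (rule l2_I(2))
    fix F0 :: "int set" assume F0: "finite F0"
    have "E F0 t \<le> (l2n (\<lambda>k. cmod (u a k)))\<^sup>2"
    proof (rule field_le_epsilon)
      fix e :: real assume e: "0 < e"
      have "(sum h \<longlongrightarrow> infsum h UNIV) (finite_subsets_at_top UNIV)"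
        using has_sum_infsum[OF hs] by (simp add: has_sum_def)
      \<comment> \<open>The tail is later multiplied by \<open>2 * (t - a)\<close>; the added 1
        covers \<open>t = a\<close>.\<close>
      then have "\<forall>\<^sub>F F in finite_subsets_at_top UNIV. infsum h UNIV - e / (2 * (t - a) + 1) < sum h F"
        using e a by (intro order_tendstoD(1)) auto
      then obtain F1 where F1: "finite F1" "\<And>F. finite F \<Longrightarrow> F1 \<subseteq> F \<Longrightarrow> infsum h UNIV - e / (2 * (t - a) + 1) < sum h F"
        unfolding eventually_finite_subsets_at_top by auto
      define F where "F = F0 \<union> F1"
      have F: "finite F" using F0 F1 by (simp add: F_def)
      have "infsum h UNIV = sum h F + infsum h (- F)"
        using infsum_Un_disjoint[of h F "- F"] hs summable_on_subset_banach[OF hs] F by simp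
      then have t1: "infsum h (- F) < e / (2 * (t - a) + 1)" using F1(2)[OF F] by (simp add: F_def)
      have t0: "0 \<le> infsum h (- F)" by (intro infsum_nonneg h0)
      have "E F0 t \<le> E F t" unfolding E_def by (intro sum_mono2 F) (auto simp: F_def)
      also have "\<dots> \<le> E F a + 2 * infsum h (- F) * (t - a)" by (rule EF[OF F])
      also have "E F a \<le> (l2n (\<lambda>k. cmod (u a k)))\<^sup>2"
        unfolding E_def l2n_power2 using l2u[of a] a F by (intro finite_sum_le_infsum) (auto simp: l2_def)
      also have "2 * infsum h (- F) * (t - a) \<le> infsum h (- F) * (2 * (t - a) + 1)" using t0 by (simp add: algebra_simps)
      also have "\<dots> \<le> e" using t1 a by (simp add: pos_less_divide_eq add_nonneg_pos less_imp_le)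
      finally show "E F0 t \<le> (l2n (\<lambda>k. cmod (u a k)))\<^sup>2 + e" by simp
    qed
    then show "L2_set (\<lambda>k. cmod (u t k)) F0 \<le> l2n (\<lambda>k. cmod (u a k))"
      unfolding L2_set_def E_def by (intro real_le_lsqrt) (auto simp: l2n_nonneg)
  qed
qed

end

section \<open>Continuity in time with values in Sobolev spaces\<close>

lemma l2_mono':
  assumes "l2 b" "\<And>k. 0 \<le> a k" "\<And>k. a k \<le> b k"
  shows "l2 a" and "l2n a \<le> l2n b"
  using l2_mono[OF assms(1), of a] assms(2,3) by (metis abs_of_nonneg abs_ge_self order_trans)+

definition coef_norm :: "real \<Rightarrow> (int \<Rightarrow> complex) \<Rightarrow> real" where
  "coef_norm r c = l2n (\<lambda>k. jb k powr (r / 2) * cmod (c k))"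

definition coef_finite :: "real \<Rightarrow> (int \<Rightarrow> complex) \<Rightarrow> bool" where
  "coef_finite r c \<longleftrightarrow> l2 (\<lambda>k. jb k powr (r / 2) * cmod (c k))"

definition coef_cont :: "real \<Rightarrow> real set \<Rightarrow> (real \<Rightarrow> int \<Rightarrow> complex) \<Rightarrow> bool" where
  "coef_cont r I u \<longleftrightarrow> (\<forall>t\<in>I. coef_finite r (u t)) \<and> (\<forall>t\<in>I. ((\<lambda>t'. coef_norm r (u t' - u t)) \<longlongrightarrow> 0) (at t within I))"

lemma coef_norm_nonneg: "0 \<le> coef_norm r c" by (simp add: coef_norm_def l2n_nonneg)

lemma coef_norm_add:
  assumes "coef_finite r a" "coef_finite r b"
  shows "coef_finite r (a + b)" and "coef_norm r (a + b) \<le> coef_norm r a + coef_norm r b"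
proof -
  let ?w = "\<lambda>k::int. jb k powr (r / 2)"
  have le: "\<bar>?w k * cmod ((a + b) k)\<bar> \<le> \<bar>?w k * cmod (a k) + ?w k * cmod (b k)\<bar>" for k
    using mult_left_mono[OF norm_triangle_ineq[of "a k" "b k"], of "?w k"] by (simp add: distrib_left)
  note l = l2_add[OF assms[unfolded coef_finite_def]]
  show "coef_finite r (a + b)" unfolding coef_finite_def by (rule l2_mono(1)[OF l(1) le])
  show "coef_norm r (a + b) \<le> coef_norm r a + coef_norm r b"
    unfolding coef_norm_def by (rule order_trans[OF l2_mono(2)[OF l(1) le] l(2)])
qed

lemma coef_norm_scale:
  shows "coef_finite r a \<Longrightarrow> coef_finite r (\<lambda>k. z * a k)" and "coef_norm r (\<lambda>k. z * a k) = cmod z * coef_norm r a"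
  using l2_scale[of "\<lambda>k. jb k powr (r / 2) * cmod (a k)" "cmod z"] l2n_scale[of "cmod z" "\<lambda>k. jb k powr (r / 2) * cmod (a k)"]
  by (simp_all add: coef_finite_def coef_norm_def norm_mult mult_ac)

lemma coef_norm_uminus: "coef_finite r (- a) = coef_finite r a" "coef_norm r (- a) = coef_norm r a"
  by (simp_all add: coef_finite_def coef_norm_def)

lemma coef_norm_diff_abs:
  assumes "coef_finite r a" "coef_finite r b"
  shows "coef_finite r (a - b)" and "\<bar>coef_norm r a - coef_norm r b\<bar> \<le> coef_norm r (a - b)"
proof -
  show d: "coef_finite r (a - b)" using coef_norm_add(1)[of r a "- b"] assms coef_norm_uminus by simp
  have d': "coef_finite r (b - a)" using coef_norm_add(1)[of r b "- a"] assms coef_norm_uminus by simp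
  have "b - a = - (a - b)" by simp
  then have e: "coef_norm r (b - a) = coef_norm r (a - b)" using coef_norm_uminus(2) by metis
  have "b + (a - b) = a" "a + (b - a) = b" by simp_all
  then show "\<bar>coef_norm r a - coef_norm r b\<bar> \<le> coef_norm r (a - b)"
    using coef_norm_add(2)[OF assms(2) d] coef_norm_add(2)[OF assms(1) d'] e by simp
qed

lemma coef_cont_continuous:
  assumes "coef_cont r I u"
  shows "continuous_on I (\<lambda>t. coef_norm r (u t))"
  unfolding continuous_on_def
proof
  fix t assume t: "t \<in> I"
  have ev: "\<forall>\<^sub>F t' in at t within I. t' \<in> I" by (simp add: eventually_at_topological) (use open_UNIV in blast)
  have "((\<lambda>t'. coef_norm r (u t') - coef_norm r (u t)) \<longlongrightarrow> 0) (at t within I)"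
  proof (rule Lim_null_comparison)
    show "\<forall>\<^sub>F t' in at t within I. norm (coef_norm r (u t') - coef_norm r (u t)) \<le> coef_norm r (u t' - u t)"
      using ev by eventually_elim (use assms t coef_norm_diff_abs(2) in \<open>auto simp: coef_cont_def\<close>)
    show "((\<lambda>t'. coef_norm r (u t' - u t)) \<longlongrightarrow> 0) (at t within I)" using assms t by (simp add: coef_cont_def)
  qed
  then show "((\<lambda>t'. coef_norm r (u t')) \<longlongrightarrow> coef_norm r (u t)) (at t within I)" by (simp add: LIM_zero_iff)
qed

text \<open>Dominated convergence in the frequency: the squared distance to \<open>u t\<close> is a
  series of continuous functions with the summable majorant
  \<open>(2 * c k)\<^sup>2\<close>.\<close>

lemma coef_cont_dominated:
  assumes cont: "\<And>k. continuous_on I (\<lambda>t. u t k)" and c: "l2 c"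
    and dom: "\<And>t k. t \<in> I \<Longrightarrow> jb k powr (r / 2) * cmod (u t k) \<le> c k"
  shows "coef_cont r I u"
  unfolding coef_cont_def
proof (intro conjI ballI)
  show "coef_finite r (u t)" if "t \<in> I" for t
    unfolding coef_finite_def by (rule l2_mono'(1)[OF c]) (use dom[OF that] in auto)
  fix t assume t: "t \<in> I"
  let ?f = "\<lambda>k t'. (jb k powr (r / 2) * cmod (u t' k - u t k))\<^sup>2"
  have "continuous_on I (\<lambda>t'. \<Sum>\<^sub>\<infinity>k. ?f k t')"
  proof (rule continuous_on_infsum)
    show "continuous_on I (?f k)" for k by (intro continuous_intros cont)
    show "(\<lambda>k. (2 * c k)\<^sup>2) summable_on UNIV" using l2_scale[OF c, of 2] by (simp add: l2_def)
    fix k t' assume t': "t' \<in> I"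
    have "jb k powr (r / 2) * cmod (u t' k - u t k) \<le> jb k powr (r / 2) * (cmod (u t' k) + cmod (u t k))"
      by (intro mult_left_mono norm_triangle_ineq4) simp
    also have "\<dots> \<le> 2 * c k" using dom[OF t, of k] dom[OF t', of k] by (simp add: distrib_left)
    finally have "?f k t' \<le> (2 * c k)\<^sup>2" by (rule power_mono) simp
    then show "norm (?f k t') \<le> (2 * c k)\<^sup>2" by (simp only: real_norm_def abs_of_nonneg zero_le_power2)
  qed
  then have "((\<lambda>t'. \<Sum>\<^sub>\<infinity>k. ?f k t') \<longlongrightarrow> (\<Sum>\<^sub>\<infinity>k. ?f k t)) (at t within I)"
    using t unfolding continuous_on_def by blast
  then have "((\<lambda>t'. sqrt (\<Sum>\<^sub>\<infinity>k. ?f k t')) \<longlongrightarrow> sqrt (\<Sum>\<^sub>\<infinity>k. ?f k t)) (at t within I)"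
    by (rule tendsto_real_sqrt)
  then show "((\<lambda>t'. coef_norm r (u t' - u t)) \<longlongrightarrow> 0) (at t within I)" by (simp add: coef_norm_def l2n_def)
qed

lemma coef_cont_local:
  assumes "\<And>t. t \<in> I \<Longrightarrow> \<exists>S. open S \<and> t \<in> S \<and> coef_cont r (I \<inter> S) u"
  shows "coef_cont r I u"
  unfolding coef_cont_def
proof (intro conjI ballI)
  fix t assume t: "t \<in> I"
  then obtain S where S: "open S" "t \<in> S" "coef_cont r (I \<inter> S) u" using assms by blast
  then show "coef_finite r (u t)" using t by (simp add: coef_cont_def)
  have "at t within I = at t within (I \<inter> S)"
    by (rule at_within_nhd[of t S]) (use S in auto)
  then show "((\<lambda>t'. coef_norm r (u t' - u t)) \<longlongrightarrow> 0) (at t within I)" using S t by (simp add: coef_cont_def)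
qed

lemma coef_cont_subset: "coef_cont r I u \<Longrightarrow> J \<subseteq> I \<Longrightarrow> coef_cont r J u"
  unfolding coef_cont_def by (meson subsetD tendsto_within_subset)

context dissipative
begin

lemma hn_coef_norm: "hn = coef_norm s" by (intro ext) (simp add: hn_def coef_norm_def)

lemma Hc_coef_finite: "c \<in> Hc \<longleftrightarrow> (\<forall>k. c (- k) = cnj (c k)) \<and> coef_finite s c"
  by (simp add: Hc_def coef_finite_def)

lemma W_coef_cont:
  assumes "0 \<le> T" "0 \<le> \<delta>" "u \<in> W \<delta> T"
  shows "coef_cont s {0..T} u" and "t \<in> {0..T} \<Longrightarrow> coef_norm s (u t) \<le> nW 0 \<delta> T u"
proof -
  have le: "jb k powr (s / 2) * cmod (u t k) \<le> Mx 0 \<delta> T u k" if "t \<in> {0..T}" for t k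
    by (rule order_trans[OF mult_right_mono[OF wgt_ge_Hs] Mx_ge[OF assms(1) order_refl assms(3) that]])
      (use that assms in auto)
  show "coef_cont s {0..T} u"
    by (rule coef_cont_dominated[OF W_cont[OF assms(3)] l2_Mx[OF assms(1) order_refl assms(3)] le])
  show "coef_norm s (u t) \<le> nW 0 \<delta> T u" if t: "t \<in> {0..T}"
    unfolding coef_norm_def nW_def
    by (rule l2_mono'(2)[OF l2_Mx[OF assms(1) order_refl assms(3)]]) (use le[OF t] in auto)
qed

lemma W_Hc: "0 \<le> T \<Longrightarrow> 0 \<le> \<delta> \<Longrightarrow> u \<in> W \<delta> T \<Longrightarrow> t \<in> {0..T} \<Longrightarrow> u t \<in> Hc"
  using W_coef_cont(1)[of T \<delta> u] W_sym[of u \<delta> T t] by (auto simp: Hc_coef_finite coef_cont_def)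

lemma W_sig:
  assumes "0 \<le> T" "0 \<le> \<delta>" "u \<in> W \<delta> T" "0 < t" "t \<le> T"
  shows "coef_finite sig (u t)" and "t powr gam * coef_norm sig (u t) \<le> nW 0 \<delta> T u"
proof -
  have le: "t powr gam * (jb k powr (sig / 2) * cmod (u t k)) \<le> Mx 0 \<delta> T u k" for k
  proof -
    have "t powr gam * jb k powr (sig / 2) * 1 \<le> t powr gam * jb k powr (sig / 2) * exp (nu * min t \<delta> * \<bar>of_int k\<bar>)"
      using assms eta by (intro mult_left_mono) (auto simp: nu_def)
    then have "t powr gam * jb k powr (sig / 2) \<le> wgt 0 \<delta> t k" using wgt_ge[of 0 t k \<delta>] by simp
    from mult_right_mono[OF this, of "cmod (u t k)"] Mx_ge[OF assms(1) order_refl assms(3), of t k] assms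
    show ?thesis by (simp add: mult.assoc)
  qed
  have 1: "l2 (\<lambda>k. t powr gam * (jb k powr (sig / 2) * cmod (u t k)))" "l2n (\<lambda>k. t powr gam * (jb k powr (sig / 2) * cmod (u t k))) \<le> nW 0 \<delta> T u"
    unfolding nW_def
    using l2_mono'[OF l2_Mx[OF assms(1) order_refl assms(3)], of "\<lambda>k. t powr gam * (jb k powr (sig / 2) * cmod (u t k))"] le
    by auto
  show "t powr gam * coef_norm sig (u t) \<le> nW 0 \<delta> T u"
    using 1(2) unfolding l2n_scale by (simp add: coef_norm_def)
  have inv: "t powr (- gam) * (t powr gam * x) = x" for x :: real
    using assms by (simp flip: mult.assoc powr_add)
  show "coef_finite sig (u t)" using l2_scale[OF 1(1), of "t powr (- gam)"] unfolding inv coef_finite_def .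
qed

text \<open>For times at least \<open>a\<close> the strip has width at least
  \<open>min a \<delta>\<close>, and the corresponding exponential dominates every Sobolev weight.
  The constant is uniform over the space, as the seminorms of the target require.\<close>

lemma W_cont_Hinf:
  assumes "0 \<le> T" "0 < \<delta>" "u \<in> W \<delta> T"
  shows "coef_cont r {0<..T} u" and "0 < a \<Longrightarrow> \<exists>C\<ge>0. \<forall>u\<in>W \<delta> T. \<forall>t. a \<le> t \<and> t \<le> T \<longrightarrow> coef_norm r (u t) \<le> C * nW 0 \<delta> T u"
proof -
  have C: "\<exists>C>0. \<forall>u\<in>W \<delta> T. \<forall>t k. a \<le> t \<and> t \<le> T \<longrightarrow> jb k powr (r / 2) * cmod (u t k) \<le> C * Mx 0 \<delta> T u k"
    if a: "0 < a" for a
  proof -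
    have nu: "0 < nu" using eta by (simp add: nu_def)
    let ?b = "nu * min a \<delta>"
    have b: "0 < ?b" using nu a assms by simp
    obtain C where C: "C > 0" "\<And>k. jb k powr ((r - s) / 2) * exp (- ?b * \<bar>of_int k\<bar>) \<le> C"
      using jb_powr_exp_bound[OF b, of "(r - s) / 2"] by blast
    show ?thesis
    proof (intro exI[of _ C] conjI ballI allI impI C)
      fix u t k assume u: "u \<in> W \<delta> T" and t: "a \<le> t \<and> t \<le> T"
      let ?K = "\<bar>of_int k\<bar> :: real"
      have "jb k powr (r / 2) = jb k powr ((r - s) / 2) * jb k powr (s / 2)"
        by (simp flip: powr_add) (simp add: field_simps)
      then have "jb k powr (r / 2) = (jb k powr ((r - s) / 2) * exp (- ?b * ?K)) * (jb k powr (s / 2) * exp (?b * ?K))"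
        by (simp add: exp_minus)
      also have "\<dots> \<le> C * wgt 0 \<delta> t k"
      proof (intro mult_mono C)
        have "?b * ?K \<le> nu * min t \<delta> * ?K" using t nu by (intro mult_right_mono mult_left_mono) auto
        moreover have "jb k powr (s / 2) * 1 \<le> jb k powr (s / 2) * (1 + t powr gam * jb k powr gam)"
          by (intro mult_left_mono) auto
        ultimately have "(jb k powr (s / 2) * 1) * exp (?b * ?K) \<le>
          (jb k powr (s / 2) * (1 + t powr gam * jb k powr gam)) * exp (nu * min t \<delta> * ?K)"
          by (intro mult_mono[of "jb k powr (s / 2) * 1"]) auto
        then show "jb k powr (s / 2) * exp (?b * ?K) \<le> wgt 0 \<delta> t k" unfolding wgt_def by simp
      qed (use C in auto)
      finally have "jb k powr (r / 2) * cmod (u t k) \<le> C * wgt 0 \<delta> t k * cmod (u t k)" by (rule mult_right_mono) simp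
      also have "\<dots> \<le> C * Mx 0 \<delta> T u k"
        unfolding mult.assoc using C Mx_ge[OF assms(1) order_refl u, of t k] t a by (intro mult_left_mono) auto
      finally show "jb k powr (r / 2) * cmod (u t k) \<le> C * Mx 0 \<delta> T u k" .
    qed
  qed
  show "coef_cont r {0<..T} u"
  proof (rule coef_cont_local)
    fix t assume t: "t \<in> {0<..T}"
    \<comment> \<open>The majorant degenerates at time 0, and continuity is a local matter; a
      neighbourhood bounded below by \<open>t / 2\<close> is enough.\<close>
    obtain C where C: "C > 0" "\<And>t' k. t / 2 \<le> t' \<Longrightarrow> t' \<le> T \<Longrightarrow> jb k powr (r / 2) * cmod (u t' k) \<le> C * Mx 0 \<delta> T u k"
      using C[of "t / 2"] t assms(3) by auto
    have "coef_cont r ({0<..T} \<inter> {t / 2<..}) u"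
      by (rule coef_cont_dominated[OF continuous_on_subset[OF W_cont[OF assms(3)]] l2_scale[OF l2_Mx[OF assms(1) order_refl assms(3)], of C]])
        (use C(2) in auto)
    then show "\<exists>S. open S \<and> t \<in> S \<and> coef_cont r ({0<..T} \<inter> S) u"
      using t by (intro exI[of _ "{t / 2<..}"]) auto
  qed
  assume "0 < a"
  from C[OF this] obtain C where C: "C > 0" "\<And>u t k. u \<in> W \<delta> T \<Longrightarrow> a \<le> t \<Longrightarrow> t \<le> T \<Longrightarrow> jb k powr (r / 2) * cmod (u t k) \<le> C * Mx 0 \<delta> T u k"
    by blast
  show "\<exists>C\<ge>0. \<forall>u\<in>W \<delta> T. \<forall>t. a \<le> t \<and> t \<le> T \<longrightarrow> coef_norm r (u t) \<le> C * nW 0 \<delta> T u"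
  proof (intro exI[of _ C] conjI ballI allI impI)
    fix u t assume u: "u \<in> W \<delta> T" and t: "a \<le> t \<and> t \<le> T"
    have "coef_norm r (u t) \<le> l2n (\<lambda>k. C * Mx 0 \<delta> T u k)"
      unfolding coef_norm_def
      by (rule l2_mono'(2)[OF l2_scale[OF l2_Mx[OF assms(1) order_refl u]]]) (use C(2)[OF u, of t] t in auto)
    then show "coef_norm r (u t) \<le> C * nW 0 \<delta> T u" using C by (simp add: l2n_scale nW_def)
  qed (use C in simp)
qed

section \<open>Weak solutions\<close>

lemma mild_continuous:
  assumes "0 \<le> T" "mild T c u"
  shows "continuous_on {0..T} (\<lambda>t. u t k)"
proof -
  have int: "forcing u k integrable_on {0..T}" using mildD[OF assms(2), of T k] assms(1) by blast
  have "continuous_on {0..T} (\<lambda>t. mlt t k * (c k + integral {0..t} (forcing u k)))"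
    by (intro continuous_intros indefinite_integral_continuous_1 int)
  then show ?thesis
  proof (rule continuous_on_eq)
    fix t assume t: "t \<in> {0..T}"
    have "integral {0..t} (forcing u k) = mlt (- t) k * u t k - c k"
      using t by (intro integral_unique mildD[OF assms(2)]) auto
    then show "mlt t k * (c k + integral {0..t} (forcing u k)) = u t k"
      using mlt_minus(2)[of t k] by (simp flip: mult.assoc)
  qed
qed

text \<open>Regularity from the equation itself: a bound at each time separately already controls
  the convolution, and the gain of the Duhamel integral then provides a square-summable majorant
  valid for all times at once. No analyticity is claimed, hence width 0.\<close>

lemma weak_mild_in_W:
  assumes T: "0 \<le> T" and M: "0 \<le> M" and zero: "\<And>t. t \<notin> {0..T} \<Longrightarrow> u t = 0"
    and sym: "\<And>t k. t \<in> {0..T} \<Longrightarrow> u t (- k) = cnj (u t k)"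
    and m: "mild T c u" and c: "c \<in> Hc"
    and b: "\<And>t. 0 < t \<Longrightarrow> t \<le> T \<Longrightarrow> coef_finite sig (u t) \<and> t powr gam * coef_norm sig (u t) \<le> M"
  shows "u \<in> W 0 T"
proof -
  define lm where "lm = 3 * \<eta> / 4 + 1"
  have lm: "0 \<le> lm" "3 * \<eta> / 4 + 1 \<le> lm" "lm - 3 * \<eta> / 4 = 1" using eta by (auto simp: lm_def)
  define G where "G = 2 powr (sig / 2) * (M * M)"
  have G: "0 \<le> G" using M by (simp add: G_def)
  have conv: "norm (conv (u r) (u r) k) \<le> G * (r powr (- 2 * gam) * jb k powr (- sig / 2) * exp (lm * r) * exp (- nu * min r 0 * \<bar>of_int k\<bar>))"
    if r: "0 < r" "r \<le> T" for r k
  proof -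
    let ?A = "\<lambda>j. r powr gam * (jb j powr (sig / 2) * cmod (u r j))"
    have l2: "l2 ?A" using b[OF r] by (intro l2_scale) (simp add: coef_finite_def)
    have nA: "l2n ?A \<le> M" using b[OF r] by (simp add: l2n_scale coef_norm_def)
    have e: "exp (- lm * r) \<le> 1" using lm r by simp
    have a1: "r powr gam * jb j powr (sig / 2) * exp (nu * 0 * \<bar>of_int j\<bar>) * cmod (u r j) \<le> ?A j" for j by simp
    have a2: "exp (- lm * r) * r powr gam * jb j powr (sig / 2) * exp (nu * 0 * \<bar>of_int j\<bar>) * cmod (u r j) \<le> ?A j" for j
      using mult_right_mono[OF e, of "?A j"] by (simp add: mult.assoc)
    have "norm (conv (u r) (u r) k) \<le> 2 powr (sig / 2) * (r powr (- 2 * gam) * jb k powr (- sig / 2) * exp (lm * r) * exp (- nu * 0 * \<bar>of_int k\<bar>)) * (l2n ?A * l2n ?A)"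
      by (rule conv_bound(3)[OF r(1) order_refl l2 l2 a1 a2])
    also have "\<dots> \<le> 2 powr (sig / 2) * (r powr (- 2 * gam) * jb k powr (- sig / 2) * exp (lm * r) * exp (- nu * 0 * \<bar>of_int k\<bar>)) * (M * M)"
      by (intro mult_left_mono mult_mono nA) (auto simp: l2n_nonneg M)
    finally show ?thesis using r by (simp add: G_def mult_ac)
  qed
  let ?c = "\<lambda>k. linK T * (jb k powr (s / 2) * cmod (c k)) + duhK T * G * \<bar>of_int k\<bar> powr (1 - 2 * th0)"
  have l2: "l2 ?c" using c by (intro l2_add(1) l2_scale l2_gain) (simp add: Hc_def)
  have bound: "wgt lm 0 t k * cmod (u t k) \<le> ?c k" if t: "t \<in> {0..T}" for t k
  proof -
    have F: "(forcing u k has_integral (mlt (- t) k * u t k - c k)) {0..t}" using t by (intro mildD[OF m]) auto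
    have lin: "wgt lm 0 t k * cmod (mlt t k * c k) \<le> linK T * (jb k powr (s / 2) * cmod (c k))"
    proof -
      have "wgt lm 0 t k * cmod (mlt t k * c k) \<le> wgt 0 0 t k * cmod (mlt t k * c k)"
        using wgt_lm_le(1)[of t T lm 0 k] t lm by (intro mult_right_mono) auto
      also have "\<dots> \<le> linK T * (jb k powr (s / 2) * cmod (c k))"
        using mult_right_mono[OF wgt_mlt_bound[of 0 t T k], of "cmod (c k)"] t by (simp add: norm_mult mult_ac)
      finally show ?thesis .
    qed
    show ?thesis
    \<comment> \<open>Frequency 0 is treated apart because recovering the convolution from the
      forcing divides by \<open>frc k\<close>.\<close>
    proof (cases "k = 0")
      case True
      have "forcing u k = (\<lambda>_. 0)" by (auto simp: forcing_def frc_def True)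
      then have "mlt (- t) k * u t k - c k = 0" using F has_integral_unique[OF F] by (metis has_integral_0)
      then have "u t k = mlt t k * c k" using mlt_minus(2)[of t k] by (metis eq_iff_diff_eq_0 mult.assoc mult_1)
      then show ?thesis using lin True by simp
    next
      case False
      let ?I = "integral {0..t} (\<lambda>r. mlt (t - r) k * conv (u r) (u r) k)"
      have f0: "frc k \<noteq> 0" using False by (simp add: frc_def)
      have "((\<lambda>r. mlt t k / frc k * forcing u k r) has_integral mlt t k / frc k * (mlt (- t) k * u t k - c k)) {0..t}"
        by (rule has_integral_mult_right[OF F])
      moreover have "mlt t k / frc k * forcing u k r = mlt (t - r) k * conv (u r) (u r) k" for r
        using f0 mlt_add[of t "- r" k] by (simp add: forcing_def)
      ultimately have H: "((\<lambda>r. mlt (t - r) k * conv (u r) (u r) k) has_integral mlt t k / frc k * (mlt (- t) k * u t k - c k)) {0..t}"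
        by simp
      have "frc k * ?I = mlt t k * (mlt (- t) k * u t k - c k)"
        unfolding integral_unique[OF H] using f0 by simp
      then have ueq: "u t k = mlt t k * c k + frc k * ?I"
        using mlt_minus(2)[of t k] by (simp add: right_diff_distrib flip: mult.assoc)
      have "wgt lm 0 t k * (\<bar>of_int k\<bar> / 2 * norm ?I) \<le> duhK T * (lm - 3 * \<eta> / 4) powr (- eps) * G * \<bar>of_int k\<bar> powr (1 - 2 * th0)"
        by (rule duhamel_bound[OF has_integral_integrable[OF H]]) (use t lm G conv in auto)
      then have d: "wgt lm 0 t k * cmod (frc k * ?I) \<le> duhK T * G * \<bar>of_int k\<bar> powr (1 - 2 * th0)"
        using lm by (simp add: norm_mult norm_frc)
      have "wgt lm 0 t k * cmod (u t k) \<le> wgt lm 0 t k * (cmod (mlt t k * c k) + cmod (frc k * ?I))"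
        unfolding ueq using wgt_pos[of lm 0 t k] by (intro mult_left_mono norm_triangle_ineq) auto
      then show ?thesis using lin d by (simp add: distrib_left)
    qed
  qed
  show ?thesis by (rule W_I[OF zero mild_continuous[OF T m] sym l2 bound lm(1)])
qed

lemma W_restrict:
  assumes "u \<in> W \<delta> T" "0 \<le> \<delta>'" "\<delta>' \<le> \<delta>" "T' \<le> T" "0 \<le> T"
  shows "(\<lambda>t. if t \<in> {0..T'} then u t else 0) \<in> W \<delta>' T'"
proof (rule W_I[OF _ _ _ l2_Mx[OF assms(5) order_refl assms(1)] _ order_refl])
  show "continuous_on {0..T'} (\<lambda>t. (if t \<in> {0..T'} then u t else 0) k)" for k
    by (rule continuous_on_eq[OF continuous_on_subset[OF W_cont[OF assms(1)]]]) (use assms in auto)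
  fix t k assume t: "t \<in> {0..T'}"
  have "nu * min t \<delta>' * \<bar>of_int k\<bar> \<le> nu * min t \<delta> * \<bar>of_int k\<bar>"
    using assms eta by (intro mult_right_mono mult_left_mono) (auto simp: nu_def)
  then have "wgt 0 \<delta>' t k \<le> wgt 0 \<delta> t k"
    unfolding wgt_def by (intro mult_left_mono) auto
  then have "wgt 0 \<delta>' t k * cmod (u t k) \<le> wgt 0 \<delta> t k * cmod (u t k)" by (rule mult_right_mono) simp
  also have "\<dots> \<le> Mx 0 \<delta> T u k" using t assms by (intro Mx_ge) auto
  finally show "wgt 0 \<delta>' t k * cmod ((if t \<in> {0..T'} then u t else 0) k) \<le> Mx 0 \<delta> T u k" using t by simp
qed (use W_sym[OF assms(1)] in auto)

lemma unique_mild_in_W: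
  assumes "0 \<le> T" "0 \<le> \<delta>" "u \<in> W \<delta> T" "v \<in> W \<delta> T" "mild T c u" "mild T c v"
  shows "u = v"
  using unique_in_W[OF assms(1-4)] W_mild_iff[OF assms(1,2)] assms by blast

lemma local_mild_solution:
  "\<exists>T0>0. \<forall>T. 0 < T \<and> T \<le> T0 \<longrightarrow> (\<forall>\<delta>\<ge>0. \<forall>c\<in>Hc. hn c \<le> R \<longrightarrow>
    (\<exists>u\<in>W \<delta> T. nW 0 \<delta> T u \<le> 2 * (linK 1 * \<bar>R\<bar>) \<and> mild T c u))"
proof -
  obtain T0 where T0: "T0 > 0" "\<And>T \<delta> c. 0 < T \<Longrightarrow> T \<le> T0 \<Longrightarrow> \<delta> \<ge> 0 \<Longrightarrow> c \<in> Hc \<Longrightarrow> hn c \<le> R \<Longrightarrow>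
    \<exists>u\<in>W \<delta> T. nW 0 \<delta> T u \<le> 2 * (linK 1 * \<bar>R\<bar>) \<and> u = lin T c + bil T u u"
    using local_solution[of R] by blast
  show ?thesis
    using T0 W_mild_iff by (intro exI[of _ T0]) (meson less_imp_le)
qed

text \<open>For negative \<open>s\<close> the class of weak solutions contains no information on the blow-up of
  the \<open>L\<^sup>2\<close> norm at time 0. Comparing with the local solutions that start at small positive times
  provides it.\<close>

theorem weak_unique:
  assumes T: "0 < T" and c: "c \<in> Hc"
    and zero: "\<And>t. t \<notin> {0..T} \<Longrightarrow> u t = 0" and sym: "\<And>t k. u t (- k) = cnj (u t k)"
    and us: "coef_cont s {0..T} u" and uinf: "coef_cont sig {0<..<T} u" and m: "mild T c u"
    and v: "v \<in> W 0 T" "mild T c v"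
  shows "u = v"
proof -
  have T0: "0 \<le> T" using T by simp
  have cpt: "\<exists>B\<ge>0. \<forall>t. a \<le> t \<and> t \<le> b \<longrightarrow> coef_norm sig (u t) \<le> B" if ab: "0 < a" "b < T" for a b
  proof -
    have "continuous_on {a..b} (\<lambda>t. coef_norm sig (u t))"
      by (rule coef_cont_continuous[OF coef_cont_subset[OF uinf]]) (use ab in auto)
    then have "bounded ((\<lambda>t. coef_norm sig (u t)) ` {a..b})" by (intro compact_imp_bounded compact_continuous_image) auto
    then obtain B where "\<forall>t\<in>{a..b}. \<bar>coef_norm sig (u t)\<bar> \<le> B" by (auto simp: bounded_iff)
    then have "\<forall>t. a \<le> t \<and> t \<le> b \<longrightarrow> coef_norm sig (u t) \<le> \<bar>B\<bar>"
      by (meson abs_ge_self atLeastAtMost_iff order_trans)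
    then show ?thesis by (intro exI[of _ "\<bar>B\<bar>"]) auto
  qed
  have fin: "coef_finite sig (u t)" if "0 < t" "t < T" for t using uinf that by (auto simp: coef_cont_def)
  have uHc: "u t \<in> Hc" if "t \<in> {0..T}" for t using us that sym by (auto simp: Hc_coef_finite coef_cont_def)
  \<comment> \<open>By continuity at time 0 the values \<open>u a\<close> for small \<open>a\<close>
    stay in this ball, so the local solutions started from them have a common lifetime and a common
    bound.\<close>
  define R where "R = hn (u 0) + 1"
  have "((\<lambda>t. coef_norm s (u t)) \<longlongrightarrow> coef_norm s (u 0)) (at 0 within {0..T})"
    using coef_cont_continuous[OF us] T by (simp add: continuous_on_def)
  then have "\<forall>\<^sub>F t in at 0 within {0..T}. coef_norm s (u t) < R"
    by (rule order_tendstoD(2)) (simp add: R_def hn_coef_norm)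
  then obtain d where d: "d > 0" "\<And>t. 0 < t \<Longrightarrow> t \<le> T \<Longrightarrow> t < d \<Longrightarrow> hn (u t) < R"
    unfolding eventually_at hn_coef_norm by (auto simp: dist_real_def)
  obtain \<tau> where \<tau>: "\<tau> > 0" "\<And>T' c. 0 < T' \<Longrightarrow> T' \<le> \<tau> \<Longrightarrow> c \<in> Hc \<Longrightarrow> hn c \<le> R \<Longrightarrow>
    \<exists>u\<in>W 0 T'. nW 0 0 T' u \<le> 2 * (linK 1 * \<bar>R\<bar>) \<and> mild T' c u"
    using local_mild_solution[of R] by (metis order_refl)
  define M where "M = 2 * (linK 1 * \<bar>R\<bar>)"
  have M: "0 \<le> M" using linK_pos[of 1] by (simp add: M_def)
  have eqv: "u t = v t" if t: "0 \<le> t" "t < T" for t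
  proof (cases "t = 0")
    case True
    then show ?thesis using mild_initial[OF T0 m] mild_initial[OF T0 v(2)] by simp
  next
    case False
    define T' where "T' = t"
    have T': "0 < T'" "T' < T" using False t by (auto simp: T'_def)
    have small: "x powr gam * coef_norm sig (u x) \<le> M" if x: "0 < x" "x \<le> min \<tau> T'" for x
    proof -
      \<comment> \<open>From a positive starting time \<open>u\<close> is bounded in
        \<open>H^sig\<close> up to \<open>x\<close>, so it coincides with the local solution of
        datum \<open>u a\<close>. The bound \<open>M\<close> of the latter does not depend on
        \<open>a\<close>.\<close>
      have step: "(x - a) powr gam * coef_norm sig (u x) \<le> M" if a: "0 < a" "a < d" "a < x" for a
      proof -
        define L where "L = x - a"
        have L: "0 < L" "L \<le> \<tau>" "a + L = x" using x a by (auto simp: L_def)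
        have aT: "a \<in> {0..T}" "a \<le> T" using a x T' by auto
        obtain w where w: "w \<in> W 0 L" "nW 0 0 L w \<le> M" "mild L (u a) w"
          using \<tau>(2)[OF L(1,2) uHc[OF aT(1)]] d(2)[of a] a aT unfolding M_def by force
        define z where "z = (\<lambda>r. if r \<in> {0..L} then u (a + r) else 0)"
        have zm: "mild L (u a) z"
          by (rule mild_cong[OF mild_translate[OF m, of a]]) (use a aT x T' in \<open>auto simp: z_def L_def\<close>)
        obtain B where B: "B \<ge> 0" "\<And>t. a \<le> t \<Longrightarrow> t \<le> x \<Longrightarrow> coef_norm sig (u t) \<le> B"
          using cpt[of a x] a x T' by auto
        have "z \<in> W 0 L"
        proof (rule weak_mild_in_W[OF _ _ _ _ zm uHc[OF aT(1)], of "L powr gam * B"])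
          fix r assume r: "0 < r" "r \<le> L"
          have "r powr gam * coef_norm sig (u (a + r)) \<le> L powr gam * B"
            using r a L gam B(2)[of "a + r"] by (intro mult_mono powr_mono2) (auto simp: coef_norm_nonneg)
          then show "coef_finite sig (z r) \<and> r powr gam * coef_norm sig (z r) \<le> L powr gam * B"
            using r fin[of "a + r"] a L x T' by (auto simp: z_def)
        qed (use L B sym in \<open>auto simp: z_def\<close>)
        then have "z = w" using unique_mild_in_W[OF _ order_refl _ w(1) zm w(3)] L by simp
        from fun_cong[OF this, of L] have "u x = w L" using L by (simp add: z_def)
        then show ?thesis using W_sig(2)[OF _ order_refl w(1) L(1) order_refl] L w(2) by (simp add: L_def)
      qed
      \<comment> \<open>Letting the starting time tend to 0 produces the missing bound at the
        initial time.\<close>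
      have "((\<lambda>a. (x - a) powr gam * coef_norm sig (u x)) \<longlongrightarrow> (x - 0) powr gam * coef_norm sig (u x)) (at_right 0)"
        using x by (intro tendsto_intros) auto
      moreover have "\<forall>\<^sub>F a in at_right 0. (x - a) powr gam * coef_norm sig (u x) \<le> M"
        unfolding eventually_at_right_field using step d(1) x by (intro exI[of _ "min d x"]) auto
      ultimately have "(x - 0) powr gam * coef_norm sig (u x) \<le> M"
        by (rule tendsto_upperbound) simp
      then show ?thesis by simp
    qed
    obtain B where B: "B \<ge> 0" "\<And>t. min \<tau> T' \<le> t \<Longrightarrow> t \<le> T' \<Longrightarrow> coef_norm sig (u t) \<le> B"
      using cpt[of "min \<tau> T'" T'] \<tau>(1) T' by auto
    define M' where "M' = max M (T' powr gam * B)"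
    define z where "z = (\<lambda>r. if r \<in> {0..T'} then u r else 0)"
    have zm: "mild T' c z" by (rule mild_cong[OF m]) (use T' in \<open>auto simp: z_def\<close>)
    have "z \<in> W 0 T'"
    proof (rule weak_mild_in_W[OF _ _ _ _ zm c, of M'])
      fix r assume r: "0 < r" "r \<le> T'"
      have "r powr gam * coef_norm sig (u r) \<le> M'"
      proof (cases "r \<le> min \<tau> T'")
        case True
        then show ?thesis using small[OF r(1) True] by (simp add: M'_def)
      next
        case False
        have "r powr gam * coef_norm sig (u r) \<le> T' powr gam * B"
          using r gam B(2)[of r] False by (intro mult_mono powr_mono2) (auto simp: coef_norm_nonneg)
        then show ?thesis by (simp add: M'_def)
      qed
      then show "coef_finite sig (z r) \<and> r powr gam * coef_norm sig (z r) \<le> M'"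
        using r fin[of r] T' by (simp add: z_def)
    qed (use T' M sym in \<open>auto simp: z_def M'_def\<close>)
    moreover have "(\<lambda>t. if t \<in> {0..T'} then v t else 0) \<in> W 0 T'"
      using T' by (intro W_restrict[OF v(1)]) auto
    moreover have "mild T' c (\<lambda>t. if t \<in> {0..T'} then v t else 0)"
      by (rule mild_cong[OF v(2)]) (use T' in auto)
    ultimately have "z = (\<lambda>t. if t \<in> {0..T'} then v t else 0)"
      using unique_mild_in_W[OF _ order_refl] zm T' by (meson less_imp_le)
    from fun_cong[OF this, of t] show ?thesis using t by (simp add: z_def T'_def)
  qed
  \<comment> \<open>The solution class says nothing on smoothness at the final time; there the
    coefficients are compared by continuity.\<close>
  have "u T k = v T k" for k
  proof -
    have "((\<lambda>t. u t k) \<longlongrightarrow> u T k) (at T within {0..<T})" "((\<lambda>t. v t k) \<longlongrightarrow> v T k) (at T within {0..<T})"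
      using mild_continuous[OF T0 m, of k] mild_continuous[OF T0 v(2), of k] T0
      by (auto simp: continuous_on_def intro: tendsto_within_subset[where S = "{0..T}"])
    moreover have "((\<lambda>t. u t k) \<longlongrightarrow> v T k) (at T within {0..<T}) \<longleftrightarrow> ((\<lambda>t. v t k) \<longlongrightarrow> v T k) (at T within {0..<T})"
      by (rule Lim_cong_within) (use eqv in auto)
    moreover have "at T within {0..<T} \<noteq> bot" using T by (simp add: at_within_eq_bot_iff)
    ultimately show ?thesis using tendsto_unique by blast
  qed
  then have "u t = v t" for t
    using eqv[of t] zero[of t] W_zero[OF v(1), of t] by (cases "t = T") (auto intro!: ext, force)
  then show ?thesis by (intro ext) simp
qed

end

section \<open>Global solutions\<close>

context dissipative
begin

text \<open>In \<open>L\<^sup>2\<close> the time of existence depends on a norm that does not grow, so the local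
  solutions can be concatenated.\<close>

context
  assumes s0: "s = 0"
begin

lemma gam_0: "gam = 0"
  unfolding gam_def by (simp add: s0)

lemma wgt_0: "wgt 0 \<delta> t k = (1 + t powr 0) * exp (nu * min t \<delta> * \<bar>of_int k\<bar>)"
  unfolding wgt_def gam_0 using jb_pos[of k] by (simp add: s0)

text \<open>Since \<open>t powr 0\<close> is 1 except for the value 0 at \<open>t = 0\<close>, this
  weight takes only the values 1 and 2. Translating or gluing in time therefore costs a factor
  2.\<close>

lemma wgt_00: "0 \<le> t \<Longrightarrow> 1 \<le> wgt 0 0 t k \<and> wgt 0 0 t k \<le> 2"
  by (simp add: wgt_0)

text \<open>The energy inequality starts at positive times; continuity in \<open>L^2\<close> at 0
  extends it to the datum along \<open>t / Suc n\<close>.\<close>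

lemma energy_le_initial:
  assumes T: "0 \<le> T" and \<delta>: "0 < \<delta>" and u: "u \<in> W \<delta> T" and m: "mild T c u" and t: "0 \<le> t" "t \<le> T"
  shows "hn (u t) \<le> hn c"
proof (cases "t = 0")
  case True
  then show ?thesis using mild_initial[OF T m] by simp
next
  case False
  then have t0: "0 < t" using t by simp
  have h: "hn a = l2n (\<lambda>k. cmod (a k))" for a
    unfolding hn_def by (simp add: s0 less_imp_neq[OF jb_pos, symmetric])
  have "coef_cont s {0..T} u" using W_coef_cont(1)[OF T _ u] \<delta> by simp
  then have cont: "continuous_on {0..T} (\<lambda>t. hn (u t))" unfolding hn_coef_norm by (rule coef_cont_continuous)
  have conv0: "(\<lambda>n. t / real (Suc n)) \<longlonglongrightarrow> 0"
    by (rule real_tendsto_divide_at_top[OF tendsto_const filterlim_compose[OF filterlim_real_sequentially filterlim_Suc]])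
  have bounds: "0 < t / real (Suc n)" "t / real (Suc n) \<le> t" for n using t0 by (auto simp: field_simps)
  have mem: "t / real (Suc n) \<in> {0..T}" for n
    using bounds(1)[of n] bounds(2)[of n] t by (simp del: of_nat_Suc)
  have lim: "(\<lambda>n. hn (u (t / real (Suc n)))) \<longlonglongrightarrow> hn (u 0)"
    by (rule continuous_on_tendsto_compose[OF cont conv0])
      (use T mem in \<open>simp_all del: of_nat_Suc\<close>)
  have "hn (u t) \<le> hn (u 0)"
  proof (rule LIMSEQ_le_const[OF lim], intro exI allI impI)
    fix n
    show "hn (u t) \<le> hn (u (t / real (Suc n)))"
      unfolding h by (rule energy_decreasing(1)[OF T \<delta> u m]) (use bounds t in auto)
  qed
  then show ?thesis using mild_initial[OF T m] by simp
qed

lemma translate_in_W: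
  assumes "z \<in> W 0 T" "0 \<le> a" "0 \<le> b" "a + b \<le> T"
  shows "(\<lambda>r. if r \<in> {0..b} then z (a + r) else 0) \<in> W 0 b"
proof (rule W_I[OF _ _ _ l2_scale[OF l2_Mx[OF _ order_refl assms(1)], of 2] _ order_refl])
  show T: "0 \<le> T" using assms by simp
  show "continuous_on {0..b} (\<lambda>t. (if t \<in> {0..b} then z (a + t) else 0) k)" for k
  proof (rule continuous_on_eq)
    show "continuous_on {0..b} (\<lambda>t. z (a + t) k)"
      by (rule continuous_on_compose2[OF W_cont[OF assms(1), of k], where f = "\<lambda>t. a + t"])
        (use assms in \<open>auto intro!: continuous_intros\<close>)
  qed simp
  fix t k assume t: "t \<in> {0..b}"
  have "wgt 0 0 t k * cmod (z (a + t) k) \<le> (2 * wgt 0 0 (a + t) k) * cmod (z (a + t) k)"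
    using wgt_00[of t k] wgt_00[of "a + t" k] t assms by (intro mult_right_mono) auto
  also have "\<dots> \<le> 2 * Mx 0 0 T z k"
    using Mx_ge[OF T order_refl assms(1), of "a + t" k] t assms by simp
  finally show "wgt 0 0 t k * cmod ((if t \<in> {0..b} then z (a + t) else 0) k) \<le> 2 * Mx 0 0 T z k" using t by simp
qed (use W_sym[OF assms(1)] in auto)

lemma glue_in_W:
  assumes u: "u \<in> W 0 a" "mild a c u" and v: "v \<in> W 0 b" "mild b (u a) v" and ab: "0 \<le> a" "0 \<le> b"
  shows "(\<lambda>t. if t \<le> a then u t else v (t - a)) \<in> W 0 (a + b)" 
    and "mild (a + b) c (\<lambda>t. if t \<le> a then u t else v (t - a))"
proof -
  let ?z = "\<lambda>t. if t \<le> a then u t else v (t - a)"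
  show m: "mild (a + b) c ?z" by (rule mild_glue[OF u(2) v(2) ab])
  show "?z \<in> W 0 (a + b)"
  proof (rule W_I[OF _ mild_continuous[OF _ m] _ l2_add(1)[OF l2_Mx[OF ab(1) order_refl u(1)] l2_scale[OF l2_Mx[OF ab(2) order_refl v(1)], of 2]] _ order_refl])
    show "?z t = 0" if "t \<notin> {0..a + b}" for t
      using that W_zero[OF u(1), of t] W_zero[OF v(1), of "t - a"] ab by auto
    show "?z t (- k) = cnj (?z t k)" for t k using W_sym[OF u(1)] W_sym[OF v(1)] by simp
    fix t k assume t: "t \<in> {0..a + b}"
    note nn = Mx_nonneg[OF ab(1) order_refl u(1), of k] Mx_nonneg[OF ab(2) order_refl v(1), of k]
    show "wgt 0 0 t k * cmod (?z t k) \<le> Mx 0 0 a u k + 2 * Mx 0 0 b v k"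
    proof (cases "t \<le> a")
      case True
      then show ?thesis using Mx_ge[OF ab(1) order_refl u(1), of t k] t nn by simp
    next
      case False
      have "wgt 0 0 t k * cmod (v (t - a) k) \<le> (2 * wgt 0 0 (t - a) k) * cmod (v (t - a) k)"
        using wgt_00[of t k] wgt_00[of "t - a" k] t False by (intro mult_right_mono) auto
      then show ?thesis using Mx_ge[OF ab(2) order_refl v(1), of "t - a" k] False t nn by simp
    qed
  qed (use ab in auto)
qed

text \<open>The bound \<open>M\<close> does not depend on the number \<open>n\<close> of steps. The
  energy keeps the norm below \<open>R\<close> at every restart, and each time
  \<open>t \<ge> \<tau>\<close> is the end of a local solution started at \<open>t - \<tau>\<close>,
  carrying the analyticity gained during \<open>\<tau>\<close>.\<close>

theorem L2_global:
  "\<exists>\<tau>0>0. \<forall>\<tau>. 0 < \<tau> \<and> \<tau> \<le> \<tau>0 \<longrightarrow> (\<exists>M\<ge>0. \<forall>n. \<forall>c\<in>Hc. hn c \<le> R \<longrightarrow>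
    (\<exists>z\<in>W 0 (real n * \<tau>). mild (real n * \<tau>) c z \<and>
      (\<forall>t k. \<tau> \<le> t \<and> t \<le> real n * \<tau> \<longrightarrow> cmod (z t k) \<le> M * exp (- (nu * \<tau>) * \<bar>of_int k\<bar>))))"
proof -
  define M where "M = 2 * (linK 1 * \<bar>R\<bar>)"
  have M: "0 \<le> M" using linK_pos[of 1] by (simp add: M_def)
  obtain T0 where T0: "T0 > 0" "\<And>T \<delta> c. 0 < T \<Longrightarrow> T \<le> T0 \<Longrightarrow> \<delta> \<ge> 0 \<Longrightarrow> c \<in> Hc \<Longrightarrow> hn c \<le> R \<Longrightarrow>
    \<exists>u\<in>W \<delta> T. nW 0 \<delta> T u \<le> M \<and> mild T c u"
    using local_mild_solution[of R] unfolding M_def by blast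
  show ?thesis
  proof (rule exI[of _ T0], intro conjI allI impI T0(1), rule exI[of _ M], intro conjI M allI ballI impI)
    fix \<tau> n c assume \<tau>: "0 < \<tau> \<and> \<tau> \<le> T0" and c: "c \<in> Hc" "hn c \<le> R"
    have \<tau>0: "0 < \<tau>" "0 \<le> \<tau>" using \<tau> by auto
    have loc: "\<exists>w\<in>W 0 \<tau>. mild \<tau> c w \<and> (\<forall>t\<in>{0..\<tau>}. w t \<in> Hc \<and> hn (w t) \<le> R) \<and> (\<forall>k. cmod (w \<tau> k) \<le> M * exp (- (nu * \<tau>) * \<bar>of_int k\<bar>))"
      if c: "c \<in> Hc" "hn c \<le> R" for c
    proof -
      \<comment> \<open>The cap equals the length of the interval, so the strip reaches width
        \<open>\<tau>\<close> at the final time. For gluing, the width is afterwards lowered to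
        0.\<close>
      obtain w where w: "w \<in> W \<tau> \<tau>" "nW 0 \<tau> \<tau> w \<le> M" "mild \<tau> c w"
        using T0(2)[of \<tau> \<tau> c] \<tau> c by auto
      have "w = (\<lambda>t. if t \<in> {0..\<tau>} then w t else 0)" using W_zero[OF w(1)] by (intro ext) auto
      then have w0: "w \<in> W 0 \<tau>" using W_restrict[OF w(1), of 0 \<tau>] \<tau>0 by auto
      have "cmod (w \<tau> k) \<le> M * exp (- (nu * \<tau>) * \<bar>of_int k\<bar>)" for k
      proof -
        let ?e = "exp (nu * \<tau> * \<bar>of_int k\<bar>)"
        have "?e * cmod (w \<tau> k) \<le> wgt 0 \<tau> \<tau> k * cmod (w \<tau> k)"
          using \<tau>0 by (intro mult_right_mono) (auto simp: wgt_0)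
        also have "\<dots> \<le> M"
          using Mx_ge[OF \<tau>0(2) order_refl w(1), of \<tau> k] Mx_le_nW[OF \<tau>0(2) order_refl w(1), of k] w(2) \<tau>0 by auto
        finally have "exp (- (nu * \<tau>) * \<bar>of_int k\<bar>) * (?e * cmod (w \<tau> k)) \<le> exp (- (nu * \<tau>) * \<bar>of_int k\<bar>) * M"
          by (rule mult_left_mono) simp
        moreover have "exp (- (nu * \<tau>) * \<bar>of_int k\<bar>) * (?e * cmod (w \<tau> k)) = cmod (w \<tau> k)"
          by (simp flip: mult.assoc exp_add)
        ultimately show ?thesis by (simp only: mult.commute)
      qed
      moreover have "w t \<in> Hc \<and> hn (w t) \<le> R" if "t \<in> {0..\<tau>}" for t
        using W_Hc[OF \<tau>0(2,2) w(1) that] energy_le_initial[OF \<tau>0(2,1) w(1,3), of t] that c by auto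
      ultimately show ?thesis using w0 w(3) by blast
    qed
    have ex: "\<exists>z\<in>W 0 (real n * \<tau>). mild (real n * \<tau>) c z \<and> (\<forall>t\<in>{0..real n * \<tau>}. z t \<in> Hc \<and> hn (z t) \<le> R)" for n
    proof (induction n)
      case 0
      have l: "lin 0 c \<in> W 0 0" by (rule lin_W(1)[OF order_refl order_refl c(1)])
      have l0: "lin 0 c 0 = c" by (intro ext) (simp add: lin_def)
      have "mild 0 c (lin 0 c)"
        unfolding mild_def using has_integral_refl(2) l0 by auto
      then show ?case using l l0 c by auto
    next
      case (Suc n)
      then obtain z where z: "z \<in> W 0 (real n * \<tau>)" "mild (real n * \<tau>) c z" "\<And>t. t \<in> {0..real n * \<tau>} \<Longrightarrow> z t \<in> Hc \<and> hn (z t) \<le> R"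
        by blast
      have n0: "0 \<le> real n * \<tau>" using \<tau>0 by simp
      obtain w where w: "w \<in> W 0 \<tau>" "mild \<tau> (z (real n * \<tau>)) w" "\<And>t. t \<in> {0..\<tau>} \<Longrightarrow> w t \<in> Hc \<and> hn (w t) \<le> R"
        using loc[of "z (real n * \<tau>)"] z(3)[of "real n * \<tau>"] n0 by auto
      have e: "real n * \<tau> + \<tau> = real (Suc n) * \<tau>" by (simp add: algebra_simps)
      let ?y = "\<lambda>t. if t \<le> real n * \<tau> then z t else w (t - real n * \<tau>)"
      have "?y \<in> W 0 (real (Suc n) * \<tau>)" "mild (real (Suc n) * \<tau>) c ?y"
        using glue_in_W[OF z(1,2) w(1,2) n0 \<tau>0(2)] unfolding e by auto
      moreover have "?y t \<in> Hc \<and> hn (?y t) \<le> R" if "t \<in> {0..real (Suc n) * \<tau>}" for t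
        using that z(3)[of t] w(3)[of "t - real n * \<tau>"] by (cases "t \<le> real n * \<tau>") (auto simp: algebra_simps)
      ultimately show ?case by blast
    qed
    then obtain z where z: "z \<in> W 0 (real n * \<tau>)" "mild (real n * \<tau>) c z" "\<And>t. t \<in> {0..real n * \<tau>} \<Longrightarrow> z t \<in> Hc \<and> hn (z t) \<le> R"
      by blast
    have "cmod (z t k) \<le> M * exp (- (nu * \<tau>) * \<bar>of_int k\<bar>)" if t: "\<tau> \<le> t" "t \<le> real n * \<tau>" for t k
    proof -
      \<comment> \<open>On the window of length \<open>\<tau>\<close> ending at \<open>t\<close>,
        uniqueness identifies the glued solution with a fresh local one; its decay at the end of the
        window is the claim.\<close>
      define a where "a = t - \<tau>"
      have a: "0 \<le> a" "a + \<tau> = t" "a \<le> real n * \<tau>" using t \<tau>0 by (auto simp: a_def)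
      obtain w where w: "w \<in> W 0 \<tau>" "mild \<tau> (z a) w" "\<And>k. cmod (w \<tau> k) \<le> M * exp (- (nu * \<tau>) * \<bar>of_int k\<bar>)"
        using loc[of "z a"] z(3)[of a] a by auto
      let ?y = "\<lambda>r. if r \<in> {0..\<tau>} then z (a + r) else 0"
      have "?y \<in> W 0 \<tau>" by (rule translate_in_W[OF z(1)]) (use a t \<tau>0 in auto)
      moreover have "mild \<tau> (z a) ?y"
        by (rule mild_cong[OF mild_translate[OF z(2) a(1,3)]]) (use a t in auto)
      ultimately have "?y = w" using unique_mild_in_W[OF \<tau>0(2) order_refl _ w(1) _ w(2)] by blast
      from fun_cong[OF this, of \<tau>] show ?thesis using w(3)[of k] a \<tau>0 by simp
    qed
    then show "\<exists>z\<in>W 0 (real n * \<tau>). mild (real n * \<tau>) c z \<and>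
      (\<forall>t k. \<tau> \<le> t \<and> t \<le> real n * \<tau> \<longrightarrow> cmod (z t k) \<le> M * exp (- (nu * \<tau>) * \<bar>of_int k\<bar>))"
      using z by blast
  qed
qed

end

text \<open>The local solution in \<open>H^s\<close> is in \<open>L^2\<close> at a positive time,
  from where the \<open>L^2\<close> theory continues it. The weighted norm is bounded by the local
  solution up to \<open>t0\<close> and by the uniform analytic decay afterwards, both uniformly over
  the ball of data.\<close>

theorem global_solution:
  assumes T: "0 < T"
  shows "\<exists>\<delta>>0. \<exists>M. \<forall>c\<in>Hc. hn c \<le> R \<longrightarrow> (\<exists>u\<in>W \<delta> T. nW 0 \<delta> T u \<le> M \<and> mild T c u)"
proof -
  \<comment> \<open>The multiplier, \<open>nu\<close> and the notion \<open>mild\<close> do not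
    involve \<open>s\<close>, so both instances share them; only spaces and norms differ.\<close>
  interpret L: dissipative \<beta> \<eta> 0 by unfold_locales (use eta in auto)
  have L0: "L.gam = 0" "L.sig = 0" by (simp_all add: L.gam_def L.sig_def)
  have nu: "0 < nu" using eta by (simp add: nu_def)
  define M0 where "M0 = 2 * (linK 1 * \<bar>R\<bar>)"
  obtain t0 where t0: "t0 > 0" "\<And>c. c \<in> Hc \<Longrightarrow> hn c \<le> R \<Longrightarrow> \<exists>u\<in>W t0 t0. nW 0 t0 t0 u \<le> M0 \<and> mild t0 c u"
    using local_mild_solution[of R] unfolding M0_def by (metis less_imp_le order_refl)
  \<comment> \<open>Switching halfway leaves the overlap \<open>[t1, t0]\<close>. It is needed
    because the analytic decay of the continued solution starts only a time
    \<open>\<tau> \<le> t1\<close> after the switch.\<close>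
  define t1 where "t1 = t0 / 2"
  have t1: "0 < t1" "t1 < t0" "0 \<le> t0" using t0 by (auto simp: t1_def)
  define R1 where "R1 = t1 powr (- gam) * M0"
  obtain \<tau>0 where \<tau>0: "\<tau>0 > 0" "\<And>\<tau>. 0 < \<tau> \<Longrightarrow> \<tau> \<le> \<tau>0 \<Longrightarrow> (\<exists>M\<ge>0. \<forall>n. \<forall>c\<in>L.Hc. L.hn c \<le> R1 \<longrightarrow>
    (\<exists>z\<in>L.W 0 (real n * \<tau>). mild (real n * \<tau>) c z \<and>
      (\<forall>t k. \<tau> \<le> t \<and> t \<le> real n * \<tau> \<longrightarrow> cmod (z t k) \<le> M * exp (- (nu * \<tau>) * \<bar>of_int k\<bar>))))"
    using L.L2_global[OF refl, of R1] by blast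
  define \<tau> where "\<tau> = min \<tau>0 t1"
  have \<tau>: "0 < \<tau>" "\<tau> \<le> \<tau>0" "\<tau> \<le> t1" using \<tau>0 t1 by (auto simp: \<tau>_def)
  obtain M1 where M1: "M1 \<ge> 0" "\<And>n c. c \<in> L.Hc \<Longrightarrow> L.hn c \<le> R1 \<Longrightarrow>
    \<exists>z\<in>L.W 0 (real n * \<tau>). mild (real n * \<tau>) c z \<and>
      (\<forall>t k. \<tau> \<le> t \<and> t \<le> real n * \<tau> \<longrightarrow> cmod (z t k) \<le> M1 * exp (- (nu * \<tau>) * \<bar>of_int k\<bar>))"
    using \<tau>0(2)[OF \<tau>(1,2)] by blast
  obtain n where n: "T + t1 \<le> real n * \<tau>"
    using reals_Archimedean3[OF \<tau>(1)] by (metis less_imp_le)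
  \<comment> \<open>The decay has rate \<open>nu * \<tau>\<close>. A weight with half this rate
    leaves the other half to make the majorant \<open>e\<close> square-summable.\<close>
  define \<delta> where "\<delta> = \<tau> / 2"
  have \<delta>: "0 < \<delta>" "\<delta> \<le> t0" using \<tau> t1 by (auto simp: \<delta>_def)
  define e where "e k = M1 * (1 + T powr gam) * (jb k powr (s / 2 + gam) * exp (- (nu * \<tau> / 2) * \<bar>of_int k\<bar>)) +
      M1 * (1 + T powr gam) * (jb k powr (s / 2) * exp (- (nu * \<tau> / 2) * \<bar>of_int k\<bar>))" for k :: int
  have l2e: "l2 e" unfolding e_def using nu \<tau> by (intro l2_add(1) l2_scale l2_exp_abs) auto
  have e0: "0 \<le> e k" for k unfolding e_def using M1 by simp
  show ?thesis
  proof (rule exI[of _ \<delta>], intro conjI \<delta>(1), rule exI[of _ "M0 + l2n e"], intro ballI impI)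
    fix c assume c: "c \<in> Hc" "hn c \<le> R"
    obtain u0 where u0: "u0 \<in> W t0 t0" "nW 0 t0 t0 u0 \<le> M0" "mild t0 c u0" using t0(2)[OF c] by blast
    have u0k: "cmod (u0 t k) \<le> t powr (- gam) * Mx 0 t0 t0 u0 k" if t: "0 < t" "t \<le> t0" for t k
    proof -
      have "1 * 1 \<le> jb k powr (sig / 2) * exp (nu * min t t0 * \<bar>of_int k\<bar>)"
      proof (rule mult_mono)
        show "1 \<le> jb k powr (sig / 2)" using sig jb_ge_1[of k] by (intro ge_one_powr_ge_zero) auto
        show "1 \<le> exp (nu * min t t0 * \<bar>of_int k\<bar>)" using nu t by simp
      qed auto
      then have "t powr gam * 1 * cmod (u0 t k) \<le> t powr gam * (jb k powr (sig / 2) * exp (nu * min t t0 * \<bar>of_int k\<bar>)) * cmod (u0 t k)"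
        by (intro mult_right_mono mult_left_mono) auto
      also have "\<dots> = exp (- 0 * t) * t powr gam * jb k powr (sig / 2) * exp (nu * min t t0 * \<bar>of_int k\<bar>) * cmod (u0 t k)" by simp
      also have "\<dots> \<le> Mx 0 t0 t0 u0 k" by (rule W_fixed_time[OF order_refl _ u0(1)]) (use t in auto)
      finally have "t powr (- gam) * (t powr gam * cmod (u0 t k)) \<le> t powr (- gam) * Mx 0 t0 t0 u0 k"
        by (intro mult_left_mono) auto
      moreover have "t powr (- gam) * (t powr gam * cmod (u0 t k)) = cmod (u0 t k)"
        using t by (simp flip: mult.assoc powr_add)
      ultimately show ?thesis by simp
    qed
    have l2M: "l2 (Mx 0 t0 t0 u0)" by (rule l2_Mx[OF t1(3) order_refl u0(1)])
    have j0: "jb k \<noteq> 0" for k using jb_pos[of k] by linarith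
    have a: "u0 t1 \<in> L.Hc" "L.hn (u0 t1) \<le> R1"
    proof -
      have 1: "0 \<le> jb k powr (0 / 2) * cmod (u0 t1 k)" "jb k powr (0 / 2) * cmod (u0 t1 k) \<le> t1 powr (- gam) * Mx 0 t0 t0 u0 k" for k
        using u0k[of t1 k] t1 by (auto simp: j0)
      note 2 = l2_mono'[OF l2_scale[OF l2M, of "t1 powr (- gam)"] 1]
      show "u0 t1 \<in> L.Hc" using 2(1) W_sym[OF u0(1)] by (simp add: L.Hc_def)
      have "L.hn (u0 t1) \<le> t1 powr (- gam) * nW 0 t0 t0 u0" using 2(2) by (simp add: L.hn_def l2n_scale nW_def)
      also have "\<dots> \<le> R1" unfolding R1_def by (intro mult_left_mono u0(2)) simp
      finally show "L.hn (u0 t1) \<le> R1" .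
    qed
    obtain z where z: "z \<in> L.W 0 (real n * \<tau>)" "mild (real n * \<tau>) (u0 t1) z"
      "\<And>t k. \<tau> \<le> t \<Longrightarrow> t \<le> real n * \<tau> \<Longrightarrow> cmod (z t k) \<le> M1 * exp (- (nu * \<tau>) * \<bar>of_int k\<bar>)"
      using M1(2)[OF a] by blast
    have n0: "0 \<le> real n * \<tau>" "t1 \<le> real n * \<tau>" using n T t1 by auto
    define v where "v = (\<lambda>t. if t \<le> t1 then u0 t else z (t - t1))"
    have um1: "mild t1 c u0" by (rule mild_cong[OF u0(3)]) (use t1 in auto)
    have vm: "mild (t1 + real n * \<tau>) c v"
      unfolding v_def by (rule mild_glue[where u = u0 and v = z]) (use um1 z(2) t1 n0 in auto)
    \<comment> \<open>On the overlap both functions solve the same problem with datum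
      \<open>u0 t1\<close>, and away from time 0 the first also lies in the \<open>L^2\<close>
      space; uniqueness there identifies them.\<close>
    have veq: "v t = u0 t" if t: "t \<le> t0" for t
    proof (cases "t \<le> t1")
      case False
      let ?y = "\<lambda>r. if r \<in> {0..t1} then u0 (t1 + r) else 0"
      have tt: "t1 + t1 = t0" by (simp add: t1_def)
      have y1: "mild t1 (u0 t1) ?y"
        by (rule mild_cong[OF mild_translate[OF u0(3), of t1]]) (use t1 tt in auto)
      have y2: "?y \<in> L.W 0 t1"
      proof (rule L.W_I[OF _ L.mild_continuous[OF _ y1] _ l2_scale[OF l2M, of "2 * t1 powr (- gam)"] _ order_refl])
        fix r k assume r: "r \<in> {0..t1}"
        have "(t1 + r) powr (- gam) \<le> t1 powr (- gam)" using r t1 gam by (intro powr_mono2') auto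
        then have "cmod (u0 (t1 + r) k) \<le> t1 powr (- gam) * Mx 0 t0 t0 u0 k"
          using u0k[of "t1 + r" k] r tt t1 Mx_nonneg[OF t1(3) order_refl u0(1), of k]
          by (auto intro: order_trans mult_right_mono)
        then have "L.wgt 0 0 r k * cmod (u0 (t1 + r) k) \<le> 2 * (t1 powr (- gam) * Mx 0 t0 t0 u0 k)"
          using L.wgt_00[OF refl, of r k] r by (intro mult_mono) auto
        then show "L.wgt 0 0 r k * cmod (?y r k) \<le> 2 * t1 powr (- gam) * Mx 0 t0 t0 u0 k" using r by (simp add: mult.assoc)
      qed (use t1 W_sym[OF u0(1)] in auto)
      have z2: "(\<lambda>t. if t \<in> {0..t1} then z t else 0) \<in> L.W 0 t1"
        by (rule L.W_restrict[OF z(1)]) (use n0 in auto)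
      have z3: "mild t1 (u0 t1) (\<lambda>t. if t \<in> {0..t1} then z t else 0)"
        by (rule mild_cong[OF z(2)]) (use n0 in auto)
      have "?y = (\<lambda>t. if t \<in> {0..t1} then z t else 0)"
        by (rule L.unique_mild_in_W[OF _ order_refl y2 z2 y1 z3]) (use t1 in simp)
      from fun_cong[OF this, of "t - t1"] show ?thesis using t False tt by (simp add: v_def)
    qed (simp add: v_def)
    define u where "u = (\<lambda>t. if t \<in> {0..T} then v t else 0)"
    have um: "mild T c u" by (rule mild_cong[OF vm]) (use n t1 in \<open>auto simp: u_def\<close>)
    have bound: "wgt 0 \<delta> t k * cmod (u t k) \<le> Mx 0 t0 t0 u0 k + e k" if t: "t \<in> {0..T}" for t k
    proof (cases "t \<le> t0")
      case True
      have "nu * min t \<delta> * \<bar>of_int k\<bar> \<le> nu * min t t0 * \<bar>of_int k\<bar>"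
        using \<delta> nu by (intro mult_right_mono mult_left_mono) auto
      then have "wgt 0 \<delta> t k \<le> wgt 0 t0 t k" unfolding wgt_def by (intro mult_left_mono) auto
      then have "wgt 0 \<delta> t k * cmod (u0 t k) \<le> wgt 0 t0 t k * cmod (u0 t k)" by (rule mult_right_mono) simp
      also have "\<dots> \<le> Mx 0 t0 t0 u0 k" using True t by (intro Mx_ge[OF t1(3) order_refl u0(1)]) auto
      finally show ?thesis using t e0[of k] veq[OF True] by (simp add: u_def)
    next
      case False
      let ?K = "\<bar>of_int k\<bar> :: real"
      have tt: "t - t1 \<ge> \<tau>" "t - t1 \<le> real n * \<tau>" using False \<tau> t n t1 by (auto simp: t1_def)
      have "cmod (u t k) \<le> M1 * exp (- (nu * \<tau>) * ?K)"
        using z(3)[OF tt, of k] t False t1 by (simp add: u_def v_def)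
      moreover have "wgt 0 \<delta> t k \<le> jb k powr (s / 2) * (1 + T powr gam * jb k powr gam) * exp (nu * \<tau> / 2 * ?K)"
      proof -
        have "t powr gam \<le> T powr gam" using t gam by (intro powr_mono2) auto
        then have 1: "jb k powr (s / 2) * (1 + t powr gam * jb k powr gam) \<le> jb k powr (s / 2) * (1 + T powr gam * jb k powr gam)"
          by (intro mult_left_mono add_left_mono mult_right_mono) auto
        have 2: "exp (nu * min t \<delta> * ?K) \<le> exp (nu * \<tau> / 2 * ?K)"
        proof -
          have "nu * min t \<delta> * ?K \<le> nu * \<delta> * ?K" using nu by (intro mult_right_mono mult_left_mono) auto
          then show ?thesis by (simp add: \<delta>_def)
        qed
        show ?thesis unfolding wgt_def using mult_mono[OF 1 2] by simp
      qed
      ultimately have "wgt 0 \<delta> t k * cmod (u t k) \<le> (jb k powr (s / 2) * (1 + T powr gam * jb k powr gam) * exp (nu * \<tau> / 2 * ?K)) * (M1 * exp (- (nu * \<tau>) * ?K))"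
        by (intro mult_mono) auto
      also have "\<dots> = M1 * (jb k powr (s / 2) * (1 + T powr gam * jb k powr gam)) * (exp (nu * \<tau> / 2 * ?K) * exp (- (nu * \<tau>) * ?K))"
        by (simp add: mult_ac)
      also have "exp (nu * \<tau> / 2 * ?K) * exp (- (nu * \<tau>) * ?K) = exp (- (nu * \<tau> / 2) * ?K)"
        by (simp flip: exp_add)
      also have "M1 * (jb k powr (s / 2) * (1 + T powr gam * jb k powr gam)) * exp (- (nu * \<tau> / 2) * ?K) =
        M1 * T powr gam * (jb k powr (s / 2 + gam) * exp (- (nu * \<tau> / 2) * ?K)) + M1 * 1 * (jb k powr (s / 2) * exp (- (nu * \<tau> / 2) * ?K))"
        by (simp add: powr_add algebra_simps)
      also have "\<dots> \<le> e k" unfolding e_def using M1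
        by (intro add_mono mult_right_mono mult_left_mono) auto
      finally show ?thesis using Mx_nonneg[OF t1(3) order_refl u0(1), of k] by simp
    qed
    have T0: "0 \<le> T" using T by simp
    have l2: "l2 (\<lambda>k. Mx 0 t0 t0 u0 k + e k)" by (rule l2_add(1)[OF l2M l2e])
    have uW: "u \<in> W \<delta> T"
    proof (rule W_I[OF _ mild_continuous[OF T0 um] _ l2 bound order_refl])
      show "u t (- k) = cnj (u t k)" if "t \<in> {0..T}" for t k
        using that W_sym[OF u0(1)] L.W_sym[OF z(1)] by (simp add: u_def v_def)
    qed (auto simp: u_def)
    have "nW 0 \<delta> T u \<le> l2n (\<lambda>k. Mx 0 t0 t0 u0 k + e k)" by (rule nW_le(1)[OF T0 order_refl l2 bound])
    also have "\<dots> \<le> nW 0 t0 t0 u0 + l2n e" unfolding nW_def by (rule l2_add(2)[OF l2M l2e])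
    also have "\<dots> \<le> M0 + l2n e" using u0(2) by simp
    finally show "\<exists>u\<in>W \<delta> T. nW 0 \<delta> T u \<le> M0 + l2n e \<and> mild T c u" using uW um by blast
  qed
qed

end

section \<open>Functions with vanishing Fourier coefficients\<close>

lemma integrable_circle_mult:
  assumes "integrable circle_measure w" "continuous_on {- pi..pi} g"
  shows "integrable circle_measure (\<lambda>x. w x * g x :: real)"
proof -
  have "bounded (g ` {- pi..pi})" using assms(2) by (intro compact_imp_bounded compact_continuous_image) auto
  then obtain B where B: "\<forall>x\<in>{- pi..pi}. \<bar>g x\<bar> \<le> B" by (auto simp: bounded_iff)
  show ?thesis
  proof (rule Bochner_Integration.integrable_bound)
    show "integrable circle_measure (\<lambda>x. B * \<bar>w x\<bar>)" using assms(1) by simp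
    have "g \<in> borel_measurable circle_measure"
      by (rule continuous_imp_measurable_on_sets_lebesgue[OF assms(2)]) auto
    then show "(\<lambda>x. w x * g x) \<in> borel_measurable circle_measure"
      using assms(1) by (intro borel_measurable_times) auto
    show "AE x in circle_measure. norm (w x * g x) \<le> norm (B * \<bar>w x\<bar>)"
    proof (rule AE_I2)
      fix x assume "x \<in> space circle_measure"
      then have "\<bar>g x\<bar> \<le> B" using B by auto
      then have "\<bar>w x\<bar> * \<bar>g x\<bar> \<le> \<bar>w x\<bar> * \<bar>B\<bar>" by (intro mult_left_mono) auto
      then show "norm (w x * g x) \<le> norm (B * \<bar>w x\<bar>)" by (simp add: abs_mult mult.commute)
    qed
  qed
qed

lemma integrable_circle_continuous: "continuous_on {- pi..pi} g \<Longrightarrow> integrable circle_measure (g :: real \<Rightarrow> real)"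
  by (rule continuous_imp_integrable_real)

definition coef_zero :: "(real \<Rightarrow> real) \<Rightarrow> bool" where
  "coef_zero w \<longleftrightarrow> integrable circle_measure w \<and> (\<forall>k::int. (LINT x|circle_measure. w x * cos (of_int k * x)) = 0 \<and>
     (LINT x|circle_measure. w x * sin (of_int k * x)) = 0)"

text \<open>The product formulas shift the frequency by one in both directions. Repeated use extends
  orthogonality from single frequencies to all polynomials in \<open>cos\<close> and
  \<open>sin\<close>.\<close>

lemma coef_zero_trig:
  assumes "coef_zero w"
  shows "coef_zero (\<lambda>x. w x * cos x)" and "coef_zero (\<lambda>x. w x * sin x)"
proof -
  have w: "integrable circle_measure w" using assms by (simp add: coef_zero_def)
  have i: "integrable circle_measure (\<lambda>x. w x * cos (of_int k * x))" "integrable circle_measure (\<lambda>x. w x * sin (of_int k * x))" for k :: int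
    by (intro integrable_circle_mult[OF w] continuous_intros)+
  have z: "(LINT x|circle_measure. w x * cos (of_int k * x)) = 0" "(LINT x|circle_measure. w x * sin (of_int k * x)) = 0" for k :: int
    using assms by (auto simp: coef_zero_def)
  have k1: "of_int (k + 1) * x = of_int k * x + x" "of_int (k - 1) * x = of_int k * x - x" for k :: int and x :: real
    by (simp_all add: algebra_simps)
  have e: "w x * cos x * cos (of_int k * x) = 1/2 * (w x * cos (of_int (k + 1) * x) + w x * cos (of_int (k - 1) * x))"
    "w x * cos x * sin (of_int k * x) = 1/2 * (w x * sin (of_int (k + 1) * x) + w x * sin (of_int (k - 1) * x))"
    "w x * sin x * cos (of_int k * x) = 1/2 * (w x * sin (of_int (k + 1) * x) - w x * sin (of_int (k - 1) * x))"
    "w x * sin x * sin (of_int k * x) = 1/2 * (w x * cos (of_int (k - 1) * x) - w x * cos (of_int (k + 1) * x))" for x k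
    unfolding k1 by (simp_all add: cos_add sin_add cos_diff sin_diff algebra_simps)
  show "coef_zero (\<lambda>x. w x * cos x)" "coef_zero (\<lambda>x. w x * sin x)"
    unfolding coef_zero_def e using i z by (auto intro!: integrable_circle_mult[OF w] continuous_intros simp del: of_int_add of_int_diff)
qed

lemma coef_zero_lincomb:
  assumes "coef_zero v" "coef_zero w"
  shows "coef_zero (\<lambda>x. a * v x + b * w x)"
proof -
  have i: "integrable circle_measure (\<lambda>x. u x * cos (of_int k * x))" "integrable circle_measure (\<lambda>x. u x * sin (of_int k * x))"
    if "coef_zero u" for k :: int and u
    using that unfolding coef_zero_def by (intro integrable_circle_mult continuous_intros, simp)+
  have "(a * v x + b * w x) * y = a * (v x * y) + b * (w x * y)" for x y by (simp add: algebra_simps)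
  then show ?thesis using assms i[OF assms(1)] i[OF assms(2)] unfolding coef_zero_def by auto
qed

lemma coef_zero_polynomial:
  assumes "real_polynomial_function (p :: complex \<Rightarrow> real)" "coef_zero w"
  shows "coef_zero (\<lambda>x. w x * p (cis x))"
  using assms
proof (induction arbitrary: w rule: real_polynomial_function.induct)
  case (linear f)
  have "f (cis x) = f 1 * cos x + f \<i> * sin x" for x
  proof -
    have "cis x = cos x *\<^sub>R 1 + sin x *\<^sub>R \<i>" by (simp add: complex_eq_iff)
    then show ?thesis
      using linear_add[OF bounded_linear.linear[OF linear.hyps]] linear_scale[OF bounded_linear.linear[OF linear.hyps]]
      by (metis mult.commute real_scaleR_def)
  qed
  then have "(\<lambda>x. w x * f (cis x)) = (\<lambda>x. f 1 * (w x * cos x) + f \<i> * (w x * sin x))" by (simp add: algebra_simps)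
  then show ?case using coef_zero_lincomb[OF coef_zero_trig[OF linear.prems]] by simp
next
  case (const c)
  then show ?case using coef_zero_lincomb[OF const.prems const.prems, of c 0] by (simp add: mult.commute)
next
  case (add f g)
  then show ?case using coef_zero_lincomb[OF add.IH(1)[OF add.prems] add.IH(2)[OF add.prems], of 1 1]
    by (simp add: algebra_simps)
next
  case (mult f g)
  then show ?case using mult.IH(2)[OF mult.IH(1)[OF mult.prems]] by (simp add: mult.assoc)
qed

text \<open>Continuous functions on the unit circle are uniformly approximated by polynomials, for
  which the integral vanishes.\<close>

lemma coef_zero_continuous:
  assumes w: "coef_zero w" and H: "continuous_on UNIV (H :: complex \<Rightarrow> real)"
  shows "(LINT x|circle_measure. w x * H (cis x)) = 0"
proof -
  have wi: "integrable circle_measure w" using w by (simp add: coef_zero_def)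
  have ccis: "continuous_on {- pi..pi} (\<lambda>x. h (cis x))" if "continuous_on UNIV h" for h :: "complex \<Rightarrow> real"
    by (rule continuous_on_compose2[OF that]) (auto intro!: continuous_intros)
  have "\<bar>LINT x|circle_measure. w x * H (cis x)\<bar> \<le> e * (LINT x|circle_measure. \<bar>w x\<bar>)" if e: "0 < e" for e
  proof -
    obtain p where p: "real_polynomial_function p" "\<And>z. z \<in> sphere 0 1 \<Longrightarrow> \<bar>H z - p z\<bar> < e"
      using Stone_Weierstrass_real_polynomial_function[of "sphere 0 1" H e] e continuous_on_subset[OF H] by auto
    have pc: "continuous_on UNIV p" using continuous_real_polymonial_function[OF p(1)]
      by (simp add: continuous_at_imp_continuous_on)
    have 0: "(LINT x|circle_measure. w x * p (cis x)) = 0"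
      using coef_zero_polynomial[OF p(1) w] unfolding coef_zero_def by (metis (no_types, lifting) Bochner_Integration.integral_cong cos_zero mult.right_neutral mult_zero_left of_int_0)
    have i: "integrable circle_measure (\<lambda>x. w x * H (cis x))" "integrable circle_measure (\<lambda>x. w x * p (cis x))"
      by (intro integrable_circle_mult[OF wi] ccis H pc)+
    have "(LINT x|circle_measure. w x * H (cis x)) = (LINT x|circle_measure. w x * H (cis x) - w x * p (cis x))"
      using i 0 by simp
    also have "\<bar>\<dots>\<bar> \<le> (LINT x|circle_measure. \<bar>w x * H (cis x) - w x * p (cis x)\<bar>)"
      using integral_norm_bound[of circle_measure "\<lambda>x. w x * H (cis x) - w x * p (cis x)"] by simp
    also have "\<dots> \<le> (LINT x|circle_measure. e * \<bar>w x\<bar>)"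
    proof (rule integral_mono)
      show "integrable circle_measure (\<lambda>x. \<bar>w x * H (cis x) - w x * p (cis x)\<bar>)" using i by auto
      show "integrable circle_measure (\<lambda>x. e * \<bar>w x\<bar>)" using wi by simp
      fix x
      have "\<bar>w x\<bar> * \<bar>H (cis x) - p (cis x)\<bar> \<le> \<bar>w x\<bar> * e" using p(2)[of "cis x"] by (intro mult_left_mono) auto
      then show "\<bar>w x * H (cis x) - w x * p (cis x)\<bar> \<le> e * \<bar>w x\<bar>"
        by (simp add: abs_mult mult.commute flip: right_diff_distrib)
    qed
    finally show ?thesis by simp
  qed
  note b = this
  define J where "J = (LINT x|circle_measure. \<bar>w x\<bar>)"
  define I where "I = \<bar>LINT x|circle_measure. w x * H (cis x)\<bar>"
  have J: "0 < 2 * (J + 1)"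
  proof -
    have "0 \<le> J" by (simp add: J_def)
    then show ?thesis by simp
  qed
  have IJ: "0 < e \<Longrightarrow> I \<le> e * J" for e using b[of e] by (simp add: I_def J_def)
  have "I = 0"
  proof (rule ccontr)
    assume "I \<noteq> 0"
    then have I: "0 < I" by (simp add: I_def)
    \<comment> \<open>This choice of the accuracy makes the right side smaller than
      \<open>I / 2\<close>.\<close>
    then have "I \<le> I / (2 * (J + 1)) * J" using J by (intro IJ) simp
    also have "\<dots> < I" using I J mult_pos_pos[OF I, of "J + 2"] by (simp add: field_simps)
    finally show False by simp
  qed
  then show ?thesis by (simp add: I_def)
qed

text \<open>The indicator of an arc is the limit of bounded continuous functions of the distance to
  the arc. The approximation takes place on the circle and thus respects periodicity.\<close>

lemma coef_zero_half_line:
  assumes w: "coef_zero w" and a: "- pi \<le> a" "a < pi"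
  shows "(LINT x|circle_measure. w x * indicator {..a} x) = 0"
proof -
  have wi: "integrable circle_measure w" using w by (simp add: coef_zero_def)
  define C where "C = cis ` {- pi..a}"
  have C: "closed C" "C \<noteq> {}"
    unfolding C_def using a by (auto intro!: compact_imp_closed compact_continuous_image continuous_intros)
  define H where "H n z = max 0 (1 - real n * infdist z C)" for n z
  have Hc: "continuous_on UNIV (H n)" for n unfolding H_def by (intro continuous_intros)
  have ccis: "continuous_on {- pi..pi} (\<lambda>x. H n (cis x))" for n
    by (rule continuous_on_compose2[OF Hc]) (auto intro!: continuous_intros)
  have lim: "(\<lambda>n. H n z) \<longlonglongrightarrow> indicator C z" for z
  proof (cases "z \<in> C")
    case True
    then show ?thesis by (simp add: H_def)
  next
    case False
    then have d: "0 < infdist z C" using in_closed_iff_infdist_zero[OF C, of z] infdist_nonneg[of z C] by (simp add: less_le)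
    obtain N where N: "1 < real N * infdist z C" using reals_Archimedean3[OF d] by blast
    have "\<forall>\<^sub>F n in sequentially. 0 = H n z"
    proof (rule eventually_sequentiallyI[of N])
      fix n assume "N \<le> n"
      then have "real N * infdist z C \<le> real n * infdist z C" using d by (intro mult_right_mono) auto
      then show "0 = H n z" using N by (simp add: H_def)
    qed
    then show ?thesis using False by (simp add: tendsto_eventually eventually_mono)
  qed
  have H01: "0 \<le> H n z" "H n z \<le> 1" for n z by (auto simp: H_def infdist_nonneg)
  have "(\<lambda>n. LINT x|circle_measure. w x * H n (cis x)) \<longlonglongrightarrow> (LINT x|circle_measure. w x * indicator C (cis x))"
  proof (rule integral_dominated_convergence)
    show "integrable circle_measure (\<lambda>x. \<bar>w x\<bar>)" using wi by simp
    show m: "(\<lambda>x. w x * H n (cis x)) \<in> borel_measurable circle_measure" for n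
      using integrable_circle_mult[OF wi ccis[of n]] by auto
    show l: "AE x in circle_measure. (\<lambda>n. w x * H n (cis x)) \<longlonglongrightarrow> w x * indicator C (cis x)"
      by (intro AE_I2 tendsto_mult[OF tendsto_const lim])
    show "AE x in circle_measure. norm (w x * H n (cis x)) \<le> \<bar>w x\<bar>" for n
      using H01[of n] by (intro AE_I2) (auto simp: abs_mult intro!: mult_right_le_one_le)
    show "(\<lambda>x. w x * indicator C (cis x)) \<in> borel_measurable circle_measure"
      by (rule borel_measurable_LIMSEQ_real[OF _ m]) (rule tendsto_mult[OF tendsto_const lim])
  qed
  then have "(\<lambda>n. 0) \<longlonglongrightarrow> (LINT x|circle_measure. w x * indicator C (cis x))"
    by (simp only: coef_zero_continuous[OF w Hc])
  then have 0: "(LINT x|circle_measure. w x * indicator C (cis x)) = 0"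
    by (simp add: LIMSEQ_const_iff)
  \<comment> \<open>The point \<open>x = pi\<close> has to be excluded:
    \<open>cis pi = cis (- pi)\<close> lies in the image of the arc although
    \<open>pi > a\<close>.\<close>
  have ind: "indicator C (cis x) = (indicator {..a} x :: real)" if x: "x \<in> {- pi..pi}" "x \<noteq> pi" for x
  proof -
    have "cis x \<in> C \<longleftrightarrow> x \<le> a"
    proof
      assume "cis x \<in> C"
      then obtain y where y: "cis x = cis y" "- pi \<le> y" "y \<le> a" by (auto simp: C_def)
      show "x \<le> a"
      proof (cases "x = - pi \<or> y = - pi")
        case True
        have "y \<noteq> - pi \<or> x = - pi"
        proof (rule ccontr)
          assume "\<not> ?thesis"
          then have "y = - pi" "x \<noteq> - pi" by auto
          then have "Arg (cis x) = x" using x by (intro Arg_cis) auto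
          moreover have "cis y = cis pi" using \<open>y = - pi\<close> by (simp add: complex_eq_iff)
          moreover have "Arg (cis pi) = pi" by (rule Arg_cis) (use pi_gt_zero in auto)
          ultimately have "x = pi" using y(1) by simp
          then show False using x by simp
        qed
        then show ?thesis using True y a by auto
      next
        case False
        have "Arg (cis x) = x" by (rule Arg_cis) (use False x in auto)
        moreover have "Arg (cis y) = y" by (rule Arg_cis) (use False y a in auto)
        ultimately have "x = y" using y(1) by metis
        then show ?thesis using y(3) by simp
      qed
    qed (use x in \<open>auto simp: C_def\<close>)
    then show ?thesis by (simp add: indicator_def)
  qed
  have "(indicator {..a} :: real \<Rightarrow> real) \<in> borel_measurable circle_measure"
    by (intro measurable_restrict_space1 borel_measurable_indicator) auto
  then have i1: "(\<lambda>x. w x * indicator {..a} x) \<in> borel_measurable circle_measure"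
    using wi by (intro borel_measurable_times) auto
  have "(LINT x|circle_measure. w x * indicator {..a} x) = (LINT x|circle_measure. w x * indicator C (cis x))"
  proof (rule integral_cong_AE)
    show "(\<lambda>x. w x * indicator {..a} x) \<in> borel_measurable circle_measure" by (rule i1)
    have "(\<lambda>x. w x * H n (cis x)) \<in> borel_measurable circle_measure" for n
      using integrable_circle_mult[OF wi ccis[of n]] by auto
    then show "(\<lambda>x. w x * indicator C (cis x)) \<in> borel_measurable circle_measure"
      by (rule borel_measurable_LIMSEQ_real[rotated]) (rule tendsto_mult[OF tendsto_const lim])
    have "AE x in lebesgue. x \<noteq> pi" by (rule AE_completion) (rule AE_lborel_singleton)
    then show "AE x in circle_measure. w x * indicator {..a} x = w x * indicator C (cis x)"
      by (subst AE_restrict_space_iff) (use ind in auto)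
  qed
  then show ?thesis using 0 by simp
qed

text \<open>Half-lines form an intersection-stable generator of the Borel sets, so the integral over
  every Borel set vanishes, and then over every Lebesgue set. This determines the function up to
  null sets.\<close>

theorem coef_zero_AE:
  assumes w: "coef_zero w"
  shows "AE x in circle_measure. w x = 0"
proof -
  have wi: "integrable circle_measure w" using w by (simp add: coef_zero_def)
  have S: "{- pi..pi} \<inter> space lebesgue \<in> sets lebesgue" by simp
  define v where "v x = indicator {- pi..pi} x *\<^sub>R w x" for x
  have vi: "integrable lebesgue v" using wi unfolding v_def integrable_restrict_space[OF S] .
  have vA: "set_lebesgue_integral lebesgue A v = (LINT x|circle_measure. w x * indicator A x)" for A
    unfolding integral_restrict_space[OF S] set_lebesgue_integral_def
    by (rule Bochner_Integration.integral_cong) (auto simp: v_def)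
  have tot: "(LINT x|lebesgue. v x) = 0"
  proof -
    have "(LINT x|circle_measure. w x * cos (of_int 0 * x)) = 0" using w unfolding coef_zero_def by blast
    then show ?thesis unfolding v_def integral_restrict_space[OF S] by simp
  qed
  have half: "set_lebesgue_integral lebesgue {..a} v = 0" for a
  proof -
    consider "a < - pi" | "- pi \<le> a" "a < pi" | "pi \<le> a" by linarith
    then show ?thesis
    proof cases
      case 1
      then have "(\<lambda>x. indicator {..a} x *\<^sub>R v x) = (\<lambda>x. 0)" by (auto simp: v_def indicator_def)
      then show ?thesis by (simp add: set_lebesgue_integral_def)
    next
      case 2
      then show ?thesis using coef_zero_half_line[OF w] vA by simp
    next
      case 3
      then have "(\<lambda>x. indicator {..a} x *\<^sub>R v x) = v" by (auto simp: v_def indicator_def)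
      then show ?thesis using tot by (simp add: set_lebesgue_integral_def)
    qed
  qed
  have vset: "set_integrable lebesgue A v" if "A \<in> sets lebesgue" for A
    unfolding set_integrable_def by (rule integrable_mult_indicator[OF that vi])
  have leb: "A \<in> sets borel \<Longrightarrow> A \<in> sets lebesgue" for A :: "real set" by simp
  have sig: "A \<in> sigma_sets UNIV (range (\<lambda>a. {..a::real})) \<Longrightarrow> A \<in> sets lebesgue" for A
  proof -
    assume "A \<in> sigma_sets UNIV (range (\<lambda>a. {..a::real}))"
    then have "A \<in> sets borel" by (subst borel_eq_atMost) (simp add: sets_measure_of)
    then show ?thesis by (rule leb)
  qed
  have borel: "set_lebesgue_integral lebesgue A v = 0" if A: "A \<in> sets borel" for A
  proof -
    have mem: "A \<in> sigma_sets UNIV (range (\<lambda>a. {..a::real}))"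
      using A by (subst (asm) borel_eq_atMost) (simp add: sets_measure_of)
    have "Int_stable (range (\<lambda>a. {..a::real}))"
      by (auto simp: Int_stable_def min_def intro: exI[of _ "min _ _"])
    moreover have "range (\<lambda>a. {..a::real}) \<subseteq> Pow UNIV" by simp
    moreover note mem
    ultimately show ?thesis
    proof (induction rule: sigma_sets_induct_disjoint)
      case (basic A)
      then show ?case using half by auto
    next
      case empty
      then show ?case by (simp add: set_lebesgue_integral_def)
    next
      case (compl A)
      have Ab: "A \<in> sets lebesgue" using compl by (intro sig)
      have "set_lebesgue_integral lebesgue (A \<union> (UNIV - A)) v = set_lebesgue_integral lebesgue A v + set_lebesgue_integral lebesgue (UNIV - A) v"
        using Ab by (intro set_integral_Un vset) auto
      then show ?case using compl tot by (simp add: set_lebesgue_integral_def)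
    next
      case (union A)
      have Ab: "A i \<in> sets lebesgue" for i using union by (intro sig) auto
      show ?case
        using union Ab by (subst lebesgue_integral_countable_add) (auto simp: disjoint_family_on_def intro!: vset)
    qed
  qed
  have "AE x in lebesgue. v x = (\<lambda>_. 0) x"
  proof (rule density_unique_real)
    fix A :: "real set" assume A: "A \<in> sets lebesgue"
    \<comment> \<open>A Lebesgue set differs from a Borel set by a null set, which does not affect
      the integral.\<close>
    then obtain B N where B: "B \<in> sets borel" "negligible N" "B \<union> N = A"
      using sets_lebesgue_almost_borel by metis
    have Nn: "AE x in lebesgue. x \<notin> N" using B(2) by (simp add: negligible_iff_null_sets AE_not_in)
    have "set_lebesgue_integral lebesgue A v = set_lebesgue_integral lebesgue B v"
      unfolding set_lebesgue_integral_def
    proof (rule integral_cong_AE)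
      show "(\<lambda>x. indicator A x *\<^sub>R v x) \<in> borel_measurable lebesgue" "(\<lambda>x. indicator B x *\<^sub>R v x) \<in> borel_measurable lebesgue"
        using vset[OF A] vset[OF leb[OF B(1)]] unfolding set_integrable_def by auto
      show "AE x in lebesgue. indicator A x *\<^sub>R v x = indicator B x *\<^sub>R v x"
        using Nn by eventually_elim (use B(3) in \<open>auto simp: indicator_def\<close>)
    qed
    then show "set_lebesgue_integral lebesgue A v = set_lebesgue_integral lebesgue A (\<lambda>_. 0)"
      using borel[OF B(1)] by (simp add: set_lebesgue_integral_def)
  qed (use vi in auto)
  then show ?thesis by (subst AE_restrict_space_iff[OF S]) (auto simp: v_def elim: eventually_mono)
qed

text \<open>The integral of the square vanishes; a continuous nonnegative function with integral 0
  is 0 at every point of the closed interval, not merely almost everywhere.\<close>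

lemma coef_zero_continuous_0:
  assumes w: "coef_zero w" and c: "continuous_on {- pi..pi} w" and x: "x \<in> {- pi..pi}"
  shows "w x = 0"
proof -
  have cc: "continuous_on {- pi..pi} (\<lambda>x. w x * w x)" by (intro continuous_intros c)
  have "(LINT x|circle_measure. w x * w x) = (LINT x|circle_measure. 0)"
  proof (rule integral_cong_AE)
    show "(\<lambda>x. w x * w x) \<in> borel_measurable circle_measure"
      using integrable_circle_continuous[OF cc] by auto
  qed (use coef_zero_AE[OF w] in auto)
  then have "integral {- pi..pi} (\<lambda>x. w x * w x) = 0"
    using lebesgue_integral_eq_integral[OF integrable_circle_continuous[OF cc]] by simp
  then have "((\<lambda>x. w x * w x) has_integral 0) (cbox (- pi) pi)"
    using integrable_integral[OF integrable_continuous_real[OF cc]] by simp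
  moreover have "box (- pi) pi \<noteq> {}"
  proof -
    have "- pi < pi" using pi_gt_zero by linarith
    then show ?thesis by (metis box_real(1) greaterThanLessThan_empty_iff not_le)
  qed
  ultimately have "w x * w x = 0"
    using cc x by (intro has_integral_0_cbox_imp_0[of "- pi" pi "\<lambda>x. w x * w x" x]) auto
  then show ?thesis by simp
qed

section \<open>Fourier series of test functions\<close>

lemma integral_infsum:
  fixes \<phi> :: "'a \<Rightarrow> real \<Rightarrow> 'b::banach"
  assumes "\<And>k. continuous_on {a..b} (\<phi> k)" "M summable_on UNIV" "\<And>k x. x \<in> {a..b} \<Longrightarrow> norm (\<phi> k x) \<le> M k"
  shows "((\<lambda>k. integral {a..b} (\<phi> k)) has_sum integral {a..b} (\<lambda>x. \<Sum>\<^sub>\<infinity>k. \<phi> k x)) UNIV"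
proof -
  have "uniform_limit {a..b} (\<lambda>X x. \<Sum>k\<in>X. \<phi> k x) (\<lambda>x. \<Sum>\<^sub>\<infinity>k. \<phi> k x) (finite_subsets_at_top UNIV)"
    by (rule Weierstrass_m_test_general) (use assms in auto)
  then obtain I J where IJ: "\<And>X. ((\<lambda>x. \<Sum>k\<in>X. \<phi> k x) has_integral I X) {a..b}"
    "((\<lambda>x. \<Sum>\<^sub>\<infinity>k. \<phi> k x) has_integral J) {a..b}" "(I \<longlongrightarrow> J) (finite_subsets_at_top UNIV)"
    by (rule uniform_limit_integral) (auto intro!: continuous_on_sum assms)
  have "I X = (\<Sum>k\<in>X. integral {a..b} (\<phi> k))" if "finite X" for X
    using integral_unique[OF IJ(1)[of X]] integral_sum[OF that integrable_continuous_real[OF assms(1)]] by simp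
  then have ev: "\<forall>\<^sub>F X in finite_subsets_at_top UNIV. I X = (\<Sum>k\<in>X. integral {a..b} (\<phi> k))"
    by (intro eventually_finite_subsets_at_top_weakI) simp
  show ?thesis
    unfolding has_sum_def integral_unique[OF IJ(2)] using IJ(3) tendsto_cong[OF ev] by simp
qed

lemma continuous_cis [continuous_intros]: "continuous_on A f \<Longrightarrow> continuous_on A (\<lambda>x. cis (f x))"
  unfolding cis_conv_exp by (intro continuous_intros)

lemma cis_int_pi: "cis (of_int m * pi) = cis (of_int m * (- pi))"
  using sin_npi_int[of m] by (simp add: complex_eq_iff mult.commute)

lemma integral_cis: "integral {- pi..pi} (\<lambda>x. cis (of_int m * x)) = (if m = 0 then of_real (2 * pi) else 0)"
proof (cases "m = 0")
  case False
  have "((\<lambda>x. cis (of_int m * x)) has_integral (cis (of_int m * pi) / (\<i> * of_int m) - cis (of_int m * (- pi)) / (\<i> * of_int m))) {- pi..pi}"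
  proof (rule fundamental_theorem_of_calculus)
    fix x :: real
    have "((\<lambda>x. exp (x *\<^sub>R (\<i> * of_int m))) has_vector_derivative exp (x *\<^sub>R (\<i> * of_int m)) * (\<i> * of_int m)) (at x within {- pi..pi})"
      by (rule exp_scaleR_has_vector_derivative_right)
    then have "((\<lambda>x. exp (x *\<^sub>R (\<i> * of_int m)) / (\<i> * of_int m)) has_vector_derivative
        exp (x *\<^sub>R (\<i> * of_int m)) * (\<i> * of_int m) / (\<i> * of_int m)) (at x within {- pi..pi})"
      by (rule has_vector_derivative_divide)
    moreover have "exp (x *\<^sub>R (\<i> * of_int m)) = cis (of_int m * x)" for x
      by (simp add: cis_conv_exp scaleR_conv_of_real mult_ac)
    ultimately show "((\<lambda>x. cis (of_int m * x) / (\<i> * of_int m)) has_vector_derivative cis (of_int m * x)) (at x within {- pi..pi})"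
      using False by simp
  qed (use pi_ge_zero in linarith)
  moreover note cis_int_pi[of m]
  ultimately show ?thesis using False by (simp add: integral_unique)
qed (simp add: scaleR_conv_of_real)

lemma rep_deriv: "(Rep_ptest f has_real_derivative Rep_ptest (test_deriv f) x) (at x)"
  using smooth_periodic_has_deriv[of "Rep_ptest f" 0 x] Rep_ptest[of f] by (simp add: test_deriv.rep_eq)

lemma rep_cont [continuous_intros]: "continuous_on A h \<Longrightarrow> continuous_on A (\<lambda>x. Rep_ptest f (h x))"
  by (rule continuous_on_compose2[of UNIV "Rep_ptest f"])
    (auto intro!: continuous_at_imp_continuous_on DERIV_isCont[OF rep_deriv])

lemma rep_periodic: "Rep_ptest f (x + 2 * pi) = Rep_ptest f x"
  using Rep_ptest[of f] by (simp add: smooth_periodic_def)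

lemma rep_bound: "\<bar>Rep_ptest f x\<bar> \<le> test_norm 0 f"
  using deriv_le_SUP[of 0 f x] by (simp add: test_norm_def)

lemma rep_funpow: "(deriv ^^ n) (Rep_ptest f) = Rep_ptest ((test_deriv ^^ n) f)"
  by (induction n) (simp_all add: test_deriv.rep_eq)

text \<open>With the sign \<open>+ i k x\<close> and without the factor \<open>1 / (2 * pi)\<close>
  this is dual to \<open>fcoef\<close>: the pairing of a distribution with \<open>f\<close> becomes
  the sum of the products of coefficients.\<close>

definition test_coef :: "ptest \<Rightarrow> int \<Rightarrow> complex" where
  "test_coef f k = integral {- pi..pi} (\<lambda>x. of_real (Rep_ptest f x) * cis (of_int k * x))"

lemma test_coef_has_integral: "((\<lambda>x. of_real (Rep_ptest f x) * cis (of_int k * x)) has_integral test_coef f k) {- pi..pi}"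
  unfolding test_coef_def by (intro integrable_integral integrable_continuous_real continuous_intros)

lemma test_coef_lincomb: "test_coef (a *\<^sub>R f + b *\<^sub>R g) k = of_real a * test_coef f k + of_real b * test_coef g k"
proof -
  have "((\<lambda>x. of_real a * (of_real (Rep_ptest f x) * cis (of_int k * x)) + of_real b * (of_real (Rep_ptest g x) * cis (of_int k * x))) has_integral of_real a * test_coef f k + of_real b * test_coef g k) {- pi..pi}"
    by (intro has_integral_add has_integral_mult_right test_coef_has_integral)
  then show ?thesis
    unfolding test_coef_def by (intro integral_unique) (simp add: plus_ptest.rep_eq scaleR_ptest.rep_eq algebra_simps)
qed

lemma test_coef_uminus: "test_coef f (- k) = cnj (test_coef f k)"
  unfolding test_coef_def integral_cnj by (simp add: cis_cnj)

lemma test_coef_Re: "((\<lambda>x. Rep_ptest f x * cos (of_int k * x)) has_integral Re (test_coef f k)) {- pi..pi}"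
  and test_coef_Im: "((\<lambda>x. Rep_ptest f x * sin (of_int k * x)) has_integral Im (test_coef f k)) {- pi..pi}"
  using has_integral_Re[OF test_coef_has_integral[of f k]] has_integral_Im[OF test_coef_has_integral[of f k]] by simp_all

lemma test_coef_test_deriv: "test_coef (test_deriv f) k = - (\<i> * of_int k) * test_coef f k"
proof -
  let ?c = "\<lambda>x. cis (of_int k * x)"
  have d: "((\<lambda>x. of_real (Rep_ptest f x) * ?c x) has_vector_derivative
      of_real (Rep_ptest f x) * (\<i> * of_int k * ?c x) + of_real (Rep_ptest (test_deriv f) x) * ?c x) (at x within {- pi..pi})" for x
  proof (rule has_vector_derivative_mult)
    show "((\<lambda>x. complex_of_real (Rep_ptest f x)) has_vector_derivative of_real (Rep_ptest (test_deriv f) x)) (at x within {- pi..pi})"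
      by (rule has_vector_derivative_of_real) (use rep_deriv[of f x] in \<open>auto intro: has_vector_derivative_at_within simp: has_real_derivative_iff_has_vector_derivative\<close>)
    have "((\<lambda>x. exp (x *\<^sub>R (\<i> * of_int k))) has_vector_derivative exp (x *\<^sub>R (\<i> * of_int k)) * (\<i> * of_int k)) (at x within {- pi..pi})"
      by (rule exp_scaleR_has_vector_derivative_right)
    moreover have "exp (x *\<^sub>R (\<i> * of_int k)) = ?c x" for x
      by (simp add: cis_conv_exp scaleR_conv_of_real mult_ac)
    ultimately show "(?c has_vector_derivative \<i> * of_int k * ?c x) (at x within {- pi..pi})" by (simp add: mult.commute)
  qed
  have p: "Rep_ptest f pi = Rep_ptest f (- pi)" using rep_periodic[of f "- pi"] by simp
  have c: "?c pi = ?c (- pi)" by (rule cis_int_pi)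
  have "((\<lambda>x. of_real (Rep_ptest f x) * (\<i> * of_int k * ?c x) + of_real (Rep_ptest (test_deriv f) x) * ?c x) has_integral
      (of_real (Rep_ptest f pi) * ?c pi - of_real (Rep_ptest f (- pi)) * ?c (- pi))) {- pi..pi}"
    by (rule fundamental_theorem_of_calculus[OF _ d]) (use pi_ge_zero in linarith)
  then have I1: "((\<lambda>x. of_real (Rep_ptest f x) * (\<i> * of_int k * ?c x) + of_real (Rep_ptest (test_deriv f) x) * ?c x) has_integral 0) {- pi..pi}"
    unfolding p c by simp
   have I2: "((\<lambda>x. \<i> * of_int k * (of_real (Rep_ptest f x) * ?c x) + of_real (Rep_ptest (test_deriv f) x) * ?c x) has_integral
      (\<i> * of_int k * test_coef f k + test_coef (test_deriv f) k)) {- pi..pi}"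
    by (intro has_integral_add has_integral_mult_right test_coef_has_integral)
   have I3: "(\<lambda>x. of_real (Rep_ptest f x) * (\<i> * of_int k * ?c x) + of_real (Rep_ptest (test_deriv f) x) * ?c x) =
     (\<lambda>x. \<i> * of_int k * (of_real (Rep_ptest f x) * ?c x) + of_real (Rep_ptest (test_deriv f) x) * ?c x)"
    by (simp add: mult_ac)
  have "\<i> * of_int k * test_coef f k + test_coef (test_deriv f) k = 0" by (rule has_integral_unique[OF I2 I1[unfolded I3]])
  then show ?thesis by (simp add: eq_neg_iff_add_eq_0 add.commute)
qed

lemma test_coef_bound_0: "cmod (test_coef f k) \<le> 2 * pi * test_norm 0 f"
proof -
  have "norm (test_coef f k) \<le> integral {- pi..pi} (\<lambda>x. test_norm 0 f)"
    unfolding test_coef_def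
  proof (rule integral_norm_bound_integral)
    show "(\<lambda>x. of_real (Rep_ptest f x) * cis (of_int k * x)) integrable_on {- pi..pi}" using test_coef_has_integral by blast
    show "norm (of_real (Rep_ptest f x) * cis (of_int k * x)) \<le> test_norm 0 f" for x
      using rep_bound[of f x] by (simp add: norm_mult)
  qed auto
  then show ?thesis by simp
qed

text \<open>Four integrations by parts give two powers of \<open>jb\<close>. One pays for
  coefficients that grow like \<open>jb\<close>, the other makes the pairing summable. The 8 arises
  from \<open>(jb k)\<^sup>2 \<le> 2 + 2 * k ^ 4\<close>.\<close>

lemma test_coef_bound: "(jb k)\<^sup>2 * cmod (test_coef f k) \<le> 8 * pi * test_norm 4 f"
proof -
  have "(test_deriv ^^ 4) f = test_deriv (test_deriv (test_deriv (test_deriv f)))" by (simp add: numeral_eq_Suc)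
  then have "test_coef ((test_deriv ^^ 4) f) k = (- (\<i> * of_int k)) ^ 4 * test_coef f k"
    by (simp only: test_coef_test_deriv power4_eq_xxxx mult.assoc)
  then have "(of_int k) ^ 4 * cmod (test_coef f k) = cmod (test_coef ((test_deriv ^^ 4) f) k)" by (simp add: norm_mult norm_power)
  also have "\<dots> \<le> 2 * pi * test_norm 0 ((test_deriv ^^ 4) f)" by (rule test_coef_bound_0)
  also have "test_norm 0 ((test_deriv ^^ 4) f) \<le> test_norm 4 f"
  proof -
    have "test_norm 0 ((test_deriv ^^ 4) f) = (SUP x. \<bar>(deriv ^^ 4) (Rep_ptest f) x\<bar>)" by (simp add: test_norm_def rep_funpow)
    also have "\<dots> \<le> test_norm 4 f" unfolding test_norm_def
      by (rule member_le_sum[where f = "\<lambda>n. SUP x. \<bar>(deriv ^^ n) (Rep_ptest f) x\<bar>"]) (auto intro: SUP_deriv_nonneg)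
    finally show ?thesis .
  qed
  finally have 4: "(of_int k) ^ 4 * cmod (test_coef f k) \<le> 2 * pi * test_norm 4 f" by simp
  have 0: "cmod (test_coef f k) \<le> 2 * pi * test_norm 4 f"
    by (rule order_trans[OF test_coef_bound_0 mult_left_mono[OF test_norm_mono]]) auto
  have "0 \<le> (1 - (of_int k :: real)\<^sup>2)\<^sup>2" by simp
  then have "(jb k)\<^sup>2 \<le> 2 + 2 * (of_int k) ^ 4" by (simp add: power2_eq_square power4_eq_xxxx algebra_simps)
  then have "(jb k)\<^sup>2 * cmod (test_coef f k) \<le> (2 + 2 * (of_int k) ^ 4) * cmod (test_coef f k)" by (rule mult_right_mono) simp
  then show ?thesis using 0 4 by (simp add: distrib_right)
qed

lemma summable_jb: "(\<lambda>k::int. inverse (jb k)) summable_on UNIV"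
proof -
  have "(\<lambda>k. \<bar>inverse (jb k)\<bar>) summable_on (UNIV :: int set)"
  proof (rule summable_on_int_nat)
    show "summable (\<lambda>n. inverse (1 + (real n)\<^sup>2))"
      by (rule summable_comparison_test'[OF inverse_power_summable[of 2], of 1])
        (auto intro!: le_imp_inverse_le)
  qed auto
  then show ?thesis by (simp add: abs_of_nonneg add_nonneg_nonneg)
qed

lemma test_coef_dom: "jb k * cmod (test_coef f k) \<le> 8 * pi * test_norm 4 f * inverse (jb k)"
  using test_coef_bound[of k f] jb_pos[of k] by (simp add: power2_eq_square field_simps)

lemma test_coef_dom': "cmod (test_coef f k) \<le> 8 * pi * test_norm 4 f * inverse (jb k)"
proof -
  have "1 * cmod (test_coef f k) \<le> jb k * cmod (test_coef f k)" by (intro mult_right_mono jb_ge_1) simp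
  then show ?thesis using test_coef_dom[of k f] by simp
qed

section \<open>Distributions and their Fourier coefficients\<close>

text \<open>Growth of order 2 in \<open>k\<close>. It covers \<open>H^r\<close> for
  \<open>r \<ge> - 2\<close> as well as the nonlinearity applied to an absolutely convergent
  series.\<close>

definition bdd_coef :: "(int \<Rightarrow> complex) \<Rightarrow> bool" where
  "bdd_coef c \<longleftrightarrow> (\<exists>C\<ge>0. \<forall>k. cmod (c k) \<le> C * jb k)"

lemma coef_test_coef_bound:
  assumes "\<And>k. cmod (c k) \<le> C * jb k" "0 \<le> C"
  shows "cmod (c k * test_coef f k) \<le> C * (8 * pi * test_norm 4 f) * inverse (jb k)"
proof -
  have "cmod (c k * test_coef f k) \<le> (C * jb k) * cmod (test_coef f k)"
    unfolding norm_mult by (intro mult_right_mono assms) simp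
  also have "\<dots> \<le> C * (8 * pi * test_norm 4 f * inverse (jb k))"
    unfolding mult.assoc using mult_left_mono[OF test_coef_dom[of k f] assms(2)] by (simp only: mult.assoc)
  finally show ?thesis by (simp only: mult.assoc)
qed

lemma coef_test_coef_summable:
  assumes "\<And>k. cmod (c k) \<le> C * jb k" "0 \<le> C"
  shows "(\<lambda>k. norm (c k * test_coef f k)) summable_on UNIV" "(\<lambda>k. Re (c k * test_coef f k)) summable_on UNIV"
    and "\<bar>\<Sum>\<^sub>\<infinity>k. Re (c k * test_coef f k)\<bar> \<le> C * (8 * pi * (\<Sum>\<^sub>\<infinity>k::int. inverse (jb k))) * test_norm 4 f"
proof -
  let ?M = "\<lambda>k::int. C * (8 * pi * test_norm 4 f) * inverse (jb k)"
  have M: "?M summable_on UNIV" by (intro summable_on_cmult_right summable_jb)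
  show 1: "(\<lambda>k. norm (c k * test_coef f k)) summable_on UNIV"
    by (rule summable_on_comparison_test[OF M coef_test_coef_bound[OF assms]]) simp
  have 2: "(\<lambda>k. norm (Re (c k * test_coef f k))) summable_on UNIV"
    by (rule summable_on_comparison_test[OF 1]) (auto simp: abs_Re_le_cmod simp del: times_complex.sel)
  then show "(\<lambda>k. Re (c k * test_coef f k)) summable_on UNIV" by (rule abs_summable_summable)
  have "norm (\<Sum>\<^sub>\<infinity>k. Re (c k * test_coef f k)) \<le> (\<Sum>\<^sub>\<infinity>k. norm (Re (c k * test_coef f k)))" by (rule norm_infsum_bound[OF 2])
  also have "\<dots> \<le> infsum ?M UNIV"
    by (rule infsum_mono[OF 2 M]) (use coef_test_coef_bound[OF assms] abs_Re_le_cmod order_trans in \<open>metis real_norm_def\<close>)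
  also have "\<dots> = C * (8 * pi * (\<Sum>\<^sub>\<infinity>k::int. inverse (jb k))) * test_norm 4 f"
    by (simp add: infsum_cmult_right' mult_ac)
  finally show "\<bar>\<Sum>\<^sub>\<infinity>k. Re (c k * test_coef f k)\<bar> \<le> C * (8 * pi * (\<Sum>\<^sub>\<infinity>k::int. inverse (jb k))) * test_norm 4 f" by simp
qed

text \<open>For coefficients with \<open>c (- k) = cnj (c k)\<close> the terms of \<open>k\<close>
  and \<open>- k\<close> are conjugate, so the real part loses nothing; it makes the functional
  real-valued.\<close>

definition dist_of_coef :: "(int \<Rightarrow> complex) \<Rightarrow> pdist" where
  "dist_of_coef c = Abs_pdist (\<lambda>f. \<Sum>\<^sub>\<infinity>k. Re (c k * test_coef f k))"

lemma pairing_dist_of_coef: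
  assumes "bdd_coef c"
  shows "pairing (dist_of_coef c) f = (\<Sum>\<^sub>\<infinity>k. Re (c k * test_coef f k))"
proof -
  obtain C where C: "C \<ge> 0" "\<And>k. cmod (c k) \<le> C * jb k" using assms by (auto simp: bdd_coef_def)
  note s = coef_test_coef_summable[OF C(2,1)]
  have lin: "(\<Sum>\<^sub>\<infinity>k. Re (c k * test_coef (a *\<^sub>R f + b *\<^sub>R g) k)) = a * (\<Sum>\<^sub>\<infinity>k. Re (c k * test_coef f k)) + b * (\<Sum>\<^sub>\<infinity>k. Re (c k * test_coef g k))" for a b f g
  proof -
    have "Re (c k * test_coef (a *\<^sub>R f + b *\<^sub>R g) k) = a * Re (c k * test_coef f k) + b * Re (c k * test_coef g k)" for k
      by (simp add: test_coef_lincomb algebra_simps)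
    then have "(\<Sum>\<^sub>\<infinity>k. Re (c k * test_coef (a *\<^sub>R f + b *\<^sub>R g) k)) = (\<Sum>\<^sub>\<infinity>k. a * Re (c k * test_coef f k) + b * Re (c k * test_coef g k))" by simp
    also have "\<dots> = (\<Sum>\<^sub>\<infinity>k. a * Re (c k * test_coef f k)) + (\<Sum>\<^sub>\<infinity>k. b * Re (c k * test_coef g k))"
      by (intro infsum_add summable_on_cmult_right s(2))
    finally show ?thesis by (simp only: infsum_cmult_right')
  qed
  have "linear (\<lambda>f. \<Sum>\<^sub>\<infinity>k. Re (c k * test_coef f k))"
  proof (rule linearI)
    show "(\<Sum>\<^sub>\<infinity>k. Re (c k * test_coef (f + g) k)) = (\<Sum>\<^sub>\<infinity>k. Re (c k * test_coef f k)) + (\<Sum>\<^sub>\<infinity>k. Re (c k * test_coef g k))" for f g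
      using lin[of 1 f 1 g] by simp
    show "(\<Sum>\<^sub>\<infinity>k. Re (c k * test_coef (a *\<^sub>R f) k)) = a *\<^sub>R (\<Sum>\<^sub>\<infinity>k. Re (c k * test_coef f k))" for f a
      using lin[of a f 0 f] by simp
  qed
  moreover have "\<exists>N C. \<forall>f. \<bar>\<Sum>\<^sub>\<infinity>k. Re (c k * test_coef f k)\<bar> \<le> C * test_norm N f"
    using s(3) by blast
  ultimately have "cont_functional (\<lambda>f. \<Sum>\<^sub>\<infinity>k. Re (c k * test_coef f k))" by (simp add: cont_functional_def)
  then show ?thesis by (simp add: dist_of_coef_def Abs_pdist_inverse)
qed

lemma pairing_linear: "linear (pairing u)" and pairing_cont: "\<exists>N C. \<forall>f. \<bar>pairing u f\<bar> \<le> C * test_norm N f"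
  using pairing[of u] by (auto simp: cont_functional_def)

lemma integral_cis_mult:
  "integral {- pi..pi} (\<lambda>x. of_real (cos (of_int m * x)) * cis (of_int k * x)) = (if k = m then of_real pi else 0) + (if k = - m then of_real pi else 0)"
  "integral {- pi..pi} (\<lambda>x. of_real (sin (of_int m * x)) * cis (of_int k * x)) = (if k = m then \<i> * of_real pi else 0) - (if k = - m then \<i> * of_real pi else 0)"
proof -
  have i: "((\<lambda>x. cis (of_int l * x)) has_integral (if l = 0 then of_real (2 * pi) else 0)) {- pi..pi}" for l :: int
    unfolding integral_cis[symmetric] by (intro integrable_integral integrable_continuous_real continuous_intros)
  have k1: "of_int (k + m) * x = of_int k * x + of_int m * x" "of_int (k - m) * x = of_int k * x - of_int m * x" for x :: real
    by (simp_all add: algebra_simps)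
  have c: "of_real (cos (of_int m * x)) * cis (of_int k * x) = 1/2 * cis (of_int (k + m) * x) + 1/2 * cis (of_int (k - m) * x)" for x
    unfolding k1 by (simp add: complex_eq_iff cos_add sin_add cos_diff sin_diff field_simps)
  have s: "of_real (sin (of_int m * x)) * cis (of_int k * x) = - (\<i>/2) * cis (of_int (k + m) * x) + (\<i>/2) * cis (of_int (k - m) * x)" for x
    unfolding k1 by (simp add: complex_eq_iff cos_add sin_add cos_diff sin_diff field_simps)
  have 1: "k + m = 0 \<longleftrightarrow> k = - m" "k - m = 0 \<longleftrightarrow> k = m" by auto
  show "integral {- pi..pi} (\<lambda>x. of_real (cos (of_int m * x)) * cis (of_int k * x)) = (if k = m then of_real pi else 0) + (if k = - m then of_real pi else 0)"
    unfolding c using has_integral_add[OF has_integral_mult_right[OF i[of "k + m"], of "1/2"] has_integral_mult_right[OF i[of "k - m"], of "1/2"]]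
    by (intro integral_unique) (auto simp: 1 split: if_splits)
  show "integral {- pi..pi} (\<lambda>x. of_real (sin (of_int m * x)) * cis (of_int k * x)) = (if k = m then \<i> * of_real pi else 0) - (if k = - m then \<i> * of_real pi else 0)"
    unfolding s using has_integral_add[OF has_integral_mult_right[OF i[of "k + m"], of "- (\<i>/2)"] has_integral_mult_right[OF i[of "k - m"], of "\<i>/2"]]
    by (intro integral_unique) (auto simp: 1 split: if_splits)
qed

lemma test_coef_trig:
  "test_coef (test_cos m) k = (if k = m then of_real pi else 0) + (if k = - m then of_real pi else 0)"
  "test_coef (test_sin m) k = (if k = m then \<i> * of_real pi else 0) - (if k = - m then \<i> * of_real pi else 0)"
  unfolding test_coef_def test_cos.rep_eq test_sin.rep_eq by (rule integral_cis_mult)+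

lemma infsum_two_points:
  fixes A B :: real and m n :: int
  shows "((\<lambda>k. (if k = m then A else 0) + (if k = n then B else 0)) has_sum (A + B)) UNIV"
proof (rule has_sum_add)
  have "((\<lambda>k. if k = m then A else 0) has_sum A) UNIV" for m :: int and A :: real
    by (rule has_sum_finite_neutralI[of "{m}"]) auto
  then show "((\<lambda>k. if k = m then A else 0) has_sum A) UNIV" "((\<lambda>k. if k = n then B else 0) has_sum B) UNIV" by auto
qed

lemma infsum_two_pointsI:
  fixes A B :: real and m n :: int
  assumes "\<And>k. f k = (if k = m then A else 0) + (if k = n then B else 0)"
  shows "infsum f UNIV = A + B"
  unfolding assms by (rule infsumI[OF infsum_two_points])

lemma fcoef_dist_of_coef:
  assumes "bdd_coef c" "\<And>k. c (- k) = cnj (c k)"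
  shows "fcoef (dist_of_coef c) = c"
proof
  fix m
  have "pairing (dist_of_coef c) (test_cos m) = Re (c m) * pi + Re (c (- m)) * pi"
    unfolding pairing_dist_of_coef[OF assms(1)] test_coef_trig
    by (rule infsum_two_pointsI[where m = m and n = "- m"]) auto
  moreover have "pairing (dist_of_coef c) (test_sin m) = - Im (c m) * pi + Im (c (- m)) * pi"
    unfolding pairing_dist_of_coef[OF assms(1)] test_coef_trig
    by (rule infsum_two_pointsI[where m = m and n = "- m"]) auto
  ultimately show "fcoef (dist_of_coef c) m = c m"
    by (simp add: fcoef_def assms(2) complex_eq_iff field_simps)
qed

section \<open>Density of trigonometric polynomials among the test functions\<close>

definition partial :: "nat \<Rightarrow> ptest \<Rightarrow> ptest" where
  "partial n f = (\<Sum>k\<in>{- int n..int n}. (Re (test_coef f k) / (2 * pi)) *\<^sub>R test_cos k + (Im (test_coef f k) / (2 * pi)) *\<^sub>R test_sin k)"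

lemma rep_sum: "Rep_ptest (\<Sum>k\<in>K. f k) x = (\<Sum>k\<in>K. Rep_ptest (f k) x)"
  by (induction K rule: infinite_finite_induct) (auto simp: zero_ptest.rep_eq plus_ptest.rep_eq)

lemma rep_partial: "Rep_ptest (partial n f) x = (\<Sum>k\<in>{- int n..int n}. Re (test_coef f k * cis (- of_int k * x)) / (2 * pi))"
  unfolding partial_def rep_sum
  by (intro sum.cong) (auto simp: plus_ptest.rep_eq scaleR_ptest.rep_eq test_cos.rep_eq test_sin.rep_eq add_divide_distrib)

lemma test_deriv_trig: "test_deriv (test_cos k) = (- of_int k) *\<^sub>R test_sin k" "test_deriv (test_sin k) = of_int k *\<^sub>R test_cos k"
proof -
  have "(\<lambda>x. cos (of_int k * x)) = Rep_ptest (test_cos k)" "(\<lambda>x. sin (of_int k * x)) = Rep_ptest (test_sin k)"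
    by (simp_all add: test_cos.rep_eq test_sin.rep_eq)
  have "((\<lambda>x. cos (of_int k * x)) has_real_derivative - of_int k * sin (of_int k * x)) (at x)" for x :: real
    by (auto intro!: derivative_eq_intros)
  then have 1: "deriv (\<lambda>x::real. cos (of_int k * x)) = (\<lambda>x. - of_int k * sin (of_int k * x))"
    by (intro ext DERIV_imp_deriv)
  have "((\<lambda>x. sin (of_int k * x)) has_real_derivative of_int k * cos (of_int k * x)) (at x)" for x :: real
    by (auto intro!: derivative_eq_intros)
  then have 2: "deriv (\<lambda>x::real. sin (of_int k * x)) = (\<lambda>x. of_int k * cos (of_int k * x))"
    by (intro ext DERIV_imp_deriv)
  show "test_deriv (test_cos k) = (- of_int k) *\<^sub>R test_sin k" "test_deriv (test_sin k) = of_int k *\<^sub>R test_cos k"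
    by (simp_all add: Rep_ptest_inject[symmetric] test_deriv.rep_eq scaleR_ptest.rep_eq uminus_ptest.rep_eq test_cos.rep_eq test_sin.rep_eq 1 2)
qed

lemma test_deriv_partial: "test_deriv (partial n f) = partial n (test_deriv f)"
  unfolding partial_def linear_sum[OF linear_test_deriv]
proof (rule sum.cong)
  fix k
  have "Re (test_coef (test_deriv f) k) = of_int k * Im (test_coef f k)" "Im (test_coef (test_deriv f) k) = - of_int k * Re (test_coef f k)"
    by (simp_all add: test_coef_test_deriv)
  then show "test_deriv ((Re (test_coef f k) / (2 * pi)) *\<^sub>R test_cos k + (Im (test_coef f k) / (2 * pi)) *\<^sub>R test_sin k) =
      (Re (test_coef (test_deriv f) k) / (2 * pi)) *\<^sub>R test_cos k + (Im (test_coef (test_deriv f) k) / (2 * pi)) *\<^sub>R test_sin k"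
    by (simp add: linear_add[OF linear_test_deriv] linear_scale[OF linear_test_deriv] test_deriv_trig mult.commute add.commute)
qed simp

text \<open>The series converges uniformly, and integrating it term by term returns the coefficients
  of \<open>f\<close>. The difference is continuous with vanishing coefficients, hence 0 on one
  period and by periodicity everywhere.\<close>

lemma rep_fourier: "Rep_ptest f x = (\<Sum>\<^sub>\<infinity>k. Re (test_coef f k * cis (- of_int k * x)) / (2 * pi))"
proof -
  define S where "S x = (\<Sum>\<^sub>\<infinity>k. Re (test_coef f k * cis (- of_int k * x)) / (2 * pi))" for x
  let ?M = "\<lambda>k::int. 8 * pi * test_norm 4 f * inverse (jb k)"
  have M: "?M summable_on UNIV" by (intro summable_on_cmult_right summable_jb)
  have dom: "norm (Re (test_coef f k * cis (- of_int k * x)) / (2 * pi)) \<le> ?M k" for k x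
  proof -
    have "\<bar>Re (test_coef f k * cis (- of_int k * x))\<bar> \<le> cmod (test_coef f k * cis (- of_int k * x))" by (rule abs_Re_le_cmod)
    also have "\<dots> = cmod (test_coef f k)" by (simp add: norm_mult)
    also have "\<dots> \<le> ?M k" by (rule test_coef_dom')
    finally have 1: "\<bar>Re (test_coef f k * cis (- of_int k * x))\<bar> \<le> ?M k" .
    have "1 \<le> 2 * pi" using pi_gt3 by simp
    then have "\<bar>Re (test_coef f k * cis (- of_int k * x))\<bar> / (2 * pi) \<le> \<bar>Re (test_coef f k * cis (- of_int k * x))\<bar> / 1"
      by (intro divide_left_mono) auto
    then show ?thesis using 1 by (simp only: real_norm_def abs_divide) simp
  qed
  have contk: "continuous_on A (\<lambda>x. Re (test_coef f k * cis (- of_int k * x)) / (2 * pi))" for k A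
    by (intro continuous_intros) auto
  have Sc: "continuous_on A S" for A
    unfolding S_def by (rule continuous_on_infsum[OF contk M dom])
  let ?w = "\<lambda>x. Rep_ptest f x - S x"
  have coefS: "integral {- pi..pi} (\<lambda>x. S x * \<psi> x) = (\<Sum>\<^sub>\<infinity>k. Re (test_coef f k * integral {- pi..pi} (\<lambda>x. of_real (\<psi> x) * cis (of_int (- k) * x))) / (2 * pi))"
    if \<psi>: "continuous_on {- pi..pi} \<psi>" "\<And>x. \<bar>\<psi> x\<bar> \<le> 1" for \<psi> :: "real \<Rightarrow> real"
  proof -
    let ?\<phi> = "\<lambda>k x. Re (test_coef f k * cis (- of_int k * x)) / (2 * pi) * \<psi> x"
    have "((\<lambda>k. integral {- pi..pi} (?\<phi> k)) has_sum integral {- pi..pi} (\<lambda>x. \<Sum>\<^sub>\<infinity>k. ?\<phi> k x)) UNIV"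
    proof (rule integral_infsum[OF _ M])
      show "continuous_on {- pi..pi} (?\<phi> k)" for k by (intro continuous_intros \<psi>) auto
      fix k x
      have "norm (?\<phi> k x) = norm (Re (test_coef f k * cis (- of_int k * x)) / (2 * pi)) * \<bar>\<psi> x\<bar>"
        by (simp only: real_norm_def abs_mult)
      also have "\<dots> \<le> norm (Re (test_coef f k * cis (- of_int k * x)) / (2 * pi)) * 1" by (intro mult_left_mono \<psi>) simp
      finally show "norm (?\<phi> k x) \<le> ?M k" using dom[of k x] by linarith
    qed
    moreover have "(\<Sum>\<^sub>\<infinity>k. ?\<phi> k x) = S x * \<psi> x" for x by (simp only: S_def infsum_cmult_left')
    moreover have "integral {- pi..pi} (?\<phi> k) = Re (test_coef f k * integral {- pi..pi} (\<lambda>x. of_real (\<psi> x) * cis (of_int (- k) * x))) / (2 * pi)" for k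
    proof -
      have "((\<lambda>x. of_real (\<psi> x) * cis (of_int (- k) * x)) has_integral integral {- pi..pi} (\<lambda>x. of_real (\<psi> x) * cis (of_int (- k) * x))) {- pi..pi}"
        by (intro integrable_integral integrable_continuous_real continuous_intros \<psi>)
      from has_integral_divide[OF has_integral_Re[OF has_integral_mult_right[OF this, of "test_coef f k"]], of "2 * pi"]
      show ?thesis by (intro integral_unique) (simp add: algebra_simps)
    qed
    ultimately show ?thesis by (simp add: infsumI)
  qed
  have wc: "continuous_on {- pi..pi} ?w" by (intro continuous_intros Sc)
  have cz: "coef_zero ?w"
    unfolding coef_zero_def
  proof (intro conjI allI)
    show "integrable circle_measure ?w" by (rule integrable_circle_continuous[OF wc])
    fix m :: int
    have L: "(LINT x|circle_measure. ?w x * \<psi> x) = integral {- pi..pi} (\<lambda>x. Rep_ptest f x * \<psi> x) - integral {- pi..pi} (\<lambda>x. S x * \<psi> x)"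
      if \<psi>: "continuous_on {- pi..pi} \<psi>" for \<psi>
    proof -
      have "(LINT x|circle_measure. ?w x * \<psi> x) = integral {- pi..pi} (\<lambda>x. ?w x * \<psi> x)"
        by (intro lebesgue_integral_eq_integral integrable_circle_continuous continuous_intros Sc \<psi>) auto
      also have "\<dots> = integral {- pi..pi} (\<lambda>x. Rep_ptest f x * \<psi> x - S x * \<psi> x)" by (simp add: left_diff_distrib)
      also have "\<dots> = integral {- pi..pi} (\<lambda>x. Rep_ptest f x * \<psi> x) - integral {- pi..pi} (\<lambda>x. S x * \<psi> x)"
        by (intro Henstock_Kurzweil_Integration.integral_diff integrable_continuous_real continuous_intros Sc \<psi>)
      finally show ?thesis .
    qed
    have Sm: "Re (test_coef f (- m)) = Re (test_coef f m)" "Im (test_coef f (- m)) = - Im (test_coef f m)" by (simp_all add: test_coef_uminus)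
    have "integral {- pi..pi} (\<lambda>x. S x * cos (of_int m * x)) = Re (test_coef f m) / 2 + Re (test_coef f (- m)) / 2"
      unfolding coefS[of "\<lambda>x. cos (of_int m * x)", OF continuous_on_cos[OF continuous_on_mult_left[OF continuous_on_id]] abs_cos_le_one] integral_cis_mult
      by (rule infsum_two_pointsI[where m = m and n = "- m"]) auto
    then show "(LINT x|circle_measure. ?w x * cos (of_int m * x)) = 0"
      using integral_unique[OF test_coef_Re[of f m]] Sm by (subst L) (auto intro!: continuous_intros)
    have "integral {- pi..pi} (\<lambda>x. S x * sin (of_int m * x)) = Im (test_coef f m) / 2 + (- Im (test_coef f (- m)) / 2)"
      unfolding coefS[of "\<lambda>x. sin (of_int m * x)", OF continuous_on_sin[OF continuous_on_mult_left[OF continuous_on_id]] abs_sin_le_one] integral_cis_mult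
      by (rule infsum_two_pointsI[where m = m and n = "- m"]) auto
    then show "(LINT x|circle_measure. ?w x * sin (of_int m * x)) = 0"
      using integral_unique[OF test_coef_Im[of f m]] Sm by (subst L) (auto intro!: continuous_intros)
  qed
  have base: "Rep_ptest f x = S x" if "x \<in> {- pi..pi}" for x
    using coef_zero_continuous_0[OF cz wc that] by simp
  have Sper: "S (x + 2 * pi) = S x" for x
  proof -
    have "cis (- of_int k * (x + 2 * pi)) = cis (- of_int k * x)" for k :: int
    proof -
      have "of_int k * (x + 2 * pi) = of_int k * x + 2 * pi * of_int k" by (simp add: algebra_simps)
      then show ?thesis by (simp add: complex_eq_iff cos_diff sin_diff cos_add sin_add)
    qed
    then show ?thesis by (simp only: S_def)
  qed
  interpret P: periodic_fun_simple "\<lambda>x. ?w x" "2 * pi"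
    by standard (simp add: rep_periodic Sper)
  have "?w x = 0" for x
  proof -
    let ?m = "\<lfloor>(x + pi) / (2 * pi)\<rfloor>"
    have "of_int ?m * (2 * pi) \<le> x + pi" "x + pi < (of_int ?m + 1) * (2 * pi)"
      using floor_divide_lower[of "2 * pi" "x + pi"] floor_divide_upper[of "2 * pi" "x + pi"] by auto
    then have "x - of_int ?m * (2 * pi) \<in> {- pi..pi}" by (auto simp: algebra_simps)
    from base[OF this] show ?thesis using P.minus_of_int[of x ?m] by simp
  qed
  then show ?thesis by (simp add: S_def)
qed

lemma pdist_eq_iff: "u = v \<longleftrightarrow> (\<forall>f. pairing u f = pairing v f)"
  by (metis pairing_inject ext)

lemma int_partial_sums_tendsto:
  assumes "(g has_sum l) (UNIV :: int set)"
  shows "(\<lambda>n. \<Sum>k\<in>{- int n..int n}. g k) \<longlonglongrightarrow> l"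
proof -
  have "filterlim (\<lambda>n. {- int n..int n}) (finite_subsets_at_top UNIV) sequentially"
    unfolding filterlim_finite_subsets_at_top
  proof (intro allI impI)
    fix X :: "int set" assume X: "finite X \<and> X \<subseteq> UNIV"
    obtain B where B: "\<And>x. x \<in> X \<Longrightarrow> nat \<bar>x\<bar> \<le> B"
      using X finite_nat_set_iff_bounded_le[of "(\<lambda>x. nat \<bar>x\<bar>) ` X"] by auto
    show "\<forall>\<^sub>F n in sequentially. finite {- int n..int n} \<and> X \<subseteq> {- int n..int n} \<and> {- int n..int n} \<subseteq> UNIV"
    proof (rule eventually_sequentiallyI[of B])
      fix n assume "B \<le> n"
      then show "finite {- int n..int n} \<and> X \<subseteq> {- int n..int n} \<and> {- int n..int n} \<subseteq> UNIV"
        using B by force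
    qed
  qed
  then show ?thesis using assms unfolding has_sum_def by (rule filterlim_compose[rotated])
qed

lemma jb_tail_tendsto: "(\<lambda>n. (\<Sum>\<^sub>\<infinity>k::int. inverse (jb k)) - (\<Sum>k\<in>{- int n..int n}. inverse (jb k))) \<longlonglongrightarrow> 0"
  using tendsto_diff[OF tendsto_const int_partial_sums_tendsto[OF has_sum_infsum[OF summable_jb]], of "\<Sum>\<^sub>\<infinity>k::int. inverse (jb k)"]
  by simp

lemma partial_error:
  "\<bar>Rep_ptest (partial n f - f) x\<bar> \<le>
     8 * pi * test_norm 4 f * ((\<Sum>\<^sub>\<infinity>k::int. inverse (jb k)) - (\<Sum>k\<in>{- int n..int n}. inverse (jb k)))"
proof -
  let ?K = "{- int n..int n}"
  let ?g = "\<lambda>k. Re (test_coef f k * cis (- of_int k * x)) / (2 * pi)"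
  let ?M = "\<lambda>k::int. 8 * pi * test_norm 4 f * inverse (jb k)"
  have M: "?M summable_on A" for A
    by (rule summable_on_subset[of _ UNIV]) (intro summable_on_cmult_right summable_jb, simp)
  have dom: "\<bar>?g k\<bar> \<le> ?M k" for k
  proof -
    have "\<bar>Re (test_coef f k * cis (- of_int k * x))\<bar> \<le> cmod (test_coef f k * cis (- of_int k * x))" by (rule abs_Re_le_cmod)
    also have "\<dots> = cmod (test_coef f k)" by (simp add: norm_mult)
    also have "\<dots> \<le> ?M k" by (rule test_coef_dom')
    finally have 1: "\<bar>Re (test_coef f k * cis (- of_int k * x))\<bar> \<le> ?M k" .
    have "1 \<le> 2 * pi" using pi_gt3 by simp
    then have "\<bar>Re (test_coef f k * cis (- of_int k * x))\<bar> / (2 * pi) \<le> \<bar>Re (test_coef f k * cis (- of_int k * x))\<bar> / 1"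
      by (intro divide_left_mono) auto
    then show ?thesis using 1 by (simp only: real_norm_def abs_divide) simp
  qed
  have gn: "(\<lambda>k. norm (?g k)) summable_on A" for A
    by (rule summable_on_comparison_test[OF M]) (use dom in \<open>simp_all only: real_norm_def abs_ge_zero\<close>)
  have g: "?g summable_on A" for A by (rule abs_summable_summable[OF gn])
  have "infsum ?g UNIV = sum ?g ?K + infsum ?g (UNIV - ?K)"
    using infsum_Diff[OF g[of UNIV] g[of ?K]] by simp
  then have "Rep_ptest (partial n f - f) x = - infsum ?g (UNIV - ?K)"
    by (simp only: minus_ptest.rep_eq rep_partial rep_fourier[of f x])
  then have "\<bar>Rep_ptest (partial n f - f) x\<bar> = norm (infsum ?g (UNIV - ?K))" by (simp only: real_norm_def abs_minus_cancel)
  also have "\<dots> \<le> (\<Sum>\<^sub>\<infinity>k\<in>UNIV - ?K. norm (?g k))" by (rule norm_infsum_bound[OF gn])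
  also have "\<dots> \<le> infsum ?M (UNIV - ?K)" by (rule infsum_mono[OF gn M]) (use dom in \<open>simp only: real_norm_def\<close>)
  also have "\<dots> = infsum ?M UNIV - sum ?M ?K"
    using infsum_Diff[OF M[of UNIV] M[of ?K]] by simp
  also have "\<dots> = 8 * pi * test_norm 4 f * ((\<Sum>\<^sub>\<infinity>k::int. inverse (jb k)) - (\<Sum>k\<in>?K. inverse (jb k)))"
    by (simp only: infsum_cmult_right' sum_distrib_left[symmetric] right_diff_distrib)
  finally show ?thesis .
qed

text \<open>Differentiation commutes with taking partial sums, so the uniform error bound applies to
  each derivative of \<open>f\<close> separately.\<close>

lemma partial_tendsto: "(\<lambda>n. test_norm N (partial n f - f)) \<longlonglongrightarrow> 0"
proof -
  define e where "e n = (\<Sum>\<^sub>\<infinity>k::int. inverse (jb k)) - (\<Sum>k\<in>{- int n..int n}. inverse (jb k))" for n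
  have e: "e \<longlonglongrightarrow> 0" unfolding e_def by (rule jb_tail_tendsto)
  have D: "(test_deriv ^^ m) (partial n f - f) = partial n ((test_deriv ^^ m) f) - (test_deriv ^^ m) f" for m n
    by (induction m) (simp_all add: linear_diff[OF linear_test_deriv] test_deriv_partial)
  have le: "(SUP x. \<bar>(deriv ^^ m) (Rep_ptest (partial n f - f)) x\<bar>) \<le> 8 * pi * test_norm 4 ((test_deriv ^^ m) f) * e n" for m n
    unfolding rep_funpow D e_def by (rule cSUP_least[OF _ partial_error]) simp
  show ?thesis
  proof (rule tendsto_sandwich[OF _ _ tendsto_const])
    show "\<forall>\<^sub>F n in sequentially. 0 \<le> test_norm N (partial n f - f)" by (simp add: test_norm_nonneg)
    show "\<forall>\<^sub>F n in sequentially. test_norm N (partial n f - f) \<le> (\<Sum>m\<le>N. 8 * pi * test_norm 4 ((test_deriv ^^ m) f) * e n)"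
      unfolding test_norm_def by (intro always_eventually allI sum_mono le[unfolded test_norm_def])
    show "(\<lambda>n. \<Sum>m\<le>N. 8 * pi * test_norm 4 ((test_deriv ^^ m) f) * e n) \<longlonglongrightarrow> 0"
      by (intro tendsto_null_sum tendsto_mult_right_zero e)
  qed
qed

lemma fcoef_uminus: "fcoef u (- k) = cnj (fcoef u k)"
proof -
  have "test_cos (- k) = test_cos k" "test_sin (- k) = - test_sin k"
    by (simp_all add: Rep_ptest_inject[symmetric] test_cos.rep_eq test_sin.rep_eq uminus_ptest.rep_eq)
  then show ?thesis
    by (simp add: fcoef_def complex_eq_iff linear_neg[OF pairing_linear])
qed

lemma pairing_partial: "pairing u (partial n f) = (\<Sum>k\<in>{- int n..int n}. Re (fcoef u k * test_coef f k))"
  unfolding partial_def linear_sum[OF pairing_linear]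
  by (rule sum.cong) (auto simp: linear_add[OF pairing_linear] linear_scale[OF pairing_linear] fcoef_def field_simps)

lemma pairing_partial_tendsto: "(\<lambda>n. pairing u (partial n f)) \<longlonglongrightarrow> pairing u f"
proof -
  obtain N C where C: "\<And>f. \<bar>pairing u f\<bar> \<le> C * test_norm N f" using pairing_cont[of u] by blast
  have "(\<lambda>n. pairing u (partial n f) - pairing u f) \<longlonglongrightarrow> 0"
  proof (rule Lim_null_comparison)
    show "\<forall>\<^sub>F n in sequentially. norm (pairing u (partial n f) - pairing u f) \<le> C * test_norm N (partial n f - f)"
      using C[of "partial _ f - f"] by (simp add: linear_diff[OF pairing_linear])
    show "(\<lambda>n. C * test_norm N (partial n f - f)) \<longlonglongrightarrow> 0" by (intro tendsto_mult_right_zero partial_tendsto)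
  qed
  then show ?thesis by (rule LIM_zero_cancel)
qed

text \<open>The coefficients determine the values on trigonometric polynomials, and these
  approximate every test function in all the seminorms.\<close>

theorem fcoef_inject:
  assumes "fcoef u = fcoef v"
  shows "u = v"
  unfolding pdist_eq_iff
proof
  fix f
  have "(\<lambda>n. pairing u (partial n f)) = (\<lambda>n. pairing v (partial n f))" by (simp add: pairing_partial assms)
  with pairing_partial_tendsto[of u f] have "(\<lambda>n. pairing v (partial n f)) \<longlonglongrightarrow> pairing u f" by simp
  then show "pairing u f = pairing v f" using pairing_partial_tendsto[of v f] by (rule LIMSEQ_unique)
qed

lemma dist_of_coef_fcoef: "bdd_coef (fcoef u) \<Longrightarrow> dist_of_coef (fcoef u) = u"
  by (rule fcoef_inject) (rule fcoef_dist_of_coef, auto simp: fcoef_uminus)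

lemma fcoef_lincomb: "fcoef (a *\<^sub>R u + b *\<^sub>R v) k = of_real a * fcoef u k + of_real b * fcoef v k"
  by (simp add: fcoef_def plus_pdist.rep_eq scaleR_pdist.rep_eq complex_eq_iff add_divide_distrib diff_divide_distrib)

lemma fcoef_dist_deriv: "fcoef (dist_deriv u) k = \<i> * of_int k * fcoef u k"
  by (simp add: fcoef_def dist_deriv.rep_eq test_deriv_trig linear_scale[OF pairing_linear] linear_neg[OF pairing_linear] complex_eq_iff)

section \<open>Absolutely convergent Fourier series\<close>

definition abs_conv :: "(int \<Rightarrow> complex) \<Rightarrow> bool" where
  "abs_conv c \<longleftrightarrow> (\<lambda>k. norm (c k)) summable_on UNIV \<and> (\<forall>k. c (- k) = cnj (c k))"

definition fourier_sum :: "(int \<Rightarrow> complex) \<Rightarrow> real \<Rightarrow> real" where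
  "fourier_sum c x = (\<Sum>\<^sub>\<infinity>k. Re (c k * cis (of_int k * x)))"

lemma abs_conv_bdd: "abs_conv c \<Longrightarrow> bdd_coef c"
proof -
  assume "abs_conv c"
  then have s: "(\<lambda>k. norm (c k)) summable_on UNIV" by (simp add: abs_conv_def)
  have "norm (c k) \<le> (\<Sum>\<^sub>\<infinity>k. norm (c k)) * jb k" for k
  proof -
    have "norm (c k) = (\<Sum>j\<in>{k}. norm (c j))" by simp
    also have "\<dots> \<le> (\<Sum>\<^sub>\<infinity>k. norm (c k))" by (rule finite_sum_le_infsum[OF s]) auto
    also have "\<dots> * 1 \<le> (\<Sum>\<^sub>\<infinity>k. norm (c k)) * jb k" by (intro mult_left_mono jb_ge_1 infsum_nonneg) simp
    finally show ?thesis by simp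
  qed
  then show ?thesis unfolding bdd_coef_def by (intro exI[of _ "\<Sum>\<^sub>\<infinity>k. norm (c k)"]) (auto intro: infsum_nonneg)
qed

lemma abs_conv_cis: "abs_conv c \<Longrightarrow> (\<lambda>k. norm (c k * cis (of_int k * x))) summable_on UNIV"
  by (simp add: abs_conv_def norm_mult)

lemma of_real_fourier_sum:
  assumes "abs_conv c"
  shows "of_real (fourier_sum c x) = (\<Sum>\<^sub>\<infinity>k. c k * cis (of_int k * x))"
proof -
  have s: "(\<lambda>k. c k * cis (of_int k * x)) summable_on UNIV" using abs_conv_cis[OF assms] by (rule abs_summable_summable)
  have bij: "bij (uminus :: int \<Rightarrow> int)" by (rule bijI') (auto intro: exI[of _ "- _"])
  have "(\<Sum>\<^sub>\<infinity>k. c k * cis (of_int k * x)) = (\<Sum>\<^sub>\<infinity>k. c (- k) * cis (of_int (- k) * x))"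
    using infsum_reindex_bij_betw[OF bij, of "\<lambda>k. c k * cis (of_int k * x)"] by simp
  also have "\<dots> = (\<Sum>\<^sub>\<infinity>k. cnj (c k * cis (of_int k * x)))" using assms by (simp add: abs_conv_def cis_cnj)
  finally have "(\<Sum>\<^sub>\<infinity>k. c k * cis (of_int k * x)) = cnj (\<Sum>\<^sub>\<infinity>k. c k * cis (of_int k * x))" by (simp only: infsum_cnj)
  then have "Im (\<Sum>\<^sub>\<infinity>k. c k * cis (of_int k * x)) = 0" by (metis Reals_cnj_iff complex_is_Real_iff)
  moreover have "fourier_sum c x = Re (\<Sum>\<^sub>\<infinity>k. c k * cis (of_int k * x))"
    unfolding fourier_sum_def by (rule infsumI, rule has_sum_bounded_linear[OF bounded_linear_Re has_sum_infsum[OF s]])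
  ultimately show ?thesis by (simp add: complex_eq_iff)
qed

lemma fourier_sum_dom: "norm (Re (c k * cis (of_int k * x))) \<le> norm (c k)"
  using abs_Re_le_cmod[of "c k * cis (of_int k * x)"] by (simp only: norm_mult norm_cis mult_1_right real_norm_def)

lemma fourier_sum_cont: "abs_conv c \<Longrightarrow> continuous_on A (fourier_sum c)"
  unfolding fourier_sum_def[abs_def]
  by (rule continuous_on_infsum[OF _ _ fourier_sum_dom]) (auto simp: abs_conv_def simp del: times_complex.sel intro!: continuous_intros)

lemma dist_fourier_sum:
  assumes c: "abs_conv c"
  shows "dist_of_fun (fourier_sum c) = dist_of_coef c"
  unfolding pdist_eq_iff
proof
  fix f
  have i: "integrable circle_measure (fourier_sum c)" by (intro integrable_circle_continuous fourier_sum_cont c)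
  have "pairing (dist_of_fun (fourier_sum c)) f = (LINT z|circle_measure. fourier_sum c z * Rep_ptest f z)"
    using i by (simp add: dist_of_fun.rep_eq)
  also have "\<dots> = integral {- pi..pi} (\<lambda>z. fourier_sum c z * Rep_ptest f z)"
    by (intro lebesgue_integral_eq_integral integrable_circle_continuous continuous_intros fourier_sum_cont c) auto
  also have "\<dots> = integral {- pi..pi} (\<lambda>z. \<Sum>\<^sub>\<infinity>k. Re (c k * cis (of_int k * z)) * Rep_ptest f z)"
    by (simp only: fourier_sum_def infsum_cmult_left')
  also have "\<dots> = (\<Sum>\<^sub>\<infinity>k. integral {- pi..pi} (\<lambda>z. Re (c k * cis (of_int k * z)) * Rep_ptest f z))"
  proof (rule infsumI[symmetric], rule integral_infsum)
    show "(\<lambda>k. norm (c k) * test_norm 0 f) summable_on UNIV"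
      using c by (intro summable_on_cmult_left) (simp add: abs_conv_def)
    show "continuous_on {- pi..pi} (\<lambda>z. Re (c k * cis (of_int k * z)) * Rep_ptest f z)" for k by (intro continuous_intros)
    show "norm (Re (c k * cis (of_int k * z)) * Rep_ptest f z) \<le> norm (c k) * test_norm 0 f" for k z
      unfolding norm_mult[of "Re (c k * cis (of_int k * z))"] using rep_bound[of f z] by (intro mult_mono fourier_sum_dom) auto
  qed
  also have "\<dots> = (\<Sum>\<^sub>\<infinity>k. Re (c k * test_coef f k))"
  proof (rule infsum_cong, rule integral_unique)
    fix k
    show "((\<lambda>z. Re (c k * cis (of_int k * z)) * Rep_ptest f z) has_integral Re (c k * test_coef f k)) {- pi..pi}"
      using has_integral_Re[OF has_integral_mult_right[OF test_coef_has_integral[of f k], of "c k"]] by (simp add: algebra_simps)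
  qed
  finally show "pairing (dist_of_fun (fourier_sum c)) f = pairing (dist_of_coef c) f" by (simp add: pairing_dist_of_coef[OF abs_conv_bdd[OF c]])
qed

text \<open>Absolute convergence of the double series permits exchanging the sums. The second claim
  is the product formula for the two functions at the point 0.\<close>

lemma conv_abs_conv_aux:
  assumes "(\<lambda>k. norm (a k)) summable_on UNIV" "(\<lambda>k. norm (b k)) summable_on UNIV"
  shows "(\<lambda>k. norm (conv a b k)) summable_on UNIV" and "(\<Sum>\<^sub>\<infinity>k. conv a b k) = (\<Sum>\<^sub>\<infinity>k. a k) * (\<Sum>\<^sub>\<infinity>k. b k)"
proof -
  have bij: "bij (\<lambda>k. k - j)" for j :: int by (rule bijI') (auto intro: exI[of _ "_ + j"])
  have in1: "((\<lambda>k. norm (a j * b (k - j))) has_sum norm (a j) * (\<Sum>\<^sub>\<infinity>k. norm (b k))) UNIV" for j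
    unfolding norm_mult
    using has_sum_reindex_bij_betw[OF bij[of j], of "\<lambda>k. norm (b k)"] assms(2) by (intro has_sum_cmult_right) auto
  have n: "(\<lambda>(j, k). norm (a j * b (k - j))) summable_on UNIV \<times> UNIV"
    by (rule summable_on_SigmaI[where g = "\<lambda>j. norm (a j) * (\<Sum>\<^sub>\<infinity>k. norm (b k))"])
      (use in1 assms(1) in \<open>auto intro: summable_on_cmult_left\<close>)
  have s: "(\<lambda>(j, k). a j * b (k - j)) summable_on UNIV \<times> UNIV"
    by (rule abs_summable_summable) (use n in \<open>simp add: case_prod_unfold\<close>)
  have n': "(\<lambda>(k, j). norm (a j * b (k - j))) summable_on UNIV \<times> UNIV"
    using summable_on_swap[of "\<lambda>(j, k). norm (a j * b (k - j))" UNIV UNIV] n by (simp add: case_prod_unfold)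
  have n1: "(\<lambda>j. norm (a j * b (k - j))) summable_on UNIV" for k
    using summable_on_SigmaD1[OF n', of k] by simp
  have n2: "(\<lambda>k. \<Sum>\<^sub>\<infinity>j. norm (a j * b (k - j))) summable_on UNIV"
    using summable_on_SigmaD[OF n'] n1 by simp
  show "(\<lambda>k. norm (conv a b k)) summable_on UNIV"
    unfolding conv_def by (rule summable_on_comparison_test[OF n2 norm_infsum_bound[OF n1]]) simp
  have "(\<Sum>\<^sub>\<infinity>k. conv a b k) = (\<Sum>\<^sub>\<infinity>j. \<Sum>\<^sub>\<infinity>k. a j * b (k - j))"
    unfolding conv_def by (rule infsum_swap_banach[OF s, symmetric])
  also have "\<dots> = (\<Sum>\<^sub>\<infinity>j. a j * (\<Sum>\<^sub>\<infinity>k. b k))"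
    using infsum_reindex_bij_betw[OF bij, of b] by (simp only: infsum_cmult_right')
  finally show "(\<Sum>\<^sub>\<infinity>k. conv a b k) = (\<Sum>\<^sub>\<infinity>k. a k) * (\<Sum>\<^sub>\<infinity>k. b k)" by (simp only: infsum_cmult_left')
qed

lemma conv_abs_conv: "abs_conv a \<Longrightarrow> abs_conv b \<Longrightarrow> abs_conv (conv a b)"
  unfolding abs_conv_def using conv_abs_conv_aux(1)[of a b] conv_uminus[of a b] by blast

text \<open>Multiplying coefficients by the character \<open>cis (k * x)\<close> commutes with
  convolution, which reduces the claim at \<open>x\<close> to total sums.\<close>

lemma fourier_sum_conv:
  assumes "abs_conv a" "abs_conv b"
  shows "fourier_sum (conv a b) x = fourier_sum a x * fourier_sum b x"
proof -
  let ?e = "\<lambda>a k. a k * cis (of_int k * x)"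
  have "conv (?e a) (?e b) = ?e (conv a b)"
  proof
    fix k
    have "?e a j * ?e b (k - j) = a j * b (k - j) * cis (of_int k * x)" for j
    proof -
      have "of_int k * x = of_int j * x + of_int (k - j) * x" by (simp add: algebra_simps)
      then show ?thesis by (metis (no_types, lifting) cis_mult mult.assoc mult.left_commute)
    qed
    then show "conv (?e a) (?e b) k = ?e (conv a b) k" unfolding conv_def by (simp only: infsum_cmult_left')
  qed
  then have "complex_of_real (fourier_sum (conv a b) x) = of_real (fourier_sum a x) * of_real (fourier_sum b x)"
    using conv_abs_conv_aux(2)[OF abs_conv_cis[OF assms(1), of x] abs_conv_cis[OF assms(2), of x]]
    by (simp only: of_real_fourier_sum[OF conv_abs_conv[OF assms]] of_real_fourier_sum assms)
  then show ?thesis by (metis of_real_eq_iff of_real_mult)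
qed

text \<open>The density of a distribution is a choice. The second claim shows that every possible
  choice agrees almost everywhere with the Fourier sum, so squares and norms can be computed from
  the coefficients.\<close>

lemma density_dist_of_coef:
  assumes c: "abs_conv c"
  shows "is_L2_density (dist_of_coef c) (fourier_sum c)" and "is_L2_density (dist_of_coef c) g \<Longrightarrow> AE x in circle_measure. g x = fourier_sum c x"
proof -
  have m: "fourier_sum c \<in> borel_measurable circle_measure" and hi: "integrable circle_measure (fourier_sum c)"
    using integrable_circle_continuous[OF fourier_sum_cont[OF c]] by auto
  show "is_L2_density (dist_of_coef c) (fourier_sum c)"
    unfolding is_L2_density_def
    by (intro conjI m integrable_circle_continuous continuous_intros fourier_sum_cont c dist_fourier_sum[OF c, symmetric])
  assume g: "is_L2_density (dist_of_coef c) g"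
  have gi: "integrable circle_measure g"
  proof (rule Bochner_Integration.integrable_bound)
    have "integrable circle_measure (\<lambda>x. 1 :: real)" by (intro integrable_circle_continuous continuous_intros)
    then show "integrable circle_measure (\<lambda>x. 1 + (g x)\<^sup>2)" using g by (auto simp: is_L2_density_def)
    have "\<bar>y\<bar> \<le> 1 + y\<^sup>2" for y :: real
    proof -
      have "0 \<le> (\<bar>y\<bar> - 1 / 2)\<^sup>2" by simp
      then show ?thesis by (simp add: power2_eq_square algebra_simps)
    qed
    then show "AE x in circle_measure. norm (g x) \<le> norm (1 + (g x)\<^sup>2)" by (simp add: add_nonneg_nonneg)
  qed (use g in \<open>auto simp: is_L2_density_def\<close>)
  have eq: "(LINT x|circle_measure. g x * Rep_ptest f x) = (LINT x|circle_measure. fourier_sum c x * Rep_ptest f x)" for f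
  proof -
    have "dist_of_fun g = dist_of_fun (fourier_sum c)" using g dist_fourier_sum[OF c] by (simp add: is_L2_density_def)
    then have "pairing (dist_of_fun g) f = pairing (dist_of_fun (fourier_sum c)) f" by simp
    then show ?thesis using gi hi by (simp add: dist_of_fun.rep_eq)
  qed
  have z: "(LINT x|circle_measure. (g x - fourier_sum c x) * Rep_ptest f x) = 0" for f
    unfolding left_diff_distrib using eq[of f]
    by (subst Bochner_Integration.integral_diff) (auto intro!: integrable_circle_mult gi hi continuous_intros)
  have "coef_zero (\<lambda>x. g x - fourier_sum c x)"
    unfolding coef_zero_def using gi hi z[of "test_cos _"] z[of "test_sin _"] by (simp add: test_cos.rep_eq test_sin.rep_eq)
  from coef_zero_AE[OF this] show "AE x in circle_measure. g x = fourier_sum c x" by simp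
qed

lemma density_of_dist_of_coef:
  assumes "abs_conv c"
  shows "is_L2_density (dist_of_coef c) (density_of (dist_of_coef c))" and "AE x in circle_measure. density_of (dist_of_coef c) x = fourier_sum c x"
proof -
  show "is_L2_density (dist_of_coef c) (density_of (dist_of_coef c))" unfolding density_of_def by (rule someI[of _ "fourier_sum c"]) (rule density_dist_of_coef[OF assms])
  then show "AE x in circle_measure. density_of (dist_of_coef c) x = fourier_sum c x" by (rule density_dist_of_coef(2)[OF assms])
qed

lemma density_square:
  assumes c: "abs_conv c"
  shows "integrable circle_measure (\<lambda>x. (density_of (dist_of_coef c) x)\<^sup>2)"
    and "AE x in circle_measure. (density_of (dist_of_coef c) x)\<^sup>2 = fourier_sum (conv c c) x"
    and "dist_square (dist_of_coef c) = dist_of_coef (conv c c)"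
proof -
  note cc = conv_abs_conv[OF c c]
  show i: "integrable circle_measure (\<lambda>x. (density_of (dist_of_coef c) x)\<^sup>2)" using density_of_dist_of_coef(1)[OF c] by (simp add: is_L2_density_def)
  show ae: "AE x in circle_measure. (density_of (dist_of_coef c) x)\<^sup>2 = fourier_sum (conv c c) x"
    using density_of_dist_of_coef(2)[OF c] by eventually_elim (simp add: fourier_sum_conv[OF c c] power2_eq_square)
  have hi: "integrable circle_measure (fourier_sum (conv c c))" by (intro integrable_circle_continuous fourier_sum_cont cc)
  have "dist_square (dist_of_coef c) = dist_of_fun (fourier_sum (conv c c))"
    unfolding pdist_eq_iff
  proof
    fix f
    have "(LINT x|circle_measure. (density_of (dist_of_coef c) x)\<^sup>2 * Rep_ptest f x) = (LINT x|circle_measure. fourier_sum (conv c c) x * Rep_ptest f x)"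
    proof (rule integral_cong_AE)
      show "(\<lambda>x. (density_of (dist_of_coef c) x)\<^sup>2 * Rep_ptest f x) \<in> borel_measurable circle_measure"
        "(\<lambda>x. fourier_sum (conv c c) x * Rep_ptest f x) \<in> borel_measurable circle_measure"
        using integrable_circle_mult[OF i rep_cont[OF continuous_on_id]] integrable_circle_mult[OF hi rep_cont[OF continuous_on_id]]
        by auto
    qed (use ae in auto)
    then show "pairing (dist_square (dist_of_coef c)) f = pairing (dist_of_fun (fourier_sum (conv c c))) f"
      using i hi by (simp add: dist_square_def dist_of_fun.rep_eq)
  qed
  then show "dist_square (dist_of_coef c) = dist_of_coef (conv c c)" by (simp add: dist_fourier_sum[OF cc])
qed

lemma fcoef_dist_of_coef_abs_conv: "abs_conv c \<Longrightarrow> fcoef (dist_of_coef c) = c"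
  by (rule fcoef_dist_of_coef[OF abs_conv_bdd]) (auto simp: abs_conv_def)

text \<open>Parseval's identity, read off the coefficient of the squared density at frequency
  0.\<close>

lemma L2_norm_dist_of_coef:
  assumes c: "abs_conv c"
  shows "dist_of_coef c \<in> L2" and "L2_norm (dist_of_coef c) = sqrt (2 * pi) * l2n (\<lambda>k. cmod (c k))"
proof -
  note cc = conv_abs_conv[OF c c]
  show "dist_of_coef c \<in> L2" using density_dist_of_coef(1)[OF c] by (auto simp: L2_def)
  have hi: "integrable circle_measure (fourier_sum (conv c c))" by (intro integrable_circle_continuous fourier_sum_cont cc)
  have "(LINT x|circle_measure. (density_of (dist_of_coef c) x)\<^sup>2) = (LINT x|circle_measure. fourier_sum (conv c c) x)"
    by (rule integral_cong_AE) (use density_square[OF c] hi in auto)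
  also have "\<dots> = pairing (dist_of_coef (conv c c)) (test_cos 0)"
    using hi by (simp add: dist_fourier_sum[OF cc, symmetric] dist_of_fun.rep_eq test_cos.rep_eq)
  also have "\<dots> = 2 * pi * Re (fcoef (dist_of_coef (conv c c)) 0)" by (simp add: fcoef_def)
  also have "\<dots> = 2 * pi * Re (conv c c 0)" by (simp add: fcoef_dist_of_coef_abs_conv[OF cc])
  also have "conv c c 0 = (\<Sum>\<^sub>\<infinity>k. of_real ((cmod (c k))\<^sup>2))"
    using c unfolding conv_def abs_conv_def by (simp add: complex_norm_square del: of_real_power)
  also have "\<dots> = of_real (\<Sum>\<^sub>\<infinity>k. (cmod (c k))\<^sup>2)"
  proof (rule infsumI, rule has_sum_bounded_linear[OF bounded_linear_of_real has_sum_infsum])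
    obtain C where C: "0 \<le> C" "\<And>k. cmod (c k) \<le> C"
    proof
      show "cmod (c k) \<le> (\<Sum>\<^sub>\<infinity>k. cmod (c k))" for k
        using finite_sum_le_infsum[of "\<lambda>k. cmod (c k)" UNIV "{k}"] c by (simp add: abs_conv_def)
    qed (rule infsum_nonneg, simp)
    have "(\<lambda>k. C * cmod (c k)) summable_on UNIV" using c by (intro summable_on_cmult_right) (simp add: abs_conv_def)
    then show "(\<lambda>k. (cmod (c k))\<^sup>2) summable_on UNIV"
      by (rule summable_on_comparison_test) (use C in \<open>auto simp: power2_eq_square intro!: mult_right_mono\<close>)
  qed
  finally have "(LINT x|circle_measure. (density_of (dist_of_coef c) x)\<^sup>2) = 2 * pi * (l2n (\<lambda>k. cmod (c k)))\<^sup>2" by (simp add: l2n_power2)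
  then show "L2_norm (dist_of_coef c) = sqrt (2 * pi) * l2n (\<lambda>k. cmod (c k))"
    by (simp add: L2_norm_def real_sqrt_mult l2n_nonneg)
qed

lemma fcoef_u_ux:
  assumes "abs_conv (fcoef u)"
  shows "fcoef (u_ux u) k = \<i> * of_int k / 2 * conv (fcoef u) (fcoef u) k"
proof -
  have "dist_of_coef (fcoef u) = u" by (rule dist_of_coef_fcoef[OF abs_conv_bdd[OF assms]])
  then have "fcoef (dist_square u) = conv (fcoef u) (fcoef u)"
    using density_square(3)[OF assms] fcoef_dist_of_coef_abs_conv[OF conv_abs_conv[OF assms assms]] by simp
  then show ?thesis
    using fcoef_lincomb[of "1/2" "dist_deriv (dist_square u)" 0 0 k] by (simp add: u_ux_def fcoef_dist_deriv)
qed

section \<open>Distributions and coefficient sequences\<close>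

lemma fcoef_diff: "fcoef (u - v) = fcoef u - fcoef v"
  using fcoef_lincomb[of 1 u "-1" v] by (auto simp: fun_eq_iff)

lemma fcoef_0: "fcoef 0 = 0"
  using fcoef_diff[of 0 0] by simp

lemma Hs_iff: "u \<in> Hs r \<longleftrightarrow> coef_finite r (fcoef u)"
  by (simp add: Hs_def coef_finite_def l2_def)

lemma Hs_norm_coef_norm: "Hs_norm r u = sqrt (2 * pi) * coef_norm r (fcoef u)"
  by (simp add: Hs_norm_def coef_norm_def l2n_def)

lemma cont_Hs_iff: "cont_Hs r I u \<longleftrightarrow> coef_cont r I (\<lambda>t. fcoef (u t))"
proof -
  have "((\<lambda>t'. Hs_norm r (u t' - u t)) \<longlongrightarrow> 0) F \<longleftrightarrow> ((\<lambda>t'. coef_norm r (fcoef (u t') - fcoef (u t))) \<longlongrightarrow> 0) F" for t F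
    using tendsto_mult_left_iff[of "sqrt (2 * pi)" "\<lambda>t'. coef_norm r (fcoef (u t') - fcoef (u t))" 0 F]
    by (simp add: Hs_norm_coef_norm fcoef_diff)
  then show ?thesis unfolding cont_Hs_def coef_cont_def by (simp add: Hs_iff)
qed

lemma coef_finite_le:
  assumes "coef_finite r c"
  shows "cmod (c k) \<le> coef_norm r c * jb k powr (- r / 2)"
proof -
  have "jb k powr (r / 2) * cmod (c k) \<le> coef_norm r c"
    using abs_le_l2n[OF assms[unfolded coef_finite_def], of k] by (simp add: coef_norm_def)
  then have 1: "jb k powr (r / 2) * cmod (c k) * jb k powr (- r / 2) \<le> coef_norm r c * jb k powr (- r / 2)" by (intro mult_right_mono) auto
  have "jb k powr (r / 2) * jb k powr (- r / 2) = jb k powr (r / 2 + - r / 2)" by (simp only: powr_add)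
  also have "\<dots> = 1" using jb_pos[of k] by simp
  finally have 2: "jb k powr (r / 2) * jb k powr (- r / 2) = 1" .
  have "jb k powr (r / 2) * cmod (c k) * jb k powr (- r / 2) = (jb k powr (r / 2) * jb k powr (- r / 2)) * cmod (c k)" by (simp only: mult_ac)
  then show ?thesis using 1 by (simp only: 2 mult_1_left)
qed

lemma coef_finite_bdd:
  assumes "coef_finite r c" "- 2 \<le> r"
  shows "bdd_coef c"
proof -
  have "cmod (c k) \<le> coef_norm r c * jb k" for k
  proof -
    have "jb k powr (- r / 2) \<le> jb k powr 1" using assms(2) by (intro powr_mono jb_ge_1) auto
    then have "coef_norm r c * jb k powr (- r / 2) \<le> coef_norm r c * jb k"
      using jb_pos[of k] by (intro mult_left_mono coef_norm_nonneg) simp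
    then show ?thesis using coef_finite_le[OF assms(1), of k] by simp
  qed
  then show ?thesis unfolding bdd_coef_def using coef_norm_nonneg by blast
qed

lemma coef_finite_abs_conv:
  assumes "coef_finite 2 c" "\<And>k. c (- k) = cnj (c k)"
  shows "abs_conv c"
proof -
  have 1: "l2 (\<lambda>k. jb k * cmod (c k))"
    using assms(1) jb_pos by (simp add: coef_finite_def)
  have 2: "l2 (\<lambda>k::int. inverse (jb k))"
  proof -
    have "(\<lambda>k::int. (inverse (jb k))\<^sup>2) summable_on UNIV"
    proof (rule summable_on_comparison_test[OF summable_jb])
      show "(inverse (jb k))\<^sup>2 \<le> inverse (jb k)" for k :: int
        unfolding power2_eq_square using jb_ge_1[of k] by (intro mult_left_le_one_le) (auto simp: inverse_le_1_iff)
    qed simp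
    then show ?thesis by (simp add: l2_def)
  qed
  have e: "\<bar>inverse (jb k) * (jb k * cmod (c k))\<bar> = norm (c k)" for k
    using jb_pos[of k] by (simp add: abs_mult)
  then have "(\<lambda>k. norm (c k)) summable_on UNIV" using l2_mult_summable(1)[OF 2 1] by (simp only: e)
  then show ?thesis using assms(2) by (simp add: abs_conv_def)
qed

lemma pairing_fourier: "bdd_coef (fcoef u) \<Longrightarrow> pairing u f = (\<Sum>\<^sub>\<infinity>k. Re (fcoef u k * test_coef f k))"
  using dist_of_coef_fcoef[of u] pairing_dist_of_coef[of "fcoef u" f] by simp

lemma conv_abs_conv_bound:
  assumes "abs_conv a"
  shows "\<exists>C\<ge>0. \<forall>k. cmod (conv a a k) \<le> C"
proof -
  have s: "(\<lambda>k. norm (conv a a k)) summable_on UNIV" using conv_abs_conv[OF assms assms] by (simp add: abs_conv_def)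
  have "cmod (conv a a k) \<le> (\<Sum>\<^sub>\<infinity>k. norm (conv a a k))" for k
    using finite_sum_le_infsum[OF s, of "{k}"] by simp
  then show ?thesis using infsum_nonneg[of UNIV "\<lambda>k. norm (conv a a k)"] by (meson norm_ge_zero)
qed

lemma abs_int_le_jb: "\<bar>of_int k\<bar> \<le> jb k"
proof -
  have "0 \<le> (\<bar>of_int k\<bar> - 1 / 2 :: real)\<^sup>2" by simp
  then show ?thesis by (simp add: power2_eq_square algebra_simps)
qed

lemma bdd_coef_u_ux:
  assumes "abs_conv (fcoef u)"
  shows "bdd_coef (fcoef (u_ux u))"
proof -
  obtain C where C: "0 \<le> C" "\<And>k. cmod (conv (fcoef u) (fcoef u) k) \<le> C" using conv_abs_conv_bound[OF assms] by blast
  have "cmod (fcoef (u_ux u) k) \<le> C * jb k" for k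
  proof -
    have "cmod (fcoef (u_ux u) k) = \<bar>of_int k\<bar> / 2 * cmod (conv (fcoef u) (fcoef u) k)"
      by (simp add: fcoef_u_ux[OF assms] norm_mult norm_divide)
    also have "\<dots> \<le> jb k * C" using abs_int_le_jb[of k] by (intro mult_mono C) auto
    finally show ?thesis by (simp add: mult.commute)
  qed
  then show ?thesis unfolding bdd_coef_def using C(1) by blast
qed

section \<open>The integral equation for the Fourier coefficients\<close>

definition synth :: "(real \<Rightarrow> int \<Rightarrow> complex) \<Rightarrow> real \<Rightarrow> pdist" where
  "synth v t = dist_of_coef (v t)"

context dissipative
begin

text \<open>The description in \<open>S_op\<close> denotes: the damped coefficients keep the growth
  bound because the multiplier is at most 1 in modulus, and coefficients determine a
  distribution.\<close>

lemma fcoef_S_op: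
  assumes t: "0 \<le> t" and f: "bdd_coef (fcoef f)"
  shows "fcoef (S_op \<beta> \<eta> t f) = (\<lambda>k. mlt t k * fcoef f k)"
proof -
  let ?c = "\<lambda>k. mlt t k * fcoef f k"
  obtain C where C: "0 \<le> C" "\<And>k. cmod (fcoef f k) \<le> C * jb k" using f by (auto simp: bdd_coef_def)
  have "cmod (?c k) \<le> C * jb k" for k
  proof -
    have "cmod (?c k) \<le> 1 * cmod (fcoef f k)" unfolding norm_mult by (intro mult_right_mono norm_mlt_le_1 t) simp
    then show ?thesis using C(2)[of k] by simp
  qed
  then have "bdd_coef ?c" unfolding bdd_coef_def using C(1) by blast
  then have g: "fcoef (dist_of_coef ?c) = ?c" by (rule fcoef_dist_of_coef) (simp add: mlt_uminus fcoef_uminus)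
  have "S_op \<beta> \<eta> t f = dist_of_coef ?c"
    unfolding S_op_def mlt_def[symmetric]
  proof (rule the_equality)
    show "\<forall>k. fcoef (dist_of_coef ?c) k = ?c k" by (simp add: g)
    show "g' = dist_of_coef ?c" if "\<forall>k. fcoef g' k = ?c k" for g' using that by (intro fcoef_inject) (auto simp: g fun_eq_iff)
  qed
  then show ?thesis by (simp add: g)
qed

lemma fcoef_forcing:
  assumes "abs_conv (fcoef u)" "0 \<le> t"
  shows "fcoef (S_op \<beta> \<eta> t (u_ux u)) k = - (frc k * (mlt t k * conv (fcoef u) (fcoef u) k))"
    and "bdd_coef (fcoef (S_op \<beta> \<eta> t (u_ux u)))"
proof -
  note S = fcoef_S_op[OF assms(2) bdd_coef_u_ux[OF assms(1)]]
  show "fcoef (S_op \<beta> \<eta> t (u_ux u)) k = - (frc k * (mlt t k * conv (fcoef u) (fcoef u) k))"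
    by (simp add: S fcoef_u_ux[OF assms(1)] frc_def)
  obtain C where C: "0 \<le> C" "\<And>k. cmod (fcoef (u_ux u) k) \<le> C * jb k"
    using bdd_coef_u_ux[OF assms(1)] by (auto simp: bdd_coef_def)
  have "cmod (fcoef (S_op \<beta> \<eta> t (u_ux u)) k) \<le> C * jb k" for k
  proof -
    have "cmod (mlt t k * fcoef (u_ux u) k) \<le> 1 * cmod (fcoef (u_ux u) k)"
      unfolding norm_mult by (intro mult_right_mono norm_mlt_le_1 assms) simp
    then show ?thesis using C(2)[of k] by (simp add: S)
  qed
  then show "bdd_coef (fcoef (S_op \<beta> \<eta> t (u_ux u)))" unfolding bdd_coef_def using C(1) by blast
qed

lemma fcoef_has_integral:
  assumes "has_dist_integral F v A"
  shows "((\<lambda>t. fcoef (F t) k) has_integral fcoef v k) A"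
proof -
  have i: "((\<lambda>t. pairing (F t) f) has_integral pairing v f) A" for f
    using assms unfolding has_dist_integral_def absolutely_integrable_on_def has_integral_iff by blast
  have e: "fcoef w k = (1 / of_real (2 * pi)) * (of_real (pairing w (test_cos k)) - \<i> * of_real (pairing w (test_sin k)))" for w
    by (simp add: fcoef_def complex_eq_iff)
  show ?thesis unfolding e
    by (intro has_integral_mult_right has_integral_diff has_integral_of_real i)
qed

text \<open>Testing with \<open>cos\<close> and \<open>sin\<close> gives the equation for each
  coefficient. At interior times the solution is smooth, so the coefficients of \<open>u_ux\<close>
  are a convolution; nothing is needed at the two endpoints, since the integral ignores
  them.\<close>

lemma solution_mild:
  assumes T: "0 < T" and \<phi>: "\<phi> \<in> Hs s" and u: "is_solution \<beta> \<eta> s T \<phi> u"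
  shows "mild T (fcoef \<phi>) (\<lambda>t. fcoef (u t))"
  unfolding mild_def
proof (intro allI ballI)
  fix k t assume t: "t \<in> {0..T}"
  let ?c = "\<lambda>t. fcoef (u t)"
  have b: "bdd_coef (fcoef \<phi>)" using \<phi> s_gt by (intro coef_finite_bdd[of s]) (auto simp: Hs_iff)
  have as: "abs_conv (?c r)" if "0 < r" "r < T" for r
  proof (rule coef_finite_abs_conv)
    show "coef_finite 2 (?c r)" using u that by (auto simp: is_solution_def cont_Hinf_def cont_Hs_def Hs_iff)
  qed (simp add: fcoef_uminus)
  obtain v where v: "has_dist_integral (\<lambda>t'. S_op \<beta> \<eta> (t - t') (u_ux (u t'))) v {0<..<t}" "u t = S_op \<beta> \<eta> t \<phi> - v"
    using u t unfolding is_solution_def integral_equation_def by blast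
  have "((\<lambda>r. - mlt (- t) k * fcoef (S_op \<beta> \<eta> (t - r) (u_ux (u r))) k) has_integral - mlt (- t) k * fcoef v k) {0<..<t}"
    by (intro has_integral_mult_right fcoef_has_integral v)
  moreover have "- mlt (- t) k * fcoef (S_op \<beta> \<eta> (t - r) (u_ux (u r))) k = forcing ?c k r" if "r \<in> {0<..<t}" for r
  proof -
    have "mlt (- t + (t - r)) k = mlt (- t) k * mlt (t - r) k" by (rule mlt_add)
    then have "mlt (- r) k = mlt (- t) k * mlt (t - r) k" by simp
    then show ?thesis using that t by (simp add: fcoef_forcing as forcing_def)
  qed
  ultimately have "(forcing ?c k has_integral - mlt (- t) k * fcoef v k) {0<..<t}"
    using has_integral_cong by (metis (no_types, lifting))
  moreover have "- mlt (- t) k * fcoef v k = mlt (- t) k * ?c t k - fcoef \<phi> k"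
  proof -
    have "?c t k = mlt t k * fcoef \<phi> k - fcoef v k"
      using t b by (simp add: v(2) fcoef_diff fcoef_S_op)
    then show ?thesis using mlt_minus(1)[of t k] by (simp add: right_diff_distrib flip: mult.assoc)
  qed
  ultimately show "(forcing ?c k has_integral (mlt (- t) k * ?c t k - fcoef \<phi> k)) {0..t}"
    by (simp add: has_integral_Icc_iff_Ioo)
qed

context
  fixes T \<delta> :: real and v :: "real \<Rightarrow> int \<Rightarrow> complex"
  assumes T: "0 < T" and delta: "0 < \<delta>" and vW: "v \<in> W \<delta> T"
begin

lemma fcoef_synth: "fcoef (synth v t) = v t"
proof (cases "t \<in> {0..T}")
  case True
  then have "coef_finite s (v t)" using W_coef_cont(1)[OF _ _ vW] T delta by (auto simp: coef_cont_def)
  then have "bdd_coef (v t)" using s_gt by (intro coef_finite_bdd[of s]) auto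
  then show ?thesis unfolding synth_def by (rule fcoef_dist_of_coef) (rule W_sym[OF vW])
next
  case False
  then have z: "v t = 0" using W_zero[OF vW] by simp
  have "bdd_coef (0 :: int \<Rightarrow> complex)" by (auto simp: bdd_coef_def intro: exI[of _ 0])
  then show ?thesis unfolding synth_def z by (rule fcoef_dist_of_coef) simp
qed

lemma W_abs_conv: "0 < t \<Longrightarrow> t \<le> T \<Longrightarrow> abs_conv (v t)"
  using W_cont_Hinf(1)[OF _ delta vW, of 2] T by (intro coef_finite_abs_conv W_sym[OF vW]) (auto simp: coef_cont_def)

lemma synth_time: "synth v \<in> time_functions T"
  unfolding time_functions_def
proof (intro CollectI allI impI)
  fix t assume "t \<notin> {0..T}"
  then have "v t = 0" by (rule W_zero[OF vW])
  then show "synth v t = 0" by (intro fcoef_inject) (simp only: fcoef_synth fcoef_0)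
qed

lemma synth_cont: "cont_Hs s {0..T} (synth v)" and synth_Hinf: "cont_Hinf {0<..T} (synth v)"
  using W_coef_cont(1)[OF _ _ vW] W_cont_Hinf(1)[OF _ delta vW] T delta
  by (auto simp: cont_Hinf_def cont_Hs_iff fcoef_synth)

text \<open>The value of the integral is taken to be
  \<open>S_op \<beta> \<eta> t \<phi> - synth v t\<close>, which makes the equation itself trivial;
  what remains is that this distribution is the weak integral.\<close>

lemma synth_solution:
  assumes m: "mild T (fcoef \<phi>) v" and \<phi>: "\<phi> \<in> Hs s"
  shows "is_solution \<beta> \<eta> s T \<phi> (synth v)"
  unfolding is_solution_def
proof (intro conjI synth_time synth_cont)
  show "cont_Hinf {0<..<T} (synth v)"
    using synth_Hinf unfolding cont_Hinf_def cont_Hs_iff by (auto intro: coef_cont_subset)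
  show "integral_equation \<beta> \<eta> T \<phi> (synth v)"
    unfolding integral_equation_def
  proof
    fix t assume t: "t \<in> {0..T}"
    let ?d = "fcoef (S_op \<beta> \<eta> t \<phi> - synth v t)"
    let ?F = "\<lambda>r. S_op \<beta> \<eta> (t - r) (u_ux (synth v r))"
    let ?N = "nW 0 \<delta> T v"
    have b: "bdd_coef (fcoef \<phi>)" using \<phi> s_gt by (intro coef_finite_bdd[of s]) (auto simp: Hs_iff)
    have d: "?d k = mlt t k * fcoef \<phi> k - v t k" for k
      using t b by (simp add: fcoef_diff fcoef_S_op fcoef_synth)
    have F: "fcoef (?F r) k = - (frc k * (mlt (t - r) k * conv (v r) (v r) k))" and Fb: "bdd_coef (fcoef (?F r))" if "r \<in> {0<..<t}" for r k
      using that t fcoef_forcing[of "synth v r" "t - r"] W_abs_conv[of r] by (simp_all add: fcoef_synth)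
    have Fi: "((\<lambda>r. - (frc k * (mlt (t - r) k * conv (v r) (v r) k))) has_integral ?d k) {0<..<t}" for k
    proof -
      have "((\<lambda>r. - mlt t k * forcing v k r) has_integral - mlt t k * (mlt (- t) k * v t k - fcoef \<phi> k)) {0..t}"
        using t by (intro has_integral_mult_right mildD[OF m]) auto
      moreover have "- mlt t k * forcing v k r = - (frc k * (mlt (t - r) k * conv (v r) (v r) k))" for r
        using mlt_add[of t "- r" k] by (simp add: forcing_def)
      moreover have "- mlt t k * (mlt (- t) k * v t k - fcoef \<phi> k) = ?d k"
        using mlt_minus(2)[of t k] by (simp add: d right_diff_distrib flip: mult.assoc)
      ultimately show ?thesis by (simp add: has_integral_Icc_iff_Ioo)
    qed
    have dist: "has_dist_integral ?F (S_op \<beta> \<eta> t \<phi> - synth v t) {0<..<t}"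
      unfolding has_dist_integral_def
    proof
      fix f
      define G where "G = 2 powr (sig / 2) * ?N * ?N"
      \<comment> \<open>The integral is known only for each frequency. The bound
        \<open>G * r powr (- 2 * gam) * M k\<close> is integrable in \<open>r\<close> and summable
        in \<open>k\<close>, which justifies exchanging integral and series for an arbitrary test
        function.\<close>
      define p where "p k r = Re (- (frc k * (mlt (t - r) k * conv (v r) (v r) k)) * test_coef f k)" for k r
      define M where "M k = 8 * pi * test_norm 4 f * inverse (jb k)" for k
      have M: "M summable_on A" for A
        unfolding M_def by (rule summable_on_subset[of _ UNIV]) (intro summable_on_cmult_right summable_jb, simp)
      have M0: "0 \<le> M k" for k using jb_pos[of k] test_norm_nonneg[of 4 f] by (simp add: M_def)
      have G: "norm (conv (v r) (v r) k) \<le> G * r powr (- 2 * gam)" if "r \<in> {0<..<t}" for r k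
        unfolding G_def using conv_forcing_bound[OF _ _ vW vW, of r k] that t T delta by auto
      have G0: "0 \<le> G" by (simp add: G_def nW_def l2n_nonneg)
      have pb: "\<bar>p k r\<bar> \<le> G * r powr (- 2 * gam) * M k" if r: "r \<in> {0<..<t}" for k r
      proof -
        have "\<bar>p k r\<bar> \<le> cmod (- (frc k * (mlt (t - r) k * conv (v r) (v r) k)) * test_coef f k)"
          unfolding p_def by (rule abs_Re_le_cmod)
        also have "\<dots> = (\<bar>of_int k\<bar> / 2) * (cmod (mlt (t - r) k) * cmod (conv (v r) (v r) k)) * cmod (test_coef f k)"
          by (simp add: norm_mult norm_frc)
        also have "\<dots> \<le> jb k * (1 * (G * r powr (- 2 * gam))) * cmod (test_coef f k)"
          using abs_int_le_jb[of k] r G0 by (intro mult_right_mono mult_mono G norm_mlt_le_1) auto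
        also have "\<dots> = G * r powr (- 2 * gam) * (jb k * cmod (test_coef f k))" by simp
        also have "\<dots> \<le> G * r powr (- 2 * gam) * M k"
          unfolding M_def using G0 by (intro mult_left_mono test_coef_dom) auto
        finally show ?thesis .
      qed
      have ps: "(\<lambda>k. norm (p k r)) summable_on A" if "r \<in> {0<..<t}" for r A
        by (rule summable_on_comparison_test[OF summable_on_cmult_right[OF M]]) (use pb[OF that] in auto)
      have pair: "pairing (?F r) f = (\<Sum>\<^sub>\<infinity>k. p k r)" if "r \<in> {0<..<t}" for r
        using pairing_fourier[OF Fb[OF that]] by (simp only: F[OF that] p_def)
      define S where "S n r = (\<Sum>k\<in>{- int n..int n}. p k r)" for n r
      define h where "h r = G * r powr (- 2 * gam) * infsum M UNIV" for r
      have pint: "(p k has_integral Re (?d k * test_coef f k)) {0<..<t}" for k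
        unfolding p_def by (intro has_integral_Re has_integral_mult_left Fi)
      have Sint: "(S n has_integral (\<Sum>k\<in>{- int n..int n}. Re (?d k * test_coef f k))) {0<..<t}" for n
        unfolding S_def by (intro has_integral_sum pint) simp
      have "gam < 1 / 4" "0 \<le> gam" using s_gt by (auto simp: gam_def)
      then have "(\<lambda>r. r powr (- 2 * gam)) integrable_on {0..t}" using t by (intro integrable_on_powr_from_0) auto
      then have "(\<lambda>r. r powr (- 2 * gam)) integrable_on {0<..<t}" by (simp add: integrable_on_Icc_iff_Ioo)
      then have hi: "h integrable_on {0<..<t}" unfolding h_def by (intro integrable_on_mult_left integrable_on_mult_right)
      have Sb: "norm (S n r) \<le> h r" if r: "r \<in> {0<..<t}" for n r
      proof -
        have "norm (S n r) \<le> (\<Sum>k\<in>{- int n..int n}. G * r powr (- 2 * gam) * M k)"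
          unfolding S_def by (rule order_trans[OF norm_sum sum_mono]) (use pb[OF r] in simp)
        also have "\<dots> = G * r powr (- 2 * gam) * sum M {- int n..int n}" by (simp only: sum_distrib_left)
        also have "\<dots> \<le> h r"
          unfolding h_def using G0 by (intro mult_left_mono finite_sum_le_infsum[OF M]) (auto intro: M0)
        finally show ?thesis .
      qed
      have Sl: "(\<lambda>n. S n r) \<longlonglongrightarrow> pairing (?F r) f" if "r \<in> {0<..<t}" for r
        unfolding S_def pair[OF that] by (rule int_partial_sums_tendsto[OF has_sum_infsum[OF abs_summable_summable[OF ps[OF that]]]])
      have pd: "pairing (S_op \<beta> \<eta> t \<phi> - synth v t) f = (\<Sum>\<^sub>\<infinity>k. Re (?d k * test_coef f k))"
        and pds: "(\<lambda>k. Re (?d k * test_coef f k)) summable_on UNIV"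
      proof -
        have "coef_finite s (v t)" using W_coef_cont(1)[OF _ _ vW] T delta t by (auto simp: coef_cont_def)
        then obtain C where C: "0 \<le> C" "\<And>k. cmod (v t k) \<le> C * jb k"
          using s_gt coef_finite_bdd[of s "v t"] by (auto simp: bdd_coef_def)
        obtain C' where C': "0 \<le> C'" "\<And>k. cmod (fcoef \<phi> k) \<le> C' * jb k" using b by (auto simp: bdd_coef_def)
        have dC: "cmod (?d k) \<le> (C' + C) * jb k" for k
        proof -
          have "cmod (mlt t k * fcoef \<phi> k) \<le> 1 * cmod (fcoef \<phi> k)"
            unfolding norm_mult using t by (intro mult_right_mono norm_mlt_le_1) auto
          then show ?thesis
            using norm_triangle_ineq4[of "mlt t k * fcoef \<phi> k" "v t k"] C(2)[of k] C'(2)[of k]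
            unfolding d distrib_right by linarith
        qed
        have C0: "0 \<le> C' + C" using C C' by simp
        show "(\<lambda>k. Re (?d k * test_coef f k)) summable_on UNIV" by (rule coef_test_coef_summable(2)[OF dC C0])
        show "pairing (S_op \<beta> \<eta> t \<phi> - synth v t) f = (\<Sum>\<^sub>\<infinity>k. Re (?d k * test_coef f k))"
          by (rule pairing_fourier) (use dC C0 in \<open>auto simp only: bdd_coef_def\<close>)
      qed
      have dc: "(\<lambda>r. pairing (?F r) f) integrable_on {0<..<t}"
        "(\<lambda>n. integral {0<..<t} (S n)) \<longlonglongrightarrow> integral {0<..<t} (\<lambda>r. pairing (?F r) f)"
        by (rule dominated_convergence[OF has_integral_integrable[OF Sint] hi], erule Sb, erule Sl)+
      have "(\<lambda>n. integral {0<..<t} (S n)) \<longlonglongrightarrow> (\<Sum>\<^sub>\<infinity>k. Re (?d k * test_coef f k))"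
        unfolding integral_unique[OF Sint] by (rule int_partial_sums_tendsto[OF has_sum_infsum[OF pds]])
      then have "integral {0<..<t} (\<lambda>r. pairing (?F r) f) = pairing (S_op \<beta> \<eta> t \<phi> - synth v t) f"
        using LIMSEQ_unique[OF dc(2)] by (simp only: pd)
      moreover have "(\<lambda>r. pairing (?F r) f) absolutely_integrable_on {0<..<t}"
      proof (rule absolutely_integrable_integrable_bound[OF _ dc(1) hi])
        show "norm (pairing (?F r) f) \<le> h r" if "r \<in> {0<..<t}" for r
          using Lim_bounded[OF tendsto_norm[OF Sl[OF that]], of 0 "h r"] Sb[OF that] by simp
      qed
      ultimately show "(\<lambda>r. pairing (?F r) f) absolutely_integrable_on {0<..<t} \<and>
          integral {0<..<t} (\<lambda>r. pairing (?F r) f) = pairing (S_op \<beta> \<eta> t \<phi> - synth v t) f" by blast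
    qed
    show "\<exists>w. has_dist_integral ?F w {0<..<t} \<and> synth v t = S_op \<beta> \<eta> t \<phi> - w"
      using dist by (intro exI[of _ "S_op \<beta> \<eta> t \<phi> - synth v t"]) simp
  qed
qed

text \<open>Existence and uniqueness in one equivalence, which also evaluates the definite
  description in \<open>flow_map\<close>.\<close>

theorem solution_iff:
  assumes m: "mild T (fcoef \<phi>) v" and \<phi>: "\<phi> \<in> Hs s"
  shows "is_solution \<beta> \<eta> s T \<phi> u \<longleftrightarrow> u = synth v"
proof
  assume u: "is_solution \<beta> \<eta> s T \<phi> u"
  have "(\<lambda>t. fcoef (u t)) = v"
  proof (rule weak_unique[OF T])
    show "fcoef \<phi> \<in> Hc" using \<phi> by (simp add: Hc_coef_finite Hs_iff fcoef_uminus)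
    show "fcoef (u t) = 0" if "t \<notin> {0..T}" for t
      using u that by (simp add: is_solution_def time_functions_def fcoef_0)
    show "fcoef (u t) (- k) = cnj (fcoef (u t) k)" for t k by (rule fcoef_uminus)
    show "coef_cont s {0..T} (\<lambda>t. fcoef (u t))" "coef_cont sig {0<..<T} (\<lambda>t. fcoef (u t))"
      using u by (auto simp: is_solution_def cont_Hinf_def cont_Hs_iff)
    show "mild T (fcoef \<phi>) (\<lambda>t. fcoef (u t))" by (rule solution_mild[OF T \<phi> u])
    have "(\<lambda>t. if t \<in> {0..T} then v t else 0) = v" using W_zero[OF vW] by auto
    then show "v \<in> W 0 T" using W_restrict[OF vW, of 0 T] T delta by simp
    show "mild T (fcoef \<phi>) v" by (rule m)
  qed
  then have "fcoef (u t) = v t" for t by (rule fun_cong)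
  then show "u = synth v" by (intro ext fcoef_inject) (simp only: fcoef_synth)
next
  assume "u = synth v"
  then show "is_solution \<beta> \<eta> s T \<phi> u" using synth_solution[OF m \<phi>] by simp
qed

lemma synth_norms:
  shows "t \<in> {0..T} \<Longrightarrow> Hs_norm s (synth v t) \<le> sqrt (2 * pi) * nW 0 \<delta> T v"
    and "s < 0 \<Longrightarrow> t \<in> {0<..T} \<Longrightarrow> synth v t \<in> L2 \<and> t powr (\<bar>s\<bar> / 2) * L2_norm (synth v t) \<le> sqrt (2 * pi) * nW 0 \<delta> T v"
proof -
  show "Hs_norm s (synth v t) \<le> sqrt (2 * pi) * nW 0 \<delta> T v" if "t \<in> {0..T}"
    unfolding Hs_norm_coef_norm fcoef_synth using W_coef_cont(2)[OF _ _ vW that] T delta by (intro mult_left_mono) auto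
  assume s: "s < 0" and t: "t \<in> {0<..T}"
  have gs: "gam = \<bar>s\<bar> / 2" "sig = 0" using s by (auto simp: gam_def sig_def)
  have a: "abs_conv (v t)" using t by (intro W_abs_conv) auto
  have "jb k powr (0 / 2) = 1" for k using jb_pos[of k] by simp
  then have "l2n (\<lambda>k. cmod (v t k)) = coef_norm sig (v t)" by (simp only: coef_norm_def gs mult_1_left)
  then have "t powr (\<bar>s\<bar> / 2) * L2_norm (synth v t) = sqrt (2 * pi) * (t powr gam * coef_norm sig (v t))"
    by (simp add: synth_def L2_norm_dist_of_coef(2)[OF a] gs(1))
  also have "\<dots> \<le> sqrt (2 * pi) * nW 0 \<delta> T v"
    using W_sig(2)[OF _ _ vW, of t] t T delta by (intro mult_left_mono) auto
  finally show "synth v t \<in> L2 \<and> t powr (\<bar>s\<bar> / 2) * L2_norm (synth v t) \<le> sqrt (2 * pi) * nW 0 \<delta> T v"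
    using L2_norm_dist_of_coef(1)[OF a] by (simp add: synth_def)
qed

lemma synth_X_bound:
  assumes "s < 0" "t \<in> {0<..T}"
  shows "Hs_norm s (synth v t) + t powr (\<bar>s\<bar> / 2) * L2_norm (synth v t) \<le> 2 * sqrt (2 * pi) * nW 0 \<delta> T v"
  using synth_norms(1)[of t] synth_norms(2)[of t] assms by auto

lemma synth_target: "synth v \<in> target_space s T"
proof -
  have "bdd_above ((\<lambda>t. Hs_norm s (synth v t) + t powr (\<bar>s\<bar> / 2) * L2_norm (synth v t)) ` {0<..T})" if "s < 0"
    by (rule bdd_aboveI2[OF synth_X_bound[OF that]])
  then have "synth v \<in> frakX_space s T"
    unfolding frakX_space_def X_space_def
    using synth_time synth_cont synth_norms(2) by auto
  then show ?thesis unfolding target_space_def using synth_time synth_cont synth_Hinf by blast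
qed

end

lemma synth_lincomb:
  assumes T: "0 < T" and \<delta>: "0 < \<delta>" and v: "v \<in> W \<delta> T" and w: "w \<in> W \<delta> T"
  shows "synth (a *\<^sub>R v + b *\<^sub>R w) = a *\<^sub>R synth v + b *\<^sub>R synth w"
proof
  fix t
  interpret normed_subspace "W \<delta> T" "nW 0 \<delta> T" by (rule W_subspace) (use T in auto)
  have "a *\<^sub>R v + b *\<^sub>R w \<in> W \<delta> T" using v w by (intro add_mem scale_mem)
  then show "synth (a *\<^sub>R v + b *\<^sub>R w) t = (a *\<^sub>R synth v + b *\<^sub>R synth w) t"
    by (intro fcoef_inject ext)
      (simp add: fcoef_synth[OF T \<delta>] v w scaleR_fun_def fcoef_lincomb scaleR_conv_of_real)
qed

lemma synth_seminorm_bound: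
  assumes T: "0 < T" and \<delta>: "0 < \<delta>" and p: "p \<in> target_seminorms s T"
  shows "\<exists>C\<ge>0. \<forall>v\<in>W \<delta> T. p (synth v) \<le> C * nW 0 \<delta> T v"
proof -
  have s: "sup_norm s {0..T} (synth v) \<le> sqrt (2 * pi) * nW 0 \<delta> T v" if "v \<in> W \<delta> T" for v
    unfolding sup_norm_def by (rule cSUP_least) (use synth_norms(1)[OF T \<delta> that] T in auto)
  consider "p = sup_norm s {0..T}" | r a where "p = sup_norm r {a..T}" "0 < a" "a \<le> T" | "p = frakX_norm s T"
    using p by (auto simp: target_seminorms_def)
  then show ?thesis
  proof cases
    case 1
    then show ?thesis using s by (intro exI[of _ "sqrt (2 * pi)"]) auto
  next
    case 2
    obtain C where C: "0 \<le> C" "\<And>v t. v \<in> W \<delta> T \<Longrightarrow> a \<le> t \<Longrightarrow> t \<le> T \<Longrightarrow> coef_norm r (v t) \<le> C * nW 0 \<delta> T v"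
    proof -
      \<comment> \<open>The fact \<open>W_cont_Hinf\<close> presupposes some member of the space;
        the zero function serves to extract its uniform constant.\<close>
      have "(\<lambda>t. 0) \<in> W \<delta> T"
        by (rule W_I[where c = "\<lambda>k. 0" and lm = 0]) (auto simp: l2_zero fun_eq_iff)
      then show ?thesis using W_cont_Hinf(2)[OF _ \<delta> _ 2(2), of T _ r] T that by (metis less_eq_real_def)
    qed
    have "p (synth v) \<le> sqrt (2 * pi) * C * nW 0 \<delta> T v" if v: "v \<in> W \<delta> T" for v
      unfolding 2(1) sup_norm_def
    proof (rule cSUP_least)
      show "{a..T} \<noteq> {}" using 2 by simp
      fix t assume "t \<in> {a..T}"
      then show "Hs_norm r (synth v t) \<le> sqrt (2 * pi) * C * nW 0 \<delta> T v"
        unfolding Hs_norm_coef_norm fcoef_synth[OF T \<delta> v] mult.assoc using C(2)[OF v] by (intro mult_left_mono) auto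
    qed
    then show ?thesis using C(1) by (intro exI[of _ "sqrt (2 * pi) * C"]) auto
  next
    case 3
    show ?thesis
    proof (cases "s < 0")
      case True
      have "p (synth v) \<le> 2 * sqrt (2 * pi) * nW 0 \<delta> T v" if "v \<in> W \<delta> T" for v
        unfolding 3 frakX_norm_def X_norm_def if_P[OF True]
        by (rule cSUP_least) (use T synth_X_bound[OF T \<delta> that True] in auto)
      then show ?thesis by (intro exI[of _ "2 * sqrt (2 * pi)"]) auto
    next
      case False
      then show ?thesis using s 3 by (intro exI[of _ "sqrt (2 * pi)"]) (auto simp: frakX_norm_def)
    qed
  qed
qed

text \<open>The width \<open>\<delta>\<close> and the bound \<open>M\<close> are common to all data
  in the ball. All solutions therefore lie in a single normed space, where the abstract result on
  quadratic equations applies, and \<open>synth\<close> carries its conclusion to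
  distributions.\<close>

theorem well_posed:
  assumes T: "0 < T" and \<phi>: "\<phi> \<in> Hs s"
  shows "unique_solution \<beta> \<eta> s \<phi> T" and "smooth_flow_near \<beta> \<eta> s \<phi> T"
proof -
  \<comment> \<open>The radius 1 is arbitrary, since solutions exist on \<open>[0, T]\<close> for
    data of any size.\<close>
  let ?U = "Hs_ball s \<phi> 1"
  have pi2: "1 \<le> sqrt (2 * pi)" using pi_gt3 by simp
  have "Hs_norm s (\<phi> - \<phi>) = 0" by (simp add: Hs_norm_coef_norm fcoef_0 coef_norm_def l2_zero)
  then have \<phi>U: "\<phi> \<in> ?U" using \<phi> by (simp add: Hs_ball_def)
  have ball: "fcoef \<psi> \<in> Hc \<and> hn (fcoef \<psi>) \<le> hn (fcoef \<phi>) + 1" if "\<psi> \<in> ?U" for \<psi>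
  proof
    have \<psi>: "\<psi> \<in> Hs s" "Hs_norm s (\<psi> - \<phi>) < 1" using that by (auto simp: Hs_ball_def)
    show "fcoef \<psi> \<in> Hc" using \<psi> by (simp add: Hc_coef_finite Hs_iff fcoef_uminus)
    have "1 * coef_norm s (fcoef \<psi> - fcoef \<phi>) \<le> sqrt (2 * pi) * coef_norm s (fcoef \<psi> - fcoef \<phi>)"
      by (intro mult_right_mono pi2 coef_norm_nonneg)
    then have "coef_norm s (fcoef \<psi> - fcoef \<phi>) < 1" using \<psi>(2) by (simp add: Hs_norm_coef_norm fcoef_diff)
    then show "hn (fcoef \<psi>) \<le> hn (fcoef \<phi>) + 1"
      using coef_norm_diff_abs(2)[of s "fcoef \<psi>" "fcoef \<phi>"] \<psi> \<phi> unfolding hn_coef_norm by (simp add: Hs_iff abs_le_iff)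
  qed
  obtain \<delta> M where \<delta>: "0 < \<delta>" and sol: "\<And>c. c \<in> Hc \<Longrightarrow> hn c \<le> hn (fcoef \<phi>) + 1 \<Longrightarrow> \<exists>u\<in>W \<delta> T. nW 0 \<delta> T u \<le> M \<and> mild T c u"
    using global_solution[OF T, of "hn (fcoef \<phi>) + 1"] by blast
  define U where "U \<psi> = (SOME u. u \<in> W \<delta> T \<and> nW 0 \<delta> T u \<le> M \<and> mild T (fcoef \<psi>) u)" for \<psi>
  have U: "U \<psi> \<in> W \<delta> T" "nW 0 \<delta> T (U \<psi>) \<le> M" "mild T (fcoef \<psi>) (U \<psi>)" if "\<psi> \<in> ?U" for \<psi>
  proof -
    have "\<exists>u. u \<in> W \<delta> T \<and> nW 0 \<delta> T u \<le> M \<and> mild T (fcoef \<psi>) u" using sol ball[OF that] by blast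
    then have "U \<psi> \<in> W \<delta> T \<and> nW 0 \<delta> T (U \<psi>) \<le> M \<and> mild T (fcoef \<psi>) (U \<psi>)" unfolding U_def by (rule someI_ex)
    then show "U \<psi> \<in> W \<delta> T" "nW 0 \<delta> T (U \<psi>) \<le> M" "mild T (fcoef \<psi>) (U \<psi>)" by blast+
  qed
  have Hs: "\<psi> \<in> Hs s" if "\<psi> \<in> ?U" for \<psi> using that by (simp add: Hs_ball_def)
  have iff: "is_solution \<beta> \<eta> s T \<psi> u \<longleftrightarrow> u = synth (U \<psi>)" if "\<psi> \<in> ?U" for \<psi> u
    by (rule solution_iff[OF T \<delta> U(1)[OF that] U(3)[OF that] Hs[OF that]])
  have uniq: "unique_solution \<beta> \<eta> s \<psi> T" if "\<psi> \<in> ?U" for \<psi>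
    unfolding unique_solution_def iff[OF that] by blast
  then show "unique_solution \<beta> \<eta> s \<phi> T" using \<phi>U .
  have flow: "flow_map \<beta> \<eta> s T \<psi> = synth (U \<psi>)" if "\<psi> \<in> ?U" for \<psi>
    unfolding flow_map_def iff[OF that] by simp
  have T0: "0 \<le> T" "0 \<le> \<delta>" using T \<delta> by auto
  obtain K where K: "0 \<le> K" "\<And>u v. u \<in> W \<delta> T \<Longrightarrow> v \<in> W \<delta> T \<Longrightarrow> nW 0 \<delta> T (bil T u v) \<le> K * nW 0 \<delta> T u * nW 0 \<delta> T v"
    using bil_bound_0[OF T0] by blast
  have Hc: "fcoef x \<in> Hc" if "x \<in> Hs s" for x using that by (simp add: Hc_coef_finite Hs_iff fcoef_uminus)
  interpret normed_subspace "W \<delta> T" "nW 0 \<delta> T" by (rule W_subspace) (use T0 in auto)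
  \<comment> \<open>The division by \<open>sqrt (2 * pi)\<close> converts between \<open>hn\<close>
    and \<open>Hs_norm\<close>, which contains this factor.\<close>
  interpret quadratic_flow "W \<delta> T" "nW 0 \<delta> T" "Hs s" "Hs_norm s" ?U "\<lambda>\<psi>. lin T (fcoef \<psi>)" "bil T" U "linK T / sqrt (2 * pi)" K M
  proof
    show "a *\<^sub>R x + b *\<^sub>R y \<in> Hs s" if "x \<in> Hs s" "y \<in> Hs s" for a b x y
    proof -
      have "fcoef (a *\<^sub>R x + b *\<^sub>R y) = (\<lambda>k. of_real a * fcoef x k) + (\<lambda>k. of_real b * fcoef y k)"
        by (simp add: fun_eq_iff fcoef_lincomb)
      then show ?thesis unfolding Hs_iff using that by (simp only: Hs_iff) (intro coef_norm_add(1) coef_norm_scale(1))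
    qed
    show "0 \<le> Hs_norm s h" for h by (simp add: Hs_norm_coef_norm coef_norm_nonneg)
    show "?U \<subseteq> Hs s" by (auto simp: Hs_ball_def)
    show "lin T (fcoef h) \<in> W \<delta> T" if "h \<in> Hs s" for h by (rule lin_W(1)[OF T0 Hc[OF that]])
    show "lin T (fcoef (a *\<^sub>R x + b *\<^sub>R y)) = a *\<^sub>R lin T (fcoef x) + b *\<^sub>R lin T (fcoef y)" for x y a b
      by (intro ext) (simp add: lin_def scaleR_fun_def fcoef_lincomb scaleR_conv_of_real algebra_simps)
    show "nW 0 \<delta> T (lin T (fcoef h)) \<le> linK T / sqrt (2 * pi) * Hs_norm s h" if "h \<in> Hs s" for h
      using lin_W(2)[OF T0 Hc[OF that]] by (simp add: Hs_norm_coef_norm hn_coef_norm)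
    show "bil T v w \<in> W \<delta> T" if "v \<in> W \<delta> T" "w \<in> W \<delta> T" for v w
      by (rule bil_bound(1)[OF T0 order_refl that])
    show "bil T v w = bil T w v" for v w by (rule bil_commute)
    show "bil T z (a *\<^sub>R v + b *\<^sub>R w) = a *\<^sub>R bil T z v + b *\<^sub>R bil T z w" if "v \<in> W \<delta> T" "w \<in> W \<delta> T" "z \<in> W \<delta> T" for v w z a b
      by (rule bil_lincomb[OF T0 that])
    show "0 \<le> linK T / sqrt (2 * pi)" using linK_pos[of T] by simp
    show "U x = lin T (fcoef x) + bil T (U x) (U x)" if "x \<in> ?U" for x
      using W_mild_iff[OF T0 U(1)[OF that]] U(3)[OF that] by blast
  qed (use K U volterra_bil[OF T0] in auto)
  have "smooth_map_on (Hs s) (Hs_norm s) ?U (target_space s T) (target_seminorms s T) (flow_map \<beta> \<eta> s T)"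
  proof (rule smooth_flow)
    show "synth v \<in> target_space s T" if "v \<in> W \<delta> T" for v by (rule synth_target[OF T \<delta> that])
    show "synth (a *\<^sub>R v + b *\<^sub>R w) = a *\<^sub>R synth v + b *\<^sub>R synth w" if "v \<in> W \<delta> T" "w \<in> W \<delta> T" for v w a b
      by (rule synth_lincomb[OF T \<delta> that])
    show "\<exists>C\<ge>0. \<forall>v\<in>W \<delta> T. p (synth v) \<le> C * nW 0 \<delta> T v" if "p \<in> target_seminorms s T" for p
      by (rule synth_seminorm_bound[OF T \<delta> that])
  qed (rule flow)
  then show "smooth_flow_near \<beta> \<eta> s \<phi> T" unfolding smooth_flow_near_def using \<phi> \<phi>U uniq by blast
qed

end

theorem theorem1p2:
  fixes \<beta> \<eta> s :: real and \<phi> :: pdist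
  assumes "\<beta> \<ge> 0" and "\<eta> > 0" and "s > - 1 / 2" and "\<phi> \<in> Hs s"
  shows "Sup (ereal ` {T. T > 0 \<and> unique_solution \<beta> \<eta> s \<phi> T \<and> smooth_flow_near \<beta> \<eta> s \<phi> T}) = \<infinity>"
proof (rule SUP_PInfty)
  interpret dissipative \<beta> \<eta> s using assms by unfold_locales auto
  fix n :: nat
  \<comment> \<open>The successor of \<open>n\<close> is used so that the time is positive also for
    \<open>n = 0\<close>.\<close>
  have "0 < real n + 1" by simp
  from well_posed[OF this assms(4)]
  show "\<exists>i\<in>{T. T > 0 \<and> unique_solution \<beta> \<eta> s \<phi> T \<and> smooth_flow_near \<beta> \<eta> s \<phi> T}. ereal (real n) \<le> ereal i"
    by (intro bexI[of _ "real n + 1"]) auto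
qed

end
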